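(* Let $K$ be a field with algebraic closure $\bar K$, and let $R$ be a two-dimensional standard-graded $K$-algebra such that $R\otimes_K\bar K$ is a normal domain. Let $f_1,\dots,f_n\in R$ be homogeneous $R_+$-primary elements of degrees $d_i=\deg f_i$, ordered so that $1\le d_1\le d_2\le\cdots\le d_n$. Then for every $m\ge d_{n-1}+d_n$ we have $R_m\subseteq(f_1,\dots,f_n)^\star$.
   Context: Standard-graded: $R=\bigoplus_{d\ge0}R_d$, $R_0=K$, generated by finitely many elements of degree one; $f_1,\dots,f_n$ are $R_+$-primary if $V(f_1,\dots,f_n)=V(R_+)$, where $R_+=\bigoplus_{d\ge1}R_d$. Solid closure $I^\star$: for a complete local Noetherian domain $A$, an ideal $J\subseteq A$ and $f\in A$, one has $f\in J^\star$ iff there is an $A$-algebra $B$ with $\operatorname{Hom}_A(B,A)\neq 0$ and $f\in JB$. For a general Noetherian ring $R$, $f\in I^\star$ iff for every maximal ideal $\mathfrak m$ of $R$ and every minimal prime $\mathfrak q$ of the completion $\hat R_{\mathfrak m}$ the image of $f$ lies in $(I\,\hat R_{\mathfrak m}/\mathfrak q)^\star$. For algebras of finite type over a field of positive characteristic it coincides with tight closure. *)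

theory Defs
  imports "HOL-Algebra.Algebra" "HOL-Library.Extended_Nat" "HOL-Library.Poly_Mapping"
begin

section \<open>Prime ideals\<close>

definition zero_locus :: "('a, 'm) ring_scheme \<Rightarrow> 'a set \<Rightarrow> 'a set set"
  where "zero_locus R S = {P. primeideal P R \<and> S \<subseteq> P}"

definition minimal_prime :: "('a, 'm) ring_scheme \<Rightarrow> 'a set \<Rightarrow> bool"
  where "minimal_prime R Q \<longleftrightarrow>
    primeideal Q R \<and> (\<forall>P. primeideal P R \<and> P \<subseteq> Q \<longrightarrow> P = Q)"

definition krull_dim :: "('a, 'm) ring_scheme \<Rightarrow> enat"
  where "krull_dim R = Sup {enat n | n. \<exists>P :: nat \<Rightarrow> 'a set.
    (\<forall>i\<le>n. primeideal (P i) R) \<and> (\<forall>i<n. P i \<subset> P (Suc i))}"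


section \<open>Localization\<close>

definition frac_rel :: "('a, 'm) ring_scheme \<Rightarrow> 'a set \<Rightarrow> (('a \<times> 'a) \<times> ('a \<times> 'a)) set"
  where "frac_rel R S = {((a, s), (b, t)). a \<in> carrier R \<and> b \<in> carrier R \<and> s \<in> S \<and> t \<in> S \<and>
    (\<exists>u\<in>S. u \<otimes>\<^bsub>R\<^esub> (a \<otimes>\<^bsub>R\<^esub> t \<ominus>\<^bsub>R\<^esub> b \<otimes>\<^bsub>R\<^esub> s) = \<zero>\<^bsub>R\<^esub>)}"

definition fraction :: "('a, 'm) ring_scheme \<Rightarrow> 'a set \<Rightarrow> 'a \<Rightarrow> 'a \<Rightarrow> ('a \<times> 'a) set"
  where "fraction R S a s = frac_rel R S `` {(a, s)}"

text \<open>
  The set \<open>S\<close> is meant to be multiplicatively closed and to contain \<open>1\<close>. In the operations below,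
  all representatives yield the same class, so that each union is that class.
\<close>

definition localization :: "('a, 'm) ring_scheme \<Rightarrow> 'a set \<Rightarrow> ('a \<times> 'a) set ring"
  where "localization R S =
    \<lparr> carrier = (carrier R \<times> S) // frac_rel R S,
      monoid.mult = (\<lambda>x y. \<Union>(a, s)\<in>x. \<Union>(b, t)\<in>y. fraction R S (a \<otimes>\<^bsub>R\<^esub> b) (s \<otimes>\<^bsub>R\<^esub> t)),
      monoid.one = fraction R S \<one>\<^bsub>R\<^esub> \<one>\<^bsub>R\<^esub>,
      ring.zero = fraction R S \<zero>\<^bsub>R\<^esub> \<one>\<^bsub>R\<^esub>,
      ring.add = (\<lambda>x y. \<Union>(a, s)\<in>x. \<Union>(b, t)\<in>y.
        fraction R S (a \<otimes>\<^bsub>R\<^esub> t \<oplus>\<^bsub>R\<^esub> b \<otimes>\<^bsub>R\<^esub> s) (s \<otimes>\<^bsub>R\<^esub> t)) \<rparr>"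

definition to_localization :: "('a, 'm) ring_scheme \<Rightarrow> 'a set \<Rightarrow> 'a \<Rightarrow> ('a \<times> 'a) set"
  where "to_localization R S a = fraction R S a \<one>\<^bsub>R\<^esub>"


section \<open>Normal domains\<close>

definition integral_over :: "('a, 'm) ring_scheme \<Rightarrow> 'a set \<Rightarrow> 'a \<Rightarrow> bool"
  where "integral_over F A x \<longleftrightarrow>
    (\<exists>p \<in> carrier (univ_poly F A). p \<noteq> [] \<and> lead_coeff p = \<one>\<^bsub>F\<^esub> \<and> ring.eval F p x = \<zero>\<^bsub>F\<^esub>)"

definition normal_domain :: "('a, 'm) ring_scheme \<Rightarrow> bool"
  where "normal_domain A \<longleftrightarrow> domain A \<and>
    (let S = carrier A - {\<zero>\<^bsub>A\<^esub>}; F = localization A S; A' = to_localization A S ` carrier A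
     in \<forall>x \<in> carrier F. integral_over F A' x \<longrightarrow> x \<in> A')"


section \<open>Completion\<close>

primrec ideal_pow :: "('a, 'm) ring_scheme \<Rightarrow> 'a set \<Rightarrow> nat \<Rightarrow> 'a set"
  where
    "ideal_pow R I 0 = carrier R"
  | "ideal_pow R I (Suc n) = ideal_prod R (ideal_pow R I n) I"

text \<open>
  The completion is the inverse limit of the rings \<open>R/I\<^sup>n\<close>. Its components are cosets, and
  the transition map sends a coset of \<open>I\<^sup>n\<^sup>+\<^sup>1\<close> to the unique coset of \<open>I\<^sup>n\<close> containing it.
\<close>

definition adic_completion :: "('a, 'm) ring_scheme \<Rightarrow> 'a set \<Rightarrow> (nat \<Rightarrow> 'a set) ring"
  where "adic_completion R I =
    \<lparr> carrier = {x. \<forall>n. x n \<in> carrier (R Quot ideal_pow R I n) \<and> x (Suc n) \<subseteq> x n},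
      monoid.mult = (\<lambda>x y n. x n \<otimes>\<^bsub>R Quot ideal_pow R I n\<^esub> y n),
      monoid.one = (\<lambda>n. \<one>\<^bsub>R Quot ideal_pow R I n\<^esub>),
      ring.zero = (\<lambda>n. \<zero>\<^bsub>R Quot ideal_pow R I n\<^esub>),
      ring.add = (\<lambda>x y n. x n \<oplus>\<^bsub>R Quot ideal_pow R I n\<^esub> y n) \<rparr>"

definition to_adic_completion :: "('a, 'm) ring_scheme \<Rightarrow> 'a set \<Rightarrow> 'a \<Rightarrow> nat \<Rightarrow> 'a set"
  where "to_adic_completion R I a = (\<lambda>n. ideal_pow R I n +>\<^bsub>R\<^esub> a)"

definition local_ring_at :: "('a, 'm) ring_scheme \<Rightarrow> 'a set \<Rightarrow> ('a \<times> 'a) set ring"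
  where "local_ring_at R P = localization R (carrier R - P)"

definition max_ideal_at :: "('a, 'm) ring_scheme \<Rightarrow> 'a set \<Rightarrow> ('a \<times> 'a) set set"
  where "max_ideal_at R P = Idl\<^bsub>local_ring_at R P\<^esub> (to_localization R (carrier R - P) ` P)"

definition completion_at :: "('a, 'm) ring_scheme \<Rightarrow> 'a set \<Rightarrow> (nat \<Rightarrow> ('a \<times> 'a) set set) ring"
  where "completion_at R P = adic_completion (local_ring_at R P) (max_ideal_at R P)"

definition to_completion_at ::
    "('a, 'm) ring_scheme \<Rightarrow> 'a set \<Rightarrow> 'a \<Rightarrow> nat \<Rightarrow> ('a \<times> 'a) set set"
  where "to_completion_at R P a =
    to_adic_completion (local_ring_at R P) (max_ideal_at R P) (to_localization R (carrier R - P) a)"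


section \<open>Solid closure\<close>

text \<open>The set \<open>Hom\<^sub>A(M, A)\<close>:\<close>

definition linear_forms :: "('a, 'm) ring_scheme \<Rightarrow> ('a, 'b, 'n) module_scheme \<Rightarrow> ('b \<Rightarrow> 'a) set"
  where "linear_forms A M = {\<phi>. \<phi> \<in> carrier M \<rightarrow> carrier A \<and>
    (\<forall>x\<in>carrier M. \<forall>y\<in>carrier M. \<phi> (x \<oplus>\<^bsub>M\<^esub> y) = \<phi> x \<oplus>\<^bsub>A\<^esub> \<phi> y) \<and>
    (\<forall>a\<in>carrier A. \<forall>x\<in>carrier M. \<phi> (a \<odot>\<^bsub>M\<^esub> x) = a \<otimes>\<^bsub>A\<^esub> \<phi> x)}"

definition solid_algebra :: "('a, 'm) ring_scheme \<Rightarrow> ('a, 'b, 'n) module_scheme \<Rightarrow> bool"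
  where "solid_algebra A B \<longleftrightarrow> algebra A B \<and>
    (\<exists>\<phi>\<in>linear_forms A B. \<exists>b\<in>carrier B. \<phi> b \<noteq> \<zero>\<^bsub>A\<^esub>)"

text \<open>
  The definition of solid closure asks for an algebra of arbitrary size, whereas a HOL formula can
  only quantify over algebras with elements in a fixed type. The type chosen below is that of
  quotients of the polynomial ring over \<open>A\<close> in variables indexed by \<open>nat\<close> (a polynomial maps each
  monomial, a multiset of variables, to its coefficient), and this restriction is harmless: suppose
  that \<open>B\<close> is a solid algebra with \<open>f \<in> J B\<close>, say \<open>f \<cdot> 1 = a\<^sub>1 b\<^sub>1 + \<dots> + a\<^sub>n b\<^sub>n\<close> with
  \<open>a\<^sub>i \<in> J\<close> and \<open>b\<^sub>i \<in> B\<close>. The forcing algebra \<open>C = A[T\<^sub>1, \<dots>, T\<^sub>n]/(f - a\<^sub>1 T\<^sub>1 - \<dots> - a\<^sub>n T\<^sub>n)\<close> maps to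
  \<open>B\<close>. If \<open>\<phi> \<in> Hom\<^sub>A(B, A)\<close> and \<open>\<phi> b \<noteq> 0\<close>, then composing with \<open>x \<mapsto> \<phi> (b x)\<close> gives a form on \<open>C\<close>
  that does not vanish at \<open>1\<close>, and \<open>f \<in> J C\<close> by construction.
\<close>

definition complete_local_solid_closure :: "('a, 'm) ring_scheme \<Rightarrow> 'a set \<Rightarrow> 'a set"
  where "complete_local_solid_closure A J = {f \<in> carrier A.
    \<exists>B :: ('a, (nat multiset \<Rightarrow> 'a) set) module. solid_algebra A B \<and>
      f \<odot>\<^bsub>B\<^esub> \<one>\<^bsub>B\<^esub> \<in> Idl\<^bsub>B\<^esub> ((\<lambda>a. a \<odot>\<^bsub>B\<^esub> \<one>\<^bsub>B\<^esub>) ` J)}"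

definition solid_closure :: "('a, 'm) ring_scheme \<Rightarrow> 'a set \<Rightarrow> 'a set"
  where "solid_closure R I = {f \<in> carrier R.
    \<forall>M Q. maximalideal M R \<and> minimal_prime (completion_at R M) Q \<longrightarrow>
      (let A = completion_at R M Quot Q;
           h = (\<lambda>r. Q +>\<^bsub>completion_at R M\<^esub> to_completion_at R M r)
       in h f \<in> complete_local_solid_closure A (Idl\<^bsub>A\<^esub> (h ` I)))}"


section \<open>Tensor products of algebras\<close>

definition int_monoid_ring :: "('a, 'm) monoid_scheme \<Rightarrow> ('a \<Rightarrow>\<^sub>0 int) ring"
  where "int_monoid_ring M =
    \<lparr> carrier = {x. Poly_Mapping.keys x \<subseteq> carrier M},
      monoid.mult = (\<lambda>x y. frag_extend (\<lambda>p. frag_extend (\<lambda>q. frag_of (p \<otimes>\<^bsub>M\<^esub> q)) y) x),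
      monoid.one = frag_of \<one>\<^bsub>M\<^esub>,
      ring.zero = 0,
      ring.add = (+) \<rparr>"

text \<open>
  The free abelian group on the pairs \<open>(r, l)\<close> is the integral monoid ring of the multiplicative
  monoid \<open>R \<times> L\<close>, which provides the product \<open>(r \<otimes> l) (r' \<otimes> l') = r r' \<otimes> l l'\<close>. The set of defining
  relations is stable under multiplication by pairs, so that the subgroup it generates is the ideal
  it generates.
\<close>

definition tensor_relations :: "('k, 'x) ring_scheme \<Rightarrow> ('k, 'a, 'y) module_scheme \<Rightarrow>
    ('k, 'b, 'z) module_scheme \<Rightarrow> ('a \<times> 'b \<Rightarrow>\<^sub>0 int) set"
  where "tensor_relations K R L =
    {frag_of (r \<oplus>\<^bsub>R\<^esub> r', l) - frag_of (r, l) - frag_of (r', l) | r r' l.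
       r \<in> carrier R \<and> r' \<in> carrier R \<and> l \<in> carrier L} \<union>
    {frag_of (r, l \<oplus>\<^bsub>L\<^esub> l') - frag_of (r, l) - frag_of (r, l') | r l l'.
       r \<in> carrier R \<and> l \<in> carrier L \<and> l' \<in> carrier L} \<union>
    {frag_of (k \<odot>\<^bsub>R\<^esub> r, l) - frag_of (r, k \<odot>\<^bsub>L\<^esub> l) | k r l.
       k \<in> carrier K \<and> r \<in> carrier R \<and> l \<in> carrier L}"

definition algebra_tensor :: "('k, 'x) ring_scheme \<Rightarrow> ('k, 'a, 'y) module_scheme \<Rightarrow>
    ('k, 'b, 'z) module_scheme \<Rightarrow> ('a \<times> 'b \<Rightarrow>\<^sub>0 int) set ring"
  where "algebra_tensor K R L =
    int_monoid_ring (R \<times>\<times> L) Quot Idl\<^bsub>int_monoid_ring (R \<times>\<times> L)\<^esub> (tensor_relations K R L)"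


section \<open>Standard-graded algebras\<close>

definition scalars :: "('k, 'x) ring_scheme \<Rightarrow> ('k, 'a, 'y) module_scheme \<Rightarrow> 'a set"
  where "scalars K R = (\<lambda>k. k \<odot>\<^bsub>R\<^esub> \<one>\<^bsub>R\<^esub>) ` carrier K"

locale standard_graded_algebra = algebra K R for K and R (structure) +
  fixes G :: "nat \<Rightarrow> 'c set"
  assumes additive_subgroup_grade: "additive_subgroup (G d) R"
    and grade_mult: "x \<in> G i \<Longrightarrow> y \<in> G j \<Longrightarrow> x \<otimes> y \<in> G (i + j)"
    and direct_sum: "x \<in> carrier R \<Longrightarrow>
      \<exists>!c. (\<forall>d. c d \<in> G d) \<and> finite {d. c d \<noteq> \<zero>} \<and> x = (\<Oplus>d\<in>{d. c d \<noteq> \<zero>}. c d)"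
    and grade_zero: "inj_on (\<lambda>k. k \<odot>\<^bsub>R\<^esub> \<one>) (carrier K)" "G 0 = scalars K R"
    and generated_in_degree_one:
      "\<exists>S \<subseteq> G 1. finite S \<and> generate_ring R (scalars K R \<union> S) = carrier R"

definition irrelevant_ideal :: "('a, 'm) ring_scheme \<Rightarrow> (nat \<Rightarrow> 'a set) \<Rightarrow> 'a set"
  where "irrelevant_ideal R G =
    {\<Oplus>\<^bsub>R\<^esub>d\<in>D. c d | c D. finite D \<and> (\<forall>d\<in>D. 1 \<le> d \<and> c d \<in> G d)}"

definition algebraic_closure_of :: "('k, 'x) ring_scheme \<Rightarrow> ('k, 'b, 'y) module_scheme \<Rightarrow> bool"
  where "algebraic_closure_of K L \<longleftrightarrow> algebra K L \<and> algebraic_closure L (scalars K L)"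

end

theory Submission
  imports Defs
begin

text \<open>
  Let \<open>z\<close> be homogeneous of degree \<open>m\<close>. A linear form on the forcing algebra
  \<open>A[T\<^sub>1, \<dots>, T\<^sub>n]/(f\<^sub>1 T\<^sub>1 + \<dots> + f\<^sub>n T\<^sub>n - z)\<close> is given by its values \<open>w \<mu>\<close> at the monomials \<open>T\<^sup>\<mu>\<close>, and these
  are subject only to the recurrence \<open>f\<^sub>1 w (\<mu> + 1) + \<dots> + f\<^sub>n w (\<mu> + n) = z w \<mu>\<close>. Hence a solution with values
  in \<open>R\<close> and \<open>w 0 \<noteq> 0\<close> suffices: the completion at \<open>R\<^sub>+\<close> is a domain that contains \<open>R\<close>,
  and at any other maximal ideal some \<open>f\<^sub>i\<close> is a unit.

  To find a solution, cover the punctured cone by the loci where \<open>x = f\<^sub>i\<^sub>0 \<noteq> 0\<close> and where \<open>y \<noteq> 0\<close>, where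
  \<open>y = c\<^sub>1 f\<^sub>1 + \<dots> + c\<^sub>n f\<^sub>n\<close> is a second homogeneous parameter. Over each of them the forcing algebra is a
  polynomial ring, and the two trivializations differ by \<open>\<gamma>\<^sub>j = z c\<^sub>j / (x y)\<close>, of degree \<open>m - d\<^sub>i\<^sub>0 - d\<^sub>j \<ge> 0\<close>.
  Gluing a form from the two charts requires, for each monomial in turn, writing an element of
  \<open>R\<^sub>x\<^sub>y\<close> as a sum of elements of \<open>R\<^sub>x\<close> and \<open>R\<^sub>y\<close>. The obstruction lies in the second local
  cohomology of \<open>R\<close>, which vanishes in large degrees. Starting from \<open>w 0\<close> of large degree, all degrees stay
  large because those of the \<open>\<gamma>\<^sub>j\<close> are nonnegative.
\<close>

text \<open>Splitting elements of R_xy is only half of the gluing: a value found in both R_x and R_y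
  must come back to R. The intersection of R_x and R_y can exceed R in small degrees only, because
  the elements of R/(x) that are killed by R_+ form a finitely generated module over the constants
  and so live in bounded degree. This is a second reason to start in large degree, and it rests on
  the noetherian property, obtained here from a chain form of Hilbert's basis theorem.

  Dimension two is used from both sides. From above it yields y: a homogeneous element off the
  smaller primes over x leaves only R_+ over (x, y). From below it shows that x alone cannot contain
  all large degrees, since R would then grow linearly, while a chain of three primes produces two
  algebraically independent elements.

  Two distinct degrees are added in the bound because the variable of index i_0 is eliminated where
  x is invertible, so that only indices j other than i_0 carry a \<gamma>_j.

  That R is a domain is inherited from the tensor product, into which it embeds.\<close>

lemma (in abelian_monoid) finsum_Sigma:
  assumes "finite A" "\<And>a. a \<in> A \<Longrightarrow> finite (B a)"
    and "\<And>a b. a \<in> A \<Longrightarrow> b \<in> B a \<Longrightarrow> g a b \<in> carrier G"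
  shows "(\<Oplus>a\<in>A. \<Oplus>b\<in>B a. g a b) = (\<Oplus>x\<in>Sigma A B. g (fst x) (snd x))"
  using assms
proof (induction A rule: finite_induct)
  case (insert a A)
  have "Sigma (insert a A) B = Pair a ` B a \<union> Sigma A B" by auto
  moreover have "(\<Oplus>x\<in>Pair a ` B a \<union> Sigma A B. g (fst x) (snd x))
    = (\<Oplus>x\<in>Pair a ` B a. g (fst x) (snd x)) \<oplus> (\<Oplus>x\<in>Sigma A B. g (fst x) (snd x))"
    using insert by (intro finsum_Un_disjoint) auto
  moreover have "(\<Oplus>x\<in>Pair a ` B a. g (fst x) (snd x)) = (\<Oplus>b\<in>B a. g a b)"
    using insert.prems by (subst finsum_reindex) (auto simp: inj_on_def)
  ultimately show ?case
    using insert by (auto simp: Pi_def)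
qed auto

lemma finite_submultisets: "finite {\<alpha>. \<alpha> \<subseteq># \<mu>}"
proof (rule finite_subset)
  show "{\<alpha>. \<alpha> \<subseteq># \<mu>} \<subseteq> mset ` {xs. set xs \<subseteq> set_mset \<mu> \<and> length xs \<le> size \<mu>}"
  proof
    fix \<alpha> assume "\<alpha> \<in> {\<alpha>. \<alpha> \<subseteq># \<mu>}"
    moreover obtain xs where "mset xs = \<alpha>" using ex_mset by blast
    ultimately show "\<alpha> \<in> mset ` {xs. set xs \<subseteq> set_mset \<mu> \<and> length xs \<le> size \<mu>}"
      using set_mset_mono[of \<alpha> \<mu>] size_mset_mono[of \<alpha> \<mu>] by (intro image_eqI[of _ _ xs]) auto
  qed
qed (simp add: finite_lists_length_le)

text \<open>Nested submultisets \<beta> of \<alpha> of \<mu> correspond to pairs of \<beta> and the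
  difference \<delta> = \<alpha> - \<beta>. This reindexing is the associativity of the convolution
  product defined next.\<close>

lemma (in abelian_monoid) finsum_triangle:
  assumes "\<And>\<alpha> \<beta>. \<alpha> \<subseteq># \<mu> \<Longrightarrow> \<beta> \<subseteq># \<alpha> \<Longrightarrow> g \<alpha> \<beta> \<in> carrier G"
  shows "(\<Oplus>\<alpha>\<in>{\<alpha>. \<alpha> \<subseteq># \<mu>}. \<Oplus>\<beta>\<in>{\<beta>. \<beta> \<subseteq># \<alpha>}. g \<alpha> \<beta>)
    = (\<Oplus>\<beta>\<in>{\<beta>. \<beta> \<subseteq># \<mu>}. \<Oplus>\<delta>\<in>{\<delta>. \<delta> \<subseteq># \<mu> - \<beta>}. g (\<beta> + \<delta>) \<beta>)"
    (is "?l = ?r")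
proof -
  have add: "\<beta> + \<delta> \<subseteq># \<mu>" if "\<beta> \<subseteq># \<mu>" "\<delta> \<subseteq># \<mu> - \<beta>" for \<beta> \<delta>
    using that by (metis subset_mset.add_diff_inverse subset_mset.add_left_mono)
  let ?S = "Sigma {\<alpha>. \<alpha> \<subseteq># \<mu>} (\<lambda>\<alpha>. {\<beta>. \<beta> \<subseteq># \<alpha>})"
  let ?T = "Sigma {\<beta>. \<beta> \<subseteq># \<mu>} (\<lambda>\<beta>. {\<delta>. \<delta> \<subseteq># \<mu> - \<beta>})"
  let ?h = "\<lambda>x. (fst x + snd x, fst x)"
  have "?S \<subseteq> ?h ` ?T"
  proof
    fix x assume x: "x \<in> ?S"
    then have "x = ?h (snd x, fst x - snd x)"
      by (auto simp: prod_eq_iff)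
    moreover have "(snd x, fst x - snd x) \<in> ?T"
      using x by (auto intro: subset_mset.order_trans simp: subset_mset.le_diff_conv2)
    ultimately show "x \<in> ?h ` ?T" by blast
  qed
  moreover have "?h ` ?T \<subseteq> ?S"
    using add by auto
  ultimately have S: "?S = ?h ` ?T" by blast
  have "?l = (\<Oplus>x\<in>?S. g (fst x) (snd x))"
    using assms by (intro finsum_Sigma) (auto simp: finite_submultisets)
  also have "\<dots> = (\<Oplus>x\<in>?T. g (fst (?h x)) (snd (?h x)))"
    unfolding S using add assms by (intro finsum_reindex) (auto simp: inj_on_def)
  also have "\<dots> = (\<Oplus>x\<in>?T. (\<lambda>\<beta> \<delta>. g (\<beta> + \<delta>) \<beta>) (fst x) (snd x))"
    by simp
  also have "\<dots> = ?r"
    using assms add by (intro finsum_Sigma[symmetric]) (auto simp: finite_submultisets)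
  finally show ?thesis .
qed

section \<open>Polynomials with coefficients in a ring\<close>

text \<open>With coefficient functions on multisets of naturals, the cosets of polynomials have
  exactly the type over which \<open>complete_local_solid_closure\<close> quantifies.\<close>

definition mset_poly :: "('a, 'm) ring_scheme \<Rightarrow> ('i multiset \<Rightarrow> 'a) ring"
  where "mset_poly A =
    \<lparr> carrier = {p. (\<forall>\<mu>. p \<mu> \<in> carrier A) \<and> finite {\<mu>. p \<mu> \<noteq> \<zero>\<^bsub>A\<^esub>}},
      monoid.mult = (\<lambda>p q \<mu>. \<Oplus>\<^bsub>A\<^esub>\<alpha>\<in>{\<alpha>. \<alpha> \<subseteq># \<mu>}. p \<alpha> \<otimes>\<^bsub>A\<^esub> q (\<mu> - \<alpha>)),
      monoid.one = (\<lambda>\<mu>. if \<mu> = {#} then \<one>\<^bsub>A\<^esub> else \<zero>\<^bsub>A\<^esub>),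
      ring.zero = (\<lambda>\<mu>. \<zero>\<^bsub>A\<^esub>),
      ring.add = (\<lambda>p q \<mu>. p \<mu> \<oplus>\<^bsub>A\<^esub> q \<mu>) \<rparr>"

definition poly_const :: "('a, 'm) ring_scheme \<Rightarrow> 'a \<Rightarrow> 'i multiset \<Rightarrow> 'a"
  where "poly_const A a = (\<lambda>\<mu>. if \<mu> = {#} then a else \<zero>\<^bsub>A\<^esub>)"

definition poly_var :: "('a, 'm) ring_scheme \<Rightarrow> 'i \<Rightarrow> 'i multiset \<Rightarrow> 'a"
  where "poly_var A i = (\<lambda>\<mu>. if \<mu> = {#i#} then \<one>\<^bsub>A\<^esub> else \<zero>\<^bsub>A\<^esub>)"

text \<open>The linear form with value \<open>w \<mu>\<close> at the monomial \<mu>. The monomials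
  are a basis, so \<open>w\<close> can be prescribed freely.\<close>

definition poly_form :: "('a, 'm) ring_scheme \<Rightarrow> ('i multiset \<Rightarrow> 'a) \<Rightarrow> ('i multiset \<Rightarrow> 'a) \<Rightarrow> 'a"
  where "poly_form A w p = (\<Oplus>\<^bsub>A\<^esub>\<mu>\<in>{\<mu>. p \<mu> \<noteq> \<zero>\<^bsub>A\<^esub>}. p \<mu> \<otimes>\<^bsub>A\<^esub> w \<mu>)"

context cring
begin

lemma mset_poly_carrier:
  "p \<in> carrier (mset_poly R) \<longleftrightarrow> (\<forall>\<mu>. p \<mu> \<in> carrier R) \<and> finite {\<mu>. p \<mu> \<noteq> \<zero>}"
  by (simp add: mset_poly_def)

lemma mset_poly_coeff: "p \<in> carrier (mset_poly R) \<Longrightarrow> p \<mu> \<in> carrier R"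
  by (simp add: mset_poly_carrier)

lemma mset_poly_finite: "p \<in> carrier (mset_poly R) \<Longrightarrow> finite {\<mu>. p \<mu> \<noteq> \<zero>}"
  by (simp add: mset_poly_carrier)

lemma mset_poly_mult:
  "(p \<otimes>\<^bsub>mset_poly R\<^esub> q) \<mu> = (\<Oplus>\<alpha>\<in>{\<alpha>. \<alpha> \<subseteq># \<mu>}. p \<alpha> \<otimes> q (\<mu> - \<alpha>))"
  by (simp add: mset_poly_def)

lemma mset_poly_add: "(p \<oplus>\<^bsub>mset_poly R\<^esub> q) \<mu> = p \<mu> \<oplus> q \<mu>"
  by (simp add: mset_poly_def)

lemma mset_poly_zero: "\<zero>\<^bsub>mset_poly R\<^esub> = (\<lambda>\<mu>. \<zero>)"
  by (simp add: mset_poly_def)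

lemma mset_poly_one: "\<one>\<^bsub>mset_poly R\<^esub> = poly_const R \<one>"
  by (simp add: mset_poly_def poly_const_def)

lemma poly_const_closed [simp, intro]:
  "a \<in> carrier R \<Longrightarrow> poly_const R a \<in> carrier (mset_poly R)"
  by (auto simp: mset_poly_carrier poly_const_def intro: finite_subset[of _ "{{#}}"])

lemma poly_var_closed [simp, intro]: "poly_var R i \<in> carrier (mset_poly R)"
  by (auto simp: mset_poly_carrier poly_var_def intro: finite_subset[of _ "{{#i#}}"])

lemma mset_poly_add_closed:
  assumes "p \<in> carrier (mset_poly R)" "q \<in> carrier (mset_poly R)"
  shows "p \<oplus>\<^bsub>mset_poly R\<^esub> q \<in> carrier (mset_poly R)"
proof -
  have "{\<mu>. p \<mu> \<oplus> q \<mu> \<noteq> \<zero>} \<subseteq> {\<mu>. p \<mu> \<noteq> \<zero>} \<union> {\<mu>. q \<mu> \<noteq> \<zero>}" by auto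
  with assms show ?thesis
    by (auto simp: mset_poly_carrier mset_poly_add intro: finite_subset)
qed

lemma mset_poly_mult_support:
  assumes "p \<in> carrier (mset_poly R)" "q \<in> carrier (mset_poly R)"
  shows "{\<mu>. (p \<otimes>\<^bsub>mset_poly R\<^esub> q) \<mu> \<noteq> \<zero>}
    \<subseteq> (\<lambda>x. fst x + snd x) ` ({\<mu>. p \<mu> \<noteq> \<zero>} \<times> {\<mu>. q \<mu> \<noteq> \<zero>})"
proof
  fix \<mu> assume "\<mu> \<in> {\<mu>. (p \<otimes>\<^bsub>mset_poly R\<^esub> q) \<mu> \<noteq> \<zero>}"
  then have "\<exists>\<alpha>\<in>{\<alpha>. \<alpha> \<subseteq># \<mu>}. p \<alpha> \<otimes> q (\<mu> - \<alpha>) \<noteq> \<zero>"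
    unfolding mset_poly_mult mem_Collect_eq by (metis (no_types, lifting) add.finprod_one_eqI)
  then obtain \<alpha> where "\<alpha> \<subseteq># \<mu>" "p \<alpha> \<otimes> q (\<mu> - \<alpha>) \<noteq> \<zero>" by blast
  with assms have "p \<alpha> \<noteq> \<zero>" "q (\<mu> - \<alpha>) \<noteq> \<zero>" "\<mu> = \<alpha> + (\<mu> - \<alpha>)"
    by (metis l_null mset_poly_coeff, metis r_null mset_poly_coeff, simp)
  then show "\<mu> \<in> (\<lambda>x. fst x + snd x) ` ({\<mu>. p \<mu> \<noteq> \<zero>} \<times> {\<mu>. q \<mu> \<noteq> \<zero>})"
    by (intro image_eqI[of _ _ "(\<alpha>, \<mu> - \<alpha>)"]) auto
qed

lemma mset_poly_mult_closed:
  assumes "p \<in> carrier (mset_poly R)" "q \<in> carrier (mset_poly R)"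
  shows "p \<otimes>\<^bsub>mset_poly R\<^esub> q \<in> carrier (mset_poly R)"
proof -
  have "finite {\<mu>. (p \<otimes>\<^bsub>mset_poly R\<^esub> q) \<mu> \<noteq> \<zero>}"
    using mset_poly_mult_support[OF assms] assms[THEN mset_poly_finite]
    by (meson finite_SigmaI finite_imageI finite_subset)
  moreover have "(p \<otimes>\<^bsub>mset_poly R\<^esub> q) \<mu> \<in> carrier R" for \<mu>
    unfolding mset_poly_mult using assms[THEN mset_poly_coeff] by (intro finsum_closed) auto
  ultimately show ?thesis by (auto simp: mset_poly_carrier)
qed

lemma poly_const_mult:
  assumes "a \<in> carrier R" "p \<in> carrier (mset_poly R)"
  shows "poly_const R a \<otimes>\<^bsub>mset_poly R\<^esub> p = (\<lambda>\<mu>. a \<otimes> p \<mu>)"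
proof
  fix \<mu>
  have "(\<Oplus>\<alpha>\<in>{\<alpha>. \<alpha> \<subseteq># \<mu>}. poly_const R a \<alpha> \<otimes> p (\<mu> - \<alpha>))
    = (\<Oplus>\<alpha>\<in>{{#}}. poly_const R a \<alpha> \<otimes> p (\<mu> - \<alpha>))"
    using assms(1)
    by (intro add.finprod_mono_neutral_cong_right)
      (auto simp: poly_const_def finite_submultisets mset_poly_coeff[OF assms(2)])
  then show "(poly_const R a \<otimes>\<^bsub>mset_poly R\<^esub> p) \<mu> = a \<otimes> p \<mu>"
    using assms mset_poly_coeff[OF assms(2)] by (simp add: mset_poly_mult poly_const_def finsum_insert)
qed

lemma mset_poly_cring: "cring (mset_poly R :: ('i multiset \<Rightarrow> 'a) ring)" (is "cring ?P")
proof (rule cringI)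
  show "abelian_group ?P"
  proof (rule abelian_groupI)
    fix p assume p: "p \<in> carrier (mset_poly R)"
    have "{\<mu>. \<ominus> p \<mu> \<noteq> \<zero>} = {\<mu>. p \<mu> \<noteq> \<zero>}"
      using p by (metis mset_poly_coeff add.inv_eq_1_iff)
    then have "(\<lambda>\<mu>. \<ominus> p \<mu>) \<in> carrier (mset_poly R)"
      using p by (auto simp: mset_poly_carrier)
    then show "\<exists>q\<in>carrier (mset_poly R). q \<oplus>\<^bsub>mset_poly R\<^esub> p = \<zero>\<^bsub>mset_poly R\<^esub>"
      using mset_poly_coeff[OF p] by (intro bexI[of _ "\<lambda>\<mu>. \<ominus> p \<mu>"]) (auto simp: fun_eq_iff mset_poly_add mset_poly_zero l_neg)
  qed (auto simp: fun_eq_iff mset_poly_add mset_poly_zero mset_poly_add_closed mset_poly_coeff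
        intro: a_assoc a_comm, auto simp: mset_poly_carrier)
next
  show "Group.comm_monoid ?P"
  proof (rule comm_monoidI)
    fix p q r :: "'i multiset \<Rightarrow> 'a"
    assume p: "p \<in> carrier (mset_poly R)" and q: "q \<in> carrier (mset_poly R)"
    note pq = mset_poly_coeff[OF p] mset_poly_coeff[OF q]
    show "p \<otimes>\<^bsub>mset_poly R\<^esub> q = q \<otimes>\<^bsub>mset_poly R\<^esub> p"
    proof
      fix \<mu> :: "'i multiset"
      have diff2: "\<mu> - (\<mu> - \<alpha>) = \<alpha>" if "\<alpha> \<subseteq># \<mu>" for \<alpha>
        using that by (auto simp: multiset_eq_iff subseteq_mset_def)
      have "\<alpha> \<in> (\<lambda>\<alpha>. \<mu> - \<alpha>) ` {\<alpha>. \<alpha> \<subseteq># \<mu>}" if "\<alpha> \<subseteq># \<mu>" for \<alpha>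
        using that by (intro image_eqI[of _ _ "\<mu> - \<alpha>"]) (auto simp: diff2)
      then have im: "(\<lambda>\<alpha>. \<mu> - \<alpha>) ` {\<alpha>. \<alpha> \<subseteq># \<mu>} = {\<alpha>. \<alpha> \<subseteq># \<mu>}"
        by auto
      have inj: "inj_on (\<lambda>\<alpha>. \<mu> - \<alpha>) {\<alpha>. \<alpha> \<subseteq># \<mu>}"
        by (metis (mono_tags, lifting) diff2 inj_onI mem_Collect_eq)
      have "(\<Oplus>\<alpha>\<in>(\<lambda>\<alpha>. \<mu> - \<alpha>) ` {\<alpha>. \<alpha> \<subseteq># \<mu>}. p \<alpha> \<otimes> q (\<mu> - \<alpha>))
        = (\<Oplus>\<alpha>\<in>{\<alpha>. \<alpha> \<subseteq># \<mu>}. p (\<mu> - \<alpha>) \<otimes> q (\<mu> - (\<mu> - \<alpha>)))"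
        using pq inj by (intro finsum_reindex) auto
      also have "\<dots> = (\<Oplus>\<alpha>\<in>{\<alpha>. \<alpha> \<subseteq># \<mu>}. q \<alpha> \<otimes> p (\<mu> - \<alpha>))"
        using pq by (intro finsum_cong') (auto simp: m_comm diff2)
      finally show "(p \<otimes>\<^bsub>mset_poly R\<^esub> q) \<mu> = (q \<otimes>\<^bsub>mset_poly R\<^esub> p) \<mu>"
        unfolding mset_poly_mult im .
    qed
    assume r: "r \<in> carrier (mset_poly R)"
    note pqr = pq mset_poly_coeff[OF r]
    show "(p \<otimes>\<^bsub>mset_poly R\<^esub> q) \<otimes>\<^bsub>mset_poly R\<^esub> r = p \<otimes>\<^bsub>mset_poly R\<^esub> (q \<otimes>\<^bsub>mset_poly R\<^esub> r)"
    proof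
      fix \<mu> :: "'i multiset"
      have "((p \<otimes>\<^bsub>mset_poly R\<^esub> q) \<otimes>\<^bsub>mset_poly R\<^esub> r) \<mu>
        = (\<Oplus>\<alpha>\<in>{\<alpha>. \<alpha> \<subseteq># \<mu>}. \<Oplus>\<beta>\<in>{\<beta>. \<beta> \<subseteq># \<alpha>}. p \<beta> \<otimes> q (\<alpha> - \<beta>) \<otimes> r (\<mu> - \<alpha>))"
        unfolding mset_poly_mult using pqr
        by (intro finsum_cong') (auto intro!: finsum_closed finsum_ldistr simp: finite_submultisets)
      also have "\<dots> = (\<Oplus>\<beta>\<in>{\<beta>. \<beta> \<subseteq># \<mu>}. \<Oplus>\<delta>\<in>{\<delta>. \<delta> \<subseteq># \<mu> - \<beta>}.
          p \<beta> \<otimes> q (\<beta> + \<delta> - \<beta>) \<otimes> r (\<mu> - (\<beta> + \<delta>)))"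
        using pqr by (intro finsum_triangle) auto
      also have "\<dots> = (p \<otimes>\<^bsub>mset_poly R\<^esub> (q \<otimes>\<^bsub>mset_poly R\<^esub> r)) \<mu>"
        unfolding mset_poly_mult using pqr
        by (intro finsum_cong') (auto simp: finsum_rdistr m_assoc finite_submultisets
            intro!: finsum_closed finsum_cong')
      finally show "((p \<otimes>\<^bsub>mset_poly R\<^esub> q) \<otimes>\<^bsub>mset_poly R\<^esub> r) \<mu>
        = (p \<otimes>\<^bsub>mset_poly R\<^esub> (q \<otimes>\<^bsub>mset_poly R\<^esub> r)) \<mu>" .
    qed
  next
    fix p assume p: "p \<in> carrier (mset_poly R)"
    then show "\<one>\<^bsub>mset_poly R\<^esub> \<otimes>\<^bsub>mset_poly R\<^esub> p = p"
      using mset_poly_coeff[OF p] by (simp add: mset_poly_one poly_const_mult)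
  qed (auto simp: mset_poly_mult_closed mset_poly_one)
next
  fix p q r :: "'i multiset \<Rightarrow> 'a"
  assume pqr: "p \<in> carrier (mset_poly R)" "q \<in> carrier (mset_poly R)" "r \<in> carrier (mset_poly R)"
  from pqr[THEN mset_poly_coeff] show "(p \<oplus>\<^bsub>mset_poly R\<^esub> q) \<otimes>\<^bsub>mset_poly R\<^esub> r
    = p \<otimes>\<^bsub>mset_poly R\<^esub> r \<oplus>\<^bsub>mset_poly R\<^esub> q \<otimes>\<^bsub>mset_poly R\<^esub> r"
    by (auto simp: fun_eq_iff mset_poly_mult mset_poly_add l_distr Pi_def simp flip: finsum_addf)
qed


section \<open>Linear forms on the polynomial ring\<close>

lemma poly_form_superset:
  assumes "p \<in> carrier (mset_poly R)" "\<And>\<mu>. w \<mu> \<in> carrier R" "finite S" "{\<mu>. p \<mu> \<noteq> \<zero>} \<subseteq> S"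
  shows "poly_form R w p = (\<Oplus>\<mu>\<in>S. p \<mu> \<otimes> w \<mu>)"
  unfolding poly_form_def using assms mset_poly_coeff[OF assms(1)]
  by (intro add.finprod_mono_neutral_cong_left) auto

lemma poly_form_closed:
  assumes "p \<in> carrier (mset_poly R)" "\<And>\<mu>. w \<mu> \<in> carrier R"
  shows "poly_form R w p \<in> carrier R"
  unfolding poly_form_def using assms mset_poly_coeff[OF assms(1)] by (intro finsum_closed) auto

lemma poly_form_add:
  assumes p: "p \<in> carrier (mset_poly R)" and q: "q \<in> carrier (mset_poly R)"
    and w: "\<And>\<mu>. w \<mu> \<in> carrier R"
  shows "poly_form R w (p \<oplus>\<^bsub>mset_poly R\<^esub> q) = poly_form R w p \<oplus> poly_form R w q"
proof -
  let ?S = "{\<mu>. p \<mu> \<noteq> \<zero>} \<union> {\<mu>. q \<mu> \<noteq> \<zero>}"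
  note pq = mset_poly_coeff[OF p] mset_poly_coeff[OF q]
  have S: "finite ?S" using p q by (simp add: mset_poly_finite)
  have "poly_form R w (p \<oplus>\<^bsub>mset_poly R\<^esub> q) = (\<Oplus>\<mu>\<in>?S. (p \<oplus>\<^bsub>mset_poly R\<^esub> q) \<mu> \<otimes> w \<mu>)"
    using p q w S by (intro poly_form_superset mset_poly_add_closed) (auto simp: mset_poly_add)
  also have "\<dots> = (\<Oplus>\<mu>\<in>?S. p \<mu> \<otimes> w \<mu> \<oplus> q \<mu> \<otimes> w \<mu>)"
    using pq w by (intro finsum_cong') (auto simp: mset_poly_add l_distr)
  also have "\<dots> = (\<Oplus>\<mu>\<in>?S. p \<mu> \<otimes> w \<mu>) \<oplus> (\<Oplus>\<mu>\<in>?S. q \<mu> \<otimes> w \<mu>)"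
    using pq w by (intro finsum_addf) auto
  also have "\<dots> = poly_form R w p \<oplus> poly_form R w q"
    using p q w S by (simp add: poly_form_superset[where S = ?S])
  finally show ?thesis .
qed

lemma poly_form_const_mult:
  assumes "a \<in> carrier R" "p \<in> carrier (mset_poly R)" "\<And>\<mu>. w \<mu> \<in> carrier R"
  shows "poly_form R w (poly_const R a \<otimes>\<^bsub>mset_poly R\<^esub> p) = a \<otimes> poly_form R w p"
proof -
  note c = mset_poly_coeff[OF assms(2)]
  have "poly_const R a \<otimes>\<^bsub>mset_poly R\<^esub> p \<in> carrier (mset_poly R)"
    using assms by (intro mset_poly_mult_closed) auto
  then have cl: "(\<lambda>\<mu>. a \<otimes> p \<mu>) \<in> carrier (mset_poly R)"
    using assms by (simp add: poly_const_mult)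
  have "poly_form R w (poly_const R a \<otimes>\<^bsub>mset_poly R\<^esub> p)
    = (\<Oplus>\<mu>\<in>{\<mu>. p \<mu> \<noteq> \<zero>}. (poly_const R a \<otimes>\<^bsub>mset_poly R\<^esub> p) \<mu> \<otimes> w \<mu>)"
    using assms cl by (intro poly_form_superset) (auto simp: mset_poly_finite poly_const_mult)
  also have "\<dots> = a \<otimes> poly_form R w p"
    unfolding poly_form_def using assms c
    by (subst finsum_rdistr) (auto simp: mset_poly_finite poly_const_mult m_assoc intro!: finsum_cong')
  finally show ?thesis .
qed

text \<open>Multiplication by a monomial shifts the argument of \<open>w\<close>. A form therefore
  vanishes on a principal ideal as soon as the forms of all shifts of \<open>w\<close> vanish at the
  generator.\<close>

lemma poly_form_mult:
  assumes p: "p \<in> carrier (mset_poly R)" and q: "q \<in> carrier (mset_poly R)"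
    and w: "\<And>\<mu>. w \<mu> \<in> carrier R"
  shows "poly_form R w (p \<otimes>\<^bsub>mset_poly R\<^esub> q)
    = (\<Oplus>\<beta>\<in>{\<beta>. q \<beta> \<noteq> \<zero>}. q \<beta> \<otimes> poly_form R (\<lambda>\<alpha>. w (\<alpha> + \<beta>)) p)"
proof -
  let ?S = "{\<mu>. p \<mu> \<noteq> \<zero>}" and ?T = "{\<mu>. q \<mu> \<noteq> \<zero>}"
  let ?M = "(\<lambda>x. fst x + snd x) ` (?S \<times> ?T)"
  let ?t = "\<lambda>x. p (snd x) \<otimes> q (fst x) \<otimes> w (snd x + fst x)"
  note pq = mset_poly_coeff[OF p] mset_poly_coeff[OF q]
  have fin: "finite ?S" "finite ?T" using p q by (simp_all add: mset_poly_finite)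
  \<comment> \<open>The terms of the product are grouped by exponent. The exponent of
    \<open>q\<close> comes first in each pair, so that the outer sum will run over it.\<close>
  have coeff: "(p \<otimes>\<^bsub>mset_poly R\<^esub> q) \<mu> \<otimes> w \<mu> = (\<Oplus>x\<in>{x \<in> ?T \<times> ?S. snd x + fst x = \<mu>}. ?t x)" for \<mu>
  proof -
    let ?D = "{\<alpha>. \<alpha> \<subseteq># \<mu> \<and> \<alpha> \<in> ?S \<and> \<mu> - \<alpha> \<in> ?T}"
    have D: "{x \<in> ?T \<times> ?S. snd x + fst x = \<mu>} = (\<lambda>\<alpha>. (\<mu> - \<alpha>, \<alpha>)) ` ?D"
      by (auto simp: image_iff)
    have "(p \<otimes>\<^bsub>mset_poly R\<^esub> q) \<mu> = (\<Oplus>\<alpha>\<in>?D. p \<alpha> \<otimes> q (\<mu> - \<alpha>))"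
      unfolding mset_poly_mult using pq
      by (intro add.finprod_mono_neutral_cong_right) (auto simp: finite_submultisets)
    then have "(p \<otimes>\<^bsub>mset_poly R\<^esub> q) \<mu> \<otimes> w \<mu> = (\<Oplus>\<alpha>\<in>?D. p \<alpha> \<otimes> q (\<mu> - \<alpha>) \<otimes> w \<mu>)"
      using pq w fin by (simp add: finsum_ldistr)
    also have "\<dots> = (\<Oplus>\<alpha>\<in>?D. ?t (\<mu> - \<alpha>, \<alpha>))"
      using pq w by (intro finsum_cong') auto
    also have "\<dots> = (\<Oplus>x\<in>(\<lambda>\<alpha>. (\<mu> - \<alpha>, \<alpha>)) ` ?D. ?t x)"
      using pq w by (intro finsum_reindex[symmetric]) (auto simp: inj_on_def)
    finally show ?thesis unfolding D .
  qed
  have U: "?T \<times> ?S = (\<Union>\<mu>\<in>?M. {x \<in> ?T \<times> ?S. snd x + fst x = \<mu>})"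
    by force
  have "poly_form R w (p \<otimes>\<^bsub>mset_poly R\<^esub> q) = (\<Oplus>\<mu>\<in>?M. (p \<otimes>\<^bsub>mset_poly R\<^esub> q) \<mu> \<otimes> w \<mu>)"
    using p q w fin mset_poly_mult_support[OF p q]
    by (intro poly_form_superset mset_poly_mult_closed) auto
  also have "\<dots> = (\<Oplus>\<mu>\<in>?M. \<Oplus>x\<in>{x \<in> ?T \<times> ?S. snd x + fst x = \<mu>}. ?t x)"
    unfolding coeff using pq w by (intro finsum_cong') (auto intro!: finsum_closed)
  also have "\<dots> = (\<Oplus>x\<in>(\<Union>\<mu>\<in>?M. {x \<in> ?T \<times> ?S. snd x + fst x = \<mu>}). ?t x)"
  proof (rule add.finprod_UN_disjoint[symmetric])
    show "pairwise (\<lambda>i j. disjnt {x \<in> ?T \<times> ?S. snd x + fst x = i} {x \<in> ?T \<times> ?S. snd x + fst x = j}) ?M"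
      by (auto simp: pairwise_def disjnt_def)
  qed (use fin in \<open>auto intro!: m_closed pq w\<close>)
  also have "\<dots> = (\<Oplus>x\<in>?T \<times> ?S. ?t x)"
    using U by simp
  also have "\<dots> = (\<Oplus>\<beta>\<in>?T. \<Oplus>\<alpha>\<in>?S. p \<alpha> \<otimes> q \<beta> \<otimes> w (\<alpha> + \<beta>))"
    using pq w fin by (subst finsum_Sigma) auto
  also have "\<dots> = (\<Oplus>\<beta>\<in>?T. q \<beta> \<otimes> poly_form R (\<lambda>\<alpha>. w (\<alpha> + \<beta>)) p)"
    unfolding poly_form_def using pq w fin
    by (intro finsum_cong') (auto simp: finsum_rdistr m_ac intro!: finsum_cong' finsum_closed)
  finally show ?thesis .
qed

lemma poly_form_const:
  fixes w :: "'i multiset \<Rightarrow> 'a"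
  assumes "a \<in> carrier R" "\<And>\<mu>. w \<mu> \<in> carrier R"
  shows "poly_form R w (poly_const R a) = a \<otimes> w {#}"
proof -
  have "{\<mu>. poly_const R a \<mu> \<noteq> \<zero>} \<subseteq> {{#}}" by (auto simp: poly_const_def)
  then have "poly_form R w (poly_const R a) = (\<Oplus>\<mu>\<in>{{#}}. poly_const R a \<mu> \<otimes> w \<mu>)"
    using assms by (intro poly_form_superset) auto
  then show ?thesis
    using assms by (simp add: poly_const_def finsum_insert)
qed

lemma poly_form_var:
  fixes w :: "'i multiset \<Rightarrow> 'a"
  assumes "\<And>\<mu>. w \<mu> \<in> carrier R"
  shows "poly_form R w (poly_var R i) = w {#i#}"
proof -
  have "{\<mu>. poly_var R i \<mu> \<noteq> \<zero>} \<subseteq> {{#i#}}" by (auto simp: poly_var_def)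
  then have "poly_form R w (poly_var R i) = (\<Oplus>\<mu>\<in>{{#i#}}. poly_var R i \<mu> \<otimes> w \<mu>)"
    using assms by (intro poly_form_superset) auto
  then show ?thesis
    using assms by (simp add: poly_var_def finsum_insert)
qed

lemma poly_const_hom: "poly_const R \<in> ring_hom R (mset_poly R)"
proof (rule ring_hom_memI)
  fix a b assume ab: "a \<in> carrier R" "b \<in> carrier R"
  then show "poly_const R (a \<otimes> b) = poly_const R a \<otimes>\<^bsub>mset_poly R\<^esub> poly_const R b"
    by (auto simp: poly_const_mult poly_const_closed) (auto simp: poly_const_def)
  show "poly_const R (a \<oplus> b) = poly_const R a \<oplus>\<^bsub>mset_poly R\<^esub> poly_const R b"
    using ab by (auto simp: poly_const_def mset_poly_add)
qed (auto simp: mset_poly_one)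

end

section \<open>Solid closure through forms on the forcing algebra\<close>

text \<open>A quotient is a plain ring record, whereas \<open>solid_algebra\<close> expects a module
  record; the scalar action is pulled back along \<open>g\<close>.\<close>

definition algebra_of_hom :: "('b, 'm) ring_scheme \<Rightarrow> ('a \<Rightarrow> 'b) \<Rightarrow> ('a, 'b) module"
  where "algebra_of_hom S g =
    \<lparr> carrier = carrier S, monoid.mult = monoid.mult S, monoid.one = monoid.one S,
      ring.zero = ring.zero S, ring.add = ring.add S, smult = (\<lambda>a x. g a \<otimes>\<^bsub>S\<^esub> x) \<rparr>"

lemma algebra_of_hom_simps:
  "carrier (algebra_of_hom S g) = carrier S"
  "monoid.mult (algebra_of_hom S g) = monoid.mult S"
  "monoid.one (algebra_of_hom S g) = monoid.one S"
  "ring.zero (algebra_of_hom S g) = ring.zero S"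
  "ring.add (algebra_of_hom S g) = ring.add S"
  "smult (algebra_of_hom S g) = (\<lambda>a x. g a \<otimes>\<^bsub>S\<^esub> x)"
  by (simp_all add: algebra_of_hom_def)

lemma (in cring) algebra_of_hom_algebra:
  assumes "cring A" "g \<in> ring_hom A R"
  shows "algebra A (algebra_of_hom R g)"
proof -
  interpret A: cring A by fact
  interpret h: ring_hom_cring A R g
    by (intro ring_hom_cring.intro ring_hom_cring_axioms.intro assms is_cring)
  have "\<exists>y\<in>carrier R. y \<oplus> x = \<zero>" if "x \<in> carrier R" for x
    using that by (intro bexI[of _ "\<ominus> x"]) (auto simp: l_neg)
  then have "cring (algebra_of_hom R g)"
    by (intro cringI abelian_groupI comm_monoidI)
      (auto simp: algebra_of_hom_simps a_assoc m_assoc l_distr intro: a_comm m_comm)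
  then show ?thesis
    by (intro algebraI) (auto simp: algebra_of_hom_simps is_cring l_distr r_distr m_assoc A.is_cring)
qed

lemma (in ideal) finsum_in_ideal:
  assumes "\<And>i. i \<in> S \<Longrightarrow> g i \<in> I"
  shows "(\<Oplus>i\<in>S. g i) \<in> I"
  using assms
  by (induction S rule: infinite_finite_induct) (auto simp: finsum_insert Pi_def)

lemma (in cring) complete_local_solid_closureI:
  fixes w :: "nat multiset \<Rightarrow> 'a"
  assumes I: "finite I" and a: "\<And>i. i \<in> I \<Longrightarrow> a i \<in> J" and J: "J \<subseteq> carrier R"
    and z: "z \<in> carrier R" and w: "\<And>\<mu>. w \<mu> \<in> carrier R" and w0: "w {#} \<noteq> \<zero>"
    and rec: "\<And>\<mu>. (\<Oplus>i\<in>I. a i \<otimes> w (add_mset i \<mu>)) = z \<otimes> w \<mu>"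
  shows "z \<in> complete_local_solid_closure R J"
proof -
  let ?P = "mset_poly R :: (nat multiset \<Rightarrow> 'a) ring"
  interpret P: cring ?P by (rule mset_poly_cring)
  interpret c: ring_hom_cring R ?P "poly_const R"
    by (intro ring_hom_cring.intro ring_hom_cring_axioms.intro is_cring P.is_cring poly_const_hom)
  have aR: "a i \<in> carrier R" if "i \<in> I" for i using a J that by blast
  define t where "t i = poly_const R (a i) \<otimes>\<^bsub>?P\<^esub> poly_var R i" for i
  have tP: "t i \<in> carrier ?P" if "i \<in> I" for i using that aR by (auto simp: t_def)
  define F where "F = (\<Oplus>\<^bsub>?P\<^esub>i\<in>I. t i) \<oplus>\<^bsub>?P\<^esub> poly_const R (\<ominus> z)"
  have sumP: "(\<Oplus>\<^bsub>?P\<^esub>i\<in>I. t i) \<in> carrier ?P" using tP by (intro P.finsum_closed) auto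
  have FP: "F \<in> carrier ?P" using sumP z by (auto simp: F_def)
  define N where "N = PIdl\<^bsub>?P\<^esub> F"
  interpret N: ideal N ?P unfolding N_def by (rule P.cgenideal_ideal[OF FP])
  let ?Q = "?P Quot N"
  interpret Q: cring ?Q by (rule N.quotient_is_cring[OF P.is_cring])
  interpret q: ring_hom_cring ?P ?Q "(+>\<^bsub>?P\<^esub>) N" by (rule N.rcos_ring_hom_cring[OF P.is_cring])
  define g where "g = (\<lambda>a. N +>\<^bsub>?P\<^esub> poly_const R a)"
  have g: "g \<in> ring_hom R ?Q"
    using ring_hom_trans[OF poly_const_hom N.rcos_ring_hom] by (simp add: g_def comp_def)
  let ?B = "algebra_of_hom ?Q g"
  have alg: "algebra R ?B"
    by (rule Q.algebra_of_hom_algebra[OF is_cring g])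
  interpret B: algebra R ?B by (rule alg)

  have form_sum: "poly_form R v (\<Oplus>\<^bsub>?P\<^esub>i\<in>I. t i) = (\<Oplus>i\<in>I. a i \<otimes> v {#i#})"
    if v: "\<And>\<mu>. v \<mu> \<in> carrier R" for v
    using I aR tP
  proof (induction I rule: finite_induct)
    case (insert i I)
    then show ?case
      using v by (simp add: P.finsum_insert finsum_insert poly_form_add Pi_def P.finsum_closed)
        (simp add: t_def poly_form_const_mult poly_form_var)
  next
    case empty
    then show ?case by (simp add: P.finsum_empty mset_poly_zero poly_form_def)
  qed
  \<comment> \<open>The recurrence at \<beta> says exactly that the form shifted by \<beta> vanishes
    at the defining equation \<open>F\<close>.\<close>
  have form_F: "poly_form R (\<lambda>\<alpha>. w (\<alpha> + \<beta>)) F = \<zero>" for \<beta>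
    using z w sumP rec[of \<beta>]
    by (simp add: F_def poly_form_add form_sum poly_form_const l_minus r_neg del: c.hom_a_inv)
  have form_N: "poly_form R w p = \<zero>" if "p \<in> N" for p
  proof -
    from that obtain r where r: "r \<in> carrier ?P" "p = r \<otimes>\<^bsub>?P\<^esub> F"
      unfolding N_def cgenideal_def by blast
    have p: "p = F \<otimes>\<^bsub>?P\<^esub> r" unfolding r(2) by (rule P.m_comm[OF r(1) FP])
    have "poly_form R w p
      = (\<Oplus>\<beta>\<in>{\<beta>. r \<beta> \<noteq> \<zero>}. r \<beta> \<otimes> poly_form R (\<lambda>\<alpha>. w (\<alpha> + \<beta>)) F)"
      unfolding p by (rule poly_form_mult[OF FP r(1) w])
    also have "\<dots> = \<zero>"
      by (rule add.finprod_one_eqI) (simp add: form_F mset_poly_coeff[OF r(1)])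
    finally show ?thesis .
  qed
  \<comment> \<open>The form is constant on cosets of \<open>N\<close>, so the image of a coset is a
    singleton.\<close>
  define val where "val U = the_elem (poly_form R w ` U)" for U
  have val: "val (N +>\<^bsub>?P\<^esub> p) = poly_form R w p" if p: "p \<in> carrier ?P" for p
  proof -
    have "poly_form R w x = poly_form R w p" if x: "x \<in> N +>\<^bsub>?P\<^esub> p" for x
    proof -
      from x obtain y where y: "y \<in> N" "x = y \<oplus>\<^bsub>?P\<^esub> p" by (auto simp: a_r_coset_def')
      then show ?thesis using p w by (simp add: poly_form_add form_N poly_form_closed N.a_Hcarr)
    qed
    moreover have "p \<in> N +>\<^bsub>?P\<^esub> p" by (rule N.a_rcos_self[OF p])
    ultimately have "poly_form R w ` (N +>\<^bsub>?P\<^esub> p) = {poly_form R w p}" by blast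
    then show ?thesis by (simp add: val_def)
  qed
  have repr: "\<exists>p\<in>carrier ?P. U = N +>\<^bsub>?P\<^esub> p" if "U \<in> carrier ?B" for U
    using that unfolding algebra_of_hom_simps FactRing_def A_RCOSETS_def' a_r_coset_def' by auto
  have "val \<in> linear_forms R ?B"
    unfolding linear_forms_def
  proof (intro CollectI conjI ballI funcsetI)
    fix U assume "U \<in> carrier ?B"
    with repr obtain p where p: "p \<in> carrier ?P" "U = N +>\<^bsub>?P\<^esub> p" by blast
    then show "val U \<in> carrier R" using w by (simp add: val poly_form_closed)
    {
      fix V assume "V \<in> carrier ?B"
      with repr obtain q where q: "q \<in> carrier ?P" "V = N +>\<^bsub>?P\<^esub> q" by blast
      have "val (U \<oplus>\<^bsub>?B\<^esub> V) = val (N +>\<^bsub>?P\<^esub> (p \<oplus>\<^bsub>?P\<^esub> q))"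
        using p q by (simp add: algebra_of_hom_simps)
      also have "\<dots> = val U \<oplus> val V"
        unfolding val[OF P.a_closed[OF p(1) q(1)]] using p q w by (simp add: val poly_form_add)
      finally show "val (U \<oplus>\<^bsub>?B\<^esub> V) = val U \<oplus> val V" .
    }
  next
    fix b U assume b: "b \<in> carrier R" and "U \<in> carrier ?B"
    with repr obtain p where p: "p \<in> carrier ?P" "U = N +>\<^bsub>?P\<^esub> p" by blast
    have "val (b \<odot>\<^bsub>?B\<^esub> U) = val (N +>\<^bsub>?P\<^esub> (poly_const R b \<otimes>\<^bsub>?P\<^esub> p))"
      using b p by (simp add: algebra_of_hom_simps g_def)
    also have "\<dots> = b \<otimes> val U"
      unfolding val[OF P.m_closed[OF poly_const_closed[OF b] p(1)]]
      using b p w by (simp add: val poly_form_const_mult)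
    finally show "val (b \<odot>\<^bsub>?B\<^esub> U) = b \<otimes> val U" .
  qed
  moreover have "val \<one>\<^bsub>?B\<^esub> \<noteq> \<zero>"
  proof -
    have "val \<one>\<^bsub>?B\<^esub> = val (N +>\<^bsub>?P\<^esub> \<one>\<^bsub>?P\<^esub>)"
      unfolding algebra_of_hom_simps q.hom_one ..
    also have "\<dots> = w {#}"
      unfolding val[OF P.one_closed] unfolding mset_poly_one poly_form_const[OF one_closed w]
      using w by simp
    finally show ?thesis using w0 by simp
  qed
  ultimately have "solid_algebra R ?B"
    unfolding solid_algebra_def using alg by blast
  moreover have "z \<odot>\<^bsub>?B\<^esub> \<one>\<^bsub>?B\<^esub> \<in> Idl\<^bsub>?B\<^esub> ((\<lambda>a. a \<odot>\<^bsub>?B\<^esub> \<one>\<^bsub>?B\<^esub>) ` J)" (is "_ \<in> ?K")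
  proof -
    have JB: "(\<lambda>a. a \<odot>\<^bsub>?B\<^esub> \<one>\<^bsub>?B\<^esub>) ` J \<subseteq> carrier ?B" using J by auto
    interpret K: ideal ?K ?B by (rule B.genideal_ideal[OF JB])
    have gX: "g b = b \<odot>\<^bsub>?B\<^esub> \<one>\<^bsub>?B\<^esub>" if "b \<in> carrier R" for b
      using ring_hom_closed[OF g that] by (simp add: algebra_of_hom_simps)
    have "g (a i) \<in> ?K" if "i \<in> I" for i
      using that a aR gX B.genideal_self[OF JB] by force
    then have "g (a i) \<otimes>\<^bsub>?B\<^esub> (N +>\<^bsub>?P\<^esub> poly_var R i) \<in> ?K" if "i \<in> I" for i
      using that by (intro K.I_r_closed) (auto simp: algebra_of_hom_simps)
    moreover have "g (a i) \<otimes>\<^bsub>?B\<^esub> (N +>\<^bsub>?P\<^esub> poly_var R i) = N +>\<^bsub>?P\<^esub> t i" if "i \<in> I" for i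
      using that aR by (simp add: algebra_of_hom_simps g_def t_def)
    ultimately have "(\<Oplus>\<^bsub>?B\<^esub>i\<in>I. N +>\<^bsub>?P\<^esub> t i) \<in> ?K"
      by (intro K.finsum_in_ideal) auto
    \<comment> \<open>The two structures differ only in the scalar action, on which a sum does not
      depend.\<close>
    moreover have "(\<Oplus>\<^bsub>?B\<^esub>i\<in>I. N +>\<^bsub>?P\<^esub> t i) = (\<Oplus>\<^bsub>?Q\<^esub>i\<in>I. N +>\<^bsub>?P\<^esub> t i)"
      by (simp add: finsum_def finprod_def algebra_of_hom_simps)
    moreover have "(\<Oplus>\<^bsub>?Q\<^esub>i\<in>I. N +>\<^bsub>?P\<^esub> t i) = N +>\<^bsub>?P\<^esub> (\<Oplus>\<^bsub>?P\<^esub>i\<in>I. t i)"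
      using tP by (subst q.hom_finsum) (auto simp: comp_def)
    moreover have "N +>\<^bsub>?P\<^esub> (\<Oplus>\<^bsub>?P\<^esub>i\<in>I. t i) = g z"
    proof -
      have "F \<in> N" unfolding N_def by (rule P.cgenideal_self[OF FP])
      moreover have "(\<Oplus>\<^bsub>?P\<^esub>i\<in>I. t i) = F \<oplus>\<^bsub>?P\<^esub> poly_const R z"
        using sumP z by (simp add: F_def P.a_assoc c.hom_add[symmetric] l_neg
          P.l_neg flip: c.hom_add)
      ultimately have "(\<Oplus>\<^bsub>?P\<^esub>i\<in>I. t i) \<in> N +>\<^bsub>?P\<^esub> poly_const R z"
        by (auto simp: a_r_coset_def')
      then show ?thesis
        using z unfolding g_def by (intro N.a_repr_independence'[symmetric]) auto
    qed
    ultimately show ?thesis using gX z by simp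
  qed
  ultimately show ?thesis
    unfolding complete_local_solid_closure_def using z by blast
qed

section \<open>Localization of a domain\<close>

locale mult_subset = domain +
  fixes S
  assumes S_subset: "S \<subseteq> carrier R - {\<zero>}"
    and S_one: "\<one> \<in> S"
    and S_mult: "s \<in> S \<Longrightarrow> t \<in> S \<Longrightarrow> s \<otimes> t \<in> S"
begin

lemma S_carrier [simp, intro]: "s \<in> S \<Longrightarrow> s \<in> carrier R"
  using S_subset by auto

lemma S_nonzero: "s \<in> S \<Longrightarrow> s \<noteq> \<zero>"
  using S_subset by auto

text \<open>In a domain the nonzero factor \<open>u\<close> of the definition cancels, which leaves
  cross-multiplication.\<close>

lemma frac_rel_iff:
  "((a, s), (b, t)) \<in> frac_rel R S \<longleftrightarrow>
    a \<in> carrier R \<and> b \<in> carrier R \<and> s \<in> S \<and> t \<in> S \<and> a \<otimes> t = b \<otimes> s"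
proof -
  have "(\<exists>u\<in>S. u \<otimes> (a \<otimes> t \<ominus> b \<otimes> s) = \<zero>) \<longleftrightarrow> a \<otimes> t = b \<otimes> s"
    if "a \<in> carrier R" "b \<in> carrier R" "s \<in> S" "t \<in> S"
  proof
    assume "\<exists>u\<in>S. u \<otimes> (a \<otimes> t \<ominus> b \<otimes> s) = \<zero>"
    then have "a \<otimes> t \<ominus> b \<otimes> s = \<zero>"
      using that S_nonzero integral_iff by (metis S_carrier m_closed minus_closed)
    then show "a \<otimes> t = b \<otimes> s"
      using that by (metis S_carrier m_closed r_right_minus_eq)
  next
    assume "a \<otimes> t = b \<otimes> s"
    then show "\<exists>u\<in>S. u \<otimes> (a \<otimes> t \<ominus> b \<otimes> s) = \<zero>"
      using that S_one by (intro bexI[of _ \<one>]) (auto simp: a_minus_def r_neg)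
  qed
  then show ?thesis by (auto simp: frac_rel_def)
qed

lemma frac_rel_equiv: "equiv (carrier R \<times> S) (frac_rel R S)"
proof (rule equivI)
  show "frac_rel R S \<subseteq> (carrier R \<times> S) \<times> carrier R \<times> S"
    by (auto simp: frac_rel_iff)
  show "refl_on (carrier R \<times> S) (frac_rel R S)"
    by (auto simp: refl_on_def frac_rel_iff)
  show "sym (frac_rel R S)"
    by (auto simp: sym_def frac_rel_iff)
  show "trans (frac_rel R S)"
  proof (rule transI)
    fix p q r assume "(p, q) \<in> frac_rel R S" "(q, r) \<in> frac_rel R S"
    moreover obtain a s b t c u where "p = (a, s)" "q = (b, t)" "r = (c, u)"
      by (metis surj_pair)
    ultimately have h: "a \<in> carrier R" "b \<in> carrier R" "c \<in> carrier R" "s \<in> S" "t \<in> S" "u \<in> S"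
        "a \<otimes> t = b \<otimes> s" "b \<otimes> u = c \<otimes> t" and e: "p = (a, s)" "r = (c, u)"
      by (auto simp: frac_rel_iff)
    have "t \<otimes> (a \<otimes> u) = (a \<otimes> t) \<otimes> u" using h(1-6) by (simp add: m_ac)
    also have "\<dots> = (b \<otimes> u) \<otimes> s" unfolding h(7) using h(1-6) by (simp add: m_ac)
    also have "\<dots> = t \<otimes> (c \<otimes> s)" unfolding h(8) using h(1-6) by (simp add: m_ac)
    finally have "a \<otimes> u = c \<otimes> s" using h S_nonzero by (metis S_carrier m_closed m_lcancel)
    then show "(p, r) \<in> frac_rel R S" using h e by (auto simp: frac_rel_iff)
  qed
qed

lemma mem_fraction:
  assumes "a \<in> carrier R" "s \<in> S"
  shows "(b, t) \<in> fraction R S a s \<longleftrightarrow> b \<in> carrier R \<and> t \<in> S \<and> a \<otimes> t = b \<otimes> s"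
  using assms by (auto simp: fraction_def frac_rel_iff)

lemma fraction_eq:
  assumes "a \<in> carrier R" "s \<in> S" "b \<in> carrier R" "t \<in> S"
  shows "fraction R S a s = fraction R S b t \<longleftrightarrow> a \<otimes> t = b \<otimes> s"
  unfolding fraction_def using assms by (subst eq_equiv_class_iff[OF frac_rel_equiv]) (auto simp: frac_rel_iff)

abbreviation "loc \<equiv> localization R S"
abbreviation "fr a s \<equiv> fraction R S a s"

lemma loc_carrier: "x \<in> carrier loc \<longleftrightarrow> (\<exists>a\<in>carrier R. \<exists>s\<in>S. x = fr a s)"
  unfolding localization_def fraction_def by (auto simp: quotient_def)

lemma frac_closed [simp, intro]: "a \<in> carrier R \<Longrightarrow> s \<in> S \<Longrightarrow> fr a s \<in> carrier loc"
  by (auto simp: loc_carrier)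

lemma loc_cases:
  assumes "x \<in> carrier loc"
  obtains a s where "a \<in> carrier R" "s \<in> S" "x = fr a s"
  using assms by (auto simp: loc_carrier)

lemma frac_mult:
  assumes "a \<in> carrier R" "s \<in> S" "b \<in> carrier R" "t \<in> S"
  shows "fr a s \<otimes>\<^bsub>loc\<^esub> fr b t = fr (a \<otimes> b) (s \<otimes> t)"
proof -
  have "fr (a' \<otimes> b') (s' \<otimes> t') = fr (a \<otimes> b) (s \<otimes> t)"
    if "(a', s') \<in> fr a s" "(b', t') \<in> fr b t" for a' s' b' t'
  proof -
    have h: "a' \<in> carrier R" "s' \<in> S" "a \<otimes> s' = a' \<otimes> s" "b' \<in> carrier R" "t' \<in> S" "b \<otimes> t' = b' \<otimes> t"
      using that assms by (auto simp: mem_fraction)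
    have "a \<otimes> b \<otimes> (s' \<otimes> t') = (a \<otimes> s') \<otimes> (b \<otimes> t')" using assms h(1,2,4,5) by (simp add: m_ac)
    also have "\<dots> = a' \<otimes> b' \<otimes> (s \<otimes> t)" unfolding h(3,6) using assms h(1,2,4,5) by (simp add: m_ac)
    finally show ?thesis using assms h by (subst fraction_eq) (auto simp: S_mult)
  qed
  moreover have "(a, s) \<in> fr a s" "(b, t) \<in> fr b t" using assms by (auto simp: mem_fraction)
  ultimately have "(\<Union>(a', s')\<in>fr a s. \<Union>(b', t')\<in>fr b t. fr (a' \<otimes> b') (s' \<otimes> t')) = fr (a \<otimes> b) (s \<otimes> t)"
    by blast
  then show ?thesis by (simp add: localization_def)
qed

lemma frac_add:
  assumes "a \<in> carrier R" "s \<in> S" "b \<in> carrier R" "t \<in> S"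
  shows "fr a s \<oplus>\<^bsub>loc\<^esub> fr b t = fr (a \<otimes> t \<oplus> b \<otimes> s) (s \<otimes> t)"
proof -
  have "fr (a' \<otimes> t' \<oplus> b' \<otimes> s') (s' \<otimes> t') = fr (a \<otimes> t \<oplus> b \<otimes> s) (s \<otimes> t)"
    if "(a', s') \<in> fr a s" "(b', t') \<in> fr b t" for a' s' b' t'
  proof -
    have h: "a' \<in> carrier R" "s' \<in> S" "a \<otimes> s' = a' \<otimes> s" "b' \<in> carrier R" "t' \<in> S" "b \<otimes> t' = b' \<otimes> t"
      using that assms by (auto simp: mem_fraction)
    have "(a \<otimes> t \<oplus> b \<otimes> s) \<otimes> (s' \<otimes> t') = (a \<otimes> s') \<otimes> (t \<otimes> t') \<oplus> (b \<otimes> t') \<otimes> (s \<otimes> s')"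
      using assms h(1,2,4,5) by (simp add: m_ac l_distr r_distr)
    also have "\<dots> = (a' \<otimes> t' \<oplus> b' \<otimes> s') \<otimes> (s \<otimes> t)"
      unfolding h(3,6) using assms h(1,2,4,5) by (simp add: m_ac l_distr r_distr)
    finally show ?thesis using assms h by (subst fraction_eq) (auto simp: S_mult)
  qed
  moreover have "(a, s) \<in> fr a s" "(b, t) \<in> fr b t" using assms by (auto simp: mem_fraction)
  ultimately have "(\<Union>(a', s')\<in>fr a s. \<Union>(b', t')\<in>fr b t. fr (a' \<otimes> t' \<oplus> b' \<otimes> s') (s' \<otimes> t'))
      = fr (a \<otimes> t \<oplus> b \<otimes> s) (s \<otimes> t)"
    by blast
  then show ?thesis by (simp add: localization_def)
qed

lemma loc_zero: "\<zero>\<^bsub>loc\<^esub> = fr \<zero> \<one>" and loc_one: "\<one>\<^bsub>loc\<^esub> = fr \<one> \<one>"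
  by (simp_all add: localization_def)

lemma loc_cring: "cring loc"
proof (intro cringI abelian_groupI comm_monoidI)
  fix x y assume "x \<in> carrier loc" "y \<in> carrier loc"
  then show "x \<oplus>\<^bsub>loc\<^esub> y \<in> carrier loc" "x \<otimes>\<^bsub>loc\<^esub> y \<in> carrier loc"
    "x \<oplus>\<^bsub>loc\<^esub> y = y \<oplus>\<^bsub>loc\<^esub> x" "x \<otimes>\<^bsub>loc\<^esub> y = y \<otimes>\<^bsub>loc\<^esub> x"
    by (auto elim!: loc_cases simp: frac_add frac_mult S_mult m_comm a_comm)
next
  fix x y z assume "x \<in> carrier loc" "y \<in> carrier loc" "z \<in> carrier loc"
  then obtain a s b t c u where h: "a \<in> carrier R" "b \<in> carrier R" "c \<in> carrier R"
    "s \<in> S" "t \<in> S" "u \<in> S" and e: "x = fr a s" "y = fr b t" "z = fr c u"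
    by (auto elim!: loc_cases)
  have st: "s \<otimes> t \<in> S" "t \<otimes> u \<in> S" "s \<otimes> u \<in> S" "s \<otimes> t \<otimes> u \<in> S" "s \<otimes> (t \<otimes> u) \<in> S" "s \<otimes> u \<otimes> (t \<otimes> u) \<in> S"
    using h S_mult by auto
  show "x \<oplus>\<^bsub>loc\<^esub> y \<oplus>\<^bsub>loc\<^esub> z = x \<oplus>\<^bsub>loc\<^esub> (y \<oplus>\<^bsub>loc\<^esub> z)"
    unfolding e using h st by (simp add: frac_add fraction_eq)
      (simp add: m_ac a_ac l_distr r_distr)
  show "x \<otimes>\<^bsub>loc\<^esub> y \<otimes>\<^bsub>loc\<^esub> z = x \<otimes>\<^bsub>loc\<^esub> (y \<otimes>\<^bsub>loc\<^esub> z)"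
    unfolding e using h st by (simp add: frac_mult m_assoc)
  show "(x \<oplus>\<^bsub>loc\<^esub> y) \<otimes>\<^bsub>loc\<^esub> z = x \<otimes>\<^bsub>loc\<^esub> z \<oplus>\<^bsub>loc\<^esub> y \<otimes>\<^bsub>loc\<^esub> z"
    unfolding e using h st by (simp add: frac_add frac_mult fraction_eq)
      (simp add: m_ac a_ac l_distr r_distr)
next
  fix x assume "x \<in> carrier loc"
  then obtain a s where h: "a \<in> carrier R" "s \<in> S" and e: "x = fr a s"
    by (auto elim!: loc_cases)
  show "\<zero>\<^bsub>loc\<^esub> \<oplus>\<^bsub>loc\<^esub> x = x"
    unfolding e loc_zero using h S_one by (simp add: frac_add)
  show "\<one>\<^bsub>loc\<^esub> \<otimes>\<^bsub>loc\<^esub> x = x"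
    unfolding e loc_one using h S_one by (simp add: frac_mult)
  have "fr (\<ominus> a) s \<oplus>\<^bsub>loc\<^esub> x = \<zero>\<^bsub>loc\<^esub>"
    unfolding e loc_zero using h S_one S_mult by (simp add: frac_add fraction_eq l_minus l_neg)
  then show "\<exists>y\<in>carrier loc. y \<oplus>\<^bsub>loc\<^esub> x = \<zero>\<^bsub>loc\<^esub>" using h by blast
qed (auto simp: loc_zero loc_one S_one)

abbreviation "emb \<equiv> to_localization R S"

lemma emb_eq_iff: "a \<in> carrier R \<Longrightarrow> b \<in> carrier R \<Longrightarrow> emb a = emb b \<longleftrightarrow> a = b"
  using S_one by (simp add: to_localization_def fraction_eq)

lemma emb_hom: "ring_hom_cring R loc emb"
proof (intro ring_hom_cring.intro ring_hom_cring_axioms.intro ring_hom_memI loc_cring is_cring)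
qed (use S_one in \<open>auto simp: to_localization_def frac_add frac_mult loc_one\<close>)

lemma frac_mult_emb:
  assumes "a \<in> carrier R" "s \<in> S"
  shows "fr a s \<otimes>\<^bsub>loc\<^esub> emb s = emb a"
  using assms S_one S_mult by (simp add: to_localization_def frac_mult fraction_eq)

lemma emb_Units: "s \<in> S \<Longrightarrow> emb s \<in> Units loc"
proof -
  assume s: "s \<in> S"
  interpret L: cring loc by (rule loc_cring)
  have "fr \<one> s \<otimes>\<^bsub>loc\<^esub> emb s = \<one>\<^bsub>loc\<^esub>"
    using frac_mult_emb[OF one_closed s] by (simp add: to_localization_def loc_one)
  then show ?thesis
    using s S_one L.m_comm[of "fr \<one> s" "emb s"] unfolding Units_def
    by (auto simp: to_localization_def intro!: bexI[of _ "fr \<one> s"])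
qed

lemma loc_domain: "domain loc"
proof (intro domain.intro loc_cring domain_axioms.intro)
  show "\<one>\<^bsub>loc\<^esub> \<noteq> \<zero>\<^bsub>loc\<^esub>"
    using S_one by (simp add: loc_one loc_zero fraction_eq)
  fix x y assume xy: "x \<otimes>\<^bsub>loc\<^esub> y = \<zero>\<^bsub>loc\<^esub>" "x \<in> carrier loc" "y \<in> carrier loc"
  then obtain a s b t where h: "a \<in> carrier R" "b \<in> carrier R" "s \<in> S" "t \<in> S"
      and e: "x = fr a s" "y = fr b t"
    by (meson loc_cases)
  have z: "fr c u = \<zero>\<^bsub>loc\<^esub> \<longleftrightarrow> c = \<zero>" if "c \<in> carrier R" "u \<in> S" for c u
    using that S_one by (simp add: loc_zero fraction_eq)
  have "a \<otimes> b = \<zero>"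
    using xy(1) h z[of "a \<otimes> b" "s \<otimes> t"] by (simp add: e frac_mult S_mult)
  then show "x = \<zero>\<^bsub>loc\<^esub> \<or> y = \<zero>\<^bsub>loc\<^esub>"
    using h z integral_iff by (auto simp: e)
qed

end

section \<open>Adic completion\<close>

lemma set_add_mono: "A \<subseteq> A' \<Longrightarrow> B \<subseteq> B' \<Longrightarrow> A <+>\<^bsub>R\<^esub> B \<subseteq> A' <+>\<^bsub>R\<^esub> B'"
  by (auto simp: set_add_def')

lemma rcoset_mult_mono:
  assumes "A \<subseteq> A'" "B \<subseteq> B'" "I \<subseteq> I'"
  shows "rcoset_mult R I A B \<subseteq> rcoset_mult R I' A' B'"
  unfolding rcoset_mult_def a_r_coset_def'
  by (intro UN_mono assms) (use assms(3) in auto)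

lemma FactRing_cases:
  assumes "c \<in> carrier (R Quot I)"
  obtains r where "r \<in> carrier R" "c = I +>\<^bsub>R\<^esub> r"
  using assms unfolding FactRing_def A_RCOSETS_def' a_r_coset_def' by auto

lemma (in ideal) coset_eqI: "r \<in> I +> s \<Longrightarrow> s \<in> carrier R \<Longrightarrow> I +> r = I +> s"
  by (metis a_repr_independence')

lemma (in ideal) coset_eq_self: "r \<in> carrier R \<Longrightarrow> I +> r = I \<longleftrightarrow> r \<in> I"
  by (metis a_rcos_const rcos_const_imp_mem a_Hcarr)

locale completion = cring + fixes I
  assumes ideal_I: "ideal I R"
begin

abbreviation "ip n \<equiv> ideal_pow R I n"
abbreviation "compl \<equiv> adic_completion R I"

lemma pow_ideal: "ideal (ip n) R"
  by (induction n) (auto simp: oneideal ideal_I intro: ideal_prod_is_ideal)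

lemma pow_Suc_subset: "ip (Suc n) \<subseteq> ip n"
  using ideal_prod_inter[OF pow_ideal ideal_I, of n] by auto

lemma quot_cring: "cring (R Quot ip n)"
  by (rule ideal.quotient_is_cring[OF pow_ideal is_cring])

lemma coset_closed: "r \<in> carrier R \<Longrightarrow> ip n +> r \<in> carrier (R Quot ip n)"
  by (rule ring_hom_closed[OF ideal.rcos_ring_hom[OF pow_ideal]])

lemma compl_carrier:
  "x \<in> carrier compl \<longleftrightarrow> (\<forall>n. x n \<in> carrier (R Quot ip n) \<and> x (Suc n) \<subseteq> x n)"
  by (simp add: adic_completion_def)

lemma compl_ops:
  "x \<otimes>\<^bsub>compl\<^esub> y = (\<lambda>n. x n \<otimes>\<^bsub>R Quot ip n\<^esub> y n)"
  "x \<oplus>\<^bsub>compl\<^esub> y = (\<lambda>n. x n \<oplus>\<^bsub>R Quot ip n\<^esub> y n)"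
  "\<one>\<^bsub>compl\<^esub> = (\<lambda>n. \<one>\<^bsub>R Quot ip n\<^esub>)"
  "\<zero>\<^bsub>compl\<^esub> = (\<lambda>n. \<zero>\<^bsub>R Quot ip n\<^esub>)"
  by (simp_all add: adic_completion_def)

lemma compl_subset:
  assumes "x \<in> carrier compl" "i \<le> n"
  shows "x n \<subseteq> x i"
  using assms(2) by (rule lift_Suc_antimono_le[rotated]) (use assms(1) in \<open>auto simp: compl_carrier\<close>)

text \<open>The components of a point of the completion are nested cosets, so one representative of
  the component at \<open>n\<close> serves all earlier components at once.\<close>

lemma compl_coset:
  assumes x: "x \<in> carrier compl" and r: "r \<in> x n" and i: "i \<le> n"
  shows "r \<in> carrier R" "x i = ip i +> r"
proof -
  interpret ideal "ip i" R by (rule pow_ideal)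
  have "x i \<in> carrier (R Quot ip i)" using x by (simp add: compl_carrier)
  then obtain s where s: "s \<in> carrier R" "x i = ip i +> s" by (rule FactRing_cases)
  have "r \<in> x i" using compl_subset[OF x i] r by blast
  then show "x i = ip i +> r" using s coset_eqI by simp
  show "r \<in> carrier R" using \<open>r \<in> x i\<close> s a_r_coset_subset_G[OF a_subset] by blast
qed

lemma compl_nonempty:
  assumes x: "x \<in> carrier compl"
  shows "\<exists>r. r \<in> x n"
proof -
  interpret ideal "ip n" R by (rule pow_ideal)
  have "x n \<in> carrier (R Quot ip n)" using x by (simp add: compl_carrier)
  then obtain s where s: "s \<in> carrier R" "x n = ip n +> s" by (rule FactRing_cases)
  then show ?thesis using a_rcos_self by blast
qed

lemma compl_cring: "cring compl"
proof -
  note quot = quot_cring[THEN cring.is_cring]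
  have mem: "x n \<in> carrier (R Quot ip n)" if "x \<in> carrier compl" for x n
    using that by (simp add: compl_carrier)
  have mono: "x (Suc n) \<subseteq> x n" if "x \<in> carrier compl" for x n
    using that by (simp add: compl_carrier)
  show ?thesis
  proof (intro cringI abelian_groupI comm_monoidI)
    fix x y assume x: "x \<in> carrier compl" and y: "y \<in> carrier compl"
    show "x \<oplus>\<^bsub>compl\<^esub> y \<in> carrier compl"
      unfolding compl_carrier compl_ops
    proof (intro allI conjI)
      fix n
      interpret Q: cring "R Quot ip n" by (rule quot_cring)
      show "x n \<oplus>\<^bsub>R Quot ip n\<^esub> y n \<in> carrier (R Quot ip n)" using x y mem by simp
      show "x (Suc n) \<oplus>\<^bsub>R Quot ip (Suc n)\<^esub> y (Suc n) \<subseteq> x n \<oplus>\<^bsub>R Quot ip n\<^esub> y n"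
        using set_add_mono[OF mono[OF x] mono[OF y]] by (simp add: FactRing_def)
    qed
    show "x \<otimes>\<^bsub>compl\<^esub> y \<in> carrier compl"
      unfolding compl_carrier compl_ops
    proof (intro allI conjI)
      fix n
      interpret Q: cring "R Quot ip n" by (rule quot_cring)
      show "x n \<otimes>\<^bsub>R Quot ip n\<^esub> y n \<in> carrier (R Quot ip n)" using x y mem by simp
      show "x (Suc n) \<otimes>\<^bsub>R Quot ip (Suc n)\<^esub> y (Suc n) \<subseteq> x n \<otimes>\<^bsub>R Quot ip n\<^esub> y n"
        using rcoset_mult_mono[OF mono[OF x] mono[OF y] pow_Suc_subset] unfolding FactRing_def by simp
    qed
    show "x \<oplus>\<^bsub>compl\<^esub> y = y \<oplus>\<^bsub>compl\<^esub> x" "x \<otimes>\<^bsub>compl\<^esub> y = y \<otimes>\<^bsub>compl\<^esub> x"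
      unfolding compl_ops using x y mem quot_cring
      by (auto intro!: ext simp: cring.cring_simprules)
  next
    fix x y z assume x: "x \<in> carrier compl" and y: "y \<in> carrier compl" and z: "z \<in> carrier compl"
    show "x \<oplus>\<^bsub>compl\<^esub> y \<oplus>\<^bsub>compl\<^esub> z = x \<oplus>\<^bsub>compl\<^esub> (y \<oplus>\<^bsub>compl\<^esub> z)"
      "x \<otimes>\<^bsub>compl\<^esub> y \<otimes>\<^bsub>compl\<^esub> z = x \<otimes>\<^bsub>compl\<^esub> (y \<otimes>\<^bsub>compl\<^esub> z)"
      "(x \<oplus>\<^bsub>compl\<^esub> y) \<otimes>\<^bsub>compl\<^esub> z = x \<otimes>\<^bsub>compl\<^esub> z \<oplus>\<^bsub>compl\<^esub> y \<otimes>\<^bsub>compl\<^esub> z"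
      unfolding compl_ops using mem[OF x] mem[OF y] mem[OF z] quot_cring
      by (auto intro!: ext simp: cring.cring_simprules(7,11,13))
  next
    fix x assume x: "x \<in> carrier compl"
    show "\<zero>\<^bsub>compl\<^esub> \<oplus>\<^bsub>compl\<^esub> x = x" "\<one>\<^bsub>compl\<^esub> \<otimes>\<^bsub>compl\<^esub> x = x"
      unfolding compl_ops using mem[OF x] quot_cring
      by (auto intro!: ext simp: cring.cring_simprules(8,12))
    define y where "y = (\<lambda>n. \<ominus>\<^bsub>R Quot ip n\<^esub> x n)"
    have "y (Suc n) \<subseteq> y n" for n
    proof -
      \<comment> \<open>A representative at \<open>Suc n\<close> also represents the component at
        \<open>n\<close>, so both negatives are the cosets of one element.\<close>
      obtain r where r: "r \<in> x (Suc n)" using compl_nonempty[OF x] by blast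
      note rx = compl_coset[OF x r]
      have "\<ominus>\<^bsub>R Quot ip i\<^esub> (ip i +> r) = ip i +> (\<ominus> r)" for i
      proof -
        interpret ideal "ip i" R by (rule pow_ideal)
        interpret h: ring_hom_cring R "R Quot ip i" "(+>) (ip i)"
          by (rule rcos_ring_hom_cring[OF is_cring])
        show ?thesis using rx(1)[of 0] by simp
      qed
      then have "y (Suc n) = ip (Suc n) +> (\<ominus> r)" "y n = ip n +> (\<ominus> r)"
        using rx(2)[of n] rx(2)[of "Suc n"] by (simp_all add: y_def del: ideal_pow.simps)
      then show ?thesis
        using pow_Suc_subset[of n] unfolding a_r_coset_def' by blast
    qed
    moreover have "y n \<in> carrier (R Quot ip n)" for n
    proof -
      interpret Q: cring "R Quot ip n" by (rule quot_cring)
      show ?thesis using mem[OF x] by (simp add: y_def)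
    qed
    ultimately have "y \<in> carrier compl" by (simp add: compl_carrier)
    moreover have "y \<oplus>\<^bsub>compl\<^esub> x = \<zero>\<^bsub>compl\<^esub>"
      unfolding compl_ops y_def using mem[OF x] quot_cring
      by (auto intro!: ext simp: cring.cring_simprules(9))
    ultimately show "\<exists>y\<in>carrier compl. y \<oplus>\<^bsub>compl\<^esub> x = \<zero>\<^bsub>compl\<^esub>" by blast
  next
    have sub: "ip (Suc n) +> r \<subseteq> ip n +> r" for n r
      using pow_Suc_subset[of n] unfolding a_r_coset_def' by blast
    show "\<one>\<^bsub>compl\<^esub> \<in> carrier compl"
      unfolding compl_carrier compl_ops
      using coset_closed[of \<one>] sub[of _ \<one>] by (auto simp: FactRing_def)
    show "\<zero>\<^bsub>compl\<^esub> \<in> carrier compl"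
      unfolding compl_carrier compl_ops
      using cring.cring_simprules(2)[OF quot_cring] pow_Suc_subset by (auto simp: FactRing_def)
  qed
qed

abbreviation "to_compl \<equiv> to_adic_completion R I"

lemma to_compl_hom: "ring_hom_cring R compl to_compl"
proof (intro ring_hom_cring.intro ring_hom_cring_axioms.intro ring_hom_memI compl_cring is_cring)
  fix r assume r: "r \<in> carrier R"
  show "to_compl r \<in> carrier compl"
    unfolding compl_carrier to_adic_completion_def
    using coset_closed[OF r] pow_Suc_subset unfolding a_r_coset_def' by blast
  fix s assume s: "s \<in> carrier R"
  show "to_compl (r \<otimes> s) = to_compl r \<otimes>\<^bsub>compl\<^esub> to_compl s"
    "to_compl (r \<oplus> s) = to_compl r \<oplus>\<^bsub>compl\<^esub> to_compl s"
    unfolding compl_ops to_adic_completion_def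
    using r s ring_hom_mult[OF ideal.rcos_ring_hom[OF pow_ideal]] ring_hom_add[OF ideal.rcos_ring_hom[OF pow_ideal]]
    by auto
qed (simp add: compl_ops to_adic_completion_def FactRing_def)

lemma to_compl_eq_zero:
  assumes "r \<in> carrier R"
  shows "to_compl r = \<zero>\<^bsub>compl\<^esub> \<longleftrightarrow> (\<forall>n. r \<in> ip n)"
  using assms ideal.coset_eq_self[OF pow_ideal]
  by (auto simp: compl_ops to_adic_completion_def FactRing_def fun_eq_iff)

text \<open>Two nonzero points have nonzero components at some \<open>i\<close> and
  \<open>j\<close>. Representatives taken at level \<open>i + j\<close> serve both places, and
  \<open>mult\<close> keeps their product out of the ideal at that level.\<close>

lemma compl_domain:
  assumes proper: "\<one> \<notin> ip k"
    and mult: "\<And>i j r s. r \<in> carrier R \<Longrightarrow> s \<in> carrier R \<Longrightarrow> r \<notin> ip i \<Longrightarrow> s \<notin> ip j \<Longrightarrow>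
      r \<otimes> s \<notin> ip (i + j)"
  shows "domain compl"
proof (intro domain.intro compl_cring domain_axioms.intro)
  interpret to_compl: ring_hom_cring R compl to_compl by (rule to_compl_hom)
  show "\<one>\<^bsub>compl\<^esub> \<noteq> \<zero>\<^bsub>compl\<^esub>"
    using to_compl_eq_zero[OF one_closed] proper by auto
  fix x y assume xy: "x \<otimes>\<^bsub>compl\<^esub> y = \<zero>\<^bsub>compl\<^esub>" and x: "x \<in> carrier compl" and y: "y \<in> carrier compl"
  show "x = \<zero>\<^bsub>compl\<^esub> \<or> y = \<zero>\<^bsub>compl\<^esub>"
  proof (rule ccontr)
    assume "\<not> ?thesis"
    then obtain i j where ij: "x i \<noteq> ip i" "y j \<noteq> ip j"
      by (auto simp: compl_ops FactRing_def fun_eq_iff)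
    obtain r where r: "r \<in> x (i + j)" using compl_nonempty[OF x] by blast
    obtain s where s: "s \<in> y (i + j)" using compl_nonempty[OF y] by blast
    interpret ij: ideal "ip (i + j)" R by (rule pow_ideal)
    have rs: "r \<in> carrier R" "s \<in> carrier R"
      using compl_coset(1)[OF x r le_refl] compl_coset(1)[OF y s le_refl] by auto
    have "r \<notin> ip i" "s \<notin> ip j"
      using compl_coset(2)[OF x r, of i] compl_coset(2)[OF y s, of j] ij rs
        ideal.coset_eq_self[OF pow_ideal] by auto
    then have "r \<otimes> s \<notin> ip (i + j)" using rs mult by blast
    moreover have "ip (i + j) +> (r \<otimes> s) = ip (i + j)"
    proof -
      have "ip (i + j) +> (r \<otimes> s) = x (i + j) \<otimes>\<^bsub>R Quot ip (i + j)\<^esub> y (i + j)"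
        using compl_coset(2)[OF x r le_refl] compl_coset(2)[OF y s le_refl] rs
          ring_hom_mult[OF ij.rcos_ring_hom] by simp
      also have "\<dots> = \<zero>\<^bsub>R Quot ip (i + j)\<^esub>"
        using fun_cong[OF xy, of "i + j"] by (simp add: compl_ops)
      finally show ?thesis by (simp add: FactRing_def)
    qed
    ultimately show False using rs ij.coset_eq_self by simp
  qed
qed

end

section \<open>Domains and tensor products\<close>

text \<open>A subspace maximal among those that avoid \<open>v\<close>, found by Zorn's lemma, is a
  complement of the line through \<open>v\<close>; the form reads off the coefficient of
  \<open>v\<close>.\<close>

lemma exists_linear_form:
  fixes K (structure) and M (structure)
  assumes "field K" "module K M" and v: "v \<in> carrier M" "v \<noteq> \<zero>\<^bsub>M\<^esub>"
  shows "\<exists>\<phi>\<in>linear_forms K M. \<phi> v = \<one>"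
proof -
  interpret K: field K by fact
  interpret module K M by fact
  let ?sub = "\<lambda>H. H \<subseteq> carrier M \<and> \<zero>\<^bsub>M\<^esub> \<in> H \<and> v \<notin> H \<and> (\<forall>x\<in>H. \<forall>y\<in>H. x \<oplus>\<^bsub>M\<^esub> y \<in> H) \<and>
    (\<forall>k\<in>carrier K. \<forall>x\<in>H. k \<odot>\<^bsub>M\<^esub> x \<in> H)"
  define A where "A = Collect ?sub"
  have "\<exists>H\<in>A. \<forall>H'\<in>A. H \<subseteq> H' \<longrightarrow> H' = H"
    unfolding A_def
  proof (rule subset_Zorn_nonempty)
    have "{\<zero>\<^bsub>M\<^esub>} \<in> Collect ?sub" using v by auto
    then show "Collect ?sub \<noteq> {}" by blast
  next
    fix C assume C: "C \<noteq> {}" "subset.chain (Collect ?sub) C"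
    then have sub: "H \<in> C \<Longrightarrow> ?sub H" for H by (auto simp: subset.chain_def)
    have "x \<oplus>\<^bsub>M\<^esub> y \<in> \<Union>C" if "x \<in> \<Union>C" "y \<in> \<Union>C" for x y
    proof -
      from that obtain H H' where H: "H \<in> C" "x \<in> H" "H' \<in> C" "y \<in> H'" by blast
      with C(2) have "H \<subseteq> H' \<or> H' \<subseteq> H" by (auto simp: subset.chain_def)
      with H sub show ?thesis by blast
    qed
    moreover have "\<zero>\<^bsub>M\<^esub> \<in> \<Union>C" using C(1) sub by blast
    moreover have "v \<notin> \<Union>C" "\<Union>C \<subseteq> carrier M" using sub by blast+
    moreover have "\<forall>k\<in>carrier K. \<forall>x\<in>\<Union>C. k \<odot>\<^bsub>M\<^esub> x \<in> \<Union>C" using sub by blast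
    ultimately show "\<Union>C \<in> Collect ?sub" by blast
  qed
  then obtain H where "H \<in> A" and "\<forall>H'\<in>A. H \<subseteq> H' \<longrightarrow> H' = H" by blast
  then have H: "?sub H" and max: "\<And>H'. ?sub H' \<Longrightarrow> H \<subseteq> H' \<Longrightarrow> H' = H"
    by (simp_all add: A_def)
  have HM: "x \<in> H \<Longrightarrow> x \<in> carrier M" for x using H by blast
  have Hadd: "x \<in> H \<Longrightarrow> y \<in> H \<Longrightarrow> x \<oplus>\<^bsub>M\<^esub> y \<in> H" for x y using H by blast
  have Hsm: "k \<in> carrier K \<Longrightarrow> x \<in> H \<Longrightarrow> k \<odot>\<^bsub>M\<^esub> x \<in> H" for k x using H by blast
  have Hneg: "\<ominus>\<^bsub>M\<^esub> x \<in> H" if "x \<in> H" for x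
    using Hsm[of "\<ominus> \<one>" x] HM[OF that] that by (simp add: smult_l_minus)
  have vk: "k = \<zero>" if "k \<in> carrier K" "k \<odot>\<^bsub>M\<^esub> v \<in> H" for k
  proof (rule ccontr)
    assume "k \<noteq> \<zero>"
    then have "inv k \<in> carrier K" "inv k \<otimes> k = \<one>"
      using that(1) K.field_Units by auto
    then have "v = inv k \<odot>\<^bsub>M\<^esub> (k \<odot>\<^bsub>M\<^esub> v)"
      using that(1) v by (simp flip: smult_assoc1)
    then have "v \<in> H" using Hsm[OF \<open>inv k \<in> carrier K\<close> that(2)] by simp
    then show False using H by blast
  qed
  \<comment> \<open>Adding an \<open>x\<close> outside \<open>H\<close> to \<open>H\<close> must
    reach \<open>v\<close>, by maximality. In the resulting expression of \<open>v\<close> the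
    coefficient of \<open>x\<close> is nonzero, so \<open>x\<close> can be solved for.\<close>
  have ex: "\<exists>k\<in>carrier K. \<exists>h\<in>H. x = h \<oplus>\<^bsub>M\<^esub> k \<odot>\<^bsub>M\<^esub> v" if x: "x \<in> carrier M" for x
  proof (cases "x \<in> H")
    case True
    then show ?thesis using x v by (intro bexI[of _ \<zero>] bexI[of _ x]) auto
  next
    case False
    define H' where "H' = {h \<oplus>\<^bsub>M\<^esub> k \<odot>\<^bsub>M\<^esub> x | h k. h \<in> H \<and> k \<in> carrier K}"
    have "H \<subseteq> H'"
    proof
      fix h assume "h \<in> H"
      then have "h = h \<oplus>\<^bsub>M\<^esub> \<zero> \<odot>\<^bsub>M\<^esub> x" using x HM by simp
      then show "h \<in> H'" using \<open>h \<in> H\<close> unfolding H'_def by blast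
    qed
    moreover have "x \<in> H'"
    proof -
      have "x = \<zero>\<^bsub>M\<^esub> \<oplus>\<^bsub>M\<^esub> \<one> \<odot>\<^bsub>M\<^esub> x" using x by simp
      then show ?thesis using H unfolding H'_def by blast
    qed
    ultimately have "\<not> ?sub H'" using max False by blast
    moreover have "H' \<subseteq> carrier M" using x HM by (auto simp: H'_def)
    moreover have "\<zero>\<^bsub>M\<^esub> \<in> H'" using \<open>H \<subseteq> H'\<close> H by blast
    moreover have "\<forall>y\<in>H'. \<forall>z\<in>H'. y \<oplus>\<^bsub>M\<^esub> z \<in> H'"
    proof (intro ballI)
      fix y z assume "y \<in> H'" "z \<in> H'"
      then obtain h k h' k' where e: "h \<in> H" "k \<in> carrier K" "h' \<in> H" "k' \<in> carrier K"
        "y = h \<oplus>\<^bsub>M\<^esub> k \<odot>\<^bsub>M\<^esub> x" "z = h' \<oplus>\<^bsub>M\<^esub> k' \<odot>\<^bsub>M\<^esub> x"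
        by (auto simp: H'_def)
      then have "y \<oplus>\<^bsub>M\<^esub> z = (h \<oplus>\<^bsub>M\<^esub> h') \<oplus>\<^bsub>M\<^esub> (k \<oplus> k') \<odot>\<^bsub>M\<^esub> x"
        using x HM by (simp add: smult_l_distr M.a_ac)
      then show "y \<oplus>\<^bsub>M\<^esub> z \<in> H'" using e Hadd unfolding H'_def by blast
    qed
    moreover have "\<forall>c\<in>carrier K. \<forall>y\<in>H'. c \<odot>\<^bsub>M\<^esub> y \<in> H'"
    proof (intro ballI)
      fix c y assume c: "c \<in> carrier K" and "y \<in> H'"
      then obtain h k where e: "h \<in> H" "k \<in> carrier K" "y = h \<oplus>\<^bsub>M\<^esub> k \<odot>\<^bsub>M\<^esub> x"
        by (auto simp: H'_def)
      then have "c \<odot>\<^bsub>M\<^esub> y = c \<odot>\<^bsub>M\<^esub> h \<oplus>\<^bsub>M\<^esub> (c \<otimes> k) \<odot>\<^bsub>M\<^esub> x"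
        using x HM c by (simp add: smult_r_distr smult_assoc1)
      moreover have "c \<otimes> k \<in> carrier K" using c e by simp
      ultimately show "c \<odot>\<^bsub>M\<^esub> y \<in> H'" using c e Hsm unfolding H'_def by blast
    qed
    ultimately have "v \<in> H'" by blast
    then obtain h k where e: "h \<in> H" "k \<in> carrier K" "v = h \<oplus>\<^bsub>M\<^esub> k \<odot>\<^bsub>M\<^esub> x"
      by (auto simp: H'_def)
    have "k \<noteq> \<zero>" using e x HM[OF e(1)] H by auto
    then have k: "inv k \<in> carrier K" "inv k \<otimes> k = \<one>"
      using e(2) K.field_Units by auto
    have "inv k \<odot>\<^bsub>M\<^esub> v = inv k \<odot>\<^bsub>M\<^esub> h \<oplus>\<^bsub>M\<^esub> x"
      unfolding e(3) using k e x HM[OF e(1)] by (simp add: smult_r_distr flip: smult_assoc1)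
    then have "x = \<ominus>\<^bsub>M\<^esub> (inv k \<odot>\<^bsub>M\<^esub> h) \<oplus>\<^bsub>M\<^esub> inv k \<odot>\<^bsub>M\<^esub> v"
      using k e x HM[OF e(1)] by (simp add: M.r_neg1)
    then show ?thesis using k Hneg[OF Hsm[OF k(1) e(1)]] by blast
  qed
  define \<phi> where "\<phi> x = (THE k. k \<in> carrier K \<and> (\<exists>h\<in>H. x = h \<oplus>\<^bsub>M\<^esub> k \<odot>\<^bsub>M\<^esub> v))" for x
  have \<phi>: "\<phi> (h \<oplus>\<^bsub>M\<^esub> k \<odot>\<^bsub>M\<^esub> v) = k" if k: "k \<in> carrier K" and h: "h \<in> H" for h k
    unfolding \<phi>_def
  proof (rule the_equality)
    fix k' assume "k' \<in> carrier K \<and> (\<exists>h'\<in>H. h \<oplus>\<^bsub>M\<^esub> k \<odot>\<^bsub>M\<^esub> v = h' \<oplus>\<^bsub>M\<^esub> k' \<odot>\<^bsub>M\<^esub> v)"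
    then obtain h' where k': "k' \<in> carrier K" and h': "h' \<in> H"
      and e: "h \<oplus>\<^bsub>M\<^esub> k \<odot>\<^bsub>M\<^esub> v = h' \<oplus>\<^bsub>M\<^esub> k' \<odot>\<^bsub>M\<^esub> v" by blast
    have c: "h \<in> carrier M" "h' \<in> carrier M" "k \<odot>\<^bsub>M\<^esub> v \<in> carrier M" "k' \<odot>\<^bsub>M\<^esub> v \<in> carrier M"
      using h h' HM k k' v by auto
    have "k \<odot>\<^bsub>M\<^esub> v = \<ominus>\<^bsub>M\<^esub> h \<oplus>\<^bsub>M\<^esub> (h \<oplus>\<^bsub>M\<^esub> k \<odot>\<^bsub>M\<^esub> v)" using c by (simp add: M.r_neg1)
    also have "\<dots> = (\<ominus>\<^bsub>M\<^esub> h \<oplus>\<^bsub>M\<^esub> h') \<oplus>\<^bsub>M\<^esub> k' \<odot>\<^bsub>M\<^esub> v" unfolding e using c by (simp add: M.a_assoc)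
    finally have kv: "k \<odot>\<^bsub>M\<^esub> v = (\<ominus>\<^bsub>M\<^esub> h \<oplus>\<^bsub>M\<^esub> h') \<oplus>\<^bsub>M\<^esub> k' \<odot>\<^bsub>M\<^esub> v" .
    have "(k \<ominus> k') \<odot>\<^bsub>M\<^esub> v = k \<odot>\<^bsub>M\<^esub> v \<oplus>\<^bsub>M\<^esub> \<ominus>\<^bsub>M\<^esub> (k' \<odot>\<^bsub>M\<^esub> v)"
      using k k' v by (simp add: a_minus_def smult_l_distr smult_l_minus)
    also have "\<dots> = \<ominus>\<^bsub>M\<^esub> h \<oplus>\<^bsub>M\<^esub> h'"
      unfolding kv using c by (simp add: M.a_assoc M.r_neg)
    finally have "(k \<ominus> k') \<odot>\<^bsub>M\<^esub> v \<in> H" using Hadd[OF Hneg[OF h] h'] by simp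
    then have "k \<ominus> k' = \<zero>" using vk k k' by simp
    then show "k' = k" using k k' by (simp add: K.r_right_minus_eq)
  qed (use k h in blast)
  have "\<phi> \<in> linear_forms K M"
    unfolding linear_forms_def
  proof (intro CollectI conjI ballI funcsetI)
    fix x assume "x \<in> carrier M"
    from ex[OF this] obtain k h where x: "k \<in> carrier K" "h \<in> H" "x = h \<oplus>\<^bsub>M\<^esub> k \<odot>\<^bsub>M\<^esub> v" by blast
    show "\<phi> x \<in> carrier K" using x \<phi> by simp
    {
      fix y assume "y \<in> carrier M"
      from ex[OF this] obtain k' h' where y: "k' \<in> carrier K" "h' \<in> H" "y = h' \<oplus>\<^bsub>M\<^esub> k' \<odot>\<^bsub>M\<^esub> v" by blast
      have "x \<oplus>\<^bsub>M\<^esub> y = (h \<oplus>\<^bsub>M\<^esub> h') \<oplus>\<^bsub>M\<^esub> (k \<oplus> k') \<odot>\<^bsub>M\<^esub> v"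
        using x y v HM by (simp add: smult_l_distr M.a_ac)
      then show "\<phi> (x \<oplus>\<^bsub>M\<^esub> y) = \<phi> x \<oplus> \<phi> y"
        using \<phi> x y Hadd by simp
    }
  next
    fix c x assume c: "c \<in> carrier K" and "x \<in> carrier M"
    from ex[OF this(2)] obtain k h where x: "k \<in> carrier K" "h \<in> H" "x = h \<oplus>\<^bsub>M\<^esub> k \<odot>\<^bsub>M\<^esub> v" by blast
    have "c \<odot>\<^bsub>M\<^esub> x = c \<odot>\<^bsub>M\<^esub> h \<oplus>\<^bsub>M\<^esub> (c \<otimes> k) \<odot>\<^bsub>M\<^esub> v"
      using x c v HM by (simp add: smult_r_distr smult_assoc1)
    then show "\<phi> (c \<odot>\<^bsub>M\<^esub> x) = c \<otimes> \<phi> x"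
      using \<phi> x c Hsm by simp
  qed
  moreover have "\<phi> v = \<one>"
    using \<phi>[of \<one> "\<zero>\<^bsub>M\<^esub>"] H v by simp
  ultimately show ?thesis by blast
qed

section \<open>Additive maps out of a free abelian group\<close>

definition frag_eval :: "('a, 'm) ring_scheme \<Rightarrow> ('i \<Rightarrow> 'a) \<Rightarrow> ('i \<Rightarrow>\<^sub>0 int) \<Rightarrow> 'a"
  where "frag_eval R g x = (\<Oplus>\<^bsub>R\<^esub>i\<in>Poly_Mapping.keys x. [poly_mapping.lookup x i] \<cdot>\<^bsub>R\<^esub> g i)"

context abelian_group
begin

lemma frag_eval_superset:
  assumes g: "\<And>i. i \<in> S \<Longrightarrow> g i \<in> carrier G" and S: "finite S" "Poly_Mapping.keys x \<subseteq> S"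
  shows "frag_eval G g x = (\<Oplus>i\<in>S. add_pow G (poly_mapping.lookup x i) (g i))"
  unfolding frag_eval_def using assms
  by (intro add.finprod_mono_neutral_cong_left) (auto simp: in_keys_iff add_pow_def[of _ "0 :: int"])

lemma frag_eval_closed:
  assumes "\<And>i. i \<in> S \<Longrightarrow> g i \<in> carrier G" "Poly_Mapping.keys x \<subseteq> S"
  shows "frag_eval G g x \<in> carrier G"
  unfolding frag_eval_def using assms by (intro finsum_closed) auto

lemma frag_eval_of:
  assumes "g i \<in> carrier G"
  shows "frag_eval G g (frag_of i) = g i"
  using assms by (simp add: frag_eval_def finsum_insert)

lemma frag_eval_diff:
  assumes g: "\<And>i. i \<in> S \<Longrightarrow> g i \<in> carrier G"
    and x: "Poly_Mapping.keys x \<subseteq> S" and y: "Poly_Mapping.keys y \<subseteq> S"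
  shows "frag_eval G g (x - y) = frag_eval G g x \<ominus> frag_eval G g y"
proof -
  let ?T = "Poly_Mapping.keys x \<union> Poly_Mapping.keys y"
  have gT: "\<And>i. i \<in> ?T \<Longrightarrow> g i \<in> carrier G" using g x y by blast
  have T: "finite ?T" by simp
  have yn: "frag_eval G g (- y) = (\<Oplus>i\<in>?T. add_pow G (poly_mapping.lookup (- y) i) (g i))"
    using gT by (intro frag_eval_superset) auto
  have inv: "(\<Oplus>i\<in>?T. add_pow G (- poly_mapping.lookup y i) (g i)) = \<ominus> (\<Oplus>i\<in>?T. add_pow G (poly_mapping.lookup y i) (g i))"
  proof -
    have "(\<Oplus>i\<in>?T. add_pow G (- poly_mapping.lookup y i) (g i)) \<oplus> (\<Oplus>i\<in>?T. add_pow G (poly_mapping.lookup y i) (g i))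
      = (\<Oplus>i\<in>?T. add_pow G (- poly_mapping.lookup y i) (g i) \<oplus> add_pow G (poly_mapping.lookup y i) (g i))"
      using gT by (intro finsum_addf[symmetric]) auto
    also have "\<dots> = \<zero>"
      using gT by (intro add.finprod_one_eqI) (auto simp: add_pow_def[of _ "0 :: int"] simp flip: add.int_pow_mult)
    finally show ?thesis
      using gT by (intro minus_equality[symmetric]) (auto intro!: finsum_closed)
  qed
  have "frag_eval G g (x - y) = (\<Oplus>i\<in>?T. add_pow G (poly_mapping.lookup (x - y) i) (g i))"
    using gT keys_diff[of x y] by (intro frag_eval_superset) auto
  also have "\<dots> = (\<Oplus>i\<in>?T. add_pow G (poly_mapping.lookup x i) (g i) \<oplus> add_pow G (- poly_mapping.lookup y i) (g i))"
    using gT by (intro add.finprod_cong') (auto simp: lookup_minus simp flip: add.int_pow_mult)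
  also have "\<dots> = (\<Oplus>i\<in>?T. add_pow G (poly_mapping.lookup x i) (g i)) \<oplus> (\<Oplus>i\<in>?T. add_pow G (- poly_mapping.lookup y i) (g i))"
    using gT by (intro finsum_addf) auto
  also have "\<dots> = frag_eval G g x \<ominus> frag_eval G g y"
    unfolding inv a_minus_def using gT by (subst (1 2) frag_eval_superset[of ?T]) auto
  finally show ?thesis .
qed

end

section \<open>The integral monoid ring of a commutative monoid\<close>

context
  fixes M (structure)
  assumes M: "comm_monoid M"
begin

interpretation M: comm_monoid M by (rule M)

private abbreviation "IM \<equiv> int_monoid_ring M"
private abbreviation times (infixl \<open>\<star>\<close> 70) where "x \<star> y \<equiv> x \<otimes>\<^bsub>IM\<^esub> y"

lemma int_monoid_ring_carrier: "x \<in> carrier IM \<longleftrightarrow> Poly_Mapping.keys x \<subseteq> carrier M"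
  by (simp add: int_monoid_ring_def)

lemma int_monoid_ring_ops:
  "x \<oplus>\<^bsub>IM\<^esub> y = x + y" "\<zero>\<^bsub>IM\<^esub> = 0" "\<one>\<^bsub>IM\<^esub> = frag_of \<one>"
  by (simp_all add: int_monoid_ring_def)

lemma int_monoid_ring_mult:
  "x \<star> y = frag_extend (\<lambda>p. frag_extend (\<lambda>q. frag_of (p \<otimes> q)) y) x"
  by (simp add: int_monoid_ring_def)

lemma int_monoid_ring_mult_of: "frag_of p \<star> frag_of q = frag_of (p \<otimes> q)"
  by (simp add: int_monoid_ring_mult)

lemma int_monoid_ring_diff_l: "(x - x') \<star> y = x \<star> y - x' \<star> y"
  by (simp add: int_monoid_ring_mult frag_extend_diff)

lemma int_monoid_ring_diff_r: "x \<star> (y - y') = x \<star> y - x \<star> y'"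
  using subset_UNIV[of "Poly_Mapping.keys x"]
proof (induction x rule: frag_induction)
  case (diff a b)
  then show ?case by (simp add: int_monoid_ring_diff_l)
qed (simp_all add: int_monoid_ring_mult frag_extend_diff)

lemma int_monoid_ring_zero_l: "0 \<star> y = 0" and int_monoid_ring_zero_r: "x \<star> 0 = 0"
  using int_monoid_ring_diff_l[of 0 0 y] int_monoid_ring_diff_r[of x 0 0] by simp_all

lemma int_monoid_ring_add_l: "(x + x') \<star> y = x \<star> y + x' \<star> y"
  by (simp add: int_monoid_ring_mult frag_extend_add)

text \<open>A property that holds for the generators and passes to differences holds on the group
  they generate. The ring laws are thereby reduced to laws of the monoid.\<close>

lemma int_monoid_ring_induct [consumes 1, case_names zero of diff]:
  assumes "x \<in> carrier IM" "P 0" "\<And>p. p \<in> carrier M \<Longrightarrow> P (frag_of p)"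
    "\<And>a b. P a \<Longrightarrow> P b \<Longrightarrow> P (a - b)"
  shows "P x"
  using assms(1) unfolding int_monoid_ring_carrier
  by (induction rule: frag_induction) (use assms in auto)

lemma int_monoid_ring_diff_closed:
  "x \<in> carrier IM \<Longrightarrow> y \<in> carrier IM \<Longrightarrow> x - y \<in> carrier IM"
  using keys_diff[of x y] by (auto simp: int_monoid_ring_carrier)

lemma int_monoid_ring_cring: "cring IM"
proof -
  have zero: "0 \<in> carrier IM" and of_cl: "\<And>p. p \<in> carrier M \<Longrightarrow> frag_of p \<in> carrier IM"
    by (auto simp: int_monoid_ring_carrier)
  \<comment> \<open>Each law is extended by additivity one argument at a time, with the earlier
    arguments still being generators.\<close>
  have of_mult: "frag_of p \<star> y \<in> carrier IM" if "p \<in> carrier M" "y \<in> carrier IM" for p y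
    using that(2) that(1)
    by (induction rule: int_monoid_ring_induct)
      (auto simp: int_monoid_ring_diff_r int_monoid_ring_zero_r zero int_monoid_ring_mult_of of_cl
        intro: int_monoid_ring_diff_closed)
  have mult: "x \<star> y \<in> carrier IM" if "x \<in> carrier IM" "y \<in> carrier IM" for x y
    using that
    by (induction rule: int_monoid_ring_induct)
      (auto simp: int_monoid_ring_diff_l int_monoid_ring_zero_l zero of_mult
        intro: int_monoid_ring_diff_closed)
  have of_comm: "frag_of p \<star> y = y \<star> frag_of p" if "p \<in> carrier M" "y \<in> carrier IM" for p y
    using that(2) that(1)
    by (induction rule: int_monoid_ring_induct)
      (auto simp: int_monoid_ring_diff_l int_monoid_ring_diff_r int_monoid_ring_zero_l
        int_monoid_ring_zero_r int_monoid_ring_mult_of M.m_comm)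
  have comm: "x \<star> y = y \<star> x" if "x \<in> carrier IM" "y \<in> carrier IM" for x y
    using that
    by (induction rule: int_monoid_ring_induct)
      (auto simp: int_monoid_ring_diff_l int_monoid_ring_diff_r int_monoid_ring_zero_l
        int_monoid_ring_zero_r of_comm)
  have assoc1: "(frag_of p \<star> frag_of q) \<star> z = frag_of p \<star> (frag_of q \<star> z)"
    if "p \<in> carrier M" "q \<in> carrier M" "z \<in> carrier IM" for p q z
    using that(3) that(1,2)
    by (induction rule: int_monoid_ring_induct)
      (auto simp: int_monoid_ring_diff_r int_monoid_ring_zero_r int_monoid_ring_mult_of M.m_assoc)
  have assoc2: "(frag_of p \<star> y) \<star> z = frag_of p \<star> (y \<star> z)"
    if "p \<in> carrier M" "y \<in> carrier IM" "z \<in> carrier IM" for p y z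
    using that(2) that(1,3)
    by (induction rule: int_monoid_ring_induct)
      (auto simp: int_monoid_ring_diff_l int_monoid_ring_diff_r int_monoid_ring_zero_l
        int_monoid_ring_zero_r assoc1)
  have assoc: "(x \<star> y) \<star> z = x \<star> (y \<star> z)"
    if "x \<in> carrier IM" "y \<in> carrier IM" "z \<in> carrier IM" for x y z
    using that
    by (induction rule: int_monoid_ring_induct)
      (auto simp: int_monoid_ring_diff_l int_monoid_ring_zero_l assoc2)
  have one: "frag_of \<one> \<star> x = x" if "x \<in> carrier IM" for x
    using that
    by (induction rule: int_monoid_ring_induct)
      (auto simp: int_monoid_ring_diff_r int_monoid_ring_zero_r int_monoid_ring_mult_of)
  show ?thesis
  proof (intro cringI abelian_groupI comm_monoidI)
    fix x y assume "x \<in> carrier IM" "y \<in> carrier IM"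
    then show "x \<oplus>\<^bsub>IM\<^esub> y \<in> carrier IM"
      using keys_add[of x y] by (auto simp: int_monoid_ring_carrier int_monoid_ring_ops)
  next
    fix x assume "x \<in> carrier IM"
    then show "\<exists>y\<in>carrier IM. y \<oplus>\<^bsub>IM\<^esub> x = \<zero>\<^bsub>IM\<^esub>"
      by (intro bexI[of _ "- x"]) (auto simp: int_monoid_ring_carrier int_monoid_ring_ops)
  qed (auto simp: int_monoid_ring_ops mult assoc one zero of_cl int_monoid_ring_add_l intro: comm)
qed

end

text \<open>The multiplicative map that sends r to the class of r tensor 1 is injective, and so
  pulls the absence of zero divisors back to R. For injectivity, a K-linear form \<phi> on L with
  \<phi>(1) = 1 gives an additive map that sends r tensor l to \<phi>(l) r and returns r from r
  tensor 1.\<close>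

lemma domain_of_tensor_domain:
  fixes K (structure) and R and L
  assumes K: "field K" and R: "algebra K R" and L: "algebra K L" and L1: "\<one>\<^bsub>L\<^esub> \<noteq> \<zero>\<^bsub>L\<^esub>"
    and T: "domain (algebra_tensor K R L)"
  shows "domain R"
proof -
  interpret KK: field K by (rule K)
  interpret RR: cring R by (rule algebra.M_cring[OF R])
  interpret LL: cring L by (rule algebra.M_cring[OF L])
  interpret R: algebra K R by (rule R)
  interpret L: algebra K L by (rule L)
  let ?M = "R \<times>\<times> L"
  have "comm_monoid ?M"
    by (rule comm_monoidI)
      (auto simp: RR.m_assoc LL.m_assoc intro: RR.m_comm LL.m_comm)
  note M = this
  let ?IM = "int_monoid_ring ?M"
  interpret IM: cring ?IM by (rule int_monoid_ring_cring[OF M])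
  let ?rel = "tensor_relations K R L"
  have of_cl: "frag_of (r, l) \<in> carrier ?IM" if "r \<in> carrier R" "l \<in> carrier L" for r l
    using that by (auto simp: int_monoid_ring_carrier[OF M])
  have rel_cl: "?rel \<subseteq> carrier ?IM"
    unfolding tensor_relations_def
    by (auto intro!: int_monoid_ring_diff_closed[OF M] of_cl)
  define N where "N = Idl\<^bsub>?IM\<^esub> ?rel"
  interpret N: ideal N ?IM unfolding N_def by (rule IM.genideal_ideal[OF rel_cl])
  have Tdef: "algebra_tensor K R L = ?IM Quot N" by (simp add: algebra_tensor_def N_def)
  interpret T: domain "?IM Quot N" using T by (simp add: Tdef)
  interpret q: ring_hom_cring ?IM "?IM Quot N" "(+>\<^bsub>?IM\<^esub>) N" by (rule N.rcos_ring_hom_cring[OF IM.is_cring])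
  define cl where "cl r = N +>\<^bsub>?IM\<^esub> frag_of (r, \<one>\<^bsub>L\<^esub>)" for r
  have cl_zero_iff: "cl r = \<zero>\<^bsub>?IM Quot N\<^esub> \<longleftrightarrow> frag_of (r, \<one>\<^bsub>L\<^esub>) \<in> N" if "r \<in> carrier R" for r
    unfolding cl_def FactRing_def ring.simps
    by (metis LL.one_closed N.a_rcos_const N.rcos_const_imp_mem of_cl that)
  have cl_closed: "cl r \<in> carrier (?IM Quot N)" if "r \<in> carrier R" for r
    unfolding cl_def using of_cl[OF that LL.one_closed] by (rule q.hom_closed)
  have cl_mult: "cl (r \<otimes>\<^bsub>R\<^esub> s) = cl r \<otimes>\<^bsub>?IM Quot N\<^esub> cl s" if "r \<in> carrier R" "s \<in> carrier R" for r s
    unfolding cl_def using that of_cl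
    by (subst q.hom_mult[symmetric]) (auto simp: int_monoid_ring_mult_of[OF M])
  \<comment> \<open>As 0 + 0 = 0, additivity in the first argument makes minus the generator (0, 1)
    a relation.\<close>
  have cl_zero: "cl \<zero>\<^bsub>R\<^esub> = \<zero>\<^bsub>?IM Quot N\<^esub>"
  proof -
    have "frag_of (\<zero>\<^bsub>R\<^esub> \<oplus>\<^bsub>R\<^esub> \<zero>\<^bsub>R\<^esub>, \<one>\<^bsub>L\<^esub>) - frag_of (\<zero>\<^bsub>R\<^esub>, \<one>\<^bsub>L\<^esub>) - frag_of (\<zero>\<^bsub>R\<^esub>, \<one>\<^bsub>L\<^esub>) \<in> ?rel"
      unfolding tensor_relations_def by blast
    then have "- frag_of (\<zero>\<^bsub>R\<^esub>, \<one>\<^bsub>L\<^esub>) \<in> N"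
      using IM.genideal_self[OF rel_cl] by (auto simp: N_def)
    moreover have "\<ominus>\<^bsub>?IM\<^esub> (- frag_of (\<zero>\<^bsub>R\<^esub>, \<one>\<^bsub>L\<^esub>)) = frag_of (\<zero>\<^bsub>R\<^esub>, \<one>\<^bsub>L\<^esub>)"
      by (intro IM.minus_equality) (auto simp: int_monoid_ring_ops[OF M] int_monoid_ring_carrier[OF M])
    ultimately have "frag_of (\<zero>\<^bsub>R\<^esub>, \<one>\<^bsub>L\<^esub>) \<in> N" by (metis N.a_inv_closed)
    then show ?thesis by (simp add: cl_zero_iff)
  qed
  have "module K L" by (rule L.module)
  then obtain \<phi> where \<phi>: "\<phi> \<in> linear_forms K L" "\<phi> \<one>\<^bsub>L\<^esub> = \<one>"
    using exists_linear_form[OF K _ LL.one_closed L1] by blast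
  have \<phi>_closed: "l \<in> carrier L \<Longrightarrow> \<phi> l \<in> carrier K" for l
    using \<phi>(1) by (auto simp: linear_forms_def)
  have \<phi>_add: "l \<in> carrier L \<Longrightarrow> l' \<in> carrier L \<Longrightarrow> \<phi> (l \<oplus>\<^bsub>L\<^esub> l') = \<phi> l \<oplus> \<phi> l'" for l l'
    using \<phi>(1) by (auto simp: linear_forms_def)
  have \<phi>_smult: "k \<in> carrier K \<Longrightarrow> l \<in> carrier L \<Longrightarrow> \<phi> (k \<odot>\<^bsub>L\<^esub> l) = k \<otimes> \<phi> l" for k l
    using \<phi>(1) by (auto simp: linear_forms_def)
  define g where "g = (\<lambda>(r, l). \<phi> l \<odot>\<^bsub>R\<^esub> r)"
  have g: "\<And>m. m \<in> carrier ?M \<Longrightarrow> g m \<in> carrier R" by (auto simp: g_def \<phi>_closed)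
  define \<theta> where "\<theta> = frag_eval R g"
  have \<theta>_of: "\<theta> (frag_of (r, l)) = \<phi> l \<odot>\<^bsub>R\<^esub> r" if "r \<in> carrier R" "l \<in> carrier L" for r l
    unfolding \<theta>_def using that g[of "(r, l)"] by (subst RR.frag_eval_of) (auto simp: g_def)
  have \<theta>_closed: "\<theta> x \<in> carrier R" if "x \<in> carrier ?IM" for x
    unfolding \<theta>_def using g that unfolding int_monoid_ring_carrier[OF M] by (rule RR.frag_eval_closed)
  have \<theta>_diff: "\<theta> (x - y) = \<theta> x \<ominus>\<^bsub>R\<^esub> \<theta> y" if "x \<in> carrier ?IM" "y \<in> carrier ?IM" for x y
    unfolding \<theta>_def using g that unfolding int_monoid_ring_carrier[OF M] by (rule RR.frag_eval_diff)
  have \<theta>_zero: "\<theta> 0 = \<zero>\<^bsub>R\<^esub>"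
    by (simp add: \<theta>_def frag_eval_def)
  \<comment> \<open>\<open>\<theta>\<close> vanishes on the subgroup generated by the relations, hence on the ideal, because the
    relations are stable under multiplication by pairs.\<close>
  define Z where "Z = {x \<in> carrier ?IM. \<forall>m\<in>carrier ?M. \<theta> (x \<otimes>\<^bsub>?IM\<^esub> frag_of m) = \<zero>\<^bsub>R\<^esub>}"
  have ofM: "m \<in> carrier ?M \<Longrightarrow> frag_of m \<in> carrier ?IM" for m
    using of_cl by (cases m) auto
  have Zdiff: "x - y \<in> Z" if "x \<in> Z" "y \<in> Z" for x y
    using that ofM unfolding Z_def
    by (auto simp: int_monoid_ring_diff_l[OF M] \<theta>_diff IM.m_closed a_minus_def RR.r_neg
        intro: int_monoid_ring_diff_closed[OF M])
  have Z0: "0 \<in> Z"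
    by (auto simp: Z_def int_monoid_ring_zero_l[OF M] \<theta>_zero int_monoid_ring_carrier[OF M])
  have Zmult: "x \<otimes>\<^bsub>?IM\<^esub> y \<in> Z" if x: "x \<in> Z" and y: "y \<in> carrier ?IM" for x y
    using y
  proof (induction rule: int_monoid_ring_induct[OF M, consumes 1, case_names zero of diff])
    case (of p)
    have "\<theta> (x \<otimes>\<^bsub>?IM\<^esub> frag_of p \<otimes>\<^bsub>?IM\<^esub> frag_of m) = \<zero>\<^bsub>R\<^esub>" if m: "m \<in> carrier ?M" for m
    proof -
      have "x \<otimes>\<^bsub>?IM\<^esub> frag_of p \<otimes>\<^bsub>?IM\<^esub> frag_of m = x \<otimes>\<^bsub>?IM\<^esub> frag_of (p \<otimes>\<^bsub>?M\<^esub> m)"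
        using x m of ofM by (simp add: Z_def IM.m_assoc int_monoid_ring_mult_of[OF M] del: mult_DirProd)
      then show ?thesis
        using x monoid.m_closed[OF comm_monoid.axioms(1)[OF M], of p m] of m
        by (auto simp: Z_def simp del: carrier_DirProd)
    qed
    then show ?case using x of ofM by (auto simp: Z_def)
  next
    case (diff a b)
    then show ?case by (simp add: int_monoid_ring_diff_r[OF M] Zdiff)
  qed (simp add: int_monoid_ring_zero_r[OF M] Z0)
  have Zid: "ideal Z ?IM"
  proof (rule idealI)
    show "subgroup Z (add_monoid ?IM)"
    proof (rule IM.add.subgroupI)
      show "Z \<subseteq> carrier ?IM" by (auto simp: Z_def)
      show "Z \<noteq> {}" using Z0 by blast
      fix x assume x: "x \<in> Z"
      have "\<ominus>\<^bsub>?IM\<^esub> x = 0 - x"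
        using x by (intro IM.minus_equality) (auto simp: Z_def int_monoid_ring_ops[OF M] int_monoid_ring_carrier[OF M])
      then show "\<ominus>\<^bsub>?IM\<^esub> x \<in> Z" using Zdiff[OF Z0 x] by simp
      fix y assume y: "y \<in> Z"
      have "x \<oplus>\<^bsub>?IM\<^esub> y = x - (0 - y)" by (simp add: int_monoid_ring_ops[OF M])
      then show "x \<oplus>\<^bsub>?IM\<^esub> y \<in> Z" using Zdiff[OF x Zdiff[OF Z0 y]] by simp
    qed
  next
    fix x y assume "x \<in> Z" "y \<in> carrier ?IM"
    moreover from this have "x \<in> carrier ?IM" by (simp add: Z_def)
    ultimately show "x \<otimes>\<^bsub>?IM\<^esub> y \<in> Z" "y \<otimes>\<^bsub>?IM\<^esub> x \<in> Z"
      using Zmult IM.m_comm by auto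
  qed (rule IM.ring_axioms)
  have "?rel \<subseteq> Z"
  proof
    fix x assume x: "x \<in> ?rel"
    have "\<theta> (x \<otimes>\<^bsub>?IM\<^esub> frag_of (p, q)) = \<zero>\<^bsub>R\<^esub>" if pq: "p \<in> carrier R" "q \<in> carrier L" for p q
    proof -
      have cancel: "a \<ominus>\<^bsub>R\<^esub> b \<ominus>\<^bsub>R\<^esub> c = \<zero>\<^bsub>R\<^esub>" if "a = b \<oplus>\<^bsub>R\<^esub> c" "b \<in> carrier R" "c \<in> carrier R" for a b c
      proof -
        have "a \<ominus>\<^bsub>R\<^esub> b = c"
          unfolding that(1) using that(2,3) by (simp add: a_minus_def RR.a_comm[of b c] RR.a_assoc RR.r_neg)
        then show ?thesis using that(3) by (simp add: a_minus_def RR.r_neg)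
      qed
      from x consider
          (1) r r' l where "x = frag_of (r \<oplus>\<^bsub>R\<^esub> r', l) - frag_of (r, l) - frag_of (r', l)"
            "r \<in> carrier R" "r' \<in> carrier R" "l \<in> carrier L"
        | (2) r l l' where "x = frag_of (r, l \<oplus>\<^bsub>L\<^esub> l') - frag_of (r, l) - frag_of (r, l')"
            "r \<in> carrier R" "l \<in> carrier L" "l' \<in> carrier L"
        | (3) k r l where "x = frag_of (k \<odot>\<^bsub>R\<^esub> r, l) - frag_of (r, k \<odot>\<^bsub>L\<^esub> l)"
            "k \<in> carrier K" "r \<in> carrier R" "l \<in> carrier L"
        unfolding tensor_relations_def by blast
      then show ?thesis
      proof cases
        case 1
        then have "\<theta> (x \<otimes>\<^bsub>?IM\<^esub> frag_of (p, q)) = \<phi> (l \<otimes>\<^bsub>L\<^esub> q) \<odot>\<^bsub>R\<^esub> ((r \<oplus>\<^bsub>R\<^esub> r') \<otimes>\<^bsub>R\<^esub> p)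
            \<ominus>\<^bsub>R\<^esub> \<phi> (l \<otimes>\<^bsub>L\<^esub> q) \<odot>\<^bsub>R\<^esub> (r \<otimes>\<^bsub>R\<^esub> p) \<ominus>\<^bsub>R\<^esub> \<phi> (l \<otimes>\<^bsub>L\<^esub> q) \<odot>\<^bsub>R\<^esub> (r' \<otimes>\<^bsub>R\<^esub> p)"
          using pq by (simp add: int_monoid_ring_diff_l[OF M] int_monoid_ring_mult_of[OF M] \<theta>_diff \<theta>_of of_cl
              int_monoid_ring_diff_closed[OF M])
        also have "\<dots> = \<zero>\<^bsub>R\<^esub>"
          using 1 pq by (intro cancel) (auto simp: RR.l_distr R.smult_r_distr \<phi>_closed)
        finally show ?thesis .
      next
        case 2
        then have "\<theta> (x \<otimes>\<^bsub>?IM\<^esub> frag_of (p, q)) = \<phi> ((l \<oplus>\<^bsub>L\<^esub> l') \<otimes>\<^bsub>L\<^esub> q) \<odot>\<^bsub>R\<^esub> (r \<otimes>\<^bsub>R\<^esub> p)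
            \<ominus>\<^bsub>R\<^esub> \<phi> (l \<otimes>\<^bsub>L\<^esub> q) \<odot>\<^bsub>R\<^esub> (r \<otimes>\<^bsub>R\<^esub> p) \<ominus>\<^bsub>R\<^esub> \<phi> (l' \<otimes>\<^bsub>L\<^esub> q) \<odot>\<^bsub>R\<^esub> (r \<otimes>\<^bsub>R\<^esub> p)"
          using pq by (simp add: int_monoid_ring_diff_l[OF M] int_monoid_ring_mult_of[OF M] \<theta>_diff \<theta>_of of_cl
              int_monoid_ring_diff_closed[OF M])
        also have "\<dots> = \<zero>\<^bsub>R\<^esub>"
          using 2 pq by (intro cancel) (auto simp: LL.l_distr R.smult_l_distr \<phi>_closed \<phi>_add)
        finally show ?thesis .
      next
        case 3
        then have "\<theta> (x \<otimes>\<^bsub>?IM\<^esub> frag_of (p, q)) = \<phi> (l \<otimes>\<^bsub>L\<^esub> q) \<odot>\<^bsub>R\<^esub> ((k \<odot>\<^bsub>R\<^esub> r) \<otimes>\<^bsub>R\<^esub> p)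
            \<ominus>\<^bsub>R\<^esub> \<phi> ((k \<odot>\<^bsub>L\<^esub> l) \<otimes>\<^bsub>L\<^esub> q) \<odot>\<^bsub>R\<^esub> (r \<otimes>\<^bsub>R\<^esub> p)"
          using pq by (simp add: int_monoid_ring_diff_l[OF M] int_monoid_ring_mult_of[OF M] \<theta>_diff \<theta>_of of_cl)
        also have "\<phi> ((k \<odot>\<^bsub>L\<^esub> l) \<otimes>\<^bsub>L\<^esub> q) \<odot>\<^bsub>R\<^esub> (r \<otimes>\<^bsub>R\<^esub> p) = \<phi> (l \<otimes>\<^bsub>L\<^esub> q) \<odot>\<^bsub>R\<^esub> ((k \<odot>\<^bsub>R\<^esub> r) \<otimes>\<^bsub>R\<^esub> p)"
          using 3 pq KK.m_comm[of k]
          by (simp add: L.smult_assoc2 R.smult_assoc2 \<phi>_smult \<phi>_closed flip: R.smult_assoc1)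
        finally show ?thesis using 3 pq \<phi>_closed by (simp add: a_minus_def RR.r_neg)
      qed
    qed
    then show "x \<in> Z" using x rel_cl by (auto simp: Z_def)
  qed
  then have NZ: "N \<subseteq> Z" unfolding N_def by (rule IM.genideal_minimal[OF Zid])
  have inj: "r = \<zero>\<^bsub>R\<^esub>" if r: "r \<in> carrier R" "cl r = \<zero>\<^bsub>?IM Quot N\<^esub>" for r
  proof -
    have "frag_of (r, \<one>\<^bsub>L\<^esub>) \<in> Z" using r NZ cl_zero_iff by blast
    then have "\<theta> (frag_of (r, \<one>\<^bsub>L\<^esub>) \<otimes>\<^bsub>?IM\<^esub> frag_of (\<one>\<^bsub>R\<^esub>, \<one>\<^bsub>L\<^esub>)) = \<zero>\<^bsub>R\<^esub>"
      by (simp add: Z_def)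
    then show ?thesis using r \<phi>(2) by (simp add: int_monoid_ring_mult_of[OF M] \<theta>_of)
  qed
  show ?thesis
  proof (intro domain.intro domain_axioms.intro)
    show "\<one>\<^bsub>R\<^esub> \<noteq> \<zero>\<^bsub>R\<^esub>"
    proof
      assume "\<one>\<^bsub>R\<^esub> = \<zero>\<^bsub>R\<^esub>"
      then have "cl \<one>\<^bsub>R\<^esub> = \<zero>\<^bsub>?IM Quot N\<^esub>" using cl_zero by simp
      moreover have "cl \<one>\<^bsub>R\<^esub> = \<one>\<^bsub>?IM Quot N\<^esub>"
        using q.hom_one by (simp add: cl_def int_monoid_ring_ops[OF M])
      ultimately show False using T.one_not_zero by simp
    qed
    fix r s assume rs: "r \<otimes>\<^bsub>R\<^esub> s = \<zero>\<^bsub>R\<^esub>" "r \<in> carrier R" "s \<in> carrier R"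
    then have "cl r \<otimes>\<^bsub>?IM Quot N\<^esub> cl s = \<zero>\<^bsub>?IM Quot N\<^esub>"
      using cl_mult cl_zero by metis
    then have "cl r = \<zero>\<^bsub>?IM Quot N\<^esub> \<or> cl s = \<zero>\<^bsub>?IM Quot N\<^esub>"
      using T.integral cl_closed rs by blast
    then show "r = \<zero>\<^bsub>R\<^esub> \<or> s = \<zero>\<^bsub>R\<^esub>" using inj rs by blast
  qed (rule R.M_cring)
qed

section \<open>Graded domains\<close>

text \<open>The ground field is present only as \<open>G 0\<close>, whose nonzero elements are
  invertible. Scalars are then ring elements, and no separate module structure has to be carried
  along.\<close>

locale graded_domain = domain R for R (structure) +
  fixes G :: "nat \<Rightarrow> 'a set" and S :: "'a set"
  assumes grade_subgroup: "additive_subgroup (G d) R"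
    and grade_mult: "x \<in> G i \<Longrightarrow> y \<in> G j \<Longrightarrow> x \<otimes> y \<in> G (i + j)"
    and direct_sum: "x \<in> carrier R \<Longrightarrow>
      \<exists>!c. (\<forall>d. c d \<in> G d) \<and> finite {d. c d \<noteq> \<zero>} \<and> x = (\<Oplus>d\<in>{d. c d \<noteq> \<zero>}. c d)"
    and one_grade: "\<one> \<in> G 0"
    and grade_zero_inverse: "c \<in> G 0 \<Longrightarrow> c \<noteq> \<zero> \<Longrightarrow> \<exists>c'\<in>G 0. c \<otimes> c' = \<one>"
    and S_grade: "S \<subseteq> G 1" and S_finite: "finite S"
    and generated: "generate_ring R (G 0 \<union> S) = carrier R"
begin

lemma grade_carrier: "x \<in> G d \<Longrightarrow> x \<in> carrier R"
  using additive_subgroup.a_subset[OF grade_subgroup] by blast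

lemma grade_zero_carrier [simp]: "x \<in> G 0 \<Longrightarrow> x \<in> carrier R"
  by (rule grade_carrier)

lemma grade_closed [simp, intro]:
  "\<zero> \<in> G d" "x \<in> G d \<Longrightarrow> y \<in> G d \<Longrightarrow> x \<oplus> y \<in> G d" "x \<in> G d \<Longrightarrow> \<ominus> x \<in> G d"
  using grade_subgroup[of d]
  by (auto intro: additive_subgroup.zero_closed additive_subgroup.a_closed additive_subgroup.a_inv_closed)

lemma grade_finsum: "(\<And>i. i \<in> A \<Longrightarrow> g i \<in> G d) \<Longrightarrow> (\<Oplus>i\<in>A. g i) \<in> G d"
  by (induction A rule: infinite_finite_induct) (auto simp: finsum_insert Pi_def grade_carrier[of _ d])

lemma grade_pow: "x \<in> G d \<Longrightarrow> x [^] (n :: nat) \<in> G (n * d)"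
proof (induction n)
  case (Suc n)
  then have "x [^] n \<otimes> x \<in> G (n * d + d)" by (intro grade_mult)
  moreover have "n * d + d = Suc n * d" by simp
  ultimately show ?case by (simp only: nat_pow_Suc)
qed (simp add: one_grade)

lemma S_carrier: "s \<in> S \<Longrightarrow> s \<in> carrier R"
  using S_grade grade_carrier by blast

section \<open>Homogeneous components\<close>

definition component :: "'a \<Rightarrow> nat \<Rightarrow> 'a"
  where "component x = (THE c. (\<forall>d. c d \<in> G d) \<and> finite {d. c d \<noteq> \<zero>} \<and> x = (\<Oplus>d\<in>{d. c d \<noteq> \<zero>}. c d))"

lemma component_props:
  assumes "x \<in> carrier R"
  shows component_grade: "component x d \<in> G d" and component_finite: "finite {d. component x d \<noteq> \<zero>}"
    and component_sum: "x = (\<Oplus>d\<in>{d. component x d \<noteq> \<zero>}. component x d)"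
  using theI'[OF direct_sum[OF assms], folded component_def] by auto

lemma component_closed [simp]: "x \<in> carrier R \<Longrightarrow> component x d \<in> carrier R"
  by (rule grade_carrier[OF component_grade])

text \<open>The index set may contain degrees in which \<open>c\<close> vanishes, so that sums over
  a convenient \<open>D\<close> need not be trimmed to the support.\<close>

lemma component_unique:
  assumes c: "\<And>d. c d \<in> G d" and D: "finite D" "\<And>d. d \<notin> D \<Longrightarrow> c d = \<zero>" and x: "x = (\<Oplus>d\<in>D. c d)"
  shows "component x = c"
proof -
  have sub: "{d. c d \<noteq> \<zero>} \<subseteq> D" using D(2) by blast
  have "(\<Oplus>d\<in>{d. c d \<noteq> \<zero>}. c d) = (\<Oplus>d\<in>D. c d)"
    using sub grade_carrier[OF c] D by (intro add.finprod_mono_neutral_cong_left) auto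
  moreover have "x \<in> carrier R"
    unfolding x using grade_carrier[OF c] by (intro finsum_closed) auto
  ultimately show ?thesis
    unfolding component_def using c finite_subset[OF sub D(1)] x
    by (intro the1_equality[OF direct_sum]) auto
qed

lemma component_sum_superset:
  assumes "x \<in> carrier R" "finite D" "\<And>d. d \<notin> D \<Longrightarrow> component x d = \<zero>"
  shows "x = (\<Oplus>d\<in>D. component x d)"
proof -
  have "(\<Oplus>d\<in>{d. component x d \<noteq> \<zero>}. component x d) = (\<Oplus>d\<in>D. component x d)"
    using assms by (intro add.finprod_mono_neutral_cong_left) auto
  then show ?thesis using component_sum[OF assms(1)] by simp
qed

lemma component_add: "x \<in> carrier R \<Longrightarrow> y \<in> carrier R \<Longrightarrow> component (x \<oplus> y) d = component x d \<oplus> component y d"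
proof -
  assume x: "x \<in> carrier R" and y: "y \<in> carrier R"
  let ?D = "{d. component x d \<noteq> \<zero>} \<union> {d. component y d \<noteq> \<zero>}"
  have fin: "finite ?D" using x y component_finite by simp
  have "x \<oplus> y = (\<Oplus>d\<in>?D. component x d) \<oplus> (\<Oplus>d\<in>?D. component y d)"
    using component_sum_superset[OF x fin] component_sum_superset[OF y fin] by auto
  also have "\<dots> = (\<Oplus>d\<in>?D. component x d \<oplus> component y d)"
    using x y by (intro finsum_addf[symmetric]) auto
  finally have "component (x \<oplus> y) = (\<lambda>d. component x d \<oplus> component y d)"
    using x y fin by (intro component_unique[of _ ?D]) (auto simp: component_grade)
  then show ?thesis by simp
qed

lemma component_grade_eq: "x \<in> G e \<Longrightarrow> component x d = (if d = e then x else \<zero>)"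
proof -
  assume x: "x \<in> G e"
  have "component x = (\<lambda>d. if d = e then x else \<zero>)"
    using x grade_carrier[OF x] by (intro component_unique[of _ "{e}"]) (auto simp: finsum_insert)
  then show ?thesis by simp
qed

lemma component_zero [simp]: "component \<zero> d = \<zero>"
  using component_grade_eq[of \<zero> d d] by simp

lemma component_neg: "x \<in> carrier R \<Longrightarrow> component (\<ominus> x) d = \<ominus> component x d"
  using component_add[of "\<ominus> x" x d] by (intro minus_equality[symmetric]) (auto simp: l_neg)

lemma component_minus: "x \<in> carrier R \<Longrightarrow> y \<in> carrier R \<Longrightarrow> component (x \<ominus> y) d = component x d \<ominus> component y d"
  by (simp add: a_minus_def component_add component_neg)

lemma component_finsum:
  "(\<And>i. i \<in> A \<Longrightarrow> g i \<in> carrier R) \<Longrightarrow> component (\<Oplus>i\<in>A. g i) d = (\<Oplus>i\<in>A. component (g i) d)"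
  by (induction A rule: infinite_finite_induct) (auto simp: finsum_insert Pi_def component_add finsum_closed)

lemma component_mult_grade:
  assumes x: "x \<in> G e" and y: "y \<in> carrier R"
  shows "component (x \<otimes> y) d = (if e \<le> d then x \<otimes> component y (d - e) else \<zero>)"
proof -
  let ?D = "{d. component y d \<noteq> \<zero>}"
  have xc: "x \<in> carrier R" by (rule grade_carrier[OF x])
  have fin: "finite ?D" using y component_finite by simp
  have "x \<otimes> y = x \<otimes> (\<Oplus>d\<in>?D. component y d)" using component_sum[OF y] by simp
  also have "\<dots> = (\<Oplus>d\<in>?D. x \<otimes> component y d)" using xc y fin by (simp add: finsum_rdistr)
  also have "\<dots> = (\<Oplus>d\<in>?D. (\<lambda>d. if e \<le> d then x \<otimes> component y (d - e) else \<zero>) (d + e))"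
    by simp
  also have "\<dots> = (\<Oplus>d\<in>(\<lambda>d. d + e) ` ?D. if e \<le> d then x \<otimes> component y (d - e) else \<zero>)"
    using xc y by (intro finsum_reindex[symmetric]) auto
  finally have "component (x \<otimes> y) = (\<lambda>d. if e \<le> d then x \<otimes> component y (d - e) else \<zero>)"
  proof (rule component_unique[rotated 3])
    fix d show "(if e \<le> d then x \<otimes> component y (d - e) else \<zero>) \<in> G d"
      using grade_mult[OF x component_grade[OF y, of "d - e"]] by auto
    show "(if e \<le> d then x \<otimes> component y (d - e) else \<zero>) = \<zero>" if "d \<notin> (\<lambda>d. d + e) ` ?D"
      using that xc by (auto simp: image_iff) (metis le_add_diff_inverse2 r_null)
  qed (use fin in auto)
  then show ?thesis by simp
qed

text \<open>The filtration by the lowest degree that occurs. Since R is generated in degree one,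
  this is the adic filtration of the irrelevant ideal; the localized form of this fact is
  \<open>ideal_pow_irrelevant\<close>.\<close>

definition high :: "nat \<Rightarrow> 'a set"
  where "high n = {x \<in> carrier R. \<forall>d<n. component x d = \<zero>}"

lemma high_carrier: "x \<in> high n \<Longrightarrow> x \<in> carrier R"
  by (simp add: high_def)

lemma high_0: "high 0 = carrier R"
  by (auto simp: high_def)

lemma grade_high: "x \<in> G d \<Longrightarrow> n \<le> d \<Longrightarrow> x \<in> high n"
  by (simp add: high_def component_grade_eq grade_carrier)

lemma high_antimono: "m \<le> n \<Longrightarrow> high n \<subseteq> high m"
  by (auto simp: high_def)

lemma high_add: "x \<in> high n \<Longrightarrow> y \<in> high n \<Longrightarrow> x \<oplus> y \<in> high n"
  by (simp add: high_def component_add)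

lemma high_zero: "\<zero> \<in> high n"
  by (simp add: high_def)

lemma high_neg: "x \<in> high n \<Longrightarrow> \<ominus> x \<in> high n"
  by (simp add: high_def component_neg)

lemma high_finsum: "(\<And>i. i \<in> A \<Longrightarrow> g i \<in> high n) \<Longrightarrow> (\<Oplus>i\<in>A. g i) \<in> high n"
  by (induction A rule: infinite_finite_induct)
    (auto simp: finsum_insert Pi_def high_add high_zero high_carrier[of _ n])

lemma high_mult:
  assumes x: "x \<in> high i" and y: "y \<in> high j"
  shows "x \<otimes> y \<in> high (i + j)"
proof -
  have xc: "x \<in> carrier R" and yc: "y \<in> carrier R" using x y high_carrier by auto
  let ?D = "{d. component x d \<noteq> \<zero>}"
  have "x \<otimes> y = (\<Oplus>d\<in>?D. component x d) \<otimes> y" using component_sum[OF xc] by simp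
  also have "\<dots> = (\<Oplus>d\<in>?D. component x d \<otimes> y)" using xc yc component_finite by (simp add: finsum_ldistr)
  also have "\<dots> \<in> high (i + j)"
  proof (rule high_finsum)
    fix d assume "d \<in> ?D"
    then have "i \<le> d" using x by (auto simp: high_def not_less[symmetric])
    then have "component (component x d \<otimes> y) e = \<zero>" if "e < i + j" for e
      using that y xc component_mult_grade[OF component_grade[OF xc] yc, of d e] by (auto simp: high_def)
    then show "component x d \<otimes> y \<in> high (i + j)" using xc yc by (simp add: high_def)
  qed
  finally show ?thesis .
qed

lemma high_Suc_decomp:
  assumes x: "x \<in> high i"
  shows "x \<ominus> component x i \<in> high (Suc i)"
proof -
  have xc: "x \<in> carrier R" using x high_carrier by blast
  have "component (x \<ominus> component x i) d = \<zero>" if "d < Suc i" for d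
    using that x component_grade_eq[OF component_grade[OF xc, of i], of d] component_minus[OF xc component_closed[OF xc], of i d] xc
    by (cases "d = i") (auto simp: high_def a_minus_def r_neg)
  then show ?thesis using xc by (simp add: high_def)
qed

text \<open>In degree \<open>i + j\<close> only the two lowest components contribute.\<close>

lemma component_mult_high:
  assumes x: "x \<in> high i" and y: "y \<in> high j"
  shows "component (x \<otimes> y) (i + j) = component x i \<otimes> component y j"
proof -
  have xc: "x \<in> carrier R" and yc: "y \<in> carrier R" using x y high_carrier by auto
  have "x = component x i \<oplus> (x \<ominus> component x i)"
    using xc by (simp add: a_minus_def a_lcomm r_neg)
  then have "x \<otimes> y = component x i \<otimes> y \<oplus> (x \<ominus> component x i) \<otimes> y"
    using xc yc by (metis component_closed l_distr minus_closed)
  moreover have "(x \<ominus> component x i) \<otimes> y \<in> high (Suc i + j)"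
    using high_mult[OF high_Suc_decomp[OF x] y] .
  then have "component ((x \<ominus> component x i) \<otimes> y) (i + j) = \<zero>" by (simp add: high_def)
  ultimately show ?thesis
    using xc yc component_mult_grade[OF component_grade[OF xc] yc, of i "i + j"] by (simp add: component_add)
qed

lemma component_nonzero_exists:
  assumes "x \<in> carrier R" "x \<noteq> \<zero>"
  obtains i where "x \<in> high i" "component x i \<noteq> \<zero>"
proof -
  have "\<exists>d. component x d \<noteq> \<zero>"
    using component_sum_superset[OF assms(1), of "{}"] assms(2) by auto
  then have "component x (LEAST d. component x d \<noteq> \<zero>) \<noteq> \<zero>" by (rule LeastI_ex)
  moreover have "x \<in> high (LEAST d. component x d \<noteq> \<zero>)"
    using assms(1) not_less_Least by (auto simp: high_def)
  ultimately show ?thesis using that by blast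
qed

text \<open>The order of a nonzero element, the degree of its lowest component, is additive, because
  in a domain the product of two lowest components is nonzero. Lying outside
  \<open>high (Suc i)\<close> means having order at most \<open>i\<close>.\<close>

lemma not_high_mult:
  assumes "x \<in> carrier R" "y \<in> carrier R" "x \<notin> high (Suc i)" "y \<notin> high (Suc j)"
  shows "x \<otimes> y \<notin> high (Suc (i + j))"
proof -
  have "x \<noteq> \<zero>" "y \<noteq> \<zero>" using assms high_zero by auto
  then obtain i' j' where h: "x \<in> high i'" "component x i' \<noteq> \<zero>" "y \<in> high j'" "component y j' \<noteq> \<zero>"
    using component_nonzero_exists[OF assms(1)] component_nonzero_exists[OF assms(2)] by metis
  have "i' \<le> i" "j' \<le> j"
    using h assms(3,4) high_antimono[of "Suc i" i'] high_antimono[of "Suc j" j'] not_less_eq_eq by auto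
  moreover have "component (x \<otimes> y) (i' + j') \<noteq> \<zero>"
    using h assms(1,2) component_mult_high integral by (metis component_closed)
  ultimately show ?thesis unfolding high_def by (auto intro!: exI[of _ "i' + j'"])
qed

text \<open>The elements of this form contain \<open>G 0\<close> and \<open>S\<close> and are closed
  under the ring operations, so they exhaust the generated ring.\<close>

lemma S_combination:
  assumes "x \<in> carrier R"
  shows "\<exists>a\<in>G 0. \<exists>c. (\<forall>s. c s \<in> carrier R) \<and> x = a \<oplus> (\<Oplus>s\<in>S. s \<otimes> c s)"
proof -
  let ?sum = "\<lambda>c. \<Oplus>s\<in>S. s \<otimes> c s"
  have cl: "?sum c \<in> carrier R" if "\<forall>s. c s \<in> carrier R" for c
    using that S_carrier by (intro finsum_closed) auto
  have sum_add: "?sum c \<oplus> ?sum c' = ?sum (\<lambda>s. c s \<oplus> c' s)"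
    if "\<forall>s. c s \<in> carrier R" "\<forall>s. c' s \<in> carrier R" for c c'
  proof -
    have "?sum (\<lambda>s. c s \<oplus> c' s) = (\<Oplus>s\<in>S. s \<otimes> c s \<oplus> s \<otimes> c' s)"
      using that S_carrier by (intro finsum_cong') (auto simp: r_distr)
    then show ?thesis using that S_carrier by (simp add: finsum_addf Pi_def)
  qed
  have sum_mult: "r \<otimes> ?sum c = ?sum (\<lambda>s. r \<otimes> c s)" if "\<forall>s. c s \<in> carrier R" "r \<in> carrier R" for c r
    using that S_carrier S_finite
    by (subst finsum_rdistr) (auto intro!: finsum_cong' simp: m_lcomm)
  have sum_0: "?sum (\<lambda>s. \<zero>) = \<zero>"
    using S_carrier by (intro add.finprod_one_eqI) auto
  have "x \<in> generate_ring R (G 0 \<union> S)" using assms generated by simp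
  then show ?thesis
  proof (induction rule: generate_ring.induct)
    case one
    then show ?case using sum_0 by (intro bexI[of _ \<one>] exI[of _ "\<lambda>s. \<zero>"]) (auto simp: one_grade)
  next
    case (incl h)
    then consider "h \<in> G 0" | "h \<in> S" by blast
    then show ?case
    proof cases
      case 1
      then show ?thesis using sum_0 by (intro bexI[of _ h] exI[of _ "\<lambda>s. \<zero>"]) auto
    next
      case 2
      have "?sum (\<lambda>s. if s = h then \<one> else \<zero>) = (\<Oplus>s\<in>S. if h = s then s else \<zero>)"
        using S_carrier by (intro finsum_cong') auto
      also have "\<dots> = h" using 2 S_finite S_carrier by (intro finsum_singleton) auto
      finally show ?thesis
        using 2 S_carrier
        by (intro bexI[of _ \<zero>] exI[of _ "\<lambda>s. if s = h then \<one> else \<zero>"]) auto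
    qed
  next
    case (a_inv h)
    then obtain a c where h: "a \<in> G 0" "\<forall>s. c s \<in> carrier R" "h = a \<oplus> ?sum c" by blast
    have "\<ominus> ?sum c = (\<ominus> \<one>) \<otimes> ?sum c" using cl[OF h(2)] by (simp add: l_minus)
    then have "\<ominus> h = \<ominus> a \<oplus> ?sum (\<lambda>s. \<ominus> \<one> \<otimes> c s)"
      using h cl[OF h(2)] sum_mult[OF h(2), of "\<ominus> \<one>"] by (simp add: minus_add)
    then show ?case using h by (intro bexI[of _ "\<ominus> a"] exI[of _ "\<lambda>s. \<ominus> \<one> \<otimes> c s"]) auto
  next
    case (eng_add h h')
    then obtain a c a' c' where h: "a \<in> G 0" "\<forall>s. c s \<in> carrier R" "h = a \<oplus> ?sum c"
      and h': "a' \<in> G 0" "\<forall>s. c' s \<in> carrier R" "h' = a' \<oplus> ?sum c'" by blast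
    have "h \<oplus> h' = (a \<oplus> a') \<oplus> (?sum c \<oplus> ?sum c')"
      using h h' cl[OF h(2)] cl[OF h'(2)] by (simp add: a_ac)
    then show ?case
      using h h' sum_add[OF h(2) h'(2)]
      by (intro bexI[of _ "a \<oplus> a'"] exI[of _ "\<lambda>s. c s \<oplus> c' s"]) auto
  next
    case (eng_mult h h')
    then obtain a c a' c' where h: "a \<in> G 0" "\<forall>s. c s \<in> carrier R" "h = a \<oplus> ?sum c"
      and h': "a' \<in> G 0" "\<forall>s. c' s \<in> carrier R" "h' = a' \<oplus> ?sum c'" by blast
    have h'c: "h' \<in> carrier R" using h' cl[OF h'(2)] by simp
    have "h \<otimes> h' = a \<otimes> a' \<oplus> (a \<otimes> ?sum c' \<oplus> h' \<otimes> ?sum c)"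
      using h h' cl[OF h(2)] cl[OF h'(2)] by (simp add: a_ac m_ac l_distr r_distr)
    also have "\<dots> = a \<otimes> a' \<oplus> ?sum (\<lambda>s. a \<otimes> c' s \<oplus> h' \<otimes> c s)"
      using h h' h'c by (simp add: sum_mult sum_add)
    finally show ?case
      using h h' h'c grade_mult[of a 0 a' 0]
      by (intro bexI[of _ "a \<otimes> a'"] exI[of _ "\<lambda>s. a \<otimes> c' s \<oplus> h' \<otimes> c s"]) auto
  qed
qed

lemma high_1_combination:
  assumes "x \<in> high 1"
  obtains c where "\<And>s. c s \<in> carrier R" "x = (\<Oplus>s\<in>S. s \<otimes> c s)"
proof -
  have xc: "x \<in> carrier R" using assms high_carrier by blast
  then obtain a c where ac: "a \<in> G 0" "\<forall>s. c s \<in> carrier R" "x = a \<oplus> (\<Oplus>s\<in>S. s \<otimes> c s)"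
    using S_combination by blast
  have sc: "\<And>s. s \<in> S \<Longrightarrow> s \<otimes> c s \<in> carrier R" using ac S_carrier by auto
  have S1: "\<And>s. s \<in> S \<Longrightarrow> s \<in> G 1" using S_grade by auto
  have "component x 0 = component a 0 \<oplus> (\<Oplus>s\<in>S. component (s \<otimes> c s) 0)"
    using ac sc by (simp add: component_add finsum_closed component_finsum)
  also have "(\<Oplus>s\<in>S. component (s \<otimes> c s) 0) = \<zero>"
    using S1 ac by (intro add.finprod_one_eqI) (simp add: component_mult_grade[where e = "Suc 0"])
  finally have "a = \<zero>" using assms ac(1) by (simp add: high_def component_grade_eq)
  then show ?thesis using ac sc that[of c] by (simp add: finsum_closed)
qed

text \<open>Keeping only the component of degree \<open>d\<close> of each coefficient makes the
  preceding combination homogeneous. This is what permits induction on the degree.\<close>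

lemma grade_Suc_combination:
  assumes "x \<in> G (Suc d)"
  obtains c where "\<And>s. s \<in> S \<Longrightarrow> c s \<in> G d" "x = (\<Oplus>s\<in>S. s \<otimes> c s)"
proof -
  have S1: "\<And>s. s \<in> S \<Longrightarrow> s \<in> G 1" using S_grade by auto
  obtain c where c: "\<And>s. c s \<in> carrier R" "x = (\<Oplus>s\<in>S. s \<otimes> c s)"
    using high_1_combination[of x] grade_high[OF assms, of 1] by auto
  have "x = component x (Suc d)" using assms by (simp add: component_grade_eq)
  also have "\<dots> = (\<Oplus>s\<in>S. component (s \<otimes> c s) (Suc d))"
    unfolding c(2) using c S_carrier by (intro component_finsum) auto
  also have "\<dots> = (\<Oplus>s\<in>S. s \<otimes> component (c s) d)"
    using c S1 S_carrier by (intro finsum_cong') (auto simp: component_mult_grade[where e = "Suc 0"])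
  finally show ?thesis using that[of "\<lambda>s. component (c s) d"] c(1) component_grade by blast
qed

end

section \<open>Noetherian rings\<close>

context cring
begin

text \<open>Ideals of a subring \<open>A\<close> are kept as subsets of the ambient ring, so that
  adjoining elements one by one changes neither the type nor the operations.\<close>

definition subideal :: "'a set \<Rightarrow> 'a set \<Rightarrow> bool"
  where "subideal A J \<longleftrightarrow> J \<subseteq> A \<and> \<zero> \<in> J \<and> (\<forall>x\<in>J. \<forall>y\<in>J. x \<oplus> y \<in> J) \<and> (\<forall>a\<in>A. \<forall>x\<in>J. a \<otimes> x \<in> J)"

definition acc :: "'a set \<Rightarrow> bool"
  where "acc A \<longleftrightarrow> (\<forall>C. (\<forall>n :: nat. subideal A (C n)) \<and> (\<forall>n. C n \<subseteq> C (Suc n)) \<longrightarrow>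
    (\<exists>N. \<forall>n\<ge>N. C n = C N))"

text \<open>The combinations of the powers of \<open>t\<close> below \<open>n\<close> with
  coefficients in \<open>A\<close>. Since \<open>t\<close> may be algebraic over \<open>A\<close>,
  this \<open>n\<close> is a bound and not a degree.\<close>

primrec adjoin_upto :: "'a set \<Rightarrow> 'a \<Rightarrow> nat \<Rightarrow> 'a set"
  where
    "adjoin_upto A t 0 = {\<zero>}"
  | "adjoin_upto A t (Suc n) = {a \<otimes> t [^] n \<oplus> y | a y. a \<in> A \<and> y \<in> adjoin_upto A t n}"

definition adjoin :: "'a set \<Rightarrow> 'a \<Rightarrow> 'a set"
  where "adjoin A t = (\<Union>n. adjoin_upto A t n)"

text \<open>The leading coefficients in degree \<open>i\<close> that occur in some presentation of
  some element of \<open>J\<close>; presentations need not be unique.\<close>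

definition leading :: "'a set \<Rightarrow> 'a \<Rightarrow> nat \<Rightarrow> 'a set \<Rightarrow> 'a set"
  where "leading A t i J = {a \<in> A. \<exists>y\<in>adjoin_upto A t i. a \<otimes> t [^] i \<oplus> y \<in> J}"

context
  fixes A t
  assumes A: "subring A R" and t: "t \<in> carrier R"
begin

private abbreviation "U n \<equiv> adjoin_upto A t n"
private abbreviation "B \<equiv> adjoin A t"
private abbreviation "L i J \<equiv> leading A t i J"

lemma A_carrier: "a \<in> A \<Longrightarrow> a \<in> carrier R"
  using subringE(1)[OF A] by blast

lemma adjoin_upto_carrier: "x \<in> U n \<Longrightarrow> x \<in> carrier R"
  by (induction n arbitrary: x) (auto simp: A_carrier t)

lemma adjoin_upto_SucI: "a \<in> A \<Longrightarrow> y \<in> U n \<Longrightarrow> a \<otimes> t [^] n \<oplus> y \<in> U (Suc n)"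
  by auto

lemma adjoin_upto_Suc: "x \<in> U n \<Longrightarrow> x \<in> U (Suc n)"
proof -
  assume x: "x \<in> U n"
  have "x = \<zero> \<otimes> t [^] n \<oplus> x" using adjoin_upto_carrier[OF x] t by simp
  then show ?thesis using x subringE(2)[OF A] by auto
qed

lemma adjoin_upto_mono: "m \<le> n \<Longrightarrow> U m \<subseteq> U n"
  by (rule lift_Suc_mono_le[of U]) (auto simp del: adjoin_upto.simps intro: adjoin_upto_Suc)

lemma adjoin_upto_zero: "\<zero> \<in> U n"
  using adjoin_upto_mono[of 0 n] by auto

lemma adjoin_upto_add: "x \<in> U n \<Longrightarrow> y \<in> U n \<Longrightarrow> x \<oplus> y \<in> U n"
proof (induction n arbitrary: x y)
  case (Suc n)
  then obtain a x' b y' where e: "a \<in> A" "x' \<in> U n" "x = a \<otimes> t [^] n \<oplus> x'"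
    "b \<in> A" "y' \<in> U n" "y = b \<otimes> t [^] n \<oplus> y'" by auto
  then have eq: "x \<oplus> y = (a \<oplus> b) \<otimes> t [^] n \<oplus> (x' \<oplus> y')"
    using t adjoin_upto_carrier by (simp add: A_carrier l_distr a_ac)
  show ?case unfolding eq by (intro adjoin_upto_SucI Suc.IH subringE(7)[OF A] e)
qed auto

lemma adjoin_upto_smult: "c \<in> A \<Longrightarrow> x \<in> U n \<Longrightarrow> c \<otimes> x \<in> U n"
proof (induction n arbitrary: x)
  case (Suc n)
  then obtain a x' where e: "a \<in> A" "x' \<in> U n" "x = a \<otimes> t [^] n \<oplus> x'" by auto
  then have eq: "c \<otimes> x = (c \<otimes> a) \<otimes> t [^] n \<oplus> c \<otimes> x'"
    using t Suc.prems adjoin_upto_carrier by (simp add: A_carrier r_distr m_assoc)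
  show ?case unfolding eq by (intro adjoin_upto_SucI Suc.IH subringE(6)[OF A] e Suc.prems(1))
qed (auto simp: A_carrier)

lemma adjoin_upto_neg: "x \<in> U n \<Longrightarrow> \<ominus> x \<in> U n"
  using adjoin_upto_smult[of "\<ominus> \<one>" x n] adjoin_upto_carrier[of x n] subringE(3,5)[OF A]
  by (simp add: l_minus)

lemma adjoin_upto_mult_t: "x \<in> U n \<Longrightarrow> t \<otimes> x \<in> U (Suc n)"
proof (induction n arbitrary: x)
  case 0
  then show ?case using t adjoin_upto_zero[of "Suc 0"] by (simp del: adjoin_upto.simps(2))
next
  case (Suc n)
  then obtain a x' where e: "a \<in> A" "x' \<in> U n" "x = a \<otimes> t [^] n \<oplus> x'" by auto
  then have "t \<otimes> x = a \<otimes> t [^] Suc n \<oplus> t \<otimes> x'"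
    using t adjoin_upto_carrier by (simp add: A_carrier r_distr m_ac)
  then show ?case using e Suc.IH[OF e(2)] by (auto simp del: nat_pow_Suc)
qed

lemma adjoin_upto_mult_pow: "x \<in> U n \<Longrightarrow> t [^] k \<otimes> x \<in> U (n + k)"
proof (induction k)
  case 0
  then show ?case using adjoin_upto_carrier by simp
next
  case (Suc k)
  then show ?case
    using adjoin_upto_mult_t[of "t [^] k \<otimes> x" "n + k"] t adjoin_upto_carrier[of x n]
    by (simp add: m_ac del: adjoin_upto.simps)
qed

lemma adjoin_upto_mult: "x \<in> U n \<Longrightarrow> y \<in> U m \<Longrightarrow> x \<otimes> y \<in> U (n + m)"
proof (induction n arbitrary: x)
  case 0
  then show ?case using adjoin_upto_zero adjoin_upto_carrier by simp
next
  case (Suc n)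
  then obtain a x' where e: "a \<in> A" "x' \<in> U n" "x = a \<otimes> t [^] n \<oplus> x'" by auto
  have "x \<otimes> y = a \<otimes> (t [^] n \<otimes> y) \<oplus> x' \<otimes> y"
    using e t Suc.prems adjoin_upto_carrier by (simp add: A_carrier l_distr m_assoc)
  moreover have "a \<otimes> (t [^] n \<otimes> y) \<in> U (m + n)"
    using e Suc.prems by (intro adjoin_upto_smult adjoin_upto_mult_pow) auto
  moreover have "x' \<otimes> y \<in> U (n + m)" using Suc e by blast
  ultimately have "x \<otimes> y \<in> U (n + m)"
    using adjoin_upto_add by (simp add: add.commute)
  then show ?case using adjoin_upto_Suc[of "x \<otimes> y" "n + m"] by (simp del: adjoin_upto.simps)
qed

lemma A_subset_adjoin: "A \<subseteq> B"
proof
  fix a assume a: "a \<in> A"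
  then have "a = a \<otimes> t [^] (0 :: nat) \<oplus> \<zero>" using A_carrier by simp
  then have "a \<in> U (Suc 0)" using a by auto
  then show "a \<in> B" unfolding adjoin_def by blast
qed

lemma t_in_adjoin: "t \<in> B"
proof -
  have "\<one> \<otimes> t [^] (0 :: nat) \<oplus> \<zero> \<in> U (Suc 0)"
    using subringE(3)[OF A] by (intro adjoin_upto_SucI) auto
  then have "\<one> \<in> U (Suc 0)" by (simp del: adjoin_upto.simps)
  from adjoin_upto_mult_t[OF this] have "t \<in> U (Suc (Suc 0))" using t by (simp del: adjoin_upto.simps)
  then show ?thesis unfolding adjoin_def by blast
qed

lemma adjoin_subring: "subring B R"
proof (rule subringI)
  have up: "x \<in> U (max n m)" "y \<in> U (max n m)" if "x \<in> U n" "y \<in> U m" for x y n m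
    using that adjoin_upto_mono[of n "max n m"] adjoin_upto_mono[of m "max n m"] by auto
  show "B \<subseteq> carrier R" using adjoin_upto_carrier by (auto simp: adjoin_def)
  show "\<one> \<in> B" using A_subset_adjoin subringE(3)[OF A] by blast
  show "\<ominus> h \<in> B" if "h \<in> B" for h using that adjoin_upto_neg by (auto simp: adjoin_def)
  show "h1 \<otimes> h2 \<in> B" if "h1 \<in> B" "h2 \<in> B" for h1 h2
  proof -
    from that obtain n m where "h1 \<in> U n" "h2 \<in> U m" unfolding adjoin_def by blast
    then show ?thesis using adjoin_upto_mult unfolding adjoin_def by blast
  qed
  show "h1 \<oplus> h2 \<in> B" if "h1 \<in> B" "h2 \<in> B" for h1 h2
  proof -
    from that obtain n m where "h1 \<in> U n" "h2 \<in> U m" unfolding adjoin_def by blast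
    then have "h1 \<oplus> h2 \<in> U (max n m)" using up adjoin_upto_add by blast
    then show ?thesis unfolding adjoin_def by blast
  qed
qed

lemma leading_subideal:
  assumes J: "subideal B J"
  shows "subideal A (L i J)"
  unfolding subideal_def
proof (intro conjI ballI)
  show "L i J \<subseteq> A" by (auto simp: leading_def)
  have "\<zero> \<otimes> t [^] i \<oplus> \<zero> \<in> J" using J t by (simp add: subideal_def)
  then show "\<zero> \<in> L i J"
    using adjoin_upto_zero subringE(2)[OF A] by (auto simp: leading_def)
  fix a assume "a \<in> L i J"
  then obtain x where a: "a \<in> A" "x \<in> U i" "a \<otimes> t [^] i \<oplus> x \<in> J" by (auto simp: leading_def)
  {
    fix b assume "b \<in> L i J"
    then obtain y where b: "b \<in> A" "y \<in> U i" "b \<otimes> t [^] i \<oplus> y \<in> J" by (auto simp: leading_def)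
    have "(a \<otimes> t [^] i \<oplus> x) \<oplus> (b \<otimes> t [^] i \<oplus> y) = (a \<oplus> b) \<otimes> t [^] i \<oplus> (x \<oplus> y)"
      using a b t adjoin_upto_carrier[of _ i] by (simp add: A_carrier l_distr a_ac)
    moreover have "(a \<otimes> t [^] i \<oplus> x) \<oplus> (b \<otimes> t [^] i \<oplus> y) \<in> J" using J a b by (simp add: subideal_def)
    ultimately show "a \<oplus> b \<in> L i J"
      using a b adjoin_upto_add subringE(7)[OF A] by (auto simp: leading_def)
  }
  fix c assume c: "c \<in> A"
  have "c \<otimes> (a \<otimes> t [^] i \<oplus> x) = (c \<otimes> a) \<otimes> t [^] i \<oplus> c \<otimes> x"
    using a c t adjoin_upto_carrier[of _ i] by (simp add: A_carrier r_distr m_assoc)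
  moreover have "c \<otimes> (a \<otimes> t [^] i \<oplus> x) \<in> J"
    using J a c A_subset_adjoin by (auto simp: subideal_def)
  ultimately show "c \<otimes> a \<in> L i J"
    using a c adjoin_upto_smult subringE(6)[OF A] by (auto simp: leading_def)
qed

lemma leading_Suc:
  assumes J: "subideal B J"
  shows "L i J \<subseteq> L (Suc i) J"
proof
  fix a assume "a \<in> L i J"
  then obtain x where a: "a \<in> A" "x \<in> U i" "a \<otimes> t [^] i \<oplus> x \<in> J" by (auto simp: leading_def)
  have "t \<otimes> (a \<otimes> t [^] i \<oplus> x) = a \<otimes> t [^] Suc i \<oplus> t \<otimes> x"
    using a t adjoin_upto_carrier[of _ i] by (simp add: A_carrier r_distr m_ac)
  moreover have "t \<otimes> (a \<otimes> t [^] i \<oplus> x) \<in> J"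
    using J a t_in_adjoin by (auto simp: subideal_def)
  ultimately have "a \<otimes> t [^] Suc i \<oplus> t \<otimes> x \<in> J" by simp
  then show "a \<in> L (Suc i) J"
    using a adjoin_upto_mult_t[OF a(2)] unfolding leading_def by blast
qed

lemma leading_mono: "J \<subseteq> J' \<Longrightarrow> L i J \<subseteq> L i J'"
  by (auto simp: leading_def)

text \<open>From an element of \<open>J'\<close> one subtracts an element of \<open>J\<close> with
  the same leading coefficient. The difference stays in \<open>J'\<close> and has a smaller degree
  bound, so induction applies.\<close>

lemma leading_reflect:
  assumes J: "subideal B J" and J': "subideal B J'" and sub: "J \<subseteq> J'"
    and L: "\<And>i. L i J' \<subseteq> L i J"
  shows "J' \<subseteq> J"
proof -
  have neg: "\<ominus> x \<in> K" if "subideal B K" "x \<in> K" for K x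
  proof -
    have "\<ominus> \<one> \<in> B" by (rule subringE(5)[OF adjoin_subring subringE(3)[OF adjoin_subring]])
    moreover have "x \<in> carrier R" using that subringE(1)[OF adjoin_subring] by (auto simp: subideal_def)
    moreover have "\<ominus> \<one> \<otimes> x \<in> K"
      using that \<open>\<ominus> \<one> \<in> B\<close> unfolding subideal_def by blast
    ultimately show ?thesis by (simp add: l_minus)
  qed
  have "x \<in> J" if "x \<in> U n" "x \<in> J'" for n x
    using that
  proof (induction n arbitrary: x)
    case 0
    then show ?case using J by (simp add: subideal_def)
  next
    case (Suc n)
    then obtain a y where e: "a \<in> A" "y \<in> U n" "x = a \<otimes> t [^] n \<oplus> y" by auto
    then have "a \<in> L n J'" using Suc.prems by (auto simp: leading_def)
    then obtain y' where y': "y' \<in> U n" "a \<otimes> t [^] n \<oplus> y' \<in> J" using L by (auto simp: leading_def)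
    have c: "a \<otimes> t [^] n \<in> carrier R" "y \<in> carrier R" "y' \<in> carrier R"
      using e y' t A_carrier adjoin_upto_carrier by auto
    have "y \<ominus> y' = x \<oplus> \<ominus> (a \<otimes> t [^] n \<oplus> y')"
    proof -
      have "x \<oplus> \<ominus> (a \<otimes> t [^] n \<oplus> y') = y \<oplus> a \<otimes> t [^] n \<oplus> (\<ominus> (a \<otimes> t [^] n) \<oplus> \<ominus> y')"
        using c e by (simp add: minus_add a_comm)
      also have "\<dots> = y \<ominus> y'" using c by (simp add: a_assoc r_neg1 r_neg2 a_minus_def)
      finally show ?thesis by simp
    qed
    moreover have "x \<oplus> \<ominus> (a \<otimes> t [^] n \<oplus> y') \<in> J'"
      using Suc.prems y' sub neg[OF J'] J' by (auto simp: subideal_def)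
    ultimately have "y \<ominus> y' \<in> J'" by simp
    moreover have "y \<ominus> y' \<in> U n"
      using e y' adjoin_upto_add adjoin_upto_neg by (simp add: a_minus_def)
    ultimately have "y \<ominus> y' \<in> J" using Suc.IH by blast
    then have "(a \<otimes> t [^] n \<oplus> y') \<oplus> (y \<ominus> y') \<in> J" using y' J by (auto simp: subideal_def)
    moreover have "(a \<otimes> t [^] n \<oplus> y') \<oplus> (y \<ominus> y') = x"
    proof -
      have "y' \<oplus> (y \<ominus> y') = y" using c a_lcomm[of y' y "\<ominus> y'"] by (simp add: a_minus_def r_neg)
      then show ?thesis using c e by (simp add: a_assoc)
    qed
    ultimately show ?case by simp
  qed
  moreover have "J' \<subseteq> B" using J' by (simp add: subideal_def)
  ultimately show ?thesis unfolding adjoin_def by blast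
qed

text \<open>Hilbert's basis theorem for chains. The ideals \<open>L i (C n)\<close> increase in both
  indices. They are stable along the diagonal from \<open>N0\<close> on, and each of the finitely
  many rows below \<open>N0\<close> is stable from \<open>M i\<close> on. From \<open>N\<close> on
  all leading ideals agree, hence so do the members of the chain.\<close>

lemma acc_adjoin:
  assumes acc: "acc A"
  shows "acc B"
  unfolding acc_def
proof (intro allI impI)
  fix C assume C: "(\<forall>n :: nat. subideal B (C n)) \<and> (\<forall>n. C n \<subseteq> C (Suc n))"
  then have Cid: "\<And>n. subideal B (C n)" and Cmono: "\<And>m n. m \<le> n \<Longrightarrow> C m \<subseteq> C n"
    using lift_Suc_mono_le[of C] by auto
  have Lmono: "L i (C k) \<subseteq> L j (C l)" if "i \<le> j" "k \<le> l" for i j k l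
  proof -
    have "L i (C k) \<subseteq> L j (C k)"
      using that(1) leading_Suc[OF Cid] lift_Suc_mono_le[of "\<lambda>i. L i (C k)"] by blast
    then show ?thesis using leading_mono[OF Cmono[OF that(2)]] by blast
  qed
  have stab: "\<exists>N. \<forall>n\<ge>N. D n = D N" if "\<And>n. subideal A (D n)" "\<And>n. D n \<subseteq> D (Suc n)" for D :: "nat \<Rightarrow> 'a set"
    using acc that unfolding acc_def by blast
  obtain N0 where N0: "\<And>n. n \<ge> N0 \<Longrightarrow> L n (C n) = L N0 (C N0)"
    using stab[of "\<lambda>n. L n (C n)"] leading_subideal[OF Cid] Lmono by (meson le_SucI le_refl)
  have "\<exists>N. \<forall>n\<ge>N. L i (C n) = L i (C N)" for i
    using stab[of "\<lambda>n. L i (C n)"] leading_subideal[OF Cid] Lmono by (meson le_SucI le_refl)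
  then obtain M where M: "\<And>i n. n \<ge> M i \<Longrightarrow> L i (C n) = L i (C (M i))" by metis
  define N where "N = Max (insert N0 (M ` {..<N0}))"
  have N: "N \<ge> N0" "\<And>i. i < N0 \<Longrightarrow> N \<ge> M i" by (auto simp: N_def)
  have "C k \<subseteq> C N" if k: "k \<ge> N" for k
  proof (rule leading_reflect[OF Cid Cid Cmono[OF k]])
    fix i
    show "L i (C k) \<subseteq> L i (C N)"
    proof (cases "i < N0")
      case True
      then show ?thesis using M[of i N] M[of i k] N(2)[OF True] k by simp
    next
      case False
      have "L i (C k) \<subseteq> L (max i k) (C (max i k))" by (rule Lmono) auto
      also have "\<dots> = L N0 (C N0)" using N0[of "max i k"] False by simp
      also have "\<dots> \<subseteq> L i (C N)" using False N by (intro Lmono) auto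
      finally show ?thesis .
    qed
  qed
  then show "\<exists>N. \<forall>n\<ge>N. C n = C N" using Cmono by blast
qed

end

lemma acc_finite_extension:
  assumes "subring A R" "acc A" "finite T" "T \<subseteq> carrier R"
  shows "\<exists>A'. subring A' R \<and> acc A' \<and> A \<union> T \<subseteq> A'"
  using assms(3,4)
proof (induction T rule: finite_induct)
  case empty
  then show ?case using assms by auto
next
  case (insert t T)
  then obtain A' where A': "subring A' R" "acc A'" "A \<union> T \<subseteq> A'" by auto
  have t: "t \<in> carrier R" using insert.prems by simp
  show ?case
    using adjoin_subring[OF A'(1) t] acc_adjoin[OF A'(1) t A'(2)] A_subset_adjoin[OF A'(1) t]
      t_in_adjoin[OF A'(1) t] A'(3) by blast
qed

end

section \<open>Graded domains are noetherian\<close>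

context graded_domain
begin

lemma grade_zero_subring: "subring (G 0) R"
  using grade_mult[of _ 0 _ 0] one_grade by (intro subringI) auto

text \<open>\<open>G 0\<close> is a field: a member of the chain with a nonzero element is all of
  \<open>G 0\<close>.\<close>

lemma grade_zero_acc: "acc (G 0)"
  unfolding acc_def
proof (intro allI impI)
  fix C assume C: "(\<forall>n :: nat. subideal (G 0) (C n)) \<and> (\<forall>n. C n \<subseteq> C (Suc n))"
  then have Cid: "\<And>n. subideal (G 0) (C n)" and Cmono: "\<And>m n. m \<le> n \<Longrightarrow> C m \<subseteq> C n"
    using lift_Suc_mono_le[of C] by auto
  show "\<exists>N. \<forall>n\<ge>N. C n = C N"
  proof (cases "\<forall>n. C n = {\<zero>}")
    case False
    then obtain N c where c: "c \<in> C N" "c \<noteq> \<zero>" using Cid by (auto simp: subideal_def)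
    have "C n = G 0" if n: "n \<ge> N" for n
    proof
      show "C n \<subseteq> G 0" using Cid by (simp add: subideal_def)
      show "G 0 \<subseteq> C n"
      proof
        fix x assume x: "x \<in> G 0"
        have cn: "c \<in> C n" "c \<in> G 0" using c(1) Cmono[OF n] Cid[of n] by (auto simp: subideal_def)
        obtain c' where c': "c' \<in> G 0" "c \<otimes> c' = \<one>" using grade_zero_inverse cn c(2) by blast
        have "(x \<otimes> c') \<otimes> c \<in> C n"
          using cn c' x grade_mult[of x 0 c' 0] Cid[of n] by (auto simp: subideal_def)
        moreover have "(x \<otimes> c') \<otimes> c = x"
          using c' cn x by (metis grade_zero_carrier m_assoc m_comm r_one)
        ultimately show "x \<in> C n" by simp
      qed
    qed
    then show ?thesis by (metis le_refl)
  qed auto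
qed

lemma carrier_acc: "acc (carrier R)"
proof -
  obtain A where A: "subring A R" "acc A" "G 0 \<union> S \<subseteq> A"
    using acc_finite_extension[OF grade_zero_subring grade_zero_acc S_finite] S_carrier by blast
  have "G 0 \<union> S \<subseteq> carrier R" using S_carrier by auto
  then have "carrier R \<subseteq> A"
    using generate_ring_min_subring1[OF _ A(1,3)] generated by simp
  then show ?thesis using A(2) subringE(1)[OF A(1)] by (simp add: subset_antisym)
qed

lemma ideal_chain_stable:
  assumes "\<And>n :: nat. ideal (C n) R" "\<And>n. C n \<subseteq> C (Suc n)"
  shows "\<exists>N. \<forall>n\<ge>N. C n = C N"
proof -
  have "subideal (carrier R) (C n)" for n
  proof -
    interpret ideal "C n" R by (rule assms)
    show ?thesis by (auto simp: subideal_def I_l_closed)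
  qed
  then show ?thesis using carrier_acc assms(2) unfolding acc_def by blast
qed

text \<open>A failure would, by dependent choice, start a strictly increasing sequence of
  ideals.\<close>

lemma noetherian_induct [consumes 1]:
  assumes "ideal J R"
    and step: "\<And>J. ideal J R \<Longrightarrow> (\<And>J'. ideal J' R \<Longrightarrow> J \<subset> J' \<Longrightarrow> P J') \<Longrightarrow> P J"
  shows "P J"
proof (rule ccontr)
  assume nP: "\<not> P J"
  have "\<exists>C. \<forall>n :: nat. (ideal (C n) R \<and> \<not> P (C n)) \<and> C n \<subset> C (Suc n)"
  proof (rule dependent_nat_choice)
    show "\<exists>J. ideal J R \<and> \<not> P J" using assms(1) nP by blast
    show "\<exists>J'. (ideal J' R \<and> \<not> P J') \<and> J \<subset> J'" if "ideal J R \<and> \<not> P J" for J and n :: nat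
      using step[of J] that by blast
  qed
  then obtain C where C: "\<And>n :: nat. ideal (C n) R" "\<And>n. C n \<subset> C (Suc n)" by blast
  then obtain N where "\<And>n. n \<ge> N \<Longrightarrow> C n = C N" using ideal_chain_stable[of C] by blast
  from this[of "Suc N"] C(2)[of N] show False by simp
qed

end

section \<open>Homogeneous ideals\<close>

context graded_domain
begin

definition hideal :: "'a set \<Rightarrow> bool"
  where "hideal J \<longleftrightarrow> ideal J R \<and> (\<forall>x\<in>J. \<forall>d. component x d \<in> J)"

definition hprime :: "'a set \<Rightarrow> bool"
  where "hprime P \<longleftrightarrow> hideal P \<and> primeideal P R"

lemma hideal_ideal: "hideal J \<Longrightarrow> ideal J R"
  by (simp add: hideal_def)

lemma hideal_hc: "hideal J \<Longrightarrow> x \<in> J \<Longrightarrow> component x d \<in> J"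
  by (simp add: hideal_def)

lemma hideal_carrier: "hideal J \<Longrightarrow> x \<in> J \<Longrightarrow> x \<in> carrier R"
  using ideal.Icarr hideal_ideal by metis

lemma hideal_memI:
  assumes "hideal J" "x \<in> carrier R" "\<And>d. component x d \<in> J"
  shows "x \<in> J"
  using component_sum[OF assms(2)] ideal.finsum_in_ideal[OF hideal_ideal[OF assms(1)], of _ "component x"] assms(3)
  by metis

lemma hprime_primeideal: "hprime P \<Longrightarrow> primeideal P R"
  by (simp add: hprime_def)

lemma hprime_hideal: "hprime P \<Longrightarrow> hideal P"
  by (simp add: hprime_def)

definition extend :: "'a set \<Rightarrow> 'a \<Rightarrow> 'a set"
  where "extend J a = set_add R J (PIdl a)"

lemma extend_mem: "x \<in> extend J a \<longleftrightarrow> (\<exists>j\<in>J. \<exists>r\<in>carrier R. x = j \<oplus> r \<otimes> a)"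
  unfolding extend_def set_add_def' cgenideal_def by blast

lemma hideal_sum:
  assumes J: "hideal J" and a: "a \<in> G e"
  shows "hideal (extend J a)"
proof -
  have ac: "a \<in> carrier R" by (rule grade_carrier[OF a])
  interpret J: ideal J R by (rule hideal_ideal[OF J])
  interpret P: ideal "PIdl a" R by (rule cgenideal_ideal[OF ac])
  have "component x d \<in> extend J a" if "x \<in> extend J a" for x d
  proof -
    from that obtain j r where x: "j \<in> J" "r \<in> carrier R" "x = j \<oplus> r \<otimes> a"
      unfolding extend_mem by blast
    have "component x d = component j d \<oplus> component (a \<otimes> r) d"
      using x ac by (simp add: component_add m_comm J.Icarr)
    moreover have "component (a \<otimes> r) d \<in> PIdl a"
    proof (cases "e \<le> d")
      case True
      then have "component (a \<otimes> r) d = component r (d - e) \<otimes> a"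
        using x(2) ac by (simp add: component_mult_grade[OF a] m_comm)
      then show ?thesis using x(2) unfolding cgenideal_def by auto
    qed (use x(2) in \<open>simp add: component_mult_grade[OF a]\<close>)
    ultimately show ?thesis using hideal_hc[OF J x(1)] by (auto simp: extend_def set_add_def')
  qed
  then show ?thesis using add_ideals[OF J.is_ideal P.is_ideal] by (simp add: hideal_def extend_def)
qed

lemma zero_hideal: "hideal {\<zero>}"
  by (auto simp: hideal_def zeroideal)

lemma principal_hideal:
  assumes a: "a \<in> G e"
  shows "hideal (PIdl a)"
proof -
  have ac: "a \<in> carrier R" by (rule grade_carrier[OF a])
  have "extend {\<zero>} a = PIdl a"
    using ideal.Icarr[OF cgenideal_ideal[OF ac]] by (auto simp: extend_def set_add_def')
  then show ?thesis using hideal_sum[OF zero_hideal a] by simp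
qed

text \<open>Modulo \<open>J\<close>, an element outside \<open>J\<close> can be replaced by one
  whose lowest component is outside \<open>J\<close>. If a product of two such elements were in
  \<open>J\<close>, so would be its lowest component, which is the product of the two lowest
  components.\<close>

lemma hprimeI:
  assumes J: "hideal J" and proper: "J \<noteq> carrier R"
    and hom: "\<And>i j a b. a \<in> G i \<Longrightarrow> b \<in> G j \<Longrightarrow> a \<otimes> b \<in> J \<Longrightarrow> a \<in> J \<or> b \<in> J"
  shows "hprime J"
proof -
  interpret J: ideal J R by (rule hideal_ideal[OF J])
  have reduce: "\<exists>i x'. x' \<in> high i \<and> component x' i \<notin> J \<and> x \<ominus> x' \<in> J" if x: "x \<in> carrier R" "x \<notin> J" for x
  proof -
    have "\<exists>i. component x i \<notin> J" using hideal_memI[OF J x(1)] x(2) by blast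
    define i where "i = (LEAST i. component x i \<notin> J)"
    have i: "component x i \<notin> J" "\<And>d. d < i \<Longrightarrow> component x d \<in> J"
      unfolding i_def using LeastI_ex[OF \<open>\<exists>i. component x i \<notin> J\<close>] not_less_Least by auto
    define x0 where "x0 = (\<Oplus>d\<in>{..<i}. component x d)"
    have x0: "x0 \<in> J" unfolding x0_def using i(2) by (intro J.finsum_in_ideal) auto
    have x0c: "x0 \<in> carrier R" using x0 J.Icarr by blast
    have hc0: "component x0 d = (if d < i then component x d else \<zero>)" for d
    proof -
      have "component x0 d = (\<Oplus>e\<in>{..<i}. component (component x e) d)"
        unfolding x0_def using x by (intro component_finsum) auto
      also have "\<dots> = (\<Oplus>e\<in>{..<i}. if d = e then component x e else \<zero>)"
        using x by (intro finsum_cong') (auto simp: component_grade_eq[OF component_grade])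
      also have "\<dots> = (if d < i then component x d else \<zero>)"
        using x by (auto intro!: finsum_singleton add.finprod_one_eqI)
      finally show ?thesis .
    qed
    have hcd: "component (x \<ominus> x0) d = (if d < i then \<zero> else component x d)" for d
      unfolding component_minus[OF x(1) x0c] hc0 using x by (simp add: a_minus_def r_neg)
    have "x \<ominus> x0 \<in> high i"
      using x x0c hcd by (simp add: high_def)
    moreover have "component (x \<ominus> x0) i \<notin> J"
      using hcd[of i] i by simp
    moreover have "x \<ominus> (x \<ominus> x0) = x0"
      using x x0c by (simp add: a_minus_def minus_add r_neg2)
    ultimately show ?thesis using x0 by metis
  qed
  have "primeideal J R"
  proof (rule primeidealI[OF J.is_ideal is_cring proper[symmetric]])
    fix x y assume x: "x \<in> carrier R" and y: "y \<in> carrier R" and xy: "x \<otimes> y \<in> J"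
    show "x \<in> J \<or> y \<in> J"
    proof (rule ccontr)
      assume "\<not> ?thesis"
      then obtain i x' j y' where x': "x' \<in> high i" "component x' i \<notin> J" "x \<ominus> x' \<in> J"
        and y': "y' \<in> high j" "component y' j \<notin> J" "y \<ominus> y' \<in> J"
        using reduce[OF x] reduce[OF y] by metis
      have c: "x' \<in> carrier R" "y' \<in> carrier R" using x' y' high_carrier by auto
      have "x \<otimes> y = (x \<ominus> x') \<otimes> y \<oplus> (x' \<otimes> (y \<ominus> y') \<oplus> x' \<otimes> y')"
      proof -
        have "x' \<otimes> (y \<ominus> y') \<oplus> x' \<otimes> y' = x' \<otimes> y"
          using c y by (simp add: a_minus_def a_assoc l_neg flip: r_distr)
        moreover have "(x \<ominus> x') \<otimes> y \<oplus> x' \<otimes> y = x \<otimes> y"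
          using c x y by (simp add: a_minus_def a_assoc l_neg flip: l_distr)
        ultimately show ?thesis by simp
      qed
      moreover have m: "(x \<ominus> x') \<otimes> y \<in> J" "x' \<otimes> (y \<ominus> y') \<in> J"
        using x' y' c y J.I_r_closed J.I_l_closed by auto
      ultimately have "x \<otimes> y = ((x \<ominus> x') \<otimes> y \<oplus> x' \<otimes> (y \<ominus> y')) \<oplus> x' \<otimes> y'"
        using c x y by (simp only: a_assoc m_closed minus_closed)
      then have "x' \<otimes> y' = \<ominus> ((x \<ominus> x') \<otimes> y \<oplus> x' \<otimes> (y \<ominus> y')) \<oplus> x \<otimes> y"
        using c x y by (simp only: r_neg1 add.m_closed m_closed minus_closed)
      then have "x' \<otimes> y' \<in> J" using xy m by auto
      then have "component x' i \<otimes> component y' j \<in> J"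
        using hideal_hc[OF J, of _ "i + j"] component_mult_high[OF x'(1) y'(1)] by metis
      then show False using hom[OF component_grade component_grade] c x'(2) y'(2) by metis
    qed
  qed
  then show ?thesis using J by (simp add: hprime_def)
qed

section \<open>Homogeneous primes whose product lies in a given ideal\<close>

abbreviation "mprod xs \<equiv> foldr (\<otimes>) xs \<one>"

lemma mprod_append: "set xs \<subseteq> carrier R \<Longrightarrow> set ys \<subseteq> carrier R \<Longrightarrow> mprod (xs @ ys) = mprod xs \<otimes> mprod ys"
  by (induction xs) (auto simp: m_assoc)

text \<open>If homogeneous a and b lie outside \<open>J\<close> and their product inside, then the
  lists for J + (a) and J + (b) together serve for \<open>J\<close>. The list replaces the set of
  minimal primes over \<open>J\<close>: by \<open>prime_contains_factor\<close> every prime over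
  \<open>J\<close> contains a member.\<close>

lemma hprime_product:
  assumes "hideal J"
  shows "\<exists>Ps. (\<forall>P\<in>set Ps. hprime P \<and> J \<subseteq> P) \<and> (\<forall>xs. list_all2 (\<in>) xs Ps \<longrightarrow> mprod xs \<in> J)"
proof -
  let ?Q = "\<lambda>J Ps. (\<forall>P\<in>set Ps. hprime P \<and> J \<subseteq> P) \<and> (\<forall>xs. list_all2 (\<in>) xs Ps \<longrightarrow> mprod xs \<in> J)"
  have "hideal J \<longrightarrow> (\<exists>Ps. ?Q J Ps)" using hideal_ideal[OF assms]
  proof (induction rule: noetherian_induct)
    case (1 J)
    show ?case
    proof
      assume J: "hideal J"
      interpret J: ideal J R by (rule hideal_ideal[OF J])
      consider "J = carrier R" | "hprime J" | "J \<noteq> carrier R" "\<not> hprime J" by blast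
      then show "\<exists>Ps. ?Q J Ps"
      proof cases
        case 1
        \<comment> \<open>The empty product is 1, which lies in the unit ideal.\<close>
        then show ?thesis by (intro exI[of _ "[]"]) auto
      next
        case 2
        then show ?thesis
          by (intro exI[of _ "[J]"]) (auto simp: list_all2_Cons2 J.Icarr)
      next
        case 3
        then obtain i j a b where ab: "a \<in> G i" "b \<in> G j" "a \<otimes> b \<in> J" "a \<notin> J" "b \<notin> J"
          using hprimeI[OF J] by blast
        have c: "a \<in> carrier R" "b \<in> carrier R" using ab grade_carrier by blast+
        have bigger: "J \<subset> extend J p" if "p \<in> carrier R" "p \<notin> J" for p
        proof -
          interpret P: ideal "PIdl p" R by (rule cgenideal_ideal[OF that(1)])
          have "J \<subseteq> extend J p"
          proof
            fix x assume "x \<in> J"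
            then have "x = x \<oplus> \<zero>" by (simp add: J.Icarr)
            then show "x \<in> extend J p" using \<open>x \<in> J\<close> P.zero_closed unfolding extend_def set_add_def' by blast
          qed
          moreover have "p = \<zero> \<oplus> p" using that by simp
          then have "p \<in> extend J p"
            using J.zero_closed cgenideal_self[OF that(1)] unfolding extend_def set_add_def' by blast
          ultimately show ?thesis using that by blast
        qed
        have ex: "\<exists>Ps. ?Q (extend J p) Ps" if "p \<in> G e" "p \<notin> J" for p e
          using 1(2)[OF hideal_ideal[OF hideal_sum[OF J that(1)]] bigger] hideal_sum[OF J that(1)] that
            grade_carrier by blast
        obtain Ps where Ps: "?Q (extend J a) Ps" using ex[OF ab(1,4)] by (elim exE)
        obtain Qs where Qs: "?Q (extend J b) Qs" using ex[OF ab(2,5)] by (elim exE)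
        have "?Q J (Ps @ Qs)"
        proof (intro conjI ballI allI impI)
          have "J \<subseteq> extend J a" "J \<subseteq> extend J b"
            using bigger[OF c(1) ab(4)] bigger[OF c(2) ab(5)] by (simp_all add: psubset_imp_subset)
          moreover fix P assume "P \<in> set (Ps @ Qs)"
          then have "hprime P \<and> (extend J a \<subseteq> P \<or> extend J b \<subseteq> P)"
            using conjunct1[OF Ps] conjunct1[OF Qs] by auto
          ultimately show "hprime P" "J \<subseteq> P" by auto
        next
          fix zs assume "list_all2 (\<in>) zs (Ps @ Qs)"
          then obtain xs ys where z: "zs = xs @ ys" "list_all2 (\<in>) xs Ps" "list_all2 (\<in>) ys Qs"
            by (auto simp: list_all2_append2)
          have sub: "set xs \<subseteq> carrier R" if "list_all2 (\<in>) xs Ps" "\<forall>P\<in>set Ps. hprime P" for xs Ps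
            using that by (induction rule: list_all2_induct) (auto intro: hideal_carrier hprime_hideal)
          have cs: "set xs \<subseteq> carrier R" "set ys \<subseteq> carrier R" using sub[OF z(2)] sub[OF z(3)] conjunct1[OF Ps] conjunct1[OF Qs] by auto
          have "mprod xs \<in> extend J a" "mprod ys \<in> extend J b"
            using conjunct2[OF Ps] conjunct2[OF Qs] z(2,3) by auto
          then obtain p r q s where e: "p \<in> J" "r \<in> carrier R" "mprod xs = p \<oplus> r \<otimes> a"
            "q \<in> J" "s \<in> carrier R" "mprod ys = q \<oplus> s \<otimes> b"
            unfolding extend_mem by blast
          have "mprod zs = p \<otimes> (q \<oplus> s \<otimes> b) \<oplus> ((r \<otimes> a) \<otimes> q \<oplus> (r \<otimes> s) \<otimes> (a \<otimes> b))"
            unfolding z(1) mprod_append[OF cs] e(3,6)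
            using e(1,2,4,5) c J.Icarr by (simp add: l_distr r_distr m_ac a_ac)
          also have "\<dots> \<in> J"
          proof (intro J.a_closed)
            show "p \<otimes> (q \<oplus> s \<otimes> b) \<in> J" using e(5) c J.Icarr[OF e(4)] by (intro J.I_r_closed e(1)) auto
            show "(r \<otimes> a) \<otimes> q \<in> J" using e c by (intro J.I_l_closed) auto
            show "(r \<otimes> s) \<otimes> (a \<otimes> b) \<in> J" using e by (intro J.I_l_closed[OF ab(3)]) auto
          qed
          finally show "mprod zs \<in> J" .
        qed
        then show ?thesis by blast
      qed
    qed
  qed
  then show ?thesis using assms by blast
qed

text \<open>Otherwise each member has an element outside \<open>Q\<close>, and the product of these
  elements would lie in \<open>J\<close> but not in the prime \<open>Q\<close>.\<close>

lemma prime_contains_factor: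
  assumes Q: "primeideal Q R" and JQ: "J \<subseteq> Q" and Ps: "\<forall>P\<in>set Ps. P \<subseteq> carrier R"
    and prod: "\<forall>xs. list_all2 (\<in>) xs Ps \<longrightarrow> mprod xs \<in> J"
  shows "\<exists>P\<in>set Ps. P \<subseteq> Q"
proof (rule ccontr)
  assume "\<not> ?thesis"
  then have "\<forall>P\<in>set Ps. \<exists>p. p \<in> P \<and> p \<notin> Q" by blast
  then obtain f where f: "\<And>P. P \<in> set Ps \<Longrightarrow> f P \<in> P \<and> f P \<notin> Q" by (auto dest!: bchoice)
  interpret Q: primeideal Q R by (rule Q)
  have "mprod (map f Ps) \<notin> Q \<and> mprod (map f Ps) \<in> carrier R"
    using f Ps
  proof (induction Ps)
    case Nil
    then show ?case using Q.one_imp_carrier Q.I_notcarr by auto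
  next
    case (Cons P Ps)
    then have "f P \<in> carrier R" "f P \<notin> Q" by auto
    then show ?case using Cons Q.I_prime by auto
  qed
  moreover have "list_all2 (\<in>) (map f Ps) Ps" using f by (simp add: list_all2_conv_all_nth)
  ultimately show False using prod JQ by blast
qed

section \<open>The irrelevant ideal\<close>

lemma high_hideal: "hideal (high n)"
proof -
  have "subgroup (high n) (add_monoid R)"
    using high_add high_neg high_zero[of n] high_carrier by (intro add.subgroupI) auto
  then have "ideal (high n) R"
    using high_mult[of _ n _ 0] high_mult[of _ 0 _ n]
    by (intro idealI ring_axioms) (auto simp: high_0)
  moreover have "component x d \<in> high n" if "x \<in> high n" for x d
  proof -
    have "x \<in> carrier R" using that high_carrier by blast
    from component_grade_eq[OF component_grade[OF this], of d] show ?thesis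
      using that \<open>x \<in> carrier R\<close> by (auto simp: high_def)
  qed
  ultimately show ?thesis by (simp add: hideal_def)
qed

lemma high_1_hprime: "hprime (high 1)"
proof (rule hprimeI[OF high_hideal])
  have "\<one> \<notin> high 1" by (simp add: high_def component_grade_eq[OF one_grade])
  then show "high 1 \<noteq> carrier R" by auto
  fix i j a b assume ab: "a \<in> G i" "b \<in> G j" "a \<otimes> b \<in> high 1"
  then show "a \<in> high 1 \<or> b \<in> high 1"
  proof (cases "i = 0 \<and> j = 0")
    case True
    then have "a \<otimes> b \<in> G 0" using ab grade_mult[of a 0 b 0] by simp
    then have "a \<otimes> b = \<zero>" using ab(3) by (simp add: high_def component_grade_eq)
    then have "a = \<zero> \<or> b = \<zero>" using ab grade_carrier integral by blast
    then show ?thesis using high_zero by auto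
  next
    case False
    then show ?thesis using ab grade_high[of _ _ 1] by auto
  qed
qed

text \<open>A nonzero component of degree zero would be a unit in \<open>P\<close>.\<close>

lemma hprime_subset_high_1: assumes "hprime P" shows "P \<subseteq> high 1"
proof
  fix x assume x: "x \<in> P"
  interpret P: primeideal P R by (rule hprime_primeideal[OF assms])
  have xc: "x \<in> carrier R" using x P.Icarr by blast
  have "component x 0 = \<zero>"
  proof (rule ccontr)
    assume "component x 0 \<noteq> \<zero>"
    then obtain c where "c \<in> G 0" "component x 0 \<otimes> c = \<one>" using grade_zero_inverse component_grade[OF xc] by blast
    then have "\<one> \<in> P"
      using hideal_hc[OF hprime_hideal[OF assms] x, of 0] P.I_r_closed[of "component x 0" c] by simp
    then show False using P.one_imp_carrier P.I_notcarr by simp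
  qed
  then show "x \<in> high 1" using xc by (simp add: high_def)
qed

lemma high_1_subset:
  assumes "ideal J R" "S \<subseteq> J"
  shows "high 1 \<subseteq> J"
proof
  fix x assume "x \<in> high 1"
  then obtain c where c: "\<And>s. c s \<in> carrier R" "x = (\<Oplus>s\<in>S. s \<otimes> c s)" by (rule high_1_combination) blast
  interpret J: ideal J R by (rule assms)
  show "x \<in> J" unfolding c(2) using assms(2) c(1) by (intro J.finsum_in_ideal J.I_r_closed) auto
qed

text \<open>An element outside has a nonzero constant term. An ideal above \<open>high 1\<close>
  that contains the element also contains this term, which is a unit.\<close>

lemma high_1_maximal: "maximalideal (high 1) R"
proof (rule maximalidealI)
  show "ideal (high 1) R" by (rule hideal_ideal[OF high_hideal])
  show "carrier R \<noteq> high 1"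
    using primeideal.I_notcarr[OF hprime_primeideal[OF high_1_hprime]] .
  fix J assume J: "ideal J R" "high 1 \<subseteq> J" "J \<subseteq> carrier R"
  show "J = high 1 \<or> J = carrier R"
  proof (rule disjCI)
    assume "J \<noteq> carrier R"
    interpret J: ideal J R by (rule J)
    have "x \<in> high 1" if x: "x \<in> J" for x
    proof -
      have xc: "x \<in> carrier R" using x J.Icarr by blast
      have "component x 0 = \<zero>"
      proof (rule ccontr)
        assume "component x 0 \<noteq> \<zero>"
        then obtain c where c: "c \<in> G 0" "component x 0 \<otimes> c = \<one>" using grade_zero_inverse component_grade[OF xc] by blast
        have "x \<ominus> component x 0 \<in> J" using high_Suc_decomp[of x 0] J(2) xc by (auto simp: high_0)
        then have "x \<oplus> \<ominus> (x \<ominus> component x 0) \<in> J" using x by auto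
        moreover have "x \<oplus> \<ominus> (x \<ominus> component x 0) = component x 0"
          using xc by (simp add: a_minus_def minus_add r_neg2)
        ultimately have "\<one> \<in> J" using c J.I_r_closed[of "component x 0" c] by simp
        then show False using J.one_imp_carrier \<open>J \<noteq> carrier R\<close> by simp
      qed
      then show ?thesis using xc by (simp add: high_def)
    qed
    then show "J = high 1" using J(2) by blast
  qed
qed

lemma colon_ideal:
  assumes "ideal J R" "s \<in> carrier R"
  shows "ideal {r \<in> carrier R. s \<otimes> r \<in> J} R"
proof -
  interpret J: ideal J R by fact
  show ?thesis
  proof (intro idealI ring_axioms add.subgroupI)
    show "{r \<in> carrier R. s \<otimes> r \<in> J} \<noteq> {}" using assms(2) J.zero_closed by (auto intro!: exI[of _ \<zero>])
    fix x assume x: "x \<in> {r \<in> carrier R. s \<otimes> r \<in> J}"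
    show "\<ominus> x \<in> {r \<in> carrier R. s \<otimes> r \<in> J}" using x assms(2) J.a_inv_closed by (simp add: r_minus)
    fix y
    show "x \<oplus> y \<in> {r \<in> carrier R. s \<otimes> r \<in> J}" if "y \<in> {r \<in> carrier R. s \<otimes> r \<in> J}"
      using x that assms(2) by (simp add: r_distr)
    assume y: "y \<in> carrier R"
    have "s \<otimes> (y \<otimes> x) = y \<otimes> (s \<otimes> x)" "s \<otimes> (x \<otimes> y) = (s \<otimes> x) \<otimes> y"
      using x y assms(2) by (simp_all add: m_ac)
    then show "y \<otimes> x \<in> {r \<in> carrier R. s \<otimes> r \<in> J}" "x \<otimes> y \<in> {r \<in> carrier R. s \<otimes> r \<in> J}"
      using x y J.I_l_closed J.I_r_closed by auto
  qed auto
qed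

text \<open>An element of degree \<open>Suc k + e\<close> is a combination of generators s with
  coefficients of degree \<open>k + e\<close>. These coefficients lie in the colon ideal of
  \<open>J\<close> by s, which contains all products of \<open>k\<close> generators.\<close>

lemma grade_subset_of_products:
  assumes "ideal J R" "\<And>xs. length xs = k \<Longrightarrow> set xs \<subseteq> S \<Longrightarrow> mprod xs \<in> J"
  shows "G (k + e) \<subseteq> J"
  using assms
proof (induction k arbitrary: J)
  case 0
  interpret ideal J R by (rule 0)
  have "\<one> \<in> J" using 0(2)[of "[]"] by simp
  then have "J = carrier R" by (rule one_imp_carrier)
  then show ?case using grade_carrier by blast
next
  case (Suc k)
  interpret ideal J R by (rule Suc)
  show ?case
  proof
    fix x assume "x \<in> G (Suc k + e)"
    then obtain c where c: "\<And>s. s \<in> S \<Longrightarrow> c s \<in> G (k + e)" "x = (\<Oplus>s\<in>S. s \<otimes> c s)"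
      using grade_Suc_combination[of x "k + e"] by auto
    have "s \<otimes> c s \<in> J" if s: "s \<in> S" for s
    proof -
      have "G (k + e) \<subseteq> {r \<in> carrier R. s \<otimes> r \<in> J}"
      proof (rule Suc.IH[OF colon_ideal[OF Suc.prems(1) S_carrier[OF s]]])
        fix xs assume xs: "length xs = k" "set xs \<subseteq> S"
        then show "mprod xs \<in> {r \<in> carrier R. s \<otimes> r \<in> J}"
          using Suc.prems(2)[of "s # xs"] s S_carrier by auto
      qed
      then show ?thesis using c(1)[OF s] by blast
    qed
    then show "x \<in> J" unfolding c(2) by (intro finsum_in_ideal) auto
  qed
qed

text \<open>Every prime in the list of \<open>hprime_product\<close> is the irrelevant ideal, so the
  product of as many generators as the list has entries lies in \<open>J\<close>. The length of the
  list is the bound.\<close>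

lemma primary_contains_high_degrees:
  assumes J: "hideal J" and irr: "\<And>P. hprime P \<Longrightarrow> J \<subseteq> P \<Longrightarrow> P = high 1"
  obtains k where "\<And>d. d \<ge> k \<Longrightarrow> G d \<subseteq> J"
proof -
  obtain Ps where Ps: "\<forall>P\<in>set Ps. hprime P \<and> J \<subseteq> P" "\<forall>xs. list_all2 (\<in>) xs Ps \<longrightarrow> mprod xs \<in> J"
    using hprime_product[OF J] by blast
  have "mprod xs \<in> J" if "length xs = length Ps" "set xs \<subseteq> S" for xs
  proof -
    have "xs ! i \<in> Ps ! i" if "i < length Ps" for i
    proof -
      have "Ps ! i = high 1" using Ps(1) irr that by simp
      moreover have "xs ! i \<in> G 1" using \<open>set xs \<subseteq> S\<close> \<open>length xs = length Ps\<close> that S_grade nth_mem by fastforce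
      ultimately show ?thesis using grade_high[of _ 1 1] by simp
    qed
    then show ?thesis using Ps(2) that by (simp add: list_all2_conv_all_nth)
  qed
  then have "G (length Ps + e) \<subseteq> J" for e
    using grade_subset_of_products[OF hideal_ideal[OF J]] by blast
  then show ?thesis using that[of "length Ps"] by (metis le_add_diff_inverse)
qed

end

section \<open>Homogeneous parameters\<close>

context graded_domain
begin

lemma prime_pow:
  assumes "primeideal P R" "y \<in> carrier R" "y \<notin> P"
  shows "y [^] (n :: nat) \<notin> P"
proof (induction n)
  case 0
  then show ?case
    using ideal.one_imp_carrier[OF primeideal.axioms(1)[OF assms(1)]] primeideal.I_notcarr[OF assms(1)] by auto
next
  case (Suc n)
  then show ?case using primeideal.I_prime[OF assms(1), of "y [^] n" y] assms by auto
qed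

text \<open>A product of elements outside the prime \<open>P\<close> stays outside, so one
  homogeneous factor from \<open>I\<close> and one from each member of \<open>Qs\<close> are
  multiplied together. A further factor from \<open>S\<close> makes the degree positive, which prime
  avoidance needs for its exponents.\<close>

lemma homogeneous_separation:
  assumes I: "hideal I" "\<not> I \<subseteq> P" and P: "hprime P" "\<not> S \<subseteq> P"
    and Q: "finite Qs" "\<And>Q. Q \<in> Qs \<Longrightarrow> hideal Q \<and> \<not> Q \<subseteq> P"
  shows "\<exists>e\<ge>1. \<exists>b\<in>G e. b \<in> I \<and> b \<notin> P \<and> (\<forall>Q\<in>Qs. b \<in> Q)"
proof -
  interpret P: primeideal P R by (rule hprime_primeideal[OF P(1)])
  have hom: "\<exists>d. component x d \<in> J \<and> component x d \<notin> P" if "hideal J" "x \<in> J" "x \<notin> P" for J x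
    using hideal_memI[OF hprime_hideal[OF P(1)] hideal_carrier[OF that(1,2)]] that(3)
      hideal_hc[OF that(1,2)] by blast
  show ?thesis using Q
  proof (induction Qs rule: finite_induct)
    case empty
    obtain x where x: "x \<in> I" "x \<notin> P" using I(2) by blast
    then obtain d where d: "component x d \<in> I" "component x d \<notin> P" using hom[OF I(1)] by blast
    obtain s where s: "s \<in> S" "s \<notin> P" using P(2) by blast
    have xc: "x \<in> carrier R" using hideal_carrier[OF I(1) x(1)] .
    have "s \<otimes> component x d \<in> G (1 + d)" using s S_grade component_grade[OF xc] by (intro grade_mult) auto
    moreover have "s \<otimes> component x d \<in> I"
      using ideal.I_l_closed[OF hideal_ideal[OF I(1)] d(1) S_carrier[OF s(1)]] .
    moreover have "s \<otimes> component x d \<notin> P" using P.I_prime S_carrier[OF s(1)] s(2) d(2) xc component_closed by blast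
    ultimately show ?case by (intro exI[of _ "1 + d"]) auto
  next
    case (insert Q Qs)
    then obtain e b where b: "e \<ge> 1" "b \<in> G e" "b \<in> I" "b \<notin> P" "\<forall>Q\<in>Qs. b \<in> Q" by auto
    have Q: "hideal Q" "\<not> Q \<subseteq> P" using insert.prems by auto
    then obtain x where x: "x \<in> Q" "x \<notin> P" by blast
    then obtain d where d: "component x d \<in> Q" "component x d \<notin> P" using hom[OF Q(1)] by blast
    have xc: "x \<in> carrier R" using hideal_carrier[OF Q(1) x(1)] .
    have bc: "b \<in> carrier R" by (rule grade_carrier[OF b(2)])
    have "component x d \<otimes> b \<in> G (d + e)" using b component_grade[OF xc] by (intro grade_mult) auto
    moreover have "component x d \<otimes> b \<in> J" if "hideal J" "b \<in> J" for J
      using ideal.I_l_closed[OF hideal_ideal[OF that(1)] that(2)] xc by simp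
    moreover have "component x d \<otimes> b \<in> Q"
      using ideal.I_r_closed[OF hideal_ideal[OF Q(1)] d(1) bc] .
    moreover have "component x d \<otimes> b \<notin> P" using P.I_prime bc b(4) d(2) xc component_closed by blast
    ultimately show ?case using b I(1) insert.prems by (intro exI[of _ "d + e"]) auto
  qed
qed

text \<open>Prime avoidance adds an element that vanishes at all primes but one. To stay
  homogeneous, the two summands are first raised to powers of equal degree.\<close>

lemma homogeneous_prime_avoidance:
  assumes I: "hideal I" and fin: "finite Ps"
    and Ps: "\<And>P. P \<in> Ps \<Longrightarrow> hprime P \<and> \<not> S \<subseteq> P \<and> \<not> I \<subseteq> P"
  shows "\<exists>e\<ge>1. \<exists>y\<in>G e. y \<in> I \<and> (\<forall>P\<in>Ps. y \<notin> P)"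
  using fin Ps
proof (induction Ps rule: finite_psubset_induct)
  case (psubset Ps)
  have zero: "\<zero> \<in> I" using additive_subgroup.zero_closed[OF ideal.axioms(1)[OF hideal_ideal[OF I]]] .
  consider "Ps = {}" | P Q where "P \<in> Ps" "Q \<in> Ps" "P \<noteq> Q" "Q \<subseteq> P"
    | P where "P \<in> Ps" "\<And>Q. Q \<in> Ps \<Longrightarrow> Q \<noteq> P \<Longrightarrow> \<not> Q \<subseteq> P" by blast
  then show ?case
  proof cases
    case 1
    then show ?thesis using zero by (intro exI[of _ 1]) auto
  next
    case 2
    then obtain e y where "e \<ge> 1" "y \<in> G e" "y \<in> I" "\<forall>P\<in>Ps - {Q}. y \<notin> P"
      using psubset.IH[of "Ps - {Q}"] psubset.prems by blast
    then show ?thesis using 2 by (intro exI[of _ e]) auto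
  next
    case 3
    then obtain e y where y: "e \<ge> 1" "y \<in> G e" "y \<in> I" "\<forall>Q\<in>Ps - {P}. y \<notin> Q"
      using psubset.IH[of "Ps - {P}"] psubset.prems by blast
    show ?thesis
    proof (cases "y \<in> P")
      case False
      then show ?thesis using y by (intro exI[of _ e]) auto
    next
      case True
      have P: "hprime P" "\<not> S \<subseteq> P" "\<not> I \<subseteq> P" using psubset.prems 3(1) by auto
      have "finite (Ps - {P})" using psubset.hyps by simp
      moreover have "hideal Q \<and> \<not> Q \<subseteq> P" if "Q \<in> Ps - {P}" for Q
        using that 3(2) psubset.prems hprime_hideal by blast
      ultimately obtain e' b where b: "e' \<ge> 1" "b \<in> G e'" "b \<in> I" "b \<notin> P" "\<forall>Q\<in>Ps - {P}. b \<in> Q"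
        using homogeneous_separation[OF I P(3) P(1,2), of "Ps - {P}"] by blast
      have c: "y \<in> carrier R" "b \<in> carrier R" using y(2) b(2) grade_carrier by auto
      \<comment> \<open>Both powers have degree \<open>e * e'\<close>. The exponents are positive,
        so \<open>y [^] e'\<close> lies in \<open>P\<close> along with \<open>y\<close>, and
        \<open>b [^] e\<close> in the other primes along with \<open>b\<close>.\<close>
      define z where "z = y [^] e' \<oplus> b [^] e"
      have powI: "u [^] n \<in> J" if h: "ideal J R" "u \<in> J" "n \<ge> 1" for u J and n :: nat
      proof -
        have u: "u \<in> carrier R" using ideal.Icarr[OF h(1,2)] .
        obtain m where "n = Suc m" using h(3) by (cases n) auto
        then show ?thesis using ideal.I_l_closed[OF h(1,2), of "u [^] m"] u by simp
      qed
      have "z \<in> G (e * e')"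
        unfolding z_def using grade_pow[OF y(2), of e'] grade_pow[OF b(2), of e]
        by (simp add: mult.commute[of e' e])
      moreover have "z \<in> I"
        unfolding z_def using powI[OF hideal_ideal[OF I]] y(1,3) b(1,3)
        by (intro additive_subgroup.a_closed[OF ideal.axioms(1)[OF hideal_ideal[OF I]]]) auto
      moreover have "z \<notin> Q" if Q: "Q \<in> Ps" for Q
      proof
        assume z: "z \<in> Q"
        have "primeideal Q R" using psubset.prems[OF Q] hprime_primeideal by blast
        then interpret Q: primeideal Q R .
        note nn = prime_pow[OF \<open>primeideal Q R\<close>]
        show False
        proof (cases "Q = P")
          case True
          have "y [^] e' \<in> Q" using powI[OF Q.is_ideal] \<open>y \<in> P\<close> True b(1) by simp
          then have "\<ominus> (y [^] e') \<oplus> z \<in> Q" using z by simp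
          then have "b [^] e \<in> Q" using c by (simp add: z_def r_neg1)
          then show False using nn[OF c(2)] b(4) True by blast
        next
          case False
          have "b [^] e \<in> Q" using powI[OF Q.is_ideal] b(5) False Q y(1) by simp
          then have "z \<oplus> \<ominus> (b [^] e) \<in> Q" using z by simp
          then have "y [^] e' \<in> Q" using c by (simp add: z_def a_assoc r_neg)
          then show False using nn[OF c(1)] y(4) False Q by blast
        qed
      qed
      moreover have "e * e' \<ge> 1" using y(1) b(1) by simp
      ultimately show ?thesis by blast
    qed
  qed
qed

text \<open>The element \<open>y\<close> avoids every prime other than the irrelevant ideal in the
  list for (x). A homogeneous prime \<open>Q\<close> over (x, y) contains a member \<open>P\<close>
  of the list. If \<open>Q\<close> were not the irrelevant ideal, then \<open>y\<close> would
  separate \<open>P\<close> from \<open>Q\<close>, and \<open>dim\<close> would exclude the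
  resulting chain.\<close>

lemma exists_parameter:
  assumes x: "x \<in> G a" "x \<noteq> \<zero>" and I: "hideal I"
    and primary: "\<And>P. primeideal P R \<Longrightarrow> I \<subseteq> P \<Longrightarrow> high 1 \<subseteq> P"
    and dim: "\<And>P Q. primeideal P R \<Longrightarrow> primeideal Q R \<Longrightarrow> {\<zero>} \<subset> P \<Longrightarrow> P \<subset> Q \<Longrightarrow> Q \<subset> high 1 \<Longrightarrow> False"
  obtains b y k where "b \<ge> 1" "y \<in> G b" "y \<in> I" "\<And>d. d \<ge> k \<Longrightarrow> G d \<subseteq> extend (PIdl x) y"
proof -
  have xc: "x \<in> carrier R" by (rule grade_carrier[OF x(1)])
  have S1: "S \<subseteq> high 1" using S_grade grade_high[of _ 1 1] by auto
  have xh: "hideal (PIdl x)" by (rule principal_hideal[OF x(1)])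
  obtain Ps where Ps: "\<And>P. P \<in> set Ps \<Longrightarrow> hprime P \<and> PIdl x \<subseteq> P"
    and prod: "\<forall>xs. list_all2 (\<in>) xs Ps \<longrightarrow> mprod xs \<in> PIdl x"
    using hprime_product[OF xh] by blast
  have eq1: "P = high 1" if "hprime P" "high 1 \<subseteq> P" for P
    using that hprime_subset_high_1 by blast
  let ?Qs = "set Ps - {high 1}"
  have "hprime P \<and> \<not> S \<subseteq> P \<and> \<not> I \<subseteq> P" if "P \<in> ?Qs" for P
    using that Ps eq1 primary hprime_primeideal high_1_subset[OF hideal_ideal[OF hprime_hideal]] by blast
  then obtain b y where y: "b \<ge> 1" "y \<in> G b" "y \<in> I" "\<forall>P\<in>?Qs. y \<notin> P"
    using homogeneous_prime_avoidance[OF I, of ?Qs] by auto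
  have yc: "y \<in> carrier R" by (rule grade_carrier[OF y(2)])
  have ext: "hideal (extend (PIdl x) y)" by (rule hideal_sum[OF xh y(2)])
  have zP: "\<zero> \<in> PIdl x" using additive_subgroup.zero_closed[OF ideal.axioms(1)[OF hideal_ideal[OF xh]]] .
  have yext: "y \<in> extend (PIdl x) y"
    unfolding extend_mem using zP yc by (intro bexI[of _ \<zero>] bexI[of _ \<one>]) auto
  have xsub: "PIdl x \<subseteq> extend (PIdl x) y"
  proof
    fix j assume j: "j \<in> PIdl x"
    then have "j \<in> carrier R" using hideal_carrier[OF xh] by blast
    then show "j \<in> extend (PIdl x) y"
      unfolding extend_mem using j yc by (intro bexI[of _ j] bexI[of _ \<zero>]) auto
  qed
  have "Q = high 1" if Q: "hprime Q" "extend (PIdl x) y \<subseteq> Q" for Q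
  proof (rule ccontr)
    assume ne: "Q \<noteq> high 1"
    have "\<forall>P\<in>set Ps. P \<subseteq> carrier R" using Ps hideal_carrier[OF hprime_hideal] by blast
    then obtain P where P: "P \<in> set Ps" "P \<subseteq> Q"
      using prime_contains_factor[OF hprime_primeideal[OF Q(1)] subset_trans[OF xsub Q(2)] _ prod] by blast
    have "P \<noteq> high 1" using P Q ne eq1 by blast
    then have "y \<notin> P" using y(4) P by blast
    then have "P \<subset> Q" using P yext Q by blast
    moreover have "Q \<subset> high 1" using hprime_subset_high_1[OF Q(1)] ne by blast
    moreover have "{\<zero>} \<subset> P"
      using Ps[OF P(1)] cgenideal_self[OF xc] zP x(2) by blast
    ultimately show False
      using dim hprime_primeideal Ps[OF P(1)] Q(1) by blast
  qed
  then obtain k where "\<And>d. d \<ge> k \<Longrightarrow> G d \<subseteq> extend (PIdl x) y"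
    using primary_contains_high_degrees[OF ext] by blast
  then show ?thesis using that y by blast
qed

lemma grade_in_extend:
  assumes x: "x \<in> G a" and y: "y \<in> G b" and z: "z \<in> G d" "z \<in> extend (PIdl x) y" and ab: "a \<le> d" "b \<le> d"
  obtains u v where "u \<in> G (d - a)" "v \<in> G (d - b)" "z = x \<otimes> u \<oplus> y \<otimes> v"
proof -
  have c: "x \<in> carrier R" "y \<in> carrier R" using x y grade_carrier by auto
  obtain r s where rs: "r \<in> carrier R" "s \<in> carrier R" "z = r \<otimes> x \<oplus> s \<otimes> y"
    using z(2) unfolding extend_mem cgenideal_def by blast
  have "z = component z d" using z(1) by (simp add: component_grade_eq)
  also have "\<dots> = component (x \<otimes> r) d \<oplus> component (y \<otimes> s) d" using rs c by (simp add: component_add m_comm)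
  also have "\<dots> = x \<otimes> component r (d - a) \<oplus> y \<otimes> component s (d - b)"
    using ab rs by (simp add: component_mult_grade[OF x] component_mult_grade[OF y])
  finally show ?thesis using that component_grade rs by blast
qed

text \<open>Write z = x u + y v. The degrees of u and v suffice for splitting them with exponents (p
  - 1, q) and (p, q - 1), and the four pieces regroup. In terms of fractions this is the vanishing
  of the second local cohomology in large degrees.\<close>

lemma grade_split:
  assumes x: "x \<in> G a" and y: "y \<in> G b" and k: "\<And>d. d \<ge> k \<Longrightarrow> G d \<subseteq> extend (PIdl x) y"
    and d: "d \<ge> p * a + q * b + k" and z: "z \<in> G d"
  shows "\<exists>u\<in>G (d - p * a). \<exists>v\<in>G (d - q * b). z = x [^] p \<otimes> u \<oplus> y [^] q \<otimes> v"
  using d z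
proof (induction "p + q" arbitrary: p q d z rule: less_induct)
  case less
  have c: "x \<in> carrier R" "y \<in> carrier R" "z \<in> carrier R" using x y less.prems grade_carrier by auto
  consider "p = 0" | "q = 0" | p' q' where "p = Suc p'" "q = Suc q'" by (metis not0_implies_Suc)
  then show ?case
  proof cases
    case 1
    then show ?thesis using c less.prems by (intro bexI[of _ z] bexI[of _ \<zero>]) auto
  next
    case 2
    then show ?thesis using c less.prems by (intro bexI[of _ \<zero>] bexI[of _ z]) auto
  next
    case 3
    have "z \<in> extend (PIdl x) y" using k[of d] less.prems by auto
    then obtain u v where uv: "u \<in> G (d - a)" "v \<in> G (d - b)" "z = x \<otimes> u \<oplus> y \<otimes> v"
      using grade_in_extend[OF x y less.prems(2)] less.prems(1) 3 by auto
    have lt: "p' + q < p + q" "p + q' < p + q"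
      and ge: "d - a \<ge> p' * a + q * b + k" "d - b \<ge> p * a + q' * b + k"
      using 3 less.prems(1) by auto
    from less.hyps[OF lt(1) ge(1) uv(1)] obtain u1 u2 where
      u: "u1 \<in> G (d - a - p' * a)" "u2 \<in> G (d - a - q * b)" "u = x [^] p' \<otimes> u1 \<oplus> y [^] q \<otimes> u2"
      by blast
    from less.hyps[OF lt(2) ge(2) uv(2)] obtain v1 v2 where
      v: "v1 \<in> G (d - b - p * a)" "v2 \<in> G (d - b - q' * b)" "v = x [^] p \<otimes> v1 \<oplus> y [^] q' \<otimes> v2"
      by blast
    have cc: "u1 \<in> carrier R" "u2 \<in> carrier R" "v1 \<in> carrier R" "v2 \<in> carrier R"
      using u v grade_carrier by blast+
    have d1: "b + (d - b - p * a) = d - p * a" "a + (d - a - q * b) = d - q * b"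
      "d - a - p' * a = d - p * a" "d - b - q' * b = d - q * b"
      using less.prems(1) 3 by auto
    have "u1 \<oplus> y \<otimes> v1 \<in> G (d - p * a)"
      using u(1) grade_mult[OF y v(1)] d1 by simp
    moreover have "x \<otimes> u2 \<oplus> v2 \<in> G (d - q * b)"
      using v(2) grade_mult[OF x u(2)] d1 by simp
    moreover have "z = x [^] p \<otimes> (u1 \<oplus> y \<otimes> v1) \<oplus> y [^] q \<otimes> (x \<otimes> u2 \<oplus> v2)"
      unfolding uv(3) u(3) v(3) using c(1,2) cc by (simp add: 3 r_distr m_ac a_ac)
    ultimately show ?thesis by blast
  qed
qed

text \<open>The elements of R/(x) killed by \<open>S\<close> form a finitely generated module on
  which only the constants act, so they live in finitely many degrees. In terms of ideals, the chain
  \<open>C\<close> stabilizes.\<close>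

lemma socle_bound:
  assumes x: "x \<in> G a"
  obtains N where "\<And>d r. N \<le> d \<Longrightarrow> r \<in> G d \<Longrightarrow> (\<And>s. s \<in> S \<Longrightarrow> s \<otimes> r \<in> PIdl x) \<Longrightarrow> r \<in> PIdl x"
proof -
  have xh: "hideal (PIdl x)" by (rule principal_hideal[OF x])
  interpret X: ideal "PIdl x" R by (rule hideal_ideal[OF xh])
  \<comment> \<open>Elements killed by \<open>S\<close> modulo (x) whose components above
    \<open>n\<close> vanish modulo (x).\<close>
  define C where "C n = {r \<in> carrier R. (\<forall>s\<in>S. s \<otimes> r \<in> PIdl x) \<and> (\<forall>d>n. component r d \<in> PIdl x)}" for n :: nat
  have Cl: "y \<otimes> r \<in> C n" if r: "r \<in> C n" and y: "y \<in> carrier R" for r y n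
  proof -
    have rc: "r \<in> carrier R" using r by (simp add: C_def)
    have s: "s \<otimes> (y \<otimes> r) \<in> PIdl x" if s: "s \<in> S" for s
    proof -
      have "s \<otimes> (y \<otimes> r) = y \<otimes> (s \<otimes> r)" using S_carrier[OF s] y rc by (simp add: m_lcomm)
      then show ?thesis using r s y X.I_l_closed by (simp add: C_def)
    qed
    have "component (y \<otimes> r) d \<in> PIdl x" if d: "d > n" for d
    proof -
      \<comment> \<open>The part of \<open>y\<close> of positive degree is a combination of
        \<open>S\<close> and multiplies \<open>r\<close> into (x). Modulo (x) only the constant term
        acts, and it preserves degrees.\<close>
      define y' where "y' = y \<ominus> component y 0"
      have "y \<in> high 0" using y by (simp add: high_0)
      from high_Suc_decomp[OF this] have "y' \<in> high 1" by (simp add: y'_def)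
      then have y'c: "y' \<in> carrier R" using high_carrier by blast
      obtain c where c: "\<And>s. c s \<in> carrier R" "y' = (\<Oplus>s\<in>S. s \<otimes> c s)"
        using high_1_combination[OF \<open>y' \<in> high 1\<close>] by blast
      have "y' \<otimes> r = (\<Oplus>s\<in>S. (s \<otimes> c s) \<otimes> r)"
        unfolding c(2) using c(1) S_carrier S_finite rc by (intro finsum_ldistr) auto
      also have "\<dots> = (\<Oplus>s\<in>S. c s \<otimes> (s \<otimes> r))"
        using c(1) S_carrier rc by (intro finsum_cong') (auto simp: m_ac)
      also have "\<dots> \<in> PIdl x"
      proof (rule X.finsum_in_ideal)
        fix s assume "s \<in> S"
        then show "c s \<otimes> (s \<otimes> r) \<in> PIdl x" using r c(1) X.I_l_closed[of "s \<otimes> r" "c s"] by (simp add: C_def)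
      qed
      finally have "component (y' \<otimes> r) d \<in> PIdl x" using hideal_hc[OF xh] by blast
      moreover have "y = component y 0 \<oplus> y'" using y by (simp add: y'_def a_minus_def a_lcomm r_neg)
      then have "y \<otimes> r = component y 0 \<otimes> r \<oplus> y' \<otimes> r" using y y'c rc by (metis component_closed l_distr)
      then have "component (y \<otimes> r) d = component y 0 \<otimes> component r d \<oplus> component (y' \<otimes> r) d"
        using y y'c rc component_mult_grade[OF component_grade[OF y], of r 0 d] by (simp add: component_add)
      moreover have "component y 0 \<otimes> component r d \<in> PIdl x" using r d y X.I_l_closed by (simp add: C_def)
      ultimately show ?thesis by simp
    qed
    then show ?thesis using s rc y by (simp add: C_def)
  qed
  have "ideal (C n) R" for n
  proof (intro idealI ring_axioms add.subgroupI)
    show "C n \<subseteq> carrier R" by (auto simp: C_def)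
    have "\<zero> \<in> C n" using S_carrier by (auto simp: C_def)
    then show "C n \<noteq> {}" by blast
    fix r assume r: "r \<in> C n"
    then have rc: "r \<in> carrier R" by (simp add: C_def)
    have "\<ominus> \<one> \<otimes> r \<in> C n" using Cl[OF r] by simp
    then show "\<ominus> r \<in> C n" using rc by (simp add: l_minus)
    show "r \<oplus> r' \<in> C n" if "r' \<in> C n" for r'
      using r that S_carrier by (auto simp: C_def r_distr component_add)
    fix y assume y: "y \<in> carrier R"
    show "y \<otimes> r \<in> C n" by (rule Cl[OF r y])
    then show "r \<otimes> y \<in> C n" using m_comm[OF rc y] by simp
  qed
  moreover have "C n \<subseteq> C (Suc n)" for n by (auto simp: C_def)
  ultimately obtain N where N: "\<And>n. n \<ge> N \<Longrightarrow> C n = C N" using ideal_chain_stable[of C] by blast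
  show ?thesis
  proof (rule that[of "Suc N"])
    fix d r assume d: "Suc N \<le> d" and r: "r \<in> G d" "\<And>s. s \<in> S \<Longrightarrow> s \<otimes> r \<in> PIdl x"
    have "r \<in> C d" using r grade_carrier by (auto simp: C_def component_grade_eq[OF r(1)])
    then have "r \<in> C N" using N[of d] d by simp
    then have "component r d \<in> PIdl x" using d by (simp add: C_def)
    then show "r \<in> PIdl x" using component_grade_eq[OF r(1), of d] by simp
  qed
qed

end

section \<open>Linear growth and chains of primes\<close>

context graded_domain
begin

section \<open>Linear algebra over the field of constants\<close>

definition lin_span :: "'a set \<Rightarrow> 'a set"
  where "lin_span B = {\<Oplus>b\<in>B. c b \<otimes> b | c. \<forall>b. c b \<in> G 0}"

lemma lin_span_mem:
  assumes B: "finite B" "B \<subseteq> carrier R" and b: "b \<in> B" and c: "c \<in> G 0"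
  shows "c \<otimes> b \<in> lin_span B"
proof -
  have "(\<Oplus>b'\<in>B. (if b' = b then c else \<zero>) \<otimes> b') = (\<Oplus>b'\<in>B. if b = b' then c \<otimes> b' else \<zero>)"
    using B c by (intro finsum_cong') auto
  also have "\<dots> = c \<otimes> b" using B b c by (intro finsum_singleton) auto
  finally show ?thesis
    using c unfolding lin_span_def by (intro CollectI exI[of _ "\<lambda>b'. if b' = b then c else \<zero>"]) auto
qed

lemma lin_span_zero: "B \<subseteq> carrier R \<Longrightarrow> \<zero> \<in> lin_span B"
  unfolding lin_span_def
  by (intro CollectI exI[of _ "\<lambda>_. \<zero>"]) (auto intro!: add.finprod_one_eqI[symmetric])

lemma lin_span_add:
  assumes B: "B \<subseteq> carrier R" and "u \<in> lin_span B" "v \<in> lin_span B"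
  shows "u \<oplus> v \<in> lin_span B"
proof -
  from assms obtain c d where c: "\<forall>b. c b \<in> G 0" "u = (\<Oplus>b\<in>B. c b \<otimes> b)"
    and d: "\<forall>b. d b \<in> G 0" "v = (\<Oplus>b\<in>B. d b \<otimes> b)" by (auto simp: lin_span_def)
  have "u \<oplus> v = (\<Oplus>b\<in>B. c b \<otimes> b \<oplus> d b \<otimes> b)"
    unfolding c d using B c d by (intro finsum_addf[symmetric]) auto
  also have "\<dots> = (\<Oplus>b\<in>B. (c b \<oplus> d b) \<otimes> b)"
    using B c d by (intro finsum_cong') (auto simp: l_distr)
  finally show ?thesis using c d unfolding lin_span_def by (intro CollectI exI[of _ "\<lambda>b. c b \<oplus> d b"]) auto
qed

lemma lin_span_smult:
  assumes B: "finite B" "B \<subseteq> carrier R" and "u \<in> lin_span B" and e: "e \<in> G 0"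
  shows "e \<otimes> u \<in> lin_span B"
proof -
  from assms obtain c where c: "\<forall>b. c b \<in> G 0" "u = (\<Oplus>b\<in>B. c b \<otimes> b)" by (auto simp: lin_span_def)
  have "e \<otimes> u = (\<Oplus>b\<in>B. e \<otimes> (c b \<otimes> b))"
    unfolding c using B c e by (intro finsum_rdistr) auto
  also have "\<dots> = (\<Oplus>b\<in>B. (e \<otimes> c b) \<otimes> b)"
    using B c e by (intro finsum_cong') (auto simp: m_assoc)
  finally show ?thesis
    using c e grade_mult[of e 0 _ 0] unfolding lin_span_def by (intro CollectI exI[of _ "\<lambda>b. e \<otimes> c b"]) auto
qed

lemma lin_span_carrier: "B \<subseteq> carrier R \<Longrightarrow> u \<in> lin_span B \<Longrightarrow> u \<in> carrier R"
  by (auto simp: lin_span_def intro!: finsum_closed)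

lemma lin_span_finsum:
  "B \<subseteq> carrier R \<Longrightarrow> (\<And>i. i \<in> A \<Longrightarrow> g i \<in> lin_span B) \<Longrightarrow> (\<Oplus>i\<in>A. g i) \<in> lin_span B"
  by (induction A rule: infinite_finite_induct)
    (auto simp: finsum_insert Pi_def lin_span_add lin_span_zero lin_span_carrier)

lemma lin_span_subset:
  assumes B: "finite B" "B \<subseteq> carrier R" and B': "finite B'" "B' \<subseteq> carrier R"
    and sub: "\<And>b. b \<in> B \<Longrightarrow> b \<in> lin_span B'"
  shows "lin_span B \<subseteq> lin_span B'"
proof
  fix u assume "u \<in> lin_span B"
  then obtain c where c: "\<forall>b. c b \<in> G 0" "u = (\<Oplus>b\<in>B. c b \<otimes> b)" by (auto simp: lin_span_def)
  show "u \<in> lin_span B'"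
    unfolding c(2) using B' sub c(1) by (intro lin_span_finsum lin_span_smult) auto
qed

lemma lin_span_self: "finite B \<Longrightarrow> B \<subseteq> carrier R \<Longrightarrow> b \<in> B \<Longrightarrow> b \<in> lin_span B"
  using lin_span_mem[of B b \<one>] one_grade by auto

lemma lin_span_mono:
  assumes "finite B'" "B' \<subseteq> carrier R" "B \<subseteq> B'"
  shows "lin_span B \<subseteq> lin_span B'"
  using assms lin_span_self[OF assms(1,2)] by (intro lin_span_subset) (auto intro: finite_subset)

text \<open>Gaussian elimination: a vector whose coefficient at \<open>b\<close> is nonzero is used
  to clear \<open>b\<close> from the others. This leaves one vector fewer and one spanning element
  fewer.\<close>

lemma lin_dependent:
  assumes "finite B" "B \<subseteq> carrier R" "finite J" "card B < card J" "\<And>j. j \<in> J \<Longrightarrow> v j \<in> lin_span B"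
  shows "\<exists>c. (\<forall>j. c j \<in> G 0) \<and> (\<exists>j\<in>J. c j \<noteq> \<zero>) \<and> (\<Oplus>j\<in>J. c j \<otimes> v j) = \<zero>"
  using assms
proof (induction B arbitrary: J v rule: finite_induct)
  case empty
  then obtain j where "j \<in> J" by (metis all_not_in_conv card.empty less_nat_zero_code)
  moreover have "v j = \<zero>" if "j \<in> J" for j using empty.prems(4)[OF that] by (auto simp: lin_span_def)
  then have "(\<Oplus>j\<in>J. \<one> \<otimes> v j) = \<zero>" by (intro add.finprod_one_eqI) simp
  ultimately show ?case using one_grade by (intro exI[of _ "\<lambda>_. \<one>"]) auto
next
  case (insert b B)
  have bc: "b \<in> carrier R" "B \<subseteq> carrier R" using insert.prems by auto
  have "\<exists>a w. a \<in> G 0 \<and> w \<in> lin_span B \<and> v j = a \<otimes> b \<oplus> w" if j: "j \<in> J" for j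
  proof -
    obtain c where c: "\<forall>b. c b \<in> G 0" "v j = (\<Oplus>b\<in>insert b B. c b \<otimes> b)"
      using insert.prems(4)[OF j] by (auto simp: lin_span_def)
    have "c b' \<otimes> b' \<in> carrier R" if "b' \<in> insert b B" for b'
      using that c(1) bc by (intro m_closed) auto
    then have "v j = c b \<otimes> b \<oplus> (\<Oplus>b\<in>B. c b \<otimes> b)"
      unfolding c(2) using insert.hyps by (intro finsum_insert) auto
    then show ?thesis using c(1) by (auto simp: lin_span_def)
  qed
  then obtain a w where aw: "\<And>j. j \<in> J \<Longrightarrow> a j \<in> G 0" "\<And>j. j \<in> J \<Longrightarrow> w j \<in> lin_span B"
    "\<And>j. j \<in> J \<Longrightarrow> v j = a j \<otimes> b \<oplus> w j" by metis
  have wc: "\<And>j. j \<in> J \<Longrightarrow> w j \<in> carrier R" using aw(2) lin_span_carrier bc by blast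
  show ?case
  proof (cases "\<forall>j\<in>J. a j = \<zero>")
    case True
    then have "v j \<in> lin_span B" if "j \<in> J" for j using aw that wc bc by simp
    moreover have "card B < card J" using insert.prems(3) insert.hyps by simp
    ultimately show ?thesis using insert.IH[OF bc(2) insert.prems(2)] by blast
  next
    case False
    then obtain j0 where j0: "j0 \<in> J" "a j0 \<noteq> \<zero>" by blast
    obtain a' where a': "a' \<in> G 0" "a j0 \<otimes> a' = \<one>" using grade_zero_inverse aw(1) j0 by blast
    define q where "q j = a j \<otimes> a'" for j
    have q: "q j \<in> G 0" "q j \<otimes> a j0 = a j" if "j \<in> J" for j
      using grade_mult[OF aw(1)[OF that] a'(1)] a' aw(1)[OF that] aw(1)[OF j0(1)]
      by (auto simp: q_def m_assoc m_comm[of a'])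
    let ?J = "J - {j0}"
    define v' where "v' j = v j \<ominus> q j \<otimes> v j0" for j
    have vc: "v j \<in> carrier R" if "j \<in> J" for j using aw that wc bc by simp
    have v': "v' j = w j \<oplus> (\<ominus> q j) \<otimes> w j0" if "j \<in> J" for j
    proof -
      have "q j \<otimes> v j0 = a j \<otimes> b \<oplus> q j \<otimes> w j0"
        using aw(1,3)[OF j0(1)] q[OF that] wc[OF j0(1)] bc by (simp add: r_distr flip: m_assoc)
      then have "v' j = (w j \<oplus> a j \<otimes> b) \<oplus> (\<ominus> (a j \<otimes> b) \<oplus> \<ominus> (q j \<otimes> w j0))"
        using aw(1,3)[OF that] q[OF that] wc[OF j0(1)] wc[OF that] bc
        by (simp add: v'_def a_minus_def minus_add a_comm)
      also have "\<dots> = w j \<oplus> \<ominus> (q j \<otimes> w j0)"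
        using aw(1)[OF that] q[OF that] wc[OF j0(1)] wc[OF that] bc by (simp add: a_assoc r_neg2)
      finally show ?thesis using q[OF that] wc[OF j0(1)] by (simp add: l_minus)
    qed
    have "v' j \<in> lin_span B" if "j \<in> ?J" for j
      using that v' q aw(2) bc j0 insert.hyps by (auto intro!: lin_span_add lin_span_smult)
    moreover have "finite ?J" "card B < card ?J" using insert.prems insert.hyps j0 by auto
    ultimately obtain c where c: "\<forall>j. c j \<in> G 0" "\<exists>j\<in>?J. c j \<noteq> \<zero>" "(\<Oplus>j\<in>?J. c j \<otimes> v' j) = \<zero>"
      using insert.IH[OF bc(2)] by blast
    \<comment> \<open>The coefficient of the pivot vector makes up for all multiples of it that the
      elimination subtracted.\<close>
    define e where "e = \<ominus> (\<Oplus>j\<in>?J. c j \<otimes> q j)"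
    have s0: "(\<Oplus>j\<in>?J. c j \<otimes> q j) \<in> G 0"
      using c(1) q grade_mult[of _ 0 _ 0] by (intro grade_finsum) auto
    define c' where "c' j = (if j = j0 then e else c j)" for j
    have vj0: "v j0 \<in> carrier R" by (rule vc[OF j0(1)])
    have cl: "\<And>j. j \<in> ?J \<Longrightarrow> c j \<otimes> v j \<in> carrier R" using c(1) vc by simp
    have sv: "(\<Oplus>j\<in>?J. c j \<otimes> v j) \<in> carrier R" using cl by (intro finsum_closed) auto
    have "(\<Oplus>j\<in>?J. c j \<otimes> v' j) = (\<Oplus>j\<in>?J. c j \<otimes> v j \<oplus> (c j \<otimes> q j) \<otimes> (\<ominus> v j0))"
      using c(1) vc q vj0 by (intro finsum_cong') (auto simp: v'_def a_minus_def r_distr r_minus m_assoc)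
    also have "\<dots> = (\<Oplus>j\<in>?J. c j \<otimes> v j) \<oplus> (\<Oplus>j\<in>?J. (c j \<otimes> q j) \<otimes> (\<ominus> v j0))"
      using c(1) vc q vj0 by (intro finsum_addf) auto
    also have "(\<Oplus>j\<in>?J. (c j \<otimes> q j) \<otimes> (\<ominus> v j0)) = e \<otimes> v j0"
      using c(1) q vj0 s0 insert.prems(2)
      by (subst finsum_ldistr[symmetric]) (auto simp: e_def l_minus r_minus)
    finally have zero: "(\<Oplus>j\<in>?J. c j \<otimes> v j) \<oplus> e \<otimes> v j0 = \<zero>" using c(3) by simp
    have eG: "e \<in> G 0" unfolding e_def using s0 by simp
    have "(\<Oplus>j\<in>insert j0 ?J. c' j \<otimes> v j) = c' j0 \<otimes> v j0 \<oplus> (\<Oplus>j\<in>?J. c' j \<otimes> v j)"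
      using insert.prems(2) cl vj0 eG by (intro finsum_insert) (auto simp: c'_def)
    also have "(\<Oplus>j\<in>?J. c' j \<otimes> v j) = (\<Oplus>j\<in>?J. c j \<otimes> v j)"
      using cl by (intro finsum_cong') (auto simp: c'_def)
    finally have "(\<Oplus>j\<in>J. c' j \<otimes> v j) = \<zero>"
      using zero j0 eG vj0 sv by (simp add: insert_absorb c'_def a_comm)
    moreover have "\<forall>j. c' j \<in> G 0" using c(1) eG by (simp add: c'_def)
    moreover have "\<exists>j\<in>J. c' j \<noteq> \<zero>" using c(2) by (auto simp: c'_def)
    ultimately show ?thesis by blast
  qed
qed

lemma grade_finite_dim: "\<exists>B. finite B \<and> B \<subseteq> carrier R \<and> G d \<subseteq> lin_span B"
proof (induction d)
  case 0
  have "x \<in> lin_span {\<one>}" if "x \<in> G 0" for x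
    using lin_span_mem[of "{\<one>}" \<one> x] that by simp
  then show ?case by (intro exI[of _ "{\<one>}"]) auto
next
  case (Suc d)
  then obtain B where B: "finite B" "B \<subseteq> carrier R" "G d \<subseteq> lin_span B" by blast
  define B' where "B' = (\<lambda>(s, b). s \<otimes> b) ` (S \<times> B)"
  have B': "finite B'" "B' \<subseteq> carrier R" using B S_finite S_carrier by (auto simp: B'_def)
  have "x \<in> lin_span B'" if "x \<in> G (Suc d)" for x
  proof -
    obtain c where c: "\<And>s. s \<in> S \<Longrightarrow> c s \<in> G d" "x = (\<Oplus>s\<in>S. s \<otimes> c s)"
      using grade_Suc_combination \<open>x \<in> G (Suc d)\<close> by blast
    have "s \<otimes> c s \<in> lin_span B'" if s: "s \<in> S" for s
    proof -
      have "c s \<in> lin_span B" using B(3) c(1)[OF s] by blast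
      then obtain e where e: "\<forall>b. e b \<in> G 0" "c s = (\<Oplus>b\<in>B. e b \<otimes> b)" by (auto simp: lin_span_def)
      have "s \<otimes> c s = (\<Oplus>b\<in>B. s \<otimes> (e b \<otimes> b))"
        unfolding e(2) using B e(1) S_carrier[OF s] by (intro finsum_rdistr) auto
      also have "\<dots> = (\<Oplus>b\<in>B. e b \<otimes> (s \<otimes> b))"
        using B e(1) S_carrier[OF s] by (intro finsum_cong') (auto simp: m_lcomm)
      also have "\<dots> \<in> lin_span B'"
        using B' e(1) s by (intro lin_span_finsum lin_span_mem) (auto simp: B'_def)
      finally show ?thesis .
    qed
    then show ?thesis unfolding c(2) using B' by (intro lin_span_finsum) auto
  qed
  then show ?case using B' by blast
qed

section \<open>Filtration by the highest degree, and its growth\<close>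

definition low :: "nat \<Rightarrow> 'a set"
  where "low n = {x \<in> carrier R. \<forall>d>n. component x d = \<zero>}"

lemma low_carrier: "x \<in> low n \<Longrightarrow> x \<in> carrier R"
  by (simp add: low_def)

lemma low_exists: "x \<in> carrier R \<Longrightarrow> \<exists>n. x \<in> low n"
  using component_finite[of x] finite_nat_set_iff_bounded_le[of "{d. component x d \<noteq> \<zero>}"]
  by (auto simp: low_def not_le[symmetric])

lemma low_mono: "m \<le> n \<Longrightarrow> low m \<subseteq> low n"
  by (auto simp: low_def)

lemma low_mult:
  assumes x: "x \<in> low i" and y: "y \<in> low j"
  shows "x \<otimes> y \<in> low (i + j)"
proof -
  have xc: "x \<in> carrier R" and yc: "y \<in> carrier R" using x y low_carrier by auto
  let ?D = "{d. component x d \<noteq> \<zero>}"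
  have "x \<otimes> y = (\<Oplus>d\<in>?D. component x d) \<otimes> y" using component_sum[OF xc] by simp
  also have "\<dots> = (\<Oplus>d\<in>?D. component x d \<otimes> y)" using xc yc component_finite by (simp add: finsum_ldistr)
  finally have eq: "x \<otimes> y = (\<Oplus>d\<in>?D. component x d \<otimes> y)" .
  have "component (x \<otimes> y) e = \<zero>" if e: "e > i + j" for e
  proof -
    have "component (x \<otimes> y) e = (\<Oplus>d\<in>?D. component (component x d \<otimes> y) e)"
      unfolding eq using xc yc by (intro component_finsum) auto
    also have "\<dots> = \<zero>"
    proof (rule add.finprod_one_eqI)
      fix d assume "d \<in> ?D"
      then have "d \<le> i" using x by (auto simp: low_def not_less[symmetric])
      then show "component (component x d \<otimes> y) e = \<zero>"
        using e y xc component_mult_grade[OF component_grade[OF xc] yc, of d e] by (auto simp: low_def)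
    qed
    finally show ?thesis .
  qed
  then show ?thesis using xc yc by (simp add: low_def)
qed

lemma low_pow: "x \<in> low i \<Longrightarrow> x [^] (n :: nat) \<in> low (n * i)"
proof (induction n)
  case 0
  then show ?case by (simp add: low_def component_grade_eq[OF one_grade])
next
  case (Suc n)
  then have "x [^] n \<otimes> x \<in> low (n * i + i)" by (intro low_mult)
  moreover have "n * i + i = Suc n * i" by simp
  ultimately show ?case by (simp only: nat_pow_Suc)
qed

text \<open>In large degrees every element is \<open>x\<close> times an element of degree
  \<open>a\<close> less, so multiplication by \<open>x\<close> transports spanning sets upwards. The
  size of the spanning sets for the first \<open>k + a\<close> degrees thus bounds all later
  ones.\<close>

lemma low_linear_growth:
  assumes x: "x \<in> G a" and a: "a \<ge> 1" and k: "\<And>d. d \<ge> k \<Longrightarrow> G d \<subseteq> PIdl x"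
  obtains m where "\<And>n. \<exists>B. finite B \<and> B \<subseteq> carrier R \<and> card B \<le> m * Suc n \<and> low n \<subseteq> lin_span B"
proof -
  have xc: "x \<in> carrier R" by (rule grade_carrier[OF x])
  obtain B0 where B0: "\<And>d. finite (B0 d) \<and> B0 d \<subseteq> carrier R \<and> G d \<subseteq> lin_span (B0 d)"
    using grade_finite_dim by metis
  define m where "m = Max ((\<lambda>d. card (B0 d)) ` {..<k + a})"
  have "\<exists>B. finite B \<and> B \<subseteq> carrier R \<and> card B \<le> m \<and> G d \<subseteq> lin_span B" for d
  proof (induction d rule: less_induct)
    case (less d)
    show ?case
    proof (cases "d < k + a")
      case True
      then have "card (B0 d) \<le> m" unfolding m_def by (intro Max_ge) auto
      then show ?thesis using B0 by blast
    next
      case False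
      then obtain B where B: "finite B" "B \<subseteq> carrier R" "card B \<le> m" "G (d - a) \<subseteq> lin_span B"
        using less.IH[of "d - a"] a by auto
      let ?B = "(\<lambda>b. x \<otimes> b) ` B"
      have B': "finite ?B" "?B \<subseteq> carrier R" using B xc by auto
      have "z \<in> lin_span ?B" if z: "z \<in> G d" for z
      proof -
        have "z \<in> PIdl x" using k[of d] False z by auto
        then obtain r where r: "r \<in> carrier R" "z = r \<otimes> x" unfolding cgenideal_def by blast
        have "z = component (x \<otimes> r) d" using z r xc by (simp add: component_grade_eq m_comm)
        also have "\<dots> = x \<otimes> component r (d - a)" using False r by (simp add: component_mult_grade[OF x])
        finally have zx: "z = x \<otimes> component r (d - a)" .
        have "component r (d - a) \<in> lin_span B" using B(4) component_grade[OF r(1)] by blast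
        then obtain e where e: "\<forall>b. e b \<in> G 0" "component r (d - a) = (\<Oplus>b\<in>B. e b \<otimes> b)" by (auto simp: lin_span_def)
        have "z = (\<Oplus>b\<in>B. x \<otimes> (e b \<otimes> b))"
          unfolding zx e(2) using B e(1) xc by (intro finsum_rdistr) auto
        also have "\<dots> = (\<Oplus>b\<in>B. e b \<otimes> (x \<otimes> b))"
          using B e(1) xc by (intro finsum_cong') (auto simp: m_lcomm)
        also have "\<dots> \<in> lin_span ?B"
          using B' e(1) by (intro lin_span_finsum lin_span_mem) auto
        finally show ?thesis .
      qed
      moreover have "card ?B \<le> m" using B(1,3) card_image_le le_trans by blast
      ultimately show ?thesis using B' by blast
    qed
  qed
  then obtain B where B: "\<And>d. finite (B d)" "\<And>d. B d \<subseteq> carrier R" "\<And>d. card (B d) \<le> m" "\<And>d. G d \<subseteq> lin_span (B d)"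
    by metis
  show ?thesis
  proof (rule that)
    fix n
    let ?B = "\<Union>d\<in>{..n}. B d"
    have fin: "finite ?B" "?B \<subseteq> carrier R" using B by auto
    have "card ?B \<le> (\<Sum>d\<in>{..n}. card (B d))" by (rule card_UN_le) simp
    also have "\<dots> \<le> (\<Sum>d\<in>{..n}. m)" using B(3) by (intro sum_mono) auto
    finally have "card ?B \<le> m * Suc n" by (simp add: mult.commute)
    moreover have "low n \<subseteq> lin_span ?B"
    proof
      fix z assume z: "z \<in> low n"
      have zc: "z \<in> carrier R" using z low_carrier by blast
      have "z = (\<Oplus>d\<in>{..n}. component z d)" using z by (intro component_sum_superset) (auto simp: low_def)
      also have "\<dots> \<in> lin_span ?B"
        using B(4) component_grade[OF zc] lin_span_mono[OF fin] by (intro lin_span_finsum[OF fin(2)]) blast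
      finally show "z \<in> lin_span ?B" .
    qed
    ultimately show "\<exists>B. finite B \<and> B \<subseteq> carrier R \<and> card B \<le> m * Suc n \<and> low n \<subseteq> lin_span B"
      using fin by blast
  qed
qed

text \<open>The power of \<open>t\<close> common to all terms lies outside \<open>P\<close> and can
  be cancelled. What remains is \<open>p i0\<close> plus a multiple of \<open>t\<close>, and
  \<open>t\<close> lies in \<open>Q\<close>.\<close>

lemma lowest_coefficient_in_prime:
  assumes P: "primeideal P R" and Q: "ideal Q R" "P \<subseteq> Q" and t: "t \<in> Q" "t \<notin> P"
    and p: "\<And>i. p i \<in> carrier R" and sum: "(\<Oplus>i\<in>{..M :: nat}. t [^] i \<otimes> p i) \<in> P"
    and i0: "i0 \<le> M" "\<And>i. i < i0 \<Longrightarrow> p i = \<zero>"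
  shows "p i0 \<in> Q"
proof -
  interpret Q: ideal Q R by (rule Q)
  have tc: "t \<in> carrier R" using t Q.Icarr by blast
  let ?r = "\<Oplus>i\<in>{i0<..M}. t [^] (i - i0) \<otimes> p i"
  have rc: "?r \<in> carrier R" using tc p by (intro finsum_closed) auto
  have "(\<Oplus>i\<in>{..M}. t [^] i \<otimes> p i) = (\<Oplus>i\<in>{i0..M}. t [^] i \<otimes> p i)"
    using i0 tc p by (intro add.finprod_mono_neutral_cong_right) auto
  also have "\<dots> = (\<Oplus>i\<in>{i0..M}. t [^] i0 \<otimes> (t [^] (i - i0) \<otimes> p i))"
  proof (intro finsum_cong')
    fix i assume "i \<in> {i0..M}"
    then have "t [^] i0 \<otimes> t [^] (i - i0) = t [^] i" using nat_pow_mult[OF tc, of i0 "i - i0"] by simp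
    moreover have "t [^] i0 \<otimes> (t [^] (i - i0) \<otimes> p i) = (t [^] i0 \<otimes> t [^] (i - i0)) \<otimes> p i"
      using tc p by (simp only: m_assoc nat_pow_closed)
    ultimately show "t [^] i \<otimes> p i = t [^] i0 \<otimes> (t [^] (i - i0) \<otimes> p i)" by simp
  qed (use tc p in auto)
  also have "\<dots> = t [^] i0 \<otimes> (\<Oplus>i\<in>{i0..M}. t [^] (i - i0) \<otimes> p i)"
    using tc p by (intro finsum_rdistr[symmetric]) auto
  also have "{i0..M} = insert i0 {i0<..M}" using i0 by auto
  also have "(\<Oplus>i\<in>insert i0 {i0<..M}. t [^] (i - i0) \<otimes> p i) = p i0 \<oplus> ?r"
    using tc p by (subst finsum_insert) auto
  finally have tP: "t [^] i0 \<otimes> (p i0 \<oplus> ?r) \<in> P" using sum by simp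
  have "t [^] i0 \<notin> P"
  proof (induction i0)
    case 0
    then show ?case
      using ideal.one_imp_carrier[OF primeideal.axioms(1)[OF P]] primeideal.I_notcarr[OF P] by auto
  next
    case (Suc n)
    then show ?case using primeideal.I_prime[OF P, of "t [^] n" t] t(2) tc by auto
  qed
  then have "p i0 \<oplus> ?r \<in> P"
    using primeideal.I_prime[OF P nat_pow_closed[OF tc] a_closed[OF p rc] tP] by simp
  then have sQ: "p i0 \<oplus> ?r \<in> Q" using Q(2) by blast
  have "?r \<in> Q"
  proof (rule Q.finsum_in_ideal)
    fix i assume i: "i \<in> {i0<..M}"
    then obtain l where "i - i0 = Suc l" by (metis Suc_diff_Suc greaterThanAtMost_iff)
    then have "t [^] (i - i0) \<otimes> p i = (t [^] l \<otimes> p i) \<otimes> t" using tc p by (simp add: m_ac)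
    then show "t [^] (i - i0) \<otimes> p i \<in> Q" using Q.I_l_closed[OF t(1)] tc p by simp
  qed
  then have "(p i0 \<oplus> ?r) \<oplus> \<ominus> ?r \<in> Q" using sQ by blast
  then show ?thesis using p rc by (simp add: a_assoc r_neg)
qed

text \<open>Two strict inclusions provide elements \<open>r\<close> and \<open>t\<close> without a
  polynomial relation over the constants. Their monomials grow quadratically in number, against the
  linear growth of R that \<open>k\<close> implies.\<close>

lemma no_prime_chain_of_principal:
  assumes x: "x \<in> G a" and a: "a \<ge> 1" and k: "\<And>d. d \<ge> k \<Longrightarrow> G d \<subseteq> PIdl x"
    and P: "primeideal P0 R" "primeideal P1 R" "primeideal P2 R" "P0 \<subset> P1" "P1 \<subset> P2"
  shows False
proof -
  obtain m where m: "\<And>n. \<exists>B. finite B \<and> B \<subseteq> carrier R \<and> card B \<le> m * Suc n \<and> low n \<subseteq> lin_span B"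
    using low_linear_growth[OF x a k] by blast
  obtain r where r: "r \<in> P1" "r \<notin> P0" using P(4) by blast
  obtain t where t: "t \<in> P2" "t \<notin> P1" using P(5) by blast
  have c: "r \<in> carrier R" "t \<in> carrier R"
    using r t ideal.Icarr[OF primeideal.axioms(1)[OF P(2)]] ideal.Icarr[OF primeideal.axioms(1)[OF P(3)]] by auto
  obtain \<rho> where \<rho>: "r \<in> low \<rho>" "t \<in> low \<rho>"
  proof -
    obtain i j where "r \<in> low i" "t \<in> low j" using low_exists c by blast
    then show ?thesis using that[of "max i j"] low_mono[of i "max i j"] low_mono[of j "max i j"] by auto
  qed
  \<comment> \<open>Chosen so that the dimension bound \<open>m * Suc (2 * M * \<rho>)\<close>,
    which equals m + 2 m \<rho> M, is at most M + M^2 and thus less than the number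
    \<open>Suc M * Suc M\<close> of monomials.\<close>
  define M where "M = 2 * m * \<rho> + m"
  let ?J = "{..M} \<times> {..M}"
  let ?v = "\<lambda>z. r [^] fst z \<otimes> t [^] snd z"
  obtain B where B: "finite B" "B \<subseteq> carrier R" "card B \<le> m * Suc (2 * M * \<rho>)" "low (2 * M * \<rho>) \<subseteq> lin_span B"
    using m by blast
  have "?v z \<in> low (2 * M * \<rho>)" if z: "z \<in> ?J" for z
  proof -
    have "?v z \<in> low (fst z * \<rho> + snd z * \<rho>)" using low_pow \<rho> by (intro low_mult) auto
    moreover have "fst z * \<rho> + snd z * \<rho> \<le> M * \<rho> + M * \<rho>" using z by (intro add_mono mult_right_mono) auto
    then have "fst z * \<rho> + snd z * \<rho> \<le> 2 * M * \<rho>" by simp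
    ultimately show ?thesis using low_mono by blast
  qed
  then have v: "\<And>z. z \<in> ?J \<Longrightarrow> ?v z \<in> lin_span B" using B(4) by blast
  have "m * Suc (2 * M * \<rho>) < Suc M * Suc M"
  proof -
    have "m * Suc (2 * M * \<rho>) = m + (2 * m * \<rho>) * M" by simp
    also have "\<dots> \<le> M + M * M" by (intro add_mono mult_right_mono) (auto simp: M_def)
    also have "\<dots> < Suc M * Suc M" by simp
    finally show ?thesis .
  qed
  then have "card B < card ?J" using B(3) by (simp add: card_cartesian_product)
  from lin_dependent[where v = ?v, OF B(1,2) _ this v]
  obtain e where e: "\<forall>z. e z \<in> G 0" "\<exists>z\<in>?J. e z \<noteq> \<zero>" "(\<Oplus>z\<in>?J. e z \<otimes> ?v z) = \<zero>"
    by auto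
  define p where "p i = (\<Oplus>j\<in>{..M}. t [^] j \<otimes> e (i, j))" for i
  have ec: "e z \<in> carrier R" for z by (rule grade_zero_carrier[OF spec[OF e(1)]])
  have pc: "p i \<in> carrier R" for i unfolding p_def using c ec by (intro finsum_closed) auto
  have "(\<Oplus>i\<in>{..M}. r [^] i \<otimes> p i) = (\<Oplus>i\<in>{..M}. \<Oplus>j\<in>{..M}. e (i, j) \<otimes> ?v (i, j))"
    unfolding p_def using c ec
    by (intro finsum_cong') (auto simp: finsum_rdistr m_ac intro!: finsum_cong' finsum_closed)
  also have "\<dots> = (\<Oplus>z\<in>?J. e (fst z, snd z) \<otimes> ?v (fst z, snd z))"
    using c ec by (intro finsum_Sigma) auto
  also have "\<dots> = \<zero>" using e(3) by simp
  finally have sum0: "(\<Oplus>i\<in>{..M}. r [^] i \<otimes> p i) = \<zero>" .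
  \<comment> \<open>The lowest power of \<open>r\<close> is isolated first, then the lowest power of
    \<open>t\<close> in its coefficient. The first step passes from \<open>P0\<close> to
    \<open>P1\<close>, the second from \<open>P1\<close> to \<open>P2\<close>, where a nonzero
    constant ends up.\<close>
  define i0 where "i0 = (LEAST i. \<exists>j\<le>M. e (i, j) \<noteq> \<zero> \<and> i \<le> M)"
  have ex: "\<exists>i. \<exists>j\<le>M. e (i, j) \<noteq> \<zero> \<and> i \<le> M" using e(2) by auto
  have i0: "\<exists>j\<le>M. e (i0, j) \<noteq> \<zero> \<and> i0 \<le> M" unfolding i0_def by (rule LeastI_ex[OF ex])
  have less: "p i = \<zero>" if "i < i0" for i
  proof -
    have "e (i, j) = \<zero>" if "j \<le> M" for j
      using not_less_Least[OF \<open>i < i0\<close>[unfolded i0_def]] i0 \<open>i < i0\<close> that by auto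
    then show ?thesis unfolding p_def using c by (intro add.finprod_one_eqI) auto
  qed
  have "\<zero> \<in> P0" using additive_subgroup.zero_closed[OF ideal.axioms(1)[OF primeideal.axioms(1)[OF P(1)]]] .
  then have "(\<Oplus>i\<in>{..M}. r [^] i \<otimes> p i) \<in> P0" using sum0 by simp
  from lowest_coefficient_in_prime[OF P(1) primeideal.axioms(1)[OF P(2)] psubset_imp_subset[OF P(4)] r pc this _ less]
  have p0: "p i0 \<in> P1" using i0 by blast
  define j0 where "j0 = (LEAST j. e (i0, j) \<noteq> \<zero> \<and> j \<le> M)"
  have j0: "e (i0, j0) \<noteq> \<zero> \<and> j0 \<le> M" 
  proof -
    have "\<exists>j. e (i0, j) \<noteq> \<zero> \<and> j \<le> M" using i0 by blast
    then show ?thesis unfolding j0_def by (rule LeastI_ex)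
  qed
  have less': "e (i0, j) = \<zero>" if "j < j0" for j
    using not_less_Least[OF that[unfolded j0_def]] j0 that by auto
  from lowest_coefficient_in_prime[where p = "\<lambda>j. e (i0, j)", OF P(2) primeideal.axioms(1)[OF P(3)] psubset_imp_subset[OF P(5)] t
      ec p0[unfolded p_def] conjunct2[OF j0] less']
  have e0: "e (i0, j0) \<in> P2" .
  obtain e' where e': "e' \<in> G 0" "e (i0, j0) \<otimes> e' = \<one>" using grade_zero_inverse e(1) j0 by blast
  interpret P2: primeideal P2 R by (rule P(3))
  have "\<one> \<in> P2" using P2.I_r_closed[OF e0, of e'] e' by simp
  then show False using P2.one_imp_carrier P2.I_notcarr by simp
qed

end

section \<open>Recurrences over a punctured cone\<close>

text \<open>The intended ring is the fraction field of a graded domain, with \<open>H d\<close> the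
  image of the part of degree \<open>d\<close>. The \<open>H d\<close> do not span this ring, so
  only closure properties are required.\<close>

locale grading = cring R for R (structure) +
  fixes H :: "nat \<Rightarrow> 'a set"
  assumes H_subgroup: "additive_subgroup (H d) R"
    and H_mult: "x \<in> H i \<Longrightarrow> y \<in> H j \<Longrightarrow> x \<otimes> y \<in> H (i + j)"
    and H_one: "\<one> \<in> H 0"
begin

lemma H_carrier: "x \<in> H d \<Longrightarrow> x \<in> carrier R"
  using additive_subgroup.a_subset[OF H_subgroup] by blast

lemma H_closed:
  "\<zero> \<in> H d" "x \<in> H d \<Longrightarrow> y \<in> H d \<Longrightarrow> x \<oplus> y \<in> H d" "x \<in> H d \<Longrightarrow> \<ominus> x \<in> H d"
  using H_subgroup[of d]
  by (auto intro: additive_subgroup.zero_closed additive_subgroup.a_closed additive_subgroup.a_inv_closed)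

lemma H_pow: "x \<in> H d \<Longrightarrow> x [^] (n :: nat) \<in> H (n * d)"
proof (induction n)
  case (Suc n)
  then have "x [^] n \<otimes> x \<in> H (n * d + d)" by (intro H_mult)
  moreover have "n * d + d = Suc n * d" by simp
  ultimately show ?case by (simp only: nat_pow_Suc)
qed (simp add: H_one)

text \<open>The elements of degree \<open>d\<close> of the localization at \<open>t\<close>, where \<open>t\<close> has degree \<open>c\<close>:\<close>

definition frac_grade :: "'a \<Rightarrow> nat \<Rightarrow> nat \<Rightarrow> 'a set"
  where "frac_grade t c d = {\<alpha> \<in> carrier R. \<exists>p :: nat. t [^] p \<otimes> \<alpha> \<in> H (d + p * c)}"

context
  fixes t c
  assumes t: "t \<in> H c"
begin

lemma t_carrier: "t \<in> carrier R"
  by (rule H_carrier[OF t])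

lemma frac_grade_carrier: "\<alpha> \<in> frac_grade t c d \<Longrightarrow> \<alpha> \<in> carrier R"
  by (simp add: frac_grade_def)

lemma H_frac_grade: "\<alpha> \<in> H d \<Longrightarrow> \<alpha> \<in> frac_grade t c d"
  using H_carrier by (auto simp: frac_grade_def intro!: exI[of _ 0])

lemma frac_grade_up:
  assumes "\<alpha> \<in> carrier R" "t [^] p \<otimes> \<alpha> \<in> H (d + p * c)" "p \<le> q"
  shows "t [^] q \<otimes> \<alpha> \<in> H (d + q * c)"
proof -
  have "t [^] (q - p) \<otimes> (t [^] p \<otimes> \<alpha>) \<in> H ((q - p) * c + (d + p * c))"
    by (intro H_mult H_pow[OF t] assms)
  moreover have "(q - p) * c + (d + p * c) = d + q * c"
    using assms(3) by (simp add: diff_mult_distrib mult_le_mono1)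
  moreover have "t [^] (q - p) \<otimes> (t [^] p \<otimes> \<alpha>) = t [^] q \<otimes> \<alpha>"
    using assms(1,3) t_carrier nat_pow_mult[OF t_carrier, of "q - p" p] by (simp flip: m_assoc)
  ultimately show ?thesis by simp
qed

lemma frac_grade_add:
  assumes "\<alpha> \<in> frac_grade t c d" "\<beta> \<in> frac_grade t c d"
  shows "\<alpha> \<oplus> \<beta> \<in> frac_grade t c d"
proof -
  obtain p q where pq: "t [^] (p :: nat) \<otimes> \<alpha> \<in> H (d + p * c)" "t [^] (q :: nat) \<otimes> \<beta> \<in> H (d + q * c)"
    and c: "\<alpha> \<in> carrier R" "\<beta> \<in> carrier R" using assms by (auto simp: frac_grade_def)
  have "t [^] (max p q) \<otimes> \<alpha> \<oplus> t [^] (max p q) \<otimes> \<beta> \<in> H (d + max p q * c)"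
    by (intro H_closed frac_grade_up[OF c(1) pq(1)] frac_grade_up[OF c(2) pq(2)]) auto
  then show ?thesis using c t_carrier by (auto simp: frac_grade_def r_distr intro!: exI[of _ "max p q"])
qed

lemma frac_grade_neg: "\<alpha> \<in> frac_grade t c d \<Longrightarrow> \<ominus> \<alpha> \<in> frac_grade t c d"
  using t_carrier H_closed(3) by (auto simp: frac_grade_def r_minus)

lemma frac_grade_minus: "\<alpha> \<in> frac_grade t c d \<Longrightarrow> \<beta> \<in> frac_grade t c d \<Longrightarrow> \<alpha> \<ominus> \<beta> \<in> frac_grade t c d"
  unfolding a_minus_def by (intro frac_grade_add frac_grade_neg)

lemma frac_grade_zero: "\<zero> \<in> frac_grade t c d"
  by (rule H_frac_grade[OF H_closed(1)])

lemma frac_grade_finsum: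
  "(\<And>i. i \<in> A \<Longrightarrow> g i \<in> frac_grade t c d) \<Longrightarrow> (\<Oplus>i\<in>A. g i) \<in> frac_grade t c d"
  by (induction A rule: infinite_finite_induct)
    (auto simp: finsum_insert Pi_def frac_grade_add frac_grade_zero frac_grade_carrier[of _ d])

lemma frac_grade_mult:
  assumes "\<alpha> \<in> frac_grade t c d" "\<beta> \<in> frac_grade t c e"
  shows "\<alpha> \<otimes> \<beta> \<in> frac_grade t c (d + e)"
proof -
  obtain p q where pq: "t [^] (p :: nat) \<otimes> \<alpha> \<in> H (d + p * c)" "t [^] (q :: nat) \<otimes> \<beta> \<in> H (e + q * c)"
    and c: "\<alpha> \<in> carrier R" "\<beta> \<in> carrier R" using assms by (auto simp: frac_grade_def)
  have "(t [^] p \<otimes> \<alpha>) \<otimes> (t [^] q \<otimes> \<beta>) \<in> H ((d + p * c) + (e + q * c))"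
    by (intro H_mult pq)
  moreover have "(d + p * c) + (e + q * c) = (d + e) + (p + q) * c" by (simp add: add_mult_distrib)
  moreover have "(t [^] p \<otimes> \<alpha>) \<otimes> (t [^] q \<otimes> \<beta>) = (t [^] p \<otimes> t [^] q) \<otimes> (\<alpha> \<otimes> \<beta>)"
    using c t_carrier by (simp add: m_ac)
  ultimately have "t [^] (p + q) \<otimes> (\<alpha> \<otimes> \<beta>) \<in> H ((d + e) + (p + q) * c)"
    by (simp add: nat_pow_mult t_carrier)
  then show ?thesis using c unfolding frac_grade_def by blast
qed

lemma frac_grade_inv:
  assumes "t \<in> Units R" "z \<in> H (d + c)"
  shows "inv t \<otimes> z \<in> frac_grade t c d"
proof -
  have "z \<in> carrier R" by (rule H_carrier[OF assms(2)])
  then have "t \<otimes> (inv t \<otimes> z) = z" using assms(1) t_carrier by (simp flip: m_assoc)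
  then have "t [^] (1 :: nat) \<otimes> (inv t \<otimes> z) \<in> H (d + 1 * c)" using assms t_carrier by simp
  then show ?thesis using assms H_carrier unfolding frac_grade_def by blast
qed

end

lemma frac_grade_mult_right:
  assumes t: "t \<in> H c" and s: "s \<in> H e"
  shows "frac_grade t c d \<subseteq> frac_grade (t \<otimes> s) (c + e) d"
proof
  fix \<alpha> assume "\<alpha> \<in> frac_grade t c d"
  then obtain p where p: "t [^] (p :: nat) \<otimes> \<alpha> \<in> H (d + p * c)" "\<alpha> \<in> carrier R" by (auto simp: frac_grade_def)
  have ts: "t \<in> carrier R" "s \<in> carrier R" using t s H_carrier by auto
  have "s [^] p \<otimes> (t [^] p \<otimes> \<alpha>) \<in> H (p * e + (d + p * c))"
    by (intro H_mult H_pow[OF s] p)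
  moreover have "s [^] p \<otimes> (t [^] p \<otimes> \<alpha>) = (t \<otimes> s) [^] p \<otimes> \<alpha>"
    using ts p(2) by (simp add: nat_pow_distrib m_ac)
  moreover have "p * e + (d + p * c) = d + p * (c + e)" by (simp add: add_mult_distrib2)
  ultimately show "\<alpha> \<in> frac_grade (t \<otimes> s) (c + e) d" using p(2) by (auto simp: frac_grade_def)
qed

end

text \<open>If \<open>u \<nu>\<close> is the value of a linear form at the monomial \<open>c\<^sup>\<nu>\<close> in variables \<open>c\<^sub>j\<close>, then
  \<open>shifted_value \<gamma> u xs \<nu>\<close> is its value at \<open>c\<^sup>\<nu>\<close> times the product of the \<open>c\<^sub>j - \<gamma>\<^sub>j\<close> over \<open>j\<close> in \<open>xs\<close>.\<close>

primrec shifted_value :: "('a, 'm) ring_scheme \<Rightarrow> ('i \<Rightarrow> 'a) \<Rightarrow> ('i multiset \<Rightarrow> 'a) \<Rightarrow> 'i list \<Rightarrow> 'i multiset \<Rightarrow> 'a"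
  where
    "shifted_value R \<gamma> u [] \<nu> = u \<nu>"
  | "shifted_value R \<gamma> u (j # xs) \<nu> =
      shifted_value R \<gamma> u xs (add_mset j \<nu>) \<ominus>\<^bsub>R\<^esub> \<gamma> j \<otimes>\<^bsub>R\<^esub> shifted_value R \<gamma> u xs \<nu>"

text \<open>What remains of \<open>shifted_value\<close> without its top term
  \<open>u (mset xs + \<nu>)\<close>. Only values of \<open>u\<close> at smaller monomials occur,
  which allows \<open>u\<close> to be constructed by recursion on the size.\<close>

primrec shifted_rest :: "('a, 'm) ring_scheme \<Rightarrow> ('i \<Rightarrow> 'a) \<Rightarrow> ('i multiset \<Rightarrow> 'a) \<Rightarrow> 'i list \<Rightarrow> 'i multiset \<Rightarrow> 'a"
  where
    "shifted_rest R \<gamma> u [] \<nu> = \<zero>\<^bsub>R\<^esub>"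
  | "shifted_rest R \<gamma> u (j # xs) \<nu> =
      shifted_rest R \<gamma> u xs (add_mset j \<nu>) \<ominus>\<^bsub>R\<^esub> \<gamma> j \<otimes>\<^bsub>R\<^esub> shifted_value R \<gamma> u xs \<nu>"

lemma shifted_value_cong:
  "(\<And>\<rho>. size \<rho> \<le> length xs + size \<nu> \<Longrightarrow> u \<rho> = u' \<rho>) \<Longrightarrow>
    shifted_value R \<gamma> u xs \<nu> = shifted_value R \<gamma> u' xs \<nu>"
proof (induction xs arbitrary: \<nu>)
  case (Cons j xs)
  have "shifted_value R \<gamma> u xs (add_mset j \<nu>) = shifted_value R \<gamma> u' xs (add_mset j \<nu>)"
    "shifted_value R \<gamma> u xs \<nu> = shifted_value R \<gamma> u' xs \<nu>"
    using Cons.prems by (auto intro!: Cons.IH)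
  then show ?case by simp
qed simp

lemma shifted_rest_cong:
  "(\<And>\<rho>. size \<rho> < length xs + size \<nu> \<Longrightarrow> u \<rho> = u' \<rho>) \<Longrightarrow>
    shifted_rest R \<gamma> u xs \<nu> = shifted_rest R \<gamma> u' xs \<nu>"
proof (induction xs arbitrary: \<nu>)
  case (Cons j xs)
  have "shifted_rest R \<gamma> u xs (add_mset j \<nu>) = shifted_rest R \<gamma> u' xs (add_mset j \<nu>)"
    using Cons.prems by (intro Cons.IH) auto
  moreover have "shifted_value R \<gamma> u xs \<nu> = shifted_value R \<gamma> u' xs \<nu>"
    using Cons.prems by (intro shifted_value_cong) auto
  ultimately show ?case by simp
qed simp

context cring
begin

lemma shifted_value_closed:
  "(\<And>j. \<gamma> j \<in> carrier R) \<Longrightarrow> (\<And>\<rho>. u \<rho> \<in> carrier R) \<Longrightarrow> shifted_value R \<gamma> u xs \<nu> \<in> carrier R"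
  by (induction xs arbitrary: \<nu>) auto

lemma shifted_rest_closed:
  "(\<And>j. \<gamma> j \<in> carrier R) \<Longrightarrow> (\<And>\<rho>. u \<rho> \<in> carrier R) \<Longrightarrow> shifted_rest R \<gamma> u xs \<nu> \<in> carrier R"
  by (induction xs arbitrary: \<nu>) (auto simp: shifted_value_closed)

lemma shifted_value_rest:
  assumes "\<And>j. \<gamma> j \<in> carrier R" "\<And>\<rho>. u \<rho> \<in> carrier R"
  shows "shifted_value R \<gamma> u xs \<nu> = u (mset xs + \<nu>) \<oplus> shifted_rest R \<gamma> u xs \<nu>"
proof (induction xs arbitrary: \<nu>)
  case (Cons j xs)
  show ?case
    using assms shifted_value_closed[of \<gamma> u xs \<nu>] shifted_rest_closed[of \<gamma> u xs "add_mset j \<nu>"]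
    by (simp add: Cons.IH[of "add_mset j \<nu>"] a_minus_def a_assoc)
qed (use assms in simp)

lemma shifted_value_move:
  assumes g: "\<And>j. \<gamma> j \<in> carrier R" and u: "\<And>\<rho>. u \<rho> \<in> carrier R"
  shows "shifted_value R \<gamma> u (xs @ j # ys) \<nu> = shifted_value R \<gamma> u (j # xs @ ys) \<nu>"
proof (induction xs arbitrary: \<nu>)
  case (Cons i xs)
  let ?v = "shifted_value R \<gamma> u (xs @ ys)"
  have c: "\<And>\<nu>. ?v \<nu> \<in> carrier R" using g u by (rule shifted_value_closed)
  have "shifted_value R \<gamma> u ((i # xs) @ j # ys) \<nu>
    = (?v (add_mset j (add_mset i \<nu>)) \<ominus> \<gamma> j \<otimes> ?v (add_mset i \<nu>))
      \<ominus> \<gamma> i \<otimes> (?v (add_mset j \<nu>) \<ominus> \<gamma> j \<otimes> ?v \<nu>)"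
    by (simp add: Cons.IH)
  also have "\<dots> = (?v (add_mset j (add_mset i \<nu>)) \<ominus> \<gamma> i \<otimes> ?v (add_mset j \<nu>))
      \<ominus> \<gamma> j \<otimes> (?v (add_mset i \<nu>) \<ominus> \<gamma> i \<otimes> ?v \<nu>)"
    using c g by (simp add: a_minus_def r_distr r_minus minus_add a_ac m_ac)
  finally show ?case by (simp add: add_mset_commute)
qed simp

text \<open>The list only records an order of multiplication for the factors, and these
  commute.\<close>

lemma shifted_value_mset:
  assumes g: "\<And>j. \<gamma> j \<in> carrier R" and u: "\<And>\<rho>. u \<rho> \<in> carrier R" and "mset xs = mset ys"
  shows "shifted_value R \<gamma> u xs \<nu> = shifted_value R \<gamma> u ys \<nu>"
  using assms(3)
proof (induction xs arbitrary: ys \<nu>)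
  case (Cons j xs)
  then have "j \<in> set ys" by (metis list.set_intros(1) mset_eq_setD)
  then obtain ys1 ys2 where ys: "ys = ys1 @ j # ys2" by (meson split_list)
  then have "mset xs = mset (ys1 @ ys2)" using Cons.prems by simp
  then show ?case unfolding ys shifted_value_move[OF g u] using Cons.IH[of "ys1 @ ys2"] by simp
qed simp

text \<open>On forms, the passage from \<open>u\<close> to the function on the left is
  multiplication by the linear polynomial with constant term \<open>e\<close> and coefficients -f_j.
  It commutes with multiplication by the shifted variables.\<close>

lemma shifted_value_linear:
  assumes g: "\<And>j. \<gamma> j \<in> carrier R" and u: "\<And>\<rho>. u \<rho> \<in> carrier R"
    and f: "\<And>j. j \<in> J \<Longrightarrow> f j \<in> carrier R" and J: "finite J" and e: "e \<in> carrier R"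
  shows "shifted_value R \<gamma> (\<lambda>\<nu>. e \<otimes> u \<nu> \<ominus> (\<Oplus>j\<in>J. f j \<otimes> u (add_mset j \<nu>))) xs \<nu>
    = e \<otimes> shifted_value R \<gamma> u xs \<nu> \<ominus> (\<Oplus>j\<in>J. f j \<otimes> shifted_value R \<gamma> u xs (add_mset j \<nu>))"
proof (induction xs arbitrary: \<nu>)
  case (Cons i xs)
  let ?v = "shifted_value R \<gamma> u xs"
  have c: "\<And>\<nu>. ?v \<nu> \<in> carrier R" using g u by (rule shifted_value_closed)
  let ?s = "\<lambda>\<nu>. \<Oplus>j\<in>J. f j \<otimes> ?v (add_mset j \<nu>)"
  have s: "\<And>\<nu>. ?s \<nu> \<in> carrier R" using c f by (intro finsum_closed) auto
  have "(\<Oplus>j\<in>J. f j \<otimes> shifted_value R \<gamma> u (i # xs) (add_mset j \<nu>))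
    = (\<Oplus>j\<in>J. f j \<otimes> ?v (add_mset j (add_mset i \<nu>)) \<oplus> (\<ominus> \<gamma> i) \<otimes> (f j \<otimes> ?v (add_mset j \<nu>)))"
    using c f g by (intro finsum_cong') (auto simp: a_minus_def r_distr l_minus r_minus m_ac add_mset_commute)
  also have "\<dots> = ?s (add_mset i \<nu>) \<oplus> (\<ominus> \<gamma> i) \<otimes> ?s \<nu>"
    using c f g J by (subst finsum_rdistr) (auto intro!: finsum_addf)
  finally have sum: "(\<Oplus>j\<in>J. f j \<otimes> shifted_value R \<gamma> u (i # xs) (add_mset j \<nu>))
    = ?s (add_mset i \<nu>) \<oplus> (\<ominus> \<gamma> i) \<otimes> ?s \<nu>" .
  show ?case
    unfolding sum unfolding shifted_value.simps Cons.IH using c s g e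
    by (simp add: a_minus_def r_distr l_minus r_minus minus_add a_ac m_ac)
qed simp

end

context grading
begin

text \<open>Write t_j = T_j / x for j other than \<open>i0\<close>. Over R_x the forcing algebra is
  the polynomial ring in the t_j, with T_i0 = z/x - (sum of f_j t_j). Over R_y the point T_i = z c_i
  / y solves the equation, which suggests the coordinates s_j = t_j - \<gamma>_j: then T_j = x s_j +
  z c_j / y and T_i0 = z c_i0 / y - (sum of f_j s_j), without x in a denominator. The form to be
  built has values in R_x at monomials in the t_j and values in R_y at monomials in the s_j. Both
  charts are compared inside one ring in which \<open>x\<close> and \<open>y\<close> are
  units.\<close>

lemma exists_recurrence:
  fixes f c :: "'i \<Rightarrow> 'a" and d :: "'i \<Rightarrow> nat"
  assumes x: "x \<in> H a" "x \<in> Units R" and y: "y \<in> H b" "y \<in> Units R"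
    and I: "finite I" "i0 \<in> I" "f i0 = x" "d i0 = a"
    and f: "\<And>i. i \<in> I \<Longrightarrow> f i \<in> H (d i)" and db: "\<And>i. i \<in> I \<Longrightarrow> d i \<le> b"
    and c: "\<And>i. i \<in> I \<Longrightarrow> c i \<in> H (b - d i)" "\<And>i. i \<notin> I \<Longrightarrow> c i = \<zero>"
    and ysum: "y = (\<Oplus>i\<in>I. c i \<otimes> f i)"
    and z: "z \<in> H m" and am: "a \<le> m" and dm: "\<And>i. i \<in> I \<Longrightarrow> i \<noteq> i0 \<Longrightarrow> a + d i \<le> m"
    and split: "\<And>D \<alpha>. N \<le> D \<Longrightarrow> \<alpha> \<in> frac_grade (x \<otimes> y) (a + b) D \<Longrightarrow>
      \<exists>u\<in>frac_grade x a D. \<exists>v\<in>frac_grade y b D. \<alpha> = u \<oplus> v"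
    and inter: "\<And>D \<alpha>. N \<le> D \<Longrightarrow> \<alpha> \<in> frac_grade x a D \<Longrightarrow> \<alpha> \<in> frac_grade y b D \<Longrightarrow> \<alpha> \<in> H D"
    and u0: "u0 \<in> H N"
  shows "\<exists>w. w {#} = u0 \<and> (\<forall>\<mu>. \<exists>D. w \<mu> \<in> H D) \<and>
    (\<forall>\<mu>. (\<Oplus>i\<in>I. f i \<otimes> w (add_mset i \<mu>)) = z \<otimes> w \<mu>)"
proof -
  let ?X = "frac_grade x a" and ?Y = "frac_grade y b" and ?XY = "frac_grade (x \<otimes> y) (a + b)"
  let ?J = "I - {i0}"
  have xc: "x \<in> carrier R" and yc: "y \<in> carrier R" and zc: "z \<in> carrier R"
    using x y z H_carrier by auto
  have xyH: "x \<otimes> y \<in> H (a + b)" by (intro H_mult x y)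
  have xyU: "x \<otimes> y \<in> Units R" using x y by (intro Units_m_closed)
  have XXY: "?X D \<subseteq> ?XY D" for D by (rule frac_grade_mult_right[OF x(1) y(1)])
  have YXY: "?Y D \<subseteq> ?XY D" for D
    using frac_grade_mult_right[OF y(1) x(1)] by (simp add: m_comm[OF yc xc] Groups.add.commute[of b a])
  have cc: "c j \<in> carrier R" for j using c H_carrier by (cases "j \<in> I") auto
  have fc: "f i \<in> carrier R" if "i \<in> I" for i using f[OF that] by (rule H_carrier)
  \<comment> \<open>T_j has degree \<open>m - d j\<close>, so t_j = T_j / x has degree
    \<open>k j\<close>, and so has \<open>\<gamma> j\<close>. By \<open>dm\<close> the subtraction
    does not truncate for j in \<open>?J\<close>.\<close>
  define k where "k j = m - a - d j" for j
  define \<gamma> where "\<gamma> j = inv (x \<otimes> y) \<otimes> (z \<otimes> c j)" for j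
  have gc: "\<gamma> j \<in> carrier R" for j using xyU zc cc by (simp add: \<gamma>_def)
  have kJ: "d j + k j = m - a" "a + k j = m - d j" if "j \<in> ?J" for j
    using dm[of j] that by (auto simp: k_def)
  have i0c: "i0 \<in> I" by (rule I(2))

  \<comment> \<open>For \<open>j = i0\<close> and for \<open>j\<close> outside \<open>I\<close> the shift is irrelevant.\<close>
  define \<delta> where "\<delta> j = (if j \<in> ?J then \<gamma> j else \<zero>)" for j
  have dc: "\<delta> j \<in> carrier R" for j using gc by (simp add: \<delta>_def)
  have dXY: "\<delta> j \<in> ?XY (k j)" for j
  proof (cases "j \<in> ?J")
    case True
    have "z \<otimes> c j \<in> H (m + (b - d j))" using True by (intro H_mult z c) auto
    moreover have "m + (b - d j) = k j + (a + b)" using True dm[of j] db[of j] by (auto simp: k_def)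
    ultimately have "\<gamma> j \<in> ?XY (k j)"
      unfolding \<gamma>_def by (intro frac_grade_inv[OF xyH xyU]) simp
    then show ?thesis using True by (simp add: \<delta>_def)
  next
    case False
    then show ?thesis using frac_grade_zero[OF xyH] by (auto simp: \<delta>_def)
  qed
  have inv_xy: "inv (x \<otimes> y) = inv x \<otimes> inv y"
  proof -
    have "(inv x \<otimes> inv y) \<otimes> (x \<otimes> y) = (inv x \<otimes> x) \<otimes> (inv y \<otimes> y)"
      using x y xc yc by (simp add: m_ac del: Units_l_inv Units_r_inv)
    also have "\<dots> = \<one>" using x y by simp
    finally show ?thesis using x y xc yc by (intro comm_inv_char) (auto simp: m_comm)
  qed
  have xg: "x \<otimes> \<gamma> j = inv y \<otimes> (z \<otimes> c j)" for j
  proof -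
    have "x \<otimes> \<gamma> j = (x \<otimes> inv x) \<otimes> (inv y \<otimes> (z \<otimes> c j))"
      unfolding \<gamma>_def inv_xy using x y xc yc zc cc by (simp add: m_assoc del: Units_r_inv)
    then show ?thesis using x y zc cc by simp
  qed
  have xdY: "x \<otimes> \<delta> j \<in> ?Y (k j + a)" for j
  proof (cases "j \<in> ?J")
    case True
    have "z \<otimes> c j \<in> H (m + (b - d j))" using True by (intro H_mult z c) auto
    moreover have "m + (b - d j) = k j + a + b" using True dm[of j] db[of j] by (auto simp: k_def)
    ultimately show ?thesis
      using True frac_grade_inv[OF y] by (simp add: \<delta>_def xg)
  next
    case False
    then show ?thesis using frac_grade_zero[OF y(1)] xc by (auto simp: \<delta>_def)
  qed

  define K where "K \<nu> = (\<Sum>j\<in>#\<nu>. k j)" for \<nu> :: "'i multiset"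
  have K_add: "K (add_mset j \<nu>) = K \<nu> + k j" "K (\<mu> + \<nu>) = K \<mu> + K \<nu>" "K {#} = 0" for j \<mu> \<nu>
    by (simp_all add: K_def)
  let ?V = "shifted_value R \<delta>" and ?L = "shifted_rest R \<delta>"
  have V_XY: "?V u xs \<nu> \<in> ?XY (N + K (mset xs) + K \<nu>)"
    if "\<And>\<rho>. size \<rho> \<le> length xs + size \<nu> \<Longrightarrow> u \<rho> \<in> ?XY (N + K \<rho>)" for u xs \<nu>
    using that
  proof (induction xs arbitrary: \<nu>)
    case Nil
    then show ?case by (simp add: K_add)
  next
    case (Cons j xs)
    have "?V u xs (add_mset j \<nu>) \<in> ?XY (N + K (mset xs) + K (add_mset j \<nu>))"
      using Cons.prems by (intro Cons.IH) auto
    moreover have "?V u xs \<nu> \<in> ?XY (N + K (mset xs) + K \<nu>)"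
      using Cons.prems by (intro Cons.IH) auto
    from frac_grade_mult[OF xyH dXY[of j] this]
    have "\<delta> j \<otimes> ?V u xs \<nu> \<in> ?XY (N + K (mset (j # xs)) + K \<nu>)" by (simp add: K_add ac_simps)
    ultimately show ?case
      using frac_grade_minus[OF xyH] by (simp add: K_add ac_simps)
  qed
  have L_XY: "?L u xs \<nu> \<in> ?XY (N + K (mset xs) + K \<nu>)"
    if "\<And>\<rho>. size \<rho> < length xs + size \<nu> \<Longrightarrow> u \<rho> \<in> ?XY (N + K \<rho>)" for u xs \<nu>
    using that
  proof (induction xs arbitrary: \<nu>)
    case Nil
    then show ?case using frac_grade_zero[OF xyH] by simp
  next
    case (Cons j xs)
    have "?L u xs (add_mset j \<nu>) \<in> ?XY (N + K (mset xs) + K (add_mset j \<nu>))"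
      using Cons.prems by (intro Cons.IH) auto
    moreover have "?V u xs \<nu> \<in> ?XY (N + K (mset xs) + K \<nu>)"
      using Cons.prems by (intro V_XY) auto
    from frac_grade_mult[OF xyH dXY[of j] this]
    have "\<delta> j \<otimes> ?V u xs \<nu> \<in> ?XY (N + K (mset (j # xs)) + K \<nu>)" by (simp add: K_add ac_simps)
    ultimately show ?case
      using frac_grade_minus[OF xyH] by (simp add: K_add ac_simps)
  qed

  \<comment> \<open>The recursion runs over lists, so an order of each monomial is fixed; by
    \<open>shifted_value_mset\<close> the values do not depend on it.\<close>
  define canon where "canon \<nu> = (SOME xs. mset xs = \<nu>)" for \<nu> :: "'i multiset"
  have canon: "mset (canon \<nu>) = \<nu>" for \<nu> unfolding canon_def by (rule someI_ex[OF ex_mset])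
  have canon_len: "length (canon \<nu>) = size \<nu>" for \<nu> using canon[of \<nu>] by (metis size_mset)
  \<comment> \<open>By \<open>shifted_value_rest\<close> the sum with \<open>?L\<close> is the value
    at the product of the s_j over \<nu>, which has to lie in R_y. The rest is known from smaller
    monomials, and once it is split as \<open>s \<oplus> t\<close>, the choice
    \<open>\<ominus> s\<close> for \<open>u \<nu>\<close> leaves \<open>t\<close>.\<close>
  have "\<exists>u. \<forall>\<nu>. u \<nu> \<in> ?X (N + K \<nu>) \<and> u \<nu> \<oplus> ?L u (canon \<nu>) {#} \<in> ?Y (N + K \<nu>) \<and> (\<nu> = {#} \<longrightarrow> u \<nu> = u0)"
  proof (rule dependent_wf_choice[where R = "measure size"])
    fix u v :: "'i multiset \<Rightarrow> 'a" and \<nu> r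
    assume "\<And>\<rho>. (\<rho>, \<nu>) \<in> measure size \<Longrightarrow> u \<rho> = v \<rho>"
    then have "?L u (canon \<nu>) {#} = ?L v (canon \<nu>) {#}"
      by (intro shifted_rest_cong) (simp add: canon_len)
    then show "(r \<in> ?X (N + K \<nu>) \<and> r \<oplus> ?L u (canon \<nu>) {#} \<in> ?Y (N + K \<nu>) \<and> (\<nu> = {#} \<longrightarrow> r = u0))
      = (r \<in> ?X (N + K \<nu>) \<and> r \<oplus> ?L v (canon \<nu>) {#} \<in> ?Y (N + K \<nu>) \<and> (\<nu> = {#} \<longrightarrow> r = u0))"
      by simp
  next
    fix \<nu> and u :: "'i multiset \<Rightarrow> 'a"
    assume IH: "\<And>\<rho>. (\<rho>, \<nu>) \<in> measure size \<Longrightarrow>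
      u \<rho> \<in> ?X (N + K \<rho>) \<and> u \<rho> \<oplus> ?L u (canon \<rho>) {#} \<in> ?Y (N + K \<rho>) \<and> (\<rho> = {#} \<longrightarrow> u \<rho> = u0)"
    show "\<exists>r. r \<in> ?X (N + K \<nu>) \<and> r \<oplus> ?L u (canon \<nu>) {#} \<in> ?Y (N + K \<nu>) \<and> (\<nu> = {#} \<longrightarrow> r = u0)"
    proof (cases "\<nu> = {#}")
      case True
      have "canon {#} = []" using canon[of "{#}"] by simp
      then show ?thesis
        using True u0 H_carrier[OF u0] H_frac_grade[OF x(1) u0] H_frac_grade[OF y(1) u0]
        by (intro exI[of _ u0]) (simp add: K_add)
    next
      case False
      have "?L u (canon \<nu>) {#} \<in> ?XY (N + K (mset (canon \<nu>)) + K {#})"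
        using IH XXY by (intro L_XY) (auto simp: canon_len)
      then have "?L u (canon \<nu>) {#} \<in> ?XY (N + K \<nu>)" by (simp add: canon K_add)
      from split[OF le_add1 this] obtain s t
        where st: "s \<in> ?X (N + K \<nu>)" "t \<in> ?Y (N + K \<nu>)" "?L u (canon \<nu>) {#} = s \<oplus> t" by blast
      have "s \<in> carrier R" "t \<in> carrier R"
        using st frac_grade_carrier[OF x(1)] frac_grade_carrier[OF y(1)] by blast+
      then have "\<ominus> s \<oplus> (s \<oplus> t) = t" by (simp add: r_neg1)
      then show ?thesis using False st frac_grade_neg[OF x(1) st(1)] by (intro exI[of _ "\<ominus> s"]) simp
    qed
  qed simp
  then obtain u where u: "\<And>\<nu>. u \<nu> \<in> ?X (N + K \<nu>)" "\<And>\<nu>. u \<nu> \<oplus> ?L u (canon \<nu>) {#} \<in> ?Y (N + K \<nu>)" "u {#} = u0"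
    by blast
  have uc: "u \<nu> \<in> carrier R" for \<nu> using u(1) frac_grade_carrier[OF x(1)] by blast

  define e where "e = inv x \<otimes> z"
  have ec: "e \<in> carrier R" using x zc by (simp add: e_def)
  have eX: "e \<in> ?X (m - a)"
    unfolding e_def using z am by (intro frac_grade_inv[OF x]) simp
  \<comment> \<open>\<open>\<Psi> l \<nu>\<close> is the value at T_i0^l t^\<nu>, because T_i0 is e
    minus the sum of the f_j t_j.\<close>
  define \<Psi> where "\<Psi> = rec_nat u (\<lambda>_ v \<nu>. e \<otimes> v \<nu> \<ominus> (\<Oplus>j\<in>?J. f j \<otimes> v (add_mset j \<nu>)))"
  have \<Psi>0: "\<Psi> 0 = u" and \<Psi>Suc: "\<Psi> (Suc l) = (\<lambda>\<nu>. e \<otimes> \<Psi> l \<nu> \<ominus> (\<Oplus>j\<in>?J. f j \<otimes> \<Psi> l (add_mset j \<nu>)))" for l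
    by (simp_all add: \<Psi>_def)
  have JI: "j \<in> I" if "j \<in> ?J" for j using that by blast
  have \<Psi>X: "\<Psi> l \<nu> \<in> ?X (N + l * (m - a) + K \<nu>)" for l \<nu>
  proof (induction l arbitrary: \<nu>)
    case 0
    then show ?case using u(1) by (simp add: \<Psi>0)
  next
    case (Suc l)
    have "e \<otimes> \<Psi> l \<nu> \<in> ?X (N + Suc l * (m - a) + K \<nu>)"
      using frac_grade_mult[OF x(1) eX Suc.IH[of \<nu>]] by (simp add: ac_simps)
    moreover have "f j \<otimes> \<Psi> l (add_mset j \<nu>) \<in> ?X (N + Suc l * (m - a) + K \<nu>)" if "j \<in> ?J" for j
    proof -
      have eq: "d j + (N + l * (m - a) + K (add_mset j \<nu>)) = N + Suc l * (m - a) + K \<nu>"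
        using kJ(1)[OF that] by (simp add: K_add)
      show ?thesis
        using frac_grade_mult[OF x(1) H_frac_grade[OF x(1) f[OF JI[OF that]]] Suc.IH[of "add_mset j \<nu>"]]
        unfolding eq .
    qed
    ultimately show ?case
      unfolding \<Psi>Suc by (intro frac_grade_minus[OF x(1)] frac_grade_finsum[OF x(1)]) auto
  qed
  have \<Psi>c: "\<Psi> l \<nu> \<in> carrier R" for l \<nu> using \<Psi>X frac_grade_carrier[OF x(1)] by blast
  have Vc: "?V (\<Psi> l) xs \<nu> \<in> carrier R" for l xs \<nu> using dc \<Psi>c by (rule shifted_value_closed)

  \<comment> \<open>The constant term of T_i0 in the coordinates s_j.\<close>
  define e' where "e' = inv y \<otimes> (z \<otimes> c i0)"
  have e'Y: "e' \<in> ?Y (m - a)"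
  proof -
    have "z \<otimes> c i0 \<in> H (m + (b - d i0))" by (intro H_mult z c I(2))
    moreover have "m + (b - d i0) = m - a + b" using am db[OF I(2)] I(4) by simp
    ultimately show ?thesis unfolding e'_def by (intro frac_grade_inv[OF y]) simp
  qed
  \<comment> \<open>This is the equation for \<open>y\<close> as a combination of the
    \<open>f i\<close>, multiplied by z / (x y). It converts T_i0 from the coordinates t_j to the
    coordinates s_j.\<close>
  have e': "e = e' \<oplus> (\<Oplus>j\<in>?J. f j \<otimes> \<delta> j)"
  proof -
    have ydec: "y = c i0 \<otimes> f i0 \<oplus> (\<Oplus>j\<in>?J. c j \<otimes> f j)"
      using I(1,2) cc fc unfolding ysum
      by (subst insert_Diff[OF I(2), symmetric], subst finsum_insert) auto
    have "e = (inv x \<otimes> (inv y \<otimes> z)) \<otimes> (c i0 \<otimes> x \<oplus> (\<Oplus>j\<in>?J. c j \<otimes> f j))"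
    proof -
      have "(inv x \<otimes> (inv y \<otimes> z)) \<otimes> y = inv x \<otimes> (z \<otimes> (inv y \<otimes> y))"
        using x y yc zc by (simp add: m_ac del: Units_l_inv Units_r_inv)
      then have "e = (inv x \<otimes> (inv y \<otimes> z)) \<otimes> y" using y zc by (simp add: e_def)
      then show ?thesis using ydec I(3) by metis
    qed
    also have "\<dots> = (inv x \<otimes> (inv y \<otimes> z)) \<otimes> (c i0 \<otimes> x)
        \<oplus> (inv x \<otimes> (inv y \<otimes> z)) \<otimes> (\<Oplus>j\<in>?J. c j \<otimes> f j)"
      using x y xc zc cc fc by (intro r_distr) (auto intro!: finsum_closed)
    also have "(inv x \<otimes> (inv y \<otimes> z)) \<otimes> (c i0 \<otimes> x) = (inv x \<otimes> x) \<otimes> e'"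
      using x y xc zc cc by (simp add: e'_def m_ac del: Units_l_inv Units_r_inv)
    also have "\<dots> = e'" using x y zc cc by (simp add: e'_def)
    also have "(inv x \<otimes> (inv y \<otimes> z)) \<otimes> (\<Oplus>j\<in>?J. c j \<otimes> f j) = (\<Oplus>j\<in>?J. f j \<otimes> \<delta> j)"
    proof -
      have "(inv x \<otimes> (inv y \<otimes> z)) \<otimes> (c j \<otimes> f j) = f j \<otimes> \<delta> j" if "j \<in> ?J" for j
      proof -
        have "\<delta> j = \<gamma> j" using that by (simp add: \<delta>_def)
        then show ?thesis
          using x y zc cc fc[OF JI[OF that]] by (simp add: \<gamma>_def inv_xy m_ac)
      qed
      then show ?thesis
        using x y zc cc fc dc I(1) by (subst finsum_rdistr) (auto intro!: finsum_cong')
    qed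
    finally show ?thesis .
  qed
  have add_var: "?V (\<Psi> l) xs (add_mset j \<nu>) = ?V (\<Psi> l) (j # xs) \<nu> \<oplus> \<delta> j \<otimes> ?V (\<Psi> l) xs \<nu>" for l xs j \<nu>
    using Vc dc by (simp add: a_minus_def a_assoc l_neg)
  \<comment> \<open>Values at T_i0^l times a product of the s_j. Each factor T_i0 is rewritten as e'
    minus the sum of the f_j s_j, so no denominator x appears.\<close>
  have VY: "?V (\<Psi> l) xs {#} \<in> ?Y (N + l * (m - a) + K (mset xs))" for l xs
  proof (induction l arbitrary: xs)
    case 0
    have "?V u xs {#} = ?V u (canon (mset xs)) {#}"
      using dc uc by (rule shifted_value_mset) (simp add: canon)
    also have "\<dots> = u (mset xs) \<oplus> ?L u (canon (mset xs)) {#}"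
      using shifted_value_rest[of \<delta> u, OF dc uc] by (simp add: canon)
    finally show ?case using u(2) by (simp add: \<Psi>0)
  next
    case (Suc l)
    let ?v = "?V (\<Psi> l) xs {#}" and ?w = "\<lambda>j. ?V (\<Psi> l) (j # xs) {#}"
    have cl: "?v \<in> carrier R" "\<And>j. ?w j \<in> carrier R" using Vc by blast+
    have "?V (\<Psi> (Suc l)) xs {#} = e \<otimes> ?v \<ominus> (\<Oplus>j\<in>?J. f j \<otimes> ?V (\<Psi> l) xs (add_mset j {#}))"
      unfolding \<Psi>Suc using fc I(1) by (intro shifted_value_linear dc \<Psi>c ec) auto
    also have "(\<Oplus>j\<in>?J. f j \<otimes> ?V (\<Psi> l) xs (add_mset j {#})) = (\<Oplus>j\<in>?J. f j \<otimes> ?w j \<oplus> (f j \<otimes> \<delta> j) \<otimes> ?v)"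
      unfolding add_var using fc dc cl
      by (intro finsum_cong') (auto simp: r_distr m_assoc simp del: shifted_value.simps)
    also have "\<dots> = (\<Oplus>j\<in>?J. f j \<otimes> ?w j) \<oplus> (\<Oplus>j\<in>?J. f j \<otimes> \<delta> j) \<otimes> ?v"
      using fc dc cl I(1)
      by (subst finsum_ldistr) (auto intro!: finsum_addf simp del: shifted_value.simps)
    also have "e \<otimes> ?v \<ominus> ((\<Oplus>j\<in>?J. f j \<otimes> ?w j) \<oplus> (\<Oplus>j\<in>?J. f j \<otimes> \<delta> j) \<otimes> ?v)
      = e' \<otimes> ?v \<ominus> (\<Oplus>j\<in>?J. f j \<otimes> ?w j)"
    proof -
      have fin: "(\<Oplus>j\<in>?J. f j \<otimes> ?w j) \<in> carrier R" "(\<Oplus>j\<in>?J. f j \<otimes> \<delta> j) \<in> carrier R" "e' \<in> carrier R"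
        using fc dc cl frac_grade_carrier[OF y(1) e'Y] by (auto intro!: finsum_closed simp del: shifted_value.simps)
      have "e \<otimes> ?v = e' \<otimes> ?v \<oplus> (\<Oplus>j\<in>?J. f j \<otimes> \<delta> j) \<otimes> ?v"
        unfolding e' using fin cl by (intro l_distr)
      then show ?thesis
        using fin cl by (simp add: a_minus_def minus_add a_assoc a_lcomm[of "(\<Oplus>j\<in>?J. f j \<otimes> \<delta> j) \<otimes> ?v"] r_neg
            del: shifted_value.simps)
    qed
    also have "\<dots> \<in> ?Y (N + Suc l * (m - a) + K (mset xs))"
    proof (intro frac_grade_minus[OF y(1)] frac_grade_finsum[OF y(1)])
      show "e' \<otimes> ?v \<in> ?Y (N + Suc l * (m - a) + K (mset xs))"
        using frac_grade_mult[OF y(1) e'Y Suc.IH[of xs]] by (simp add: ac_simps)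
      fix j assume j: "j \<in> ?J"
      have eq: "d j + (N + l * (m - a) + K (mset (j # xs))) = N + Suc l * (m - a) + K (mset xs)"
        using kJ(1)[OF j] by (simp add: K_add)
      show "f j \<otimes> ?w j \<in> ?Y (N + Suc l * (m - a) + K (mset xs))"
        using frac_grade_mult[OF y(1) H_frac_grade[OF y(1) f[OF JI[OF j]]] Suc.IH[of "j # xs"]]
        unfolding eq .
    qed
    finally show ?case .
  qed
  \<comment> \<open>In t_j = s_j + \<delta>_j only \<delta>_j has x in its denominator, and x
    \<delta>_j = z c_j / y does not. One factor \<open>x\<close> for each t_j is therefore
    enough.\<close>
  have powVY: "x [^] size \<nu> \<otimes> ?V (\<Psi> l) xs \<nu> \<in> ?Y (N + l * (m - a) + K (mset xs) + (K \<nu> + size \<nu> * a))" for l xs \<nu>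
  proof (induction \<nu> arbitrary: xs)
    case empty
    then show ?case using VY Vc by (simp add: K_add)
  next
    case (add j \<nu>)
    let ?E = "N + l * (m - a) + K (mset xs) + (K (add_mset j \<nu>) + size (add_mset j \<nu>) * a)"
    have pc: "x [^] size \<nu> \<in> carrier R" using xc by simp
    have "x [^] size (add_mset j \<nu>) \<otimes> ?V (\<Psi> l) xs (add_mset j \<nu>)
      = x \<otimes> (x [^] size \<nu> \<otimes> ?V (\<Psi> l) (j # xs) \<nu>) \<oplus> (x \<otimes> \<delta> j) \<otimes> (x [^] size \<nu> \<otimes> ?V (\<Psi> l) xs \<nu>)"
      unfolding add_var using xc dc Vc[of l "j # xs" \<nu>] Vc[of l xs \<nu>] pc
      by (simp add: r_distr m_ac del: shifted_value.simps)
    also have "\<dots> \<in> ?Y ?E"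
    proof (rule frac_grade_add[OF y(1)])
      show "x \<otimes> (x [^] size \<nu> \<otimes> ?V (\<Psi> l) (j # xs) \<nu>) \<in> ?Y ?E"
        using frac_grade_mult[OF y(1) H_frac_grade[OF y(1) x(1)] add.IH[of "j # xs"]]
        by (simp add: K_add ac_simps)
      show "(x \<otimes> \<delta> j) \<otimes> (x [^] size \<nu> \<otimes> ?V (\<Psi> l) xs \<nu>) \<in> ?Y ?E"
        using frac_grade_mult[OF y(1) xdY[of j] add.IH[of xs]] by (simp add: K_add ac_simps)
    qed
    finally show ?case .
  qed

  \<comment> \<open>Since T_j = x t_j for j other than \<open>i0\<close>, the monomial T^\<mu> is a
    power of \<open>x\<close> with exponent \<open>size (rest \<mu>)\<close>, times T_i0 to the
    power \<open>count \<mu> i0\<close>, times the monomial \<open>rest \<mu>\<close> in the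
    t_j.\<close>
  define rest where "rest \<mu> = filter_mset (\<lambda>i. i \<noteq> i0) \<mu>" for \<mu>
  define w where "w \<mu> = x [^] size (rest \<mu>) \<otimes> \<Psi> (count \<mu> i0) (rest \<mu>)" for \<mu>
  have "\<exists>D. w \<mu> \<in> H D" for \<mu>
  proof -
    let ?E = "N + count \<mu> i0 * (m - a) + (K (rest \<mu>) + size (rest \<mu>) * a)"
    have "w \<mu> \<in> ?Y ?E"
      using powVY[of "rest \<mu>" "count \<mu> i0" "[]"] by (simp add: w_def K_add)
    moreover have "w \<mu> \<in> ?X ?E"
      unfolding w_def
      using frac_grade_mult[OF x(1) H_frac_grade[OF x(1) H_pow[OF x(1), of "size (rest \<mu>)"]] \<Psi>X[of "count \<mu> i0" "rest \<mu>"]]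
      by (simp add: ac_simps)
    ultimately show ?thesis using inter[of ?E] by auto
  qed
  moreover have "(\<Oplus>i\<in>I. f i \<otimes> w (add_mset i \<mu>)) = z \<otimes> w \<mu>" for \<mu>
  proof -
    let ?n = "rest \<mu>" and ?l = "count \<mu> i0" and ?p = "x [^] size (rest \<mu>)"
    let ?s = "\<Oplus>j\<in>?J. f j \<otimes> \<Psi> ?l (add_mset j ?n)"
    have pc: "?p \<in> carrier R" using xc by simp
    have sc: "?s \<in> carrier R" using fc \<Psi>c by (intro finsum_closed) auto
    have w0: "w (add_mset i0 \<mu>) = ?p \<otimes> (e \<otimes> \<Psi> ?l ?n \<ominus> ?s)"
      by (simp add: w_def rest_def \<Psi>Suc)
    have wj: "w (add_mset j \<mu>) = (x \<otimes> ?p) \<otimes> \<Psi> ?l (add_mset j ?n)" if "j \<in> ?J" for j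
      using that xc by (simp add: w_def rest_def m_comm)
    have wc: "w \<nu> \<in> carrier R" for \<nu> using xc \<Psi>c by (simp add: w_def)
    have "(\<Oplus>i\<in>I. f i \<otimes> w (add_mset i \<mu>)) = x \<otimes> w (add_mset i0 \<mu>) \<oplus> (\<Oplus>j\<in>?J. f j \<otimes> w (add_mset j \<mu>))"
      using I fc wc xc by (subst insert_Diff[OF I(2), symmetric], subst finsum_insert) auto
    also have "(\<Oplus>j\<in>?J. f j \<otimes> w (add_mset j \<mu>)) = (\<Oplus>j\<in>?J. (x \<otimes> ?p) \<otimes> (f j \<otimes> \<Psi> ?l (add_mset j ?n)))"
      using fc \<Psi>c xc pc by (intro finsum_cong') (auto simp: wj m_ac)
    also have "\<dots> = (x \<otimes> ?p) \<otimes> ?s"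
      using fc \<Psi>c xc pc I(1) by (intro finsum_rdistr[symmetric]) auto
    also have "x \<otimes> w (add_mset i0 \<mu>) \<oplus> (x \<otimes> ?p) \<otimes> ?s = (x \<otimes> ?p) \<otimes> ((e \<otimes> \<Psi> ?l ?n \<ominus> ?s) \<oplus> ?s)"
      unfolding w0 using xc pc ec \<Psi>c sc by (simp add: r_distr m_assoc)
    also have "(e \<otimes> \<Psi> ?l ?n \<ominus> ?s) \<oplus> ?s = e \<otimes> \<Psi> ?l ?n"
      using ec \<Psi>c sc by (simp add: a_minus_def a_assoc l_neg)
    also have "(x \<otimes> ?p) \<otimes> (e \<otimes> \<Psi> ?l ?n) = (x \<otimes> e) \<otimes> w \<mu>"
      using xc pc ec \<Psi>c by (simp add: w_def m_ac)
    also have "x \<otimes> e = z" unfolding e_def using x xc zc by (simp flip: m_assoc)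
    finally show ?thesis .
  qed
  moreover have "w {#} = u0" using u(3) H_carrier[OF u0] by (simp add: w_def rest_def \<Psi>0)
  ultimately show ?thesis by blast
qed

end

section \<open>The recurrence in a graded domain\<close>

lemma (in grading) H_finsum: "(\<And>i. i \<in> A \<Longrightarrow> g i \<in> H d) \<Longrightarrow> (\<Oplus>i\<in>A. g i) \<in> H d"
  by (induction A rule: infinite_finite_induct) (auto simp: finsum_insert Pi_def H_closed H_carrier[of _ d])

context graded_domain
begin

lemma Idl_finite_image:
  assumes "finite I" "\<And>i. i \<in> I \<Longrightarrow> f i \<in> carrier R" and z: "z \<in> Idl (f ` I)"
  shows "\<exists>r. (\<forall>i. r i \<in> carrier R) \<and> z = (\<Oplus>i\<in>I. r i \<otimes> f i)"
proof -
  let ?K = "{\<Oplus>i\<in>I. r i \<otimes> f i | r. \<forall>i. r i \<in> carrier R}"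
  have cl: "(\<Oplus>i\<in>I. r i \<otimes> f i) \<in> carrier R" if "\<forall>i. r i \<in> carrier R" for r
    using that assms(2) by (intro finsum_closed) auto
  have mult: "y \<otimes> k \<in> ?K" if k: "k \<in> ?K" and y: "y \<in> carrier R" for k y
  proof -
    obtain r where r: "\<forall>i. r i \<in> carrier R" "k = (\<Oplus>i\<in>I. r i \<otimes> f i)" using k by blast
    have "y \<otimes> k = (\<Oplus>i\<in>I. y \<otimes> (r i \<otimes> f i))"
      unfolding r(2) using assms(1,2) r(1) y by (intro finsum_rdistr) auto
    also have "\<dots> = (\<Oplus>i\<in>I. (y \<otimes> r i) \<otimes> f i)"
      using assms(2) r(1) y by (intro finsum_cong') (auto simp: m_assoc)
    finally show ?thesis using r(1) y by (intro CollectI exI[of _ "\<lambda>i. y \<otimes> r i"]) auto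
  qed
  have "ideal ?K R"
  proof (intro idealI ring_axioms add.subgroupI)
    show "?K \<subseteq> carrier R" using cl by blast
    show "?K \<noteq> {}" by blast
    fix k assume k: "k \<in> ?K"
    then have kc: "k \<in> carrier R" using cl by blast
    show "\<ominus> k \<in> ?K" using mult[OF k, of "\<ominus> \<one>"] kc by (simp add: l_minus)
    show "k \<oplus> k' \<in> ?K" if "k' \<in> ?K" for k'
    proof -
      obtain r r' where r: "\<forall>i. r i \<in> carrier R" "k = (\<Oplus>i\<in>I. r i \<otimes> f i)"
        and r': "\<forall>i. r' i \<in> carrier R" "k' = (\<Oplus>i\<in>I. r' i \<otimes> f i)" using k \<open>k' \<in> ?K\<close> by blast
      have "k \<oplus> k' = (\<Oplus>i\<in>I. r i \<otimes> f i \<oplus> r' i \<otimes> f i)"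
        unfolding r r' using assms(2) r r' by (intro finsum_addf[symmetric]) auto
      also have "\<dots> = (\<Oplus>i\<in>I. (r i \<oplus> r' i) \<otimes> f i)"
        using assms(2) r r' by (intro finsum_cong') (auto simp: l_distr)
      finally show ?thesis using r(1) r'(1) by (intro CollectI exI[of _ "\<lambda>i. r i \<oplus> r' i"]) auto
    qed
    fix y assume y: "y \<in> carrier R"
    show "y \<otimes> k \<in> ?K" by (rule mult[OF k y])
    then show "k \<otimes> y \<in> ?K" using m_comm[OF kc y] by simp
  qed
  moreover have "f ` I \<subseteq> ?K"
  proof
    fix g assume "g \<in> f ` I"
    then obtain i where i: "i \<in> I" "g = f i" by blast
    have "(\<Oplus>j\<in>I. (if j = i then \<one> else \<zero>) \<otimes> f j) = (\<Oplus>j\<in>I. if i = j then f j else \<zero>)"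
      using assms(2) by (intro finsum_cong') auto
    also have "\<dots> = f i" using i assms(1,2) by (intro finsum_singleton) auto
    finally show "g \<in> ?K"
      using i by (intro CollectI exI[of _ "\<lambda>j. if j = i then \<one> else \<zero>"]) auto
  qed
  ultimately have "Idl (f ` I) \<subseteq> ?K" by (rule genideal_minimal)
  then show ?thesis using z by blast
qed

lemma homogeneous_coefficients:
  assumes I: "finite I" and f: "\<And>i. i \<in> I \<Longrightarrow> f i \<in> G (d i)" and y: "y \<in> Idl (f ` I)" "y \<in> G b"
    and db: "\<And>i. i \<in> I \<Longrightarrow> d i \<le> b"
  shows "\<exists>c. (\<forall>i\<in>I. c i \<in> G (b - d i)) \<and> y = (\<Oplus>i\<in>I. c i \<otimes> f i)"
proof -
  have fc: "f i \<in> carrier R" if "i \<in> I" for i using f[OF that] by (rule grade_carrier)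
  obtain r where r: "\<forall>i. r i \<in> carrier R" "y = (\<Oplus>i\<in>I. r i \<otimes> f i)"
    using Idl_finite_image[OF I fc y(1)] by blast
  have "y = component y b" using y(2) by (simp add: component_grade_eq)
  also have "\<dots> = (\<Oplus>i\<in>I. component (r i \<otimes> f i) b)"
    unfolding r(2) using fc r(1) by (intro component_finsum) auto
  also have "\<dots> = (\<Oplus>i\<in>I. component (r i) (b - d i) \<otimes> f i)"
  proof (rule finsum_cong')
    fix i assume i: "i \<in> I"
    have "component (r i \<otimes> f i) b = component (f i \<otimes> r i) b" using fc[OF i] r(1) by (simp add: m_comm)
    also have "\<dots> = f i \<otimes> component (r i) (b - d i)"
      using component_mult_grade[OF f[OF i], of "r i" b] db[OF i] r(1) by simp
    finally show "component (r i \<otimes> f i) b = component (r i) (b - d i) \<otimes> f i" using fc[OF i] r(1) by (simp add: m_comm)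
  qed (use fc r(1) in auto)
  finally show ?thesis using component_grade r(1) by (intro exI[of _ "\<lambda>i. component (r i) (b - d i)"]) auto
qed

lemma Idl_hideal:
  assumes I: "finite I" and f: "\<And>i. i \<in> I \<Longrightarrow> f i \<in> G (d i)"
  shows "hideal (Idl (f ` I))"
proof -
  have fc: "f i \<in> carrier R" if "i \<in> I" for i using f[OF that] by (rule grade_carrier)
  have sub: "f ` I \<subseteq> carrier R" using fc by blast
  interpret J: ideal "Idl (f ` I)" R by (rule genideal_ideal[OF sub])
  have "component z e \<in> Idl (f ` I)" if z: "z \<in> Idl (f ` I)" for z e
  proof -
    obtain r where r: "\<forall>i. r i \<in> carrier R" "z = (\<Oplus>i\<in>I. r i \<otimes> f i)"
      using Idl_finite_image[OF I fc z] by blast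
    have "component z e = (\<Oplus>i\<in>I. component (r i \<otimes> f i) e)"
      unfolding r(2) using fc r(1) by (intro component_finsum) auto
    also have "\<dots> \<in> Idl (f ` I)"
    proof (rule J.finsum_in_ideal)
      fix i assume i: "i \<in> I"
      have "component (r i \<otimes> f i) e = (if d i \<le> e then f i \<otimes> component (r i) (e - d i) else \<zero>)"
        using fc[OF i] r(1) component_mult_grade[OF f[OF i], of "r i" e] by (simp add: m_comm)
      moreover have "f i \<in> Idl (f ` I)" using genideal_self[OF sub] i by blast
      ultimately show "component (r i \<otimes> f i) e \<in> Idl (f ` I)" using J.I_r_closed r(1) by simp
    qed
    finally show ?thesis .
  qed
  then show ?thesis using J.is_ideal by (simp add: hideal_def)
qed

lemma nonzero_mult_subset: "mult_subset R (carrier R - {\<zero>})"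
  by unfold_locales (auto simp: integral_iff)

text \<open>The two charts are placed in the fraction field. The hypothesis \<open>dim\<close>
  provides the second parameter, \<open>chain\<close> shows that it is not zero, and the splitting
  and intersection properties hold from degree \<open>N\<close> on.\<close>

lemma exists_recurrence_graded:
  fixes f :: "'i \<Rightarrow> 'a" and d :: "'i \<Rightarrow> nat"
  assumes I: "finite I" "i0 \<in> I" "f i0 \<noteq> \<zero>"
    and f: "\<And>i. i \<in> I \<Longrightarrow> f i \<in> G (d i)" and d: "1 \<le> d i0"
    and primary: "\<And>P. primeideal P R \<Longrightarrow> f ` I \<subseteq> P \<Longrightarrow> high 1 \<subseteq> P"
    and dim: "\<And>P Q. primeideal P R \<Longrightarrow> primeideal Q R \<Longrightarrow> {\<zero>} \<subset> P \<Longrightarrow> P \<subset> Q \<Longrightarrow> Q \<subset> high 1 \<Longrightarrow> False"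
    and chain: "primeideal P0 R" "primeideal P1 R" "primeideal P2 R" "P0 \<subset> P1" "P1 \<subset> P2"
    and z: "z \<in> G m" and am: "d i0 \<le> m" and dm: "\<And>i. i \<in> I \<Longrightarrow> i \<noteq> i0 \<Longrightarrow> d i0 + d i \<le> m"
  shows "\<exists>w. (\<forall>\<mu>. w \<mu> \<in> carrier R) \<and> w {#} \<noteq> \<zero> \<and>
    (\<forall>\<mu>. (\<Oplus>i\<in>I. f i \<otimes> w (add_mset i \<mu>)) = z \<otimes> w \<mu>)"
proof -
  have fc: "f i \<in> carrier R" if "i \<in> I" for i using f[OF that] by (rule grade_carrier)
  define x where "x = f i0"
  define a where "a = d i0"
  have x: "x \<in> G a" "x \<noteq> \<zero>" "x \<in> carrier R" and a: "a \<ge> 1"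
    using f[OF I(2)] fc[OF I(2)] I(3) d by (auto simp: x_def a_def)
  have sub: "f ` I \<subseteq> carrier R" using fc by blast
  let ?J = "Idl (f ` I)"
  interpret J: ideal ?J R by (rule genideal_ideal[OF sub])
  have prim: "high 1 \<subseteq> P" if "primeideal P R" "?J \<subseteq> P" for P
    using primary[OF that(1)] that(2) genideal_self[OF sub] by blast
  have J_h: "hideal ?J" by (rule Idl_hideal[OF I(1) f])
  obtain b0 y0 k0 where y0: "b0 \<ge> 1" "y0 \<in> G b0" "y0 \<in> ?J" "\<And>e. e \<ge> k0 \<Longrightarrow> G e \<subseteq> extend (PIdl x) y0"
  proof (rule exists_parameter[OF x(1,2) J_h])
    show "high 1 \<subseteq> P" if "primeideal P R" "?J \<subseteq> P" for P using that by (rule prim)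
    show False if "primeideal P R" "primeideal Q R" "{\<zero>} \<subset> P" "P \<subset> Q" "Q \<subset> high 1" for P Q
      using that by (rule dim)
  qed (rule that)
  have y0c: "y0 \<in> carrier R" by (rule grade_carrier[OF y0(2)])
  \<comment> \<open>With \<open>y0\<close> zero, (x) would contain all large degrees, which the
    three primes of \<open>chain\<close> exclude.\<close>
  have y0nz: "y0 \<noteq> \<zero>"
  proof
    assume "y0 = \<zero>"
    then have "extend (PIdl x) y0 \<subseteq> PIdl x"
      using hideal_carrier[OF principal_hideal[OF x(1)]] by (auto simp: extend_mem)
    then have "\<And>e. e \<ge> k0 \<Longrightarrow> G e \<subseteq> PIdl x" using y0(4) by blast
    then show False by (rule no_prime_chain_of_principal[OF x(1) a _ chain])
  qed
  \<comment> \<open>Writing \<open>y\<close> as a combination of the \<open>f i\<close> with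
    coefficients of degree \<open>b - d i\<close> needs \<open>b\<close> to be at least every
    \<open>d i\<close>; a sufficiently high power of \<open>y0\<close> achieves this.\<close>
  define q where "q = Suc (\<Sum>i\<in>I. d i)"
  define y where "y = y0 [^] q"
  define b where "b = q * b0"
  have y: "y \<in> G b" "y \<in> carrier R" unfolding y_def b_def using grade_pow[OF y0(2)] y0c by auto
  have db: "d i \<le> b" if "i \<in> I" for i
  proof -
    have "d i \<le> (\<Sum>i\<in>I. d i)" by (rule member_le_sum[OF that _ I(1)]) simp
    also have "\<dots> \<le> q * 1" by (simp add: q_def)
    also have "\<dots> \<le> q * b0" using y0(1) by (rule mult_le_mono2)
    finally show ?thesis by (simp add: b_def)
  qed
  have yJ: "y \<in> ?J"
    using J.I_l_closed[OF y0(3), of "y0 [^] (\<Sum>i\<in>I. d i)"] y0c by (simp add: y_def q_def)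
  have ynz: "y \<noteq> \<zero>"
  proof -
    have "y0 \<notin> {\<zero>}" using y0nz by simp
    from prime_pow[OF zeroprimeideal y0c this, of q] show ?thesis by (simp add: y_def)
  qed
  \<comment> \<open>The bound of \<open>grade_split\<close> for the exponents 1 of \<open>x\<close>
    and \<open>q\<close> of \<open>y0\<close>.\<close>
  define k where "k = 1 * a + q * b0 + k0"
  have k: "G e \<subseteq> extend (PIdl x) y" if e: "e \<ge> k" for e
  proof
    fix r assume "r \<in> G e"
    then obtain u v where uv: "u \<in> G (e - 1 * a)" "v \<in> G (e - q * b0)" "r = x [^] (1::nat) \<otimes> u \<oplus> y0 [^] q \<otimes> v"
      using grade_split[OF x(1) y0(2,4), where p = 1 and q = q and d = e] e unfolding k_def by blast
    have c: "u \<in> carrier R" "v \<in> carrier R" using uv grade_carrier by blast+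
    have "u \<otimes> x \<in> PIdl x" using c unfolding cgenideal_def by blast
    moreover have "r = u \<otimes> x \<oplus> v \<otimes> y" using uv(3) c x(3) y(2) by (simp add: y_def m_comm)
    ultimately show "r \<in> extend (PIdl x) y" unfolding extend_mem using c by blast
  qed
  obtain c0 where c0: "\<forall>i\<in>I. c0 i \<in> G (b - d i)" "y = (\<Oplus>i\<in>I. c0 i \<otimes> f i)"
    using homogeneous_coefficients[OF I(1) f yJ y(1) db] by blast
  define c where "c i = (if i \<in> I then c0 i else \<zero>)" for i
  have c: "\<And>i. i \<in> I \<Longrightarrow> c i \<in> G (b - d i)" "\<And>i. i \<notin> I \<Longrightarrow> c i = \<zero>"
    using c0(1) by (auto simp: c_def)
  have cc: "c i \<in> carrier R" for i using c grade_carrier by (cases "i \<in> I") auto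
  have ysum: "y = (\<Oplus>i\<in>I. c i \<otimes> f i)"
    unfolding c0(2) using cc fc by (intro finsum_cong') (auto simp: c_def)
  obtain N0 where N0: "\<And>e r. N0 \<le> e \<Longrightarrow> r \<in> G e \<Longrightarrow> (\<And>s. s \<in> S \<Longrightarrow> s \<otimes> r \<in> PIdl x) \<Longrightarrow> r \<in> PIdl x"
    using socle_bound[OF x(1)] by blast
  \<comment> \<open>A multiple of \<open>a\<close>, so that a power of \<open>x\<close> can serve as
    the nonzero starting value, and at least as large as both bounds.\<close>
  define N where "N = (k + N0) * a"
  have N: "k \<le> N" "N0 \<le> N" using a unfolding N_def
    by (metis le_add1 le_add2 le_trans mult.right_neutral mult_le_mono2)+

  interpret ms: mult_subset R "carrier R - {\<zero>}" by (rule nonzero_mult_subset)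
  let ?F = "ms.loc" and ?e = "ms.emb"
  interpret F: domain ?F by (rule ms.loc_domain)
  interpret e: ring_hom_cring R ?F ?e by (rule ms.emb_hom)
  define H where "H n = ?e ` G n" for n
  have emb_pow: "?e (r [^] n) = ?e r [^]\<^bsub>?F\<^esub> n" if "r \<in> carrier R" for r and n :: nat
    using that by (induction n) auto
  have H_mem: "r \<in> G n \<Longrightarrow> ?e r \<in> H n" for r n by (simp add: H_def)
  have H_emb: "?e r \<in> H n \<longleftrightarrow> r \<in> G n" if "r \<in> carrier R" for r n
    using that ms.emb_eq_iff grade_carrier by (auto simp: H_def)
  interpret grading ?F H
  proof (intro grading.intro grading_axioms.intro F.is_cring)
    show "additive_subgroup (H n) ?F" for n
    proof (intro additive_subgroup.intro F.add.subgroupI)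
      show "H n \<subseteq> carrier ?F" using grade_carrier by (auto simp: H_def)
      show "H n \<noteq> {}" using grade_closed(1)[of n] by (auto simp: H_def)
      fix \<alpha> assume "\<alpha> \<in> H n"
      then obtain r where r: "r \<in> G n" "\<alpha> = ?e r" by (auto simp: H_def)
      then have "\<ominus>\<^bsub>?F\<^esub> \<alpha> = ?e (\<ominus> r)" using grade_carrier by simp
      then show "\<ominus>\<^bsub>?F\<^esub> \<alpha> \<in> H n" using r H_mem by simp
      fix \<beta> assume "\<beta> \<in> H n"
      then obtain s where s: "s \<in> G n" "\<beta> = ?e s" by (auto simp: H_def)
      then have "\<alpha> \<oplus>\<^bsub>?F\<^esub> \<beta> = ?e (r \<oplus> s)" using r grade_carrier by simp
      then show "\<alpha> \<oplus>\<^bsub>?F\<^esub> \<beta> \<in> H n" using r s H_mem by simp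
    qed
    show "\<one>\<^bsub>?F\<^esub> \<in> H 0" using H_mem[OF one_grade] by simp
    show "\<alpha> \<otimes>\<^bsub>?F\<^esub> \<beta> \<in> H (i + j)" if h: "\<alpha> \<in> H i" "\<beta> \<in> H j" for \<alpha> \<beta> i j
    proof -
      obtain r where r: "r \<in> G i" "\<alpha> = ?e r" using h(1) by (auto simp: H_def)
      obtain s where s: "s \<in> G j" "\<beta> = ?e s" using h(2) by (auto simp: H_def)
      have "\<alpha> \<otimes>\<^bsub>?F\<^esub> \<beta> = ?e (r \<otimes> s)" using r s grade_carrier by simp
      then show ?thesis using H_mem[OF grade_mult[OF r(1) s(1)]] by simp
    qed
  qed

  have ex: "?e x \<in> H a" "?e x \<in> Units ?F" "?e x \<in> carrier ?F" and ey: "?e y \<in> H b" "?e y \<in> Units ?F" "?e y \<in> carrier ?F"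
    using x y ynz H_mem ms.emb_Units by auto

  \<comment> \<open>After multiplication by (x y)^p, the degree D + p (a + b) is large enough for
    \<open>grade_split\<close> to give x^p u + y^p v. Division returns v / x^p plus u / y^p.\<close>
  have split: "\<exists>u\<in>frac_grade (?e x) a D. \<exists>v\<in>frac_grade (?e y) b D. \<alpha> = u \<oplus>\<^bsub>?F\<^esub> v"
    if D: "N \<le> D" and \<alpha>: "\<alpha> \<in> frac_grade (?e x \<otimes>\<^bsub>?F\<^esub> ?e y) (a + b) D" for D \<alpha>
  proof -
    obtain p where p: "(?e x \<otimes>\<^bsub>?F\<^esub> ?e y) [^]\<^bsub>?F\<^esub> (p::nat) \<otimes>\<^bsub>?F\<^esub> \<alpha> \<in> H (D + p * (a + b))" and \<alpha>c: "\<alpha> \<in> carrier ?F"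
      using \<alpha> by (auto simp: frac_grade_def)
    then obtain r where r: "r \<in> G (D + p * (a + b))" "(?e x \<otimes>\<^bsub>?F\<^esub> ?e y) [^]\<^bsub>?F\<^esub> p \<otimes>\<^bsub>?F\<^esub> \<alpha> = ?e r"
      by (auto simp: H_def)
    have "p * a + p * b + k \<le> D + p * (a + b)" using N D by (simp add: add_mult_distrib2)
    from grade_split[OF x(1) y(1) k this r(1)]
    obtain u v where uv: "u \<in> G (D + p * b)" "v \<in> G (D + p * a)" "r = x [^] p \<otimes> u \<oplus> y [^] p \<otimes> v"
      by (auto simp: add_mult_distrib2)
    have uvc: "u \<in> carrier R" "v \<in> carrier R" using uv grade_carrier by blast+
    define xp where "xp = ?e x [^]\<^bsub>?F\<^esub> p"
    define yp where "yp = ?e y [^]\<^bsub>?F\<^esub> p"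
    have xp: "xp \<in> Units ?F" "xp \<in> carrier ?F" and yp: "yp \<in> Units ?F" "yp \<in> carrier ?F"
      using ex ey F.Units_pow_closed by (auto simp: xp_def yp_def)
    have e1: "xp \<otimes>\<^bsub>?F\<^esub> (yp \<otimes>\<^bsub>?F\<^esub> \<alpha>) = xp \<otimes>\<^bsub>?F\<^esub> ?e u \<oplus>\<^bsub>?F\<^esub> yp \<otimes>\<^bsub>?F\<^esub> ?e v"
    proof -
      have "(?e x \<otimes>\<^bsub>?F\<^esub> ?e y) [^]\<^bsub>?F\<^esub> p = xp \<otimes>\<^bsub>?F\<^esub> yp"
        unfolding xp_def yp_def by (rule F.nat_pow_distrib[OF ex(3) ey(3)])
      then have "xp \<otimes>\<^bsub>?F\<^esub> (yp \<otimes>\<^bsub>?F\<^esub> \<alpha>) = ?e r"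
        using r(2) F.m_assoc[OF xp(2) yp(2) \<alpha>c] by simp
      also have "\<dots> = ?e (x [^] p) \<otimes>\<^bsub>?F\<^esub> ?e u \<oplus>\<^bsub>?F\<^esub> ?e (y [^] p) \<otimes>\<^bsub>?F\<^esub> ?e v"
        unfolding uv(3) using uvc x(3) y(2) by simp
      also have "\<dots> = xp \<otimes>\<^bsub>?F\<^esub> ?e u \<oplus>\<^bsub>?F\<^esub> yp \<otimes>\<^bsub>?F\<^esub> ?e v"
        unfolding xp_def yp_def emb_pow[OF x(3)] emb_pow[OF y(2)] ..
      finally show ?thesis .
    qed
    define \<beta> where "\<beta> = inv\<^bsub>?F\<^esub> yp \<otimes>\<^bsub>?F\<^esub> ?e u"
    define \<gamma> where "\<gamma> = inv\<^bsub>?F\<^esub> xp \<otimes>\<^bsub>?F\<^esub> ?e v"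
    have bc: "\<beta> \<in> carrier ?F" "\<gamma> \<in> carrier ?F" using xp yp uvc by (auto simp: \<beta>_def \<gamma>_def)
    have yb: "yp \<otimes>\<^bsub>?F\<^esub> \<beta> = ?e u" and xg: "xp \<otimes>\<^bsub>?F\<^esub> \<gamma> = ?e v"
      unfolding \<beta>_def \<gamma>_def using xp yp uvc by (simp_all flip: F.m_assoc)
    have "xp \<otimes>\<^bsub>?F\<^esub> (yp \<otimes>\<^bsub>?F\<^esub> (\<gamma> \<oplus>\<^bsub>?F\<^esub> \<beta>)) = xp \<otimes>\<^bsub>?F\<^esub> (yp \<otimes>\<^bsub>?F\<^esub> \<beta>) \<oplus>\<^bsub>?F\<^esub> yp \<otimes>\<^bsub>?F\<^esub> (xp \<otimes>\<^bsub>?F\<^esub> \<gamma>)"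
      using xp yp bc by (simp add: F.r_distr F.m_ac F.a_ac)
    then have "xp \<otimes>\<^bsub>?F\<^esub> (yp \<otimes>\<^bsub>?F\<^esub> (\<gamma> \<oplus>\<^bsub>?F\<^esub> \<beta>)) = xp \<otimes>\<^bsub>?F\<^esub> (yp \<otimes>\<^bsub>?F\<^esub> \<alpha>)"
      unfolding yb xg e1 .
    then have "\<alpha> = \<gamma> \<oplus>\<^bsub>?F\<^esub> \<beta>"
      using xp yp bc \<alpha>c F.Units_l_cancel[OF xp(1)] F.Units_l_cancel[OF yp(1)]
      by (metis F.a_closed F.m_closed)
    moreover have "\<gamma> \<in> frac_grade (?e x) a D"
      using bc(2) H_mem[OF uv(2)] xg unfolding frac_grade_def xp_def by (auto intro!: exI[of _ p])
    moreover have "\<beta> \<in> frac_grade (?e y) b D"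
      using bc(1) H_mem[OF uv(1)] yb unfolding frac_grade_def yp_def by (auto intro!: exI[of _ p])
    ultimately show ?thesis by blast
  qed

  \<comment> \<open>The element \<open>x\<close> is a combination of \<open>S\<close>, so r = x
    \<beta> lies in R. Moreover s r = x (s \<beta>) is a multiple of \<open>x\<close> for each
    generator s. By \<open>socle_bound\<close> so is r, and cancelling \<open>x\<close> puts \<beta>
    into R.\<close>
  have socle: "\<beta> \<in> H n" if n: "N \<le> n" and \<beta>: "\<beta> \<in> carrier ?F"
      and S: "\<And>s. s \<in> S \<Longrightarrow> ?e s \<otimes>\<^bsub>?F\<^esub> \<beta> \<in> H (n + 1)" for n \<beta>
  proof -
    obtain a' where a': "a = Suc a'" using a by (cases a) auto
    obtain cs where cs: "\<And>s. s \<in> S \<Longrightarrow> cs s \<in> G a'" "x = (\<Oplus>s\<in>S. s \<otimes> cs s)"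
      using grade_Suc_combination x(1) unfolding a' by blast
    have csc: "\<And>s. s \<in> S \<Longrightarrow> cs s \<in> carrier R" using cs(1) grade_carrier by blast
    have "?e x = (\<Oplus>\<^bsub>?F\<^esub>s\<in>S. ?e (s \<otimes> cs s))"
      unfolding cs(2) using csc S_carrier by (subst e.hom_finsum) (auto simp: comp_def)
    then have "?e x \<otimes>\<^bsub>?F\<^esub> \<beta> = (\<Oplus>\<^bsub>?F\<^esub>s\<in>S. ?e (s \<otimes> cs s) \<otimes>\<^bsub>?F\<^esub> \<beta>)"
      using csc S_carrier S_finite \<beta> by (simp add: F.finsum_ldistr Pi_def del: e.hom_mult)
    also have "\<dots> = (\<Oplus>\<^bsub>?F\<^esub>s\<in>S. ?e (cs s) \<otimes>\<^bsub>?F\<^esub> (?e s \<otimes>\<^bsub>?F\<^esub> \<beta>))"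
      using csc S_carrier \<beta> by (intro F.finsum_cong') (auto simp: F.m_ac)
    also have "\<dots> \<in> H (a' + (n + 1))"
    proof -
      have "?e (cs s) \<otimes>\<^bsub>?F\<^esub> (?e s \<otimes>\<^bsub>?F\<^esub> \<beta>) \<in> H (a' + (n + 1))" if "s \<in> S" for s
        using that by (intro H_mult H_mem cs(1) S)
      then show ?thesis by (rule H_finsum)
    qed
    finally have "?e x \<otimes>\<^bsub>?F\<^esub> \<beta> \<in> H (n + a)" unfolding a' by (simp add: ac_simps)
    then obtain r where r: "r \<in> G (n + a)" "?e x \<otimes>\<^bsub>?F\<^esub> \<beta> = ?e r" by (auto simp: H_def)
    have rc: "r \<in> carrier R" by (rule grade_carrier[OF r(1)])
    have "s \<otimes> r \<in> PIdl x" if s: "s \<in> S" for s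
    proof -
      obtain r' where r': "r' \<in> G (n + 1)" "?e s \<otimes>\<^bsub>?F\<^esub> \<beta> = ?e r'" using S[OF s] by (auto simp: H_def)
      have r'c: "r' \<in> carrier R" by (rule grade_carrier[OF r'(1)])
      have "?e (s \<otimes> r) = ?e s \<otimes>\<^bsub>?F\<^esub> (?e x \<otimes>\<^bsub>?F\<^esub> \<beta>)" using r rc S_carrier[OF s] by simp
      also have "\<dots> = (?e s \<otimes>\<^bsub>?F\<^esub> \<beta>) \<otimes>\<^bsub>?F\<^esub> ?e x" using \<beta> ex S_carrier[OF s] by (simp add: F.m_ac)
      also have "\<dots> = ?e (r' \<otimes> x)" using r' r'c x by simp
      finally have "s \<otimes> r = r' \<otimes> x" using S_carrier[OF s] rc r'c x(3) by (subst (asm) ms.emb_eq_iff) auto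
      then show ?thesis using r'c unfolding cgenideal_def by blast
    qed
    then have "r \<in> PIdl x" using N0[OF _ r(1)] N n by simp
    then obtain r' where r': "r' \<in> carrier R" "r = r' \<otimes> x" unfolding cgenideal_def by blast
    have "r = component (x \<otimes> r') (n + a)" using r(1) r' x(3) by (simp add: component_grade_eq m_comm)
    also have "\<dots> = x \<otimes> component r' n" using r'(1) by (simp add: component_mult_grade[OF x(1)])
    finally have "?e x \<otimes>\<^bsub>?F\<^esub> \<beta> = ?e x \<otimes>\<^bsub>?F\<^esub> ?e (component r' n)" using r(2) r'(1) x(3) by simp
    then have "\<beta> = ?e (component r' n)" using F.Units_l_cancel[OF ex(2) \<beta>] r'(1) by simp
    then show ?thesis using H_mem component_grade[OF r'(1)] by simp
  qed
  \<comment> \<open>Descent on \<open>t\<close>: for s of degree \<open>t\<close>, all of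
    \<open>S\<close> multiplies s \<alpha> into R, so \<open>socle\<close> applies to s
    \<alpha>.\<close>
  have socle_pow: "\<alpha> \<in> H D" if "N \<le> D" "\<alpha> \<in> carrier ?F" "\<And>s. s \<in> G t \<Longrightarrow> ?e s \<otimes>\<^bsub>?F\<^esub> \<alpha> \<in> H (D + t)" for D \<alpha> t
    using that
  proof (induction t)
    case 0
    then show ?case using 0(3)[OF one_grade] by simp
  next
    case (Suc t)
    show ?case
    proof (rule Suc.IH[OF Suc.prems(1,2)])
      fix s assume s: "s \<in> G t"
      have sc: "s \<in> carrier R" by (rule grade_carrier[OF s])
      show "?e s \<otimes>\<^bsub>?F\<^esub> \<alpha> \<in> H (D + t)"
      proof (rule socle)
        fix s1 assume s1: "s1 \<in> S"
        have "?e (s1 \<otimes> s) \<otimes>\<^bsub>?F\<^esub> \<alpha> \<in> H (D + Suc t)"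
          using grade_mult[of s1 1 s t] s s1 S_grade by (intro Suc.prems(3)) auto
        then show "?e s1 \<otimes>\<^bsub>?F\<^esub> (?e s \<otimes>\<^bsub>?F\<^esub> \<alpha>) \<in> H (D + t + 1)"
          using sc S_carrier[OF s1] Suc.prems(2) by (simp add: F.m_assoc)
      qed (use Suc.prems sc in auto)
    qed
  qed
  \<comment> \<open>Every element of degree \<open>?t\<close> is a combination of x^p and y^q, each
    of which multiplies \<alpha> into R. Hence all of \<open>G ?t\<close> does.\<close>
  have inter: "\<alpha> \<in> H D" if D: "N \<le> D" and \<alpha>x: "\<alpha> \<in> frac_grade (?e x) a D" and \<alpha>y: "\<alpha> \<in> frac_grade (?e y) b D" for D \<alpha>
  proof -
    obtain p q where pq: "?e x [^]\<^bsub>?F\<^esub> (p::nat) \<otimes>\<^bsub>?F\<^esub> \<alpha> \<in> H (D + p * a)" "?e y [^]\<^bsub>?F\<^esub> (q::nat) \<otimes>\<^bsub>?F\<^esub> \<alpha> \<in> H (D + q * b)"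
      and \<alpha>c: "\<alpha> \<in> carrier ?F" using \<alpha>x \<alpha>y by (auto simp: frac_grade_def)
    let ?t = "p * a + q * b + k"
    show ?thesis
    proof (rule socle_pow[OF D \<alpha>c, of ?t])
      fix s assume s: "s \<in> G ?t"
      from grade_split[OF x(1) y(1) k le_refl s]
      obtain u v where uv: "u \<in> G (?t - p * a)" "v \<in> G (?t - q * b)" "s = x [^] p \<otimes> u \<oplus> y [^] q \<otimes> v" by blast
      have c: "u \<in> carrier R" "v \<in> carrier R" using uv grade_carrier by blast+
      have "?e s \<otimes>\<^bsub>?F\<^esub> \<alpha> = ?e u \<otimes>\<^bsub>?F\<^esub> (?e x [^]\<^bsub>?F\<^esub> p \<otimes>\<^bsub>?F\<^esub> \<alpha>) \<oplus>\<^bsub>?F\<^esub> ?e v \<otimes>\<^bsub>?F\<^esub> (?e y [^]\<^bsub>?F\<^esub> q \<otimes>\<^bsub>?F\<^esub> \<alpha>)"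
      proof -
        have "?e s = ?e (x [^] p) \<otimes>\<^bsub>?F\<^esub> ?e u \<oplus>\<^bsub>?F\<^esub> ?e (y [^] q) \<otimes>\<^bsub>?F\<^esub> ?e v"
          unfolding uv(3) using c x(3) y(2) by simp
        then show ?thesis
          unfolding emb_pow[OF x(3)] emb_pow[OF y(2)]
          using c ex(3) ey(3) \<alpha>c by (simp add: F.l_distr F.r_distr F.m_ac)
      qed
      moreover have "?e u \<otimes>\<^bsub>?F\<^esub> (?e x [^]\<^bsub>?F\<^esub> p \<otimes>\<^bsub>?F\<^esub> \<alpha>) \<in> H ((?t - p * a) + (D + p * a))"
        by (intro H_mult H_mem uv pq)
      moreover have "?e v \<otimes>\<^bsub>?F\<^esub> (?e y [^]\<^bsub>?F\<^esub> q \<otimes>\<^bsub>?F\<^esub> \<alpha>) \<in> H ((?t - q * b) + (D + q * b))"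
        by (intro H_mult H_mem uv pq)
      moreover have "(?t - p * a) + (D + p * a) = D + ?t" "(?t - q * b) + (D + q * b) = D + ?t" by linarith+
      ultimately show "?e s \<otimes>\<^bsub>?F\<^esub> \<alpha> \<in> H (D + ?t)" using H_closed(2) by metis
    qed
  qed
  have ysum': "?e y = (\<Oplus>\<^bsub>?F\<^esub>i\<in>I. ?e (c i) \<otimes>\<^bsub>?F\<^esub> ?e (f i))"
  proof -
    have "?e y = (\<Oplus>\<^bsub>?F\<^esub>i\<in>I. ?e (c i \<otimes> f i))"
      unfolding ysum using cc fc by (subst e.hom_finsum) (auto simp: comp_def)
    also have "\<dots> = (\<Oplus>\<^bsub>?F\<^esub>i\<in>I. ?e (c i) \<otimes>\<^bsub>?F\<^esub> ?e (f i))"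
      using cc fc by (intro F.finsum_cong') auto
    finally show ?thesis .
  qed
  have u0: "?e (x [^] (k + N0)) \<in> H N"
    unfolding N_def by (intro H_mem grade_pow x)
  have "\<exists>w. w {#} = ?e (x [^] (k + N0)) \<and> (\<forall>\<mu>. \<exists>D. w \<mu> \<in> H D) \<and>
    (\<forall>\<mu>. (\<Oplus>\<^bsub>?F\<^esub>i\<in>I. ?e (f i) \<otimes>\<^bsub>?F\<^esub> w (add_mset i \<mu>)) = ?e z \<otimes>\<^bsub>?F\<^esub> w \<mu>)"
    by (rule exists_recurrence[where f = "\<lambda>i. ?e (f i)" and c = "\<lambda>i. ?e (c i)" and d = d and ?i0.0 = i0,
          OF ex(1,2) ey(1,2) I(1,2) _ _ _ db _ _ ysum' _ _ _ split inter u0])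
      (use f c z am dm H_mem in \<open>auto simp: x_def a_def\<close>)
  then obtain w where w: "w {#} = ?e (x [^] (k + N0))" "\<And>\<mu>. \<exists>D. w \<mu> \<in> H D"
    "\<And>\<mu>. (\<Oplus>\<^bsub>?F\<^esub>i\<in>I. ?e (f i) \<otimes>\<^bsub>?F\<^esub> w (add_mset i \<mu>)) = ?e z \<otimes>\<^bsub>?F\<^esub> w \<mu>" by blast
  have "\<exists>r. r \<in> carrier R \<and> w \<mu> = ?e r" for \<mu> using w(2)[of \<mu>] grade_carrier by (auto simp: H_def)
  then obtain v where v: "\<And>\<mu>. v \<mu> \<in> carrier R" "\<And>\<mu>. w \<mu> = ?e (v \<mu>)" by metis
  have zc: "z \<in> carrier R" by (rule grade_carrier[OF z])
  have "v {#} \<noteq> \<zero>"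
  proof -
    have "?e (v {#}) = ?e (x [^] (k + N0))" using w(1) v(2) by metis
    then have "v {#} = x [^] (k + N0)" using ms.emb_eq_iff v(1) x(3) by blast
    moreover have "x \<notin> {\<zero>}" using x(2) by simp
    from prime_pow[OF zeroprimeideal x(3) this, of "k + N0"] have "x [^] (k + N0) \<noteq> \<zero>" by simp
    ultimately show ?thesis by simp
  qed
  moreover have "(\<Oplus>i\<in>I. f i \<otimes> v (add_mset i \<mu>)) = z \<otimes> v \<mu>" for \<mu>
  proof -
    have "?e (\<Oplus>i\<in>I. f i \<otimes> v (add_mset i \<mu>)) = (\<Oplus>\<^bsub>?F\<^esub>i\<in>I. ?e (f i \<otimes> v (add_mset i \<mu>)))"
      using fc v by (subst e.hom_finsum) (auto simp: comp_def)
    also have "\<dots> = (\<Oplus>\<^bsub>?F\<^esub>i\<in>I. ?e (f i) \<otimes>\<^bsub>?F\<^esub> w (add_mset i \<mu>))"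
      using fc v by (intro F.finsum_cong') auto
    also have "\<dots> = ?e (z \<otimes> v \<mu>)" unfolding w(3) using v zc by simp
    finally have "?e (\<Oplus>i\<in>I. f i \<otimes> v (add_mset i \<mu>)) = ?e (z \<otimes> v \<mu>)" .
    moreover have "(\<Oplus>i\<in>I. f i \<otimes> v (add_mset i \<mu>)) \<in> carrier R" using fc v(1) by (intro finsum_closed) auto
    moreover have "z \<otimes> v \<mu> \<in> carrier R" using zc v(1) by simp
    ultimately show ?thesis using ms.emb_eq_iff by blast
  qed
  ultimately show ?thesis using v(1) by blast
qed

end

section \<open>Completion at the irrelevant ideal\<close>

lemma (in ring_hom_cring) finsum_image_in_ideal:
  assumes "ideal T S" "\<And>i. i \<in> A \<Longrightarrow> g i \<in> carrier R" "\<And>i. i \<in> A \<Longrightarrow> h (g i) \<in> T"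
  shows "h (\<Oplus>i\<in>A. g i) \<in> T"
proof -
  have "h (\<Oplus>i\<in>A. g i) = (\<Oplus>\<^bsub>S\<^esub>i\<in>A. h (g i))"
    using assms(2) by (subst hom_finsum) (auto simp: comp_def)
  then show ?thesis using ideal.finsum_in_ideal[OF assms(1,3)] by simp
qed

lemma (in ring_hom_cring) hom_Units:
  assumes "x \<in> Units R"
  shows "h x \<in> Units S"
proof -
  obtain y where y: "y \<in> carrier R" "x \<otimes> y = \<one>" "x \<in> carrier R" using assms by (auto simp: Units_def)
  then have "h x \<otimes>\<^bsub>S\<^esub> h y = \<one>\<^bsub>S\<^esub>" by (simp flip: hom_mult)
  then show ?thesis using y S.m_comm[of "h x" "h y"] by (auto simp: Units_def)
qed

section \<open>Localization and completion at a prime\<close>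

context domain
begin

lemma prime_mult_subset:
  assumes "primeideal P R"
  shows "mult_subset R (carrier R - P)"
proof (intro mult_subset.intro mult_subset_axioms.intro domain_axioms)
  interpret P: primeideal P R by (rule assms)
  show "carrier R - P \<subseteq> carrier R - {\<zero>}" by auto
  show "\<one> \<in> carrier R - P" using P.I_notcarr P.one_imp_carrier by auto
  show "s \<otimes> t \<in> carrier R - P" if "s \<in> carrier R - P" "t \<in> carrier R - P" for s t
    using that P.I_prime[of s t] by auto
qed

lemma completion_at_prime:
  assumes "primeideal P R"
  shows "completion (local_ring_at R P) (max_ideal_at R P)"
proof -
  interpret ms: mult_subset R "carrier R - P" by (rule prime_mult_subset[OF assms])
  interpret L: cring ms.loc by (rule ms.loc_cring)
  interpret e: ring_hom_cring R ms.loc ms.emb by (rule ms.emb_hom)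
  interpret P: primeideal P R by (rule assms)
  have "ms.emb ` P \<subseteq> carrier ms.loc" using P.Icarr by auto
  then show ?thesis
    unfolding local_ring_at_def max_ideal_at_def
    by (intro completion.intro completion_axioms.intro L.is_cring L.genideal_ideal)
qed

lemma to_completion_at_hom:
  assumes "primeideal P R"
  shows "ring_hom_cring R (completion_at R P) (to_completion_at R P)"
proof -
  interpret ms: mult_subset R "carrier R - P" by (rule prime_mult_subset[OF assms])
  interpret e: ring_hom_cring R ms.loc ms.emb by (rule ms.emb_hom)
  interpret C: completion "local_ring_at R P" "max_ideal_at R P" by (rule completion_at_prime[OF assms])
  interpret c: ring_hom_cring "local_ring_at R P" C.compl C.to_compl by (rule C.to_compl_hom)
  have "C.to_compl \<circ> ms.emb \<in> ring_hom R C.compl"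
    using ring_hom_trans[OF e.homh[unfolded local_ring_at_def[symmetric]] c.homh] .
  then show ?thesis
    by (intro ring_hom_cring.intro ring_hom_cring_axioms.intro is_cring)
      (simp_all add: completion_at_def to_completion_at_def[abs_def] comp_def C.compl_cring)
qed

lemma to_completion_at_Units:
  assumes "primeideal P R" "r \<in> carrier R" "r \<notin> P"
  shows "to_completion_at R P r \<in> Units (completion_at R P)"
proof -
  interpret ms: mult_subset R "carrier R - P" by (rule prime_mult_subset[OF assms(1)])
  interpret C: completion "local_ring_at R P" "max_ideal_at R P" by (rule completion_at_prime[OF assms(1)])
  interpret c: ring_hom_cring "local_ring_at R P" C.compl C.to_compl by (rule C.to_compl_hom)
  have "ms.emb r \<in> Units (local_ring_at R P)"
    using ms.emb_Units[of r] assms by (simp add: local_ring_at_def)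
  then show ?thesis unfolding completion_at_def to_completion_at_def by (rule c.hom_Units)
qed

end

section \<open>The completion at the irrelevant ideal is a domain containing R\<close>

context graded_domain
begin

lemma irrelevant_ideal_eq: "irrelevant_ideal R G = high 1"
proof
  show "irrelevant_ideal R G \<subseteq> high 1"
  proof
    fix x assume "x \<in> irrelevant_ideal R G"
    then obtain c D where cD: "x = (\<Oplus>d\<in>D. c d)" "\<forall>d\<in>D. 1 \<le> d \<and> c d \<in> G d"
      by (auto simp: irrelevant_ideal_def)
    show "x \<in> high 1" unfolding cD(1) using cD(2) by (intro high_finsum) (auto intro: grade_high)
  qed
  show "high 1 \<subseteq> irrelevant_ideal R G"
  proof
    fix x assume x: "x \<in> high 1"
    then have xc: "x \<in> carrier R" by (rule high_carrier)
    let ?D = "{d. component x d \<noteq> \<zero>}"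
    have "\<forall>d\<in>?D. 1 \<le> d \<and> component x d \<in> G d"
      using x component_grade[OF xc] by (auto simp: high_def Suc_le_eq intro!: Nat.gr0I)
    then show "x \<in> irrelevant_ideal R G"
      unfolding irrelevant_ideal_def
      using component_sum[OF xc] component_finite[OF xc] by (intro CollectI exI[of _ "component x"] exI[of _ ?D]) auto
  qed
qed

lemma high_1_prime: "primeideal (high 1) R"
  by (rule hprime_primeideal[OF high_1_hprime])

sublocale irr: mult_subset R "carrier R - high 1"
  by (rule prime_mult_subset[OF high_1_prime])

sublocale irr_loc: cring irr.loc
  by (rule irr.loc_cring)

sublocale irr_emb: ring_hom_cring R irr.loc irr.emb
  by (rule irr.emb_hom)

context
  notes One_nat_def [simp del]
begin

text \<open>The filtration by order carried over to the localization; its steps turn out to be the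
  powers of the maximal ideal.\<close>

definition high_loc :: "nat \<Rightarrow> ('a \<times> 'a) set set"
  where "high_loc n = {irr.fr a s | a s. a \<in> high n \<and> s \<in> carrier R - high 1}"

text \<open>Denominators lie outside \<open>high 1\<close>, so they have order zero, and
  multiplication by them does not change the order of a numerator. Membership is therefore
  independent of the representative.\<close>

lemma fr_mem_high_loc:
  assumes a: "a \<in> carrier R" and s: "s \<in> carrier R - high 1"
  shows "irr.fr a s \<in> high_loc n \<longleftrightarrow> a \<in> high n"
proof
  assume "irr.fr a s \<in> high_loc n"
  then obtain b t where bt: "b \<in> high n" "t \<in> carrier R - high 1" "irr.fr a s = irr.fr b t"
    by (auto simp: high_loc_def)
  then have eq: "a \<otimes> t = b \<otimes> s" using irr.fraction_eq[OF a s _ bt(2)] high_carrier by blast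
  show "a \<in> high n"
  proof (rule ccontr)
    assume na: "a \<notin> high n"
    then obtain i where i: "n = Suc i" using a high_0 by (cases n) auto
    have "a \<otimes> t \<notin> high (Suc (i + 0))"
      using na a bt(2) unfolding i by (intro not_high_mult) (auto simp: One_nat_def)
    moreover have "b \<otimes> s \<in> high (n + 0)"
      using bt(1) s by (intro high_mult) (auto simp: high_0)
    ultimately show False by (simp add: eq i)
  qed
qed (use s in \<open>auto simp: high_loc_def\<close>)

lemma high_loc_carrier: "x \<in> high_loc n \<Longrightarrow> x \<in> carrier irr.loc"
  by (auto simp: high_loc_def high_carrier)

lemma high_loc_mult:
  assumes "x \<in> high_loc m" "y \<in> high_loc n"
  shows "x \<otimes>\<^bsub>irr.loc\<^esub> y \<in> high_loc (m + n)"
proof -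
  obtain a s b t where x: "a \<in> high m" "s \<in> carrier R - high 1" "x = irr.fr a s"
    and y: "b \<in> high n" "t \<in> carrier R - high 1" "y = irr.fr b t"
    using assms unfolding high_loc_def by blast
  have "x \<otimes>\<^bsub>irr.loc\<^esub> y = irr.fr (a \<otimes> b) (s \<otimes> t)"
    unfolding x(3) y(3) by (rule irr.frac_mult[OF high_carrier[OF x(1)] x(2) high_carrier[OF y(1)] y(2)])
  then show ?thesis
    using high_mult[OF x(1) y(1)] irr.S_mult[OF x(2) y(2)] unfolding high_loc_def by blast
qed

lemma high_loc_add:
  assumes "x \<in> high_loc n" "y \<in> high_loc n"
  shows "x \<oplus>\<^bsub>irr.loc\<^esub> y \<in> high_loc n"
proof -
  obtain a s b t where x: "a \<in> high n" "s \<in> carrier R - high 1" "x = irr.fr a s"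
    and y: "b \<in> high n" "t \<in> carrier R - high 1" "y = irr.fr b t"
    using assms unfolding high_loc_def by blast
  have "x \<oplus>\<^bsub>irr.loc\<^esub> y = irr.fr (a \<otimes> t \<oplus> b \<otimes> s) (s \<otimes> t)"
    unfolding x(3) y(3) by (rule irr.frac_add[OF high_carrier[OF x(1)] x(2) high_carrier[OF y(1)] y(2)])
  moreover have "a \<otimes> t \<oplus> b \<otimes> s \<in> high n"
    using high_mult[OF x(1), of t 0] high_mult[OF y(1), of s 0] x(2) y(2) by (auto simp: high_0 intro: high_add)
  ultimately show ?thesis
    using irr.S_mult[OF x(2) y(2)] unfolding high_loc_def by blast
qed

lemma high_loc_0: "high_loc 0 = carrier irr.loc"
  unfolding high_loc_def high_0 irr.loc_carrier set_eq_iff by blast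

lemma high_loc_ideal: "ideal (high_loc n) irr.loc"
proof (intro idealI irr_loc.ring_axioms irr_loc.add.subgroupI)
  show "high_loc n \<subseteq> carrier irr.loc" using high_loc_carrier by blast
  have "irr.fr \<zero> \<one> \<in> high_loc n" using irr.S_one by (subst fr_mem_high_loc) (auto simp: high_zero)
  then show "high_loc n \<noteq> {}" by blast
  fix x assume x: "x \<in> high_loc n"
  show l: "y \<otimes>\<^bsub>irr.loc\<^esub> x \<in> high_loc n" if "y \<in> carrier irr.loc" for y
    using high_loc_mult[of y 0 x n] that x by (simp add: high_loc_0)
  show "x \<otimes>\<^bsub>irr.loc\<^esub> y \<in> high_loc n" if "y \<in> carrier irr.loc" for y
    using high_loc_mult[of x n y 0] that x by (simp add: high_loc_0)
  show "\<ominus>\<^bsub>irr.loc\<^esub> x \<in> high_loc n"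
    using l[of "\<ominus>\<^bsub>irr.loc\<^esub> \<one>\<^bsub>irr.loc\<^esub>"] high_loc_carrier[OF x] by (simp add: irr_loc.l_minus)
  fix y assume "y \<in> high_loc n"
  with x show "x \<oplus>\<^bsub>irr.loc\<^esub> y \<in> high_loc n" by (rule high_loc_add)
qed

lemma high_loc_subset:
  assumes T: "ideal T irr.loc" and emb: "\<And>a. a \<in> high n \<Longrightarrow> irr.emb a \<in> T"
  shows "high_loc n \<subseteq> T"
proof
  fix x assume "x \<in> high_loc n"
  then obtain a s where x: "a \<in> high n" "s \<in> carrier R - high 1" "x = irr.fr a s" unfolding high_loc_def by blast
  have ac: "a \<in> carrier R" by (rule high_carrier[OF x(1)])
  have "irr.emb a \<otimes>\<^bsub>irr.loc\<^esub> irr.fr \<one> s = x"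
    using irr.frac_mult[OF ac irr.S_one one_closed x(2)] ac x(2,3) by (simp add: to_localization_def)
  then show "x \<in> T" using ideal.I_r_closed[OF T emb[OF x(1)], of "irr.fr \<one> s"] x(2) by auto
qed

lemma emb_high_loc: "a \<in> high n \<Longrightarrow> irr.emb a \<in> high_loc n"
  unfolding to_localization_def using irr.S_one by (subst fr_mem_high_loc) (auto simp: high_carrier)

lemma max_ideal_at_irrelevant: "max_ideal_at R (high 1) = high_loc 1"
proof
  have sub: "irr.emb ` high 1 \<subseteq> high_loc 1" using emb_high_loc by blast
  then show "max_ideal_at R (high 1) \<subseteq> high_loc 1"
    unfolding max_ideal_at_def local_ring_at_def by (intro irr_loc.genideal_minimal high_loc_ideal)
  have subc: "irr.emb ` high 1 \<subseteq> carrier irr.loc" using sub high_loc_carrier by blast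
  show "high_loc 1 \<subseteq> max_ideal_at R (high 1)"
    unfolding max_ideal_at_def local_ring_at_def
    using irr_loc.genideal_self[OF subc] by (intro high_loc_subset irr_loc.genideal_ideal[OF subc]) blast
qed

text \<open>Each component has degree at least \<open>Suc n\<close>, so it is a combination of
  elements of \<open>S\<close> with coefficients of degree at least \<open>n\<close>.\<close>

lemma emb_high_in_product:
  assumes T: "T = ideal_prod irr.loc (high_loc n) (high_loc 1)" and a: "a \<in> high (Suc n)"
  shows "irr.emb a \<in> T"
proof -
  have T_ideal: "ideal T irr.loc" unfolding T by (intro irr_loc.ideal_prod_is_ideal high_loc_ideal)
  have ac: "a \<in> carrier R" by (rule high_carrier[OF a])
  have "irr.emb (component a d) \<in> T" if d: "component a d \<noteq> \<zero>" for d
  proof -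
    have "Suc n \<le> d" using d a unfolding high_def by (metis (mono_tags, lifting) mem_Collect_eq not_le)
    then obtain d' where d': "d = Suc d'" "n \<le> d'" by (cases d) auto
    obtain c where c: "\<And>s. s \<in> S \<Longrightarrow> c s \<in> G d'" "component a d = (\<Oplus>s\<in>S. s \<otimes> c s)"
      using grade_Suc_combination[of "component a d" d'] component_grade[OF ac, of d] unfolding d'(1) by blast
    have cc: "c s \<in> carrier R" if "s \<in> S" for s using c(1)[OF that] by (rule grade_carrier)
    show ?thesis unfolding c(2)
    proof (rule irr_emb.finsum_image_in_ideal[OF T_ideal])
      fix s assume s: "s \<in> S"
      show "s \<otimes> c s \<in> carrier R" using s cc S_carrier by simp
      have "irr.emb (c s) \<otimes>\<^bsub>irr.loc\<^esub> irr.emb s \<in> T"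
        unfolding T using grade_high[OF c(1)[OF s] d'(2)] grade_high[of s 1 1] S_grade s
        by (intro ideal_prod.prod emb_high_loc) auto
      then show "irr.emb (s \<otimes> c s) \<in> T" using s cc S_carrier by (simp add: irr_loc.m_comm)
    qed
  qed
  then have "irr.emb (\<Oplus>d\<in>{d. component a d \<noteq> \<zero>}. component a d) \<in> T"
    using ac by (intro irr_emb.finsum_image_in_ideal[OF T_ideal]) auto
  then show ?thesis using component_sum[OF ac] by simp
qed

lemma ideal_pow_irrelevant: "ideal_pow irr.loc (high_loc 1) n = high_loc n"
proof (induction n)
  case (Suc n)
  have "ideal_prod irr.loc (high_loc n) (high_loc 1) = high_loc (Suc n)"
  proof
    show "ideal_prod irr.loc (high_loc n) (high_loc 1) \<subseteq> high_loc (Suc n)"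
    proof
      fix x assume "x \<in> ideal_prod irr.loc (high_loc n) (high_loc 1)"
      then show "x \<in> high_loc (Suc n)"
      proof induction
        case (prod i j)
        then show ?case using high_loc_mult[of i n j 1] by (simp add: One_nat_def)
      next
        case (sum s1 s2)
        then show ?case by (intro high_loc_add)
      qed
    qed
    show "high_loc (Suc n) \<subseteq> ideal_prod irr.loc (high_loc n) (high_loc 1)"
      by (intro high_loc_subset irr_loc.ideal_prod_is_ideal high_loc_ideal emb_high_in_product[OF refl])
  qed
  then show ?case using Suc by simp
qed (simp add: high_loc_0)

lemma completion_at_irrelevant: "completion_at R (high 1) = adic_completion irr.loc (high_loc 1)"
  unfolding completion_at_def max_ideal_at_irrelevant local_ring_at_def ..

lemma completion_irrelevant: "completion irr.loc (high_loc 1)"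
  by (intro completion.intro completion_axioms.intro irr_loc.is_cring high_loc_ideal)

text \<open>Orders of numerators add, so \<open>compl_domain\<close> applies. An index whose step
  omits an element is positive, and \<open>not_high_mult\<close> even keeps the product out of the
  larger step \<open>Suc (i' + j')\<close>.\<close>

lemma completion_at_irrelevant_domain: "domain (completion_at R (high 1))"
proof -
  interpret irr_compl: completion irr.loc "high_loc 1" by (rule completion_irrelevant)
  show ?thesis unfolding completion_at_irrelevant
  proof (rule irr_compl.compl_domain)
    have "\<one> \<notin> high 1" using irr.S_one by simp
    then show "\<one>\<^bsub>irr.loc\<^esub> \<notin> irr_compl.ip 1"
      unfolding ideal_pow_irrelevant irr.loc_one using irr.S_one by (subst fr_mem_high_loc) auto
    fix i j x y assume xy: "x \<in> carrier irr.loc" "y \<in> carrier irr.loc" "x \<notin> irr_compl.ip i" "y \<notin> irr_compl.ip j"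
    obtain a s where x: "a \<in> carrier R" "s \<in> carrier R - high 1" "x = irr.fr a s" using irr.loc_cases[OF xy(1)] by blast
    obtain b t where y: "b \<in> carrier R" "t \<in> carrier R - high 1" "y = irr.fr b t" using irr.loc_cases[OF xy(2)] by blast
    have n: "a \<notin> high i" "b \<notin> high j"
      using xy(3,4) fr_mem_high_loc[OF x(1,2)] fr_mem_high_loc[OF y(1,2)] unfolding ideal_pow_irrelevant x(3) y(3) by auto
    then have "i \<noteq> 0" "j \<noteq> 0" using x(1) y(1) high_0 by metis+
    then obtain i' j' where ij: "i = Suc i'" "j = Suc j'" using not0_implies_Suc by blast
    have "a \<otimes> b \<notin> high (Suc (i' + j'))" using n unfolding ij by (intro not_high_mult x y)
    then have "a \<otimes> b \<notin> high (i + j)" using high_antimono[of "Suc (i' + j')" "i + j"] by (auto simp: ij)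
    then show "x \<otimes>\<^bsub>irr.loc\<^esub> y \<notin> irr_compl.ip (i + j)"
      unfolding ideal_pow_irrelevant x(3) y(3) irr.frac_mult[OF x(1,2) y(1,2)]
      using fr_mem_high_loc[OF m_closed[OF x(1) y(1)] irr.S_mult[OF x(2) y(2)]] by simp
  qed
qed

lemma to_completion_at_irrelevant_nonzero:
  assumes "r \<in> carrier R" "r \<noteq> \<zero>"
  shows "to_completion_at R (high 1) r \<noteq> \<zero>\<^bsub>completion_at R (high 1)\<^esub>"
proof -
  interpret irr_compl: completion irr.loc "high_loc 1" by (rule completion_irrelevant)
  obtain i where i: "component r i \<noteq> \<zero>" using component_nonzero_exists[OF assms] by blast
  then have "r \<notin> high (Suc i)" unfolding high_def by blast
  then have "irr.emb r \<notin> irr_compl.ip (Suc i)"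
    unfolding ideal_pow_irrelevant to_localization_def using fr_mem_high_loc[OF assms(1) irr.S_one] by simp
  then have "\<exists>n. irr.emb r \<notin> irr_compl.ip n" by (rule exI)
  then have "irr_compl.to_compl (irr.emb r) \<noteq> \<zero>\<^bsub>irr_compl.compl\<^esub>"
    unfolding irr_compl.to_compl_eq_zero[OF irr_emb.hom_closed[OF assms(1)]] by simp
  then show ?thesis
    unfolding to_completion_at_def completion_at_irrelevant max_ideal_at_irrelevant local_ring_at_def .
qed

text \<open>In a domain the zero ideal is prime and contained in every prime.\<close>

lemma minimal_prime_completion_at_irrelevant:
  assumes "minimal_prime (completion_at R (high 1)) Q"
  shows "Q = {\<zero>\<^bsub>completion_at R (high 1)\<^esub>}"
proof -
  interpret C: domain "completion_at R (high 1)" by (rule completion_at_irrelevant_domain)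
  have "ideal Q (completion_at R (high 1))" using assms by (simp add: minimal_prime_def primeideal.axioms)
  then have "\<zero>\<^bsub>completion_at R (high 1)\<^esub> \<in> Q" by (simp add: additive_subgroup.zero_closed ideal.axioms)
  then show ?thesis using assms C.zeroprimeideal unfolding minimal_prime_def by blast
qed

lemma solid_closure_memI:
  fixes f :: "nat \<Rightarrow> 'a" and w :: "nat multiset \<Rightarrow> 'a"
  assumes I: "finite I" and f: "\<And>i. i \<in> I \<Longrightarrow> f i \<in> carrier R" and z: "z \<in> carrier R"
    and primary: "\<And>P. primeideal P R \<Longrightarrow> f ` I \<subseteq> P \<Longrightarrow> high 1 \<subseteq> P"
    and w: "\<And>\<mu>. w \<mu> \<in> carrier R" "w {#} \<noteq> \<zero>"
    and rec: "\<And>\<mu>. (\<Oplus>i\<in>I. f i \<otimes> w (add_mset i \<mu>)) = z \<otimes> w \<mu>"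
  shows "z \<in> solid_closure R (Idl (f ` I))"
proof -
  have sub: "f ` I \<subseteq> carrier R" using f by blast
  have fJ: "f i \<in> Idl (f ` I)" if "i \<in> I" for i using genideal_self[OF sub] that by blast
  have Jc: "Idl (f ` I) \<subseteq> carrier R" using ideal.Icarr[OF genideal_ideal[OF sub]] by blast
  have "h z \<in> complete_local_solid_closure A (Idl\<^bsub>A\<^esub> (h ` (Idl (f ` I))))"
    if M: "maximalideal M R" and Q: "minimal_prime (completion_at R M) Q"
      and A: "A = completion_at R M Quot Q"
      and h: "h = (\<lambda>r. Q +>\<^bsub>completion_at R M\<^esub> to_completion_at R M r)" for M Q A h
  proof -
    have Mp: "primeideal M R" by (rule maximalideal_prime[OF M])
    interpret C: ring_hom_cring R "completion_at R M" "to_completion_at R M" by (rule to_completion_at_hom[OF Mp])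
    interpret Q: primeideal Q "completion_at R M" using Q by (simp add: minimal_prime_def)
    interpret A: domain A unfolding A by (rule Q.quotient_is_domain)
    have q: "(+>\<^bsub>completion_at R M\<^esub>) Q \<in> ring_hom (completion_at R M) A" unfolding A by (rule Q.rcos_ring_hom)
    interpret h: ring_hom_cring R A h
      using ring_hom_trans[OF C.homh q] unfolding h
      by (intro ring_hom_cring.intro ring_hom_cring_axioms.intro is_cring A.is_cring) (simp add: comp_def)
    let ?J = "Idl\<^bsub>A\<^esub> (h ` (Idl (f ` I)))"
    have hsub: "h ` (Idl (f ` I)) \<subseteq> carrier A" using Jc by auto
    have hJ: "h r \<in> ?J" if "r \<in> Idl (f ` I)" for r using A.genideal_self[OF hsub] that by blast
    have hJc: "?J \<subseteq> carrier A" using ideal.Icarr[OF A.genideal_ideal[OF hsub]] by blast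
    show ?thesis
    proof (cases "M = high 1")
      case True
      have Q0: "Q = {\<zero>\<^bsub>completion_at R M\<^esub>}"
        using minimal_prime_completion_at_irrelevant Q unfolding True by blast
      show ?thesis
      proof (rule A.complete_local_solid_closureI[where I = I and a = "\<lambda>i. h (f i)" and w = "\<lambda>\<mu>. h (w \<mu>)"])
        have c: "to_completion_at R M (w {#}) \<in> carrier (completion_at R M)" using w(1) by simp
        have "to_completion_at R M (w {#}) \<noteq> \<zero>\<^bsub>completion_at R M\<^esub>"
          unfolding True by (rule to_completion_at_irrelevant_nonzero[OF w])
        then have "h (w {#}) \<noteq> Q" using Q.coset_eq_self[OF c] unfolding h Q0 by blast
        then show "h (w {#}) \<noteq> \<zero>\<^bsub>A\<^esub>" by (simp add: A FactRing_def)
        fix \<mu>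
        have "(\<Oplus>\<^bsub>A\<^esub>i\<in>I. h (f i) \<otimes>\<^bsub>A\<^esub> h (w (add_mset i \<mu>))) = (\<Oplus>\<^bsub>A\<^esub>i\<in>I. h (f i \<otimes> w (add_mset i \<mu>)))"
          using f w(1) by (intro A.finsum_cong') auto
        also have "\<dots> = h (\<Oplus>i\<in>I. f i \<otimes> w (add_mset i \<mu>))"
          using f w(1) by (subst h.hom_finsum) (auto simp: comp_def)
        also have "\<dots> = h z \<otimes>\<^bsub>A\<^esub> h (w \<mu>)" unfolding rec using z w(1) by simp
        finally show "(\<Oplus>\<^bsub>A\<^esub>i\<in>I. h (f i) \<otimes>\<^bsub>A\<^esub> h (w (add_mset i \<mu>))) = h z \<otimes>\<^bsub>A\<^esub> h (w \<mu>)" .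
      qed (use I z w(1) fJ in \<open>auto intro: hJ hJc[THEN subsetD]\<close>)
    next
      case False
      have "\<not> f ` I \<subseteq> M"
      proof
        assume "f ` I \<subseteq> M"
        then have "high 1 \<subseteq> M" by (rule primary[OF Mp])
        then show False
          using False maximalideal.I_maximal[OF high_1_maximal] primeideal.I_notcarr[OF Mp]
            ideal.Icarr[OF primeideal.axioms(1)[OF Mp]] primeideal.axioms(1)[OF Mp] by blast
      qed
      then obtain i where i: "i \<in> I" "f i \<notin> M" by blast
      let ?r = "h (f i)"
      have u: "?r \<in> Units A"
        unfolding h
        using ring_hom_cring.hom_Units[OF _ to_completion_at_Units[OF Mp f[OF i(1)] i(2)], of A] q
        by (simp add: ring_hom_cring_def ring_hom_cring_axioms_def A.is_cring C.S.is_cring)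
      have uc: "?r \<in> carrier A" "inv\<^bsub>A\<^esub> ?r \<in> carrier A" "?r \<otimes>\<^bsub>A\<^esub> inv\<^bsub>A\<^esub> ?r = \<one>\<^bsub>A\<^esub>"
        using u by auto
      let ?t = "inv\<^bsub>A\<^esub> ?r \<otimes>\<^bsub>A\<^esub> h z"
      have t: "?t \<in> carrier A" "?r \<otimes>\<^bsub>A\<^esub> ?t = h z"
        using uc z by (auto simp flip: A.m_assoc)
      show ?thesis
      \<comment> \<open>One generator is enough: sending the variable 0 to \<open>?t\<close> and all
        other variables to 1 is a ring homomorphism from the forcing algebra of \<open>?r\<close> to
        \<open>A\<close>, and \<open>w\<close> lists its values at the monomials.\<close>
      proof (rule A.complete_local_solid_closureI[where I = "{0}" and a = "\<lambda>_. ?r" and w = "\<lambda>\<mu>. ?t [^]\<^bsub>A\<^esub> count \<mu> 0"])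
        fix \<mu> :: "nat multiset"
        show "(\<Oplus>\<^bsub>A\<^esub>i\<in>{0}. ?r \<otimes>\<^bsub>A\<^esub> ?t [^]\<^bsub>A\<^esub> count (add_mset i \<mu>) 0) = h z \<otimes>\<^bsub>A\<^esub> ?t [^]\<^bsub>A\<^esub> count \<mu> 0"
        proof -
          have "?r \<otimes>\<^bsub>A\<^esub> (?t [^]\<^bsub>A\<^esub> count \<mu> 0 \<otimes>\<^bsub>A\<^esub> ?t) = (?r \<otimes>\<^bsub>A\<^esub> ?t) \<otimes>\<^bsub>A\<^esub> ?t [^]\<^bsub>A\<^esub> count \<mu> 0"
            using A.m_comm[OF A.nat_pow_closed t(1)] A.m_assoc[OF uc(1) t(1) A.nat_pow_closed] t(1) by simp
          then have "?r \<otimes>\<^bsub>A\<^esub> ?t [^]\<^bsub>A\<^esub> Suc (count \<mu> 0) = h z \<otimes>\<^bsub>A\<^esub> ?t [^]\<^bsub>A\<^esub> count \<mu> 0"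
            unfolding t(2) A.nat_pow_Suc .
          moreover have "?r \<otimes>\<^bsub>A\<^esub> ?t [^]\<^bsub>A\<^esub> Suc (count \<mu> 0) \<in> carrier A"
            by (rule A.m_closed[OF uc(1) A.nat_pow_closed[OF t(1)]])
          ultimately show ?thesis by (simp add: A.finsum_insert)
        qed
      qed (use i z t(1) fJ hJ hJc in \<open>auto\<close>)
    qed
  qed
  then show ?thesis unfolding solid_closure_def Let_def using z by blast
qed

end

end

section \<open>The degree bound\<close>

text \<open>A supremum above 1 provides a chain with at least two inclusions, and an initial piece
  of a chain is again a chain.\<close>

lemma krull_dim_2_chains:
  fixes R (structure)
  assumes "krull_dim R = 2"
  shows "\<exists>P :: nat \<Rightarrow> _ set. (\<forall>i\<le>2. primeideal (P i) R) \<and> (\<forall>i<2. P i \<subset> P (Suc i))"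
    and "\<not> (\<exists>P :: nat \<Rightarrow> _ set. (\<forall>i\<le>3. primeideal (P i) R) \<and> (\<forall>i<3. P i \<subset> P (Suc i)))"
proof -
  let ?chain = "\<lambda>n. \<exists>P :: nat \<Rightarrow> _ set. (\<forall>i\<le>n. primeideal (P i) R) \<and> (\<forall>i<n. P i \<subset> P (Suc i))"
  let ?C = "{enat n | n. ?chain n}"
  have sup: "Sup ?C = 2" using assms by (simp add: krull_dim_def)
  have "\<not> Sup ?C \<le> 1" using sup by (simp add: one_enat_def numeral_eq_enat)
  then obtain n where n: "?chain n" "\<not> enat n \<le> 1" unfolding Sup_le_iff by blast
  have "n \<ge> 2" using n(2) by (simp add: one_enat_def)
  with n(1) show "?chain 2" by (meson order_less_le_trans order_trans)
  show "\<not> ?chain 3"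
  proof
    assume "?chain 3"
    then have "enat 3 \<le> Sup ?C" by (intro Sup_upper) blast
    then show False unfolding sup by (simp add: numeral_eq_enat)
  qed
qed

lemma standard_graded_domain:
  assumes "field K" "standard_graded_algebra K R G" "domain R"
  shows "\<exists>S. graded_domain R G S"
proof -
  interpret K: field K by (rule assms(1))
  interpret R: domain R by (rule assms(3))
  interpret A: standard_graded_algebra K R G by (rule assms(2))
  obtain S where S: "S \<subseteq> G 1" "finite S" "generate_ring R (scalars K R \<union> S) = carrier R"
    using A.generated_in_degree_one by blast
  have one: "\<one>\<^bsub>R\<^esub> \<in> G 0"
    using A.smult_one[OF R.one_closed] K.one_closed unfolding A.grade_zero(2) scalars_def by (metis image_eqI)
  have inverse: "\<exists>c'\<in>G 0. c \<otimes>\<^bsub>R\<^esub> c' = \<one>\<^bsub>R\<^esub>" if c: "c \<in> G 0" "c \<noteq> \<zero>\<^bsub>R\<^esub>" for c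
  proof -
    obtain k where k: "k \<in> carrier K" "c = k \<odot>\<^bsub>R\<^esub> \<one>\<^bsub>R\<^esub>"
      using c(1) unfolding A.grade_zero(2) scalars_def by blast
    have "k \<noteq> \<zero>\<^bsub>K\<^esub>" using c(2) k(2) A.smult_l_null[OF R.one_closed] by auto
    then have u: "inv\<^bsub>K\<^esub> k \<in> carrier K" "k \<otimes>\<^bsub>K\<^esub> inv\<^bsub>K\<^esub> k = \<one>\<^bsub>K\<^esub>"
      using k(1) K.field_Units by auto
    have "c \<otimes>\<^bsub>R\<^esub> (inv\<^bsub>K\<^esub> k \<odot>\<^bsub>R\<^esub> \<one>\<^bsub>R\<^esub>) = k \<odot>\<^bsub>R\<^esub> (inv\<^bsub>K\<^esub> k \<odot>\<^bsub>R\<^esub> \<one>\<^bsub>R\<^esub>)"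
      unfolding k(2) using A.smult_assoc2[OF k(1) R.one_closed A.smult_closed[OF u(1) R.one_closed]]
        A.smult_closed[OF u(1) R.one_closed] by simp
    also have "\<dots> = (k \<otimes>\<^bsub>K\<^esub> inv\<^bsub>K\<^esub> k) \<odot>\<^bsub>R\<^esub> \<one>\<^bsub>R\<^esub>"
      using A.smult_assoc1[OF k(1) u(1) R.one_closed] by simp
    also have "\<dots> = \<one>\<^bsub>R\<^esub>" using u(2) A.smult_one[OF R.one_closed] by simp
    finally show ?thesis using u(1) unfolding A.grade_zero(2) scalars_def by blast
  qed
  have "graded_domain R G S"
  proof (intro graded_domain.intro graded_domain_axioms.intro assms(3))
    show "generate_ring R (G 0 \<union> S) = carrier R" using S(3) unfolding A.grade_zero(2) .
  qed (use A.additive_subgroup_grade A.grade_mult A.direct_sum one inverse S in auto)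
  then show ?thesis by blast
qed

theorem corollary5p1p6:
  fixes K :: "'k ring" and R :: "('k, 'a) module" and L :: "('k, 'l) module"
    and G :: "nat \<Rightarrow> 'a set" and f :: "nat \<Rightarrow> 'a" and d :: "nat \<Rightarrow> nat" and n :: nat
  assumes "field K" and "algebraic_closure_of K L"
    and "standard_graded_algebra K R G"
    and "krull_dim R = 2"
    and "normal_domain (algebra_tensor K R L)"
    and "\<And>i. i \<in> {1..n} \<Longrightarrow> f i \<in> G (d i)"
    and "zero_locus R (f ` {1..n}) = zero_locus R (irrelevant_ideal R G)"
    and "\<And>i. i \<in> {1..n} \<Longrightarrow> 1 \<le> d i"
    and "\<And>i j. 1 \<le> i \<Longrightarrow> i \<le> j \<Longrightarrow> j \<le> n \<Longrightarrow> d i \<le> d j"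
  shows "\<forall>m \<ge> d (n - 1) + d n. G m \<subseteq> solid_closure R (Idl\<^bsub>R\<^esub> (f ` {1..n}))"
proof (intro allI impI subsetI)
  fix m z assume m: "d (n - 1) + d n \<le> m" and z: "z \<in> G m"
  have "domain R"
  proof (rule domain_of_tensor_domain[OF assms(1)])
    show "algebra K R" using assms(3) by (rule standard_graded_algebra.axioms(1))
    show "algebra K L" using assms(2) by (simp add: algebraic_closure_of_def)
    have "field L" using assms(2) by (auto simp: algebraic_closure_of_def dest: algebraic_closure.axioms)
    then show "\<one>\<^bsub>L\<^esub> \<noteq> \<zero>\<^bsub>L\<^esub>" by (rule domain.one_not_zero[OF field.axioms(1)])
    show "domain (algebra_tensor K R L)" using assms(5) by (simp add: normal_domain_def)
  qed
  then obtain S where "graded_domain R G S" using standard_graded_domain[OF assms(1,3)] by blast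
  then interpret graded_domain R G S .
  have primary: "high 1 \<subseteq> P" if "primeideal P R" "f ` {1..n} \<subseteq> P" for P
    using assms(7) that unfolding zero_locus_def irrelevant_ideal_eq by blast
  have fc: "f i \<in> carrier R" if "i \<in> {1..n}" for i using grade_carrier[OF assms(6)[OF that]] .
  obtain P where P: "\<forall>i\<le>2. primeideal (P i) R" "\<forall>i<2. P i \<subset> P (Suc i)" using krull_dim_2_chains(1)[OF assms(4)] by blast
  have chain: "primeideal (P 0) R" "primeideal (P 1) R" "primeideal (P 2) R" "P 0 \<subset> P 1" "P 1 \<subset> P 2"
    using P(1)[rule_format, of 0] P(1)[rule_format, of 1] P(1)[rule_format, of 2]
      P(2)[rule_format, of 0] P(2)[rule_format, of 1] by (simp_all add: numeral_2_eq_2)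
  have dim: False
    \<comment> \<open>With the zero ideal below and the irrelevant ideal above, such a pair would
      form a chain with three strict inclusions.\<close>
    if Q: "primeideal Q R" "primeideal Q' R" "{\<zero>\<^bsub>R\<^esub>} \<subset> Q" "Q \<subset> Q'" "Q' \<subset> high 1" for Q Q'
  proof -
    define T where "T i = (if i = 0 then {\<zero>\<^bsub>R\<^esub>} else if i = 1 then Q else if i = 2 then Q' else high 1)" for i :: nat
    have "\<forall>i\<le>3. primeideal (T i) R"
      using Q(1,2) zeroprimeideal high_1_prime by (simp add: T_def)
    moreover have "\<forall>i<3. T i \<subset> T (Suc i)"
      using Q(3-5) by (auto simp: T_def less_Suc_eq numeral_3_eq_3 numeral_2_eq_2)
    ultimately show False using krull_dim_2_chains(2)[OF assms(4)] by blast
  qed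
  have not_principal: False if x: "x \<in> G a" "1 \<le> a" and sub: "f ` {1..n} \<subseteq> PIdl\<^bsub>R\<^esub> x" for x a
  proof -
    have xc: "x \<in> carrier R" by (rule grade_carrier[OF x(1)])
    obtain k where k: "\<And>e. e \<ge> k \<Longrightarrow> G e \<subseteq> PIdl\<^bsub>R\<^esub> x"
    proof (rule primary_contains_high_degrees[OF principal_hideal[OF x(1)]])
      fix P assume P: "hprime P" "PIdl\<^bsub>R\<^esub> x \<subseteq> P"
      then have "high 1 \<subseteq> P" using sub by (intro primary hprime_primeideal) blast+
      then show "P = high 1" using hprime_subset_high_1[OF P(1)] by blast
    qed (rule that)
    then show False by (rule no_prime_chain_of_principal[OF x _ chain])
  qed
  have "\<exists>i\<in>{1..n}. f i \<noteq> \<zero>\<^bsub>R\<^esub>"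
  proof (rule ccontr)
    assume "\<not> ?thesis"
    then have "f ` {1..n} \<subseteq> PIdl\<^bsub>R\<^esub> \<zero>\<^bsub>R\<^esub>" using cgenideal_self[OF zero_closed] by auto
    \<comment> \<open>Zero is homogeneous of every degree, so degree 1 can be assigned to
      it.\<close>
    then show False by (rule not_principal[of "\<zero>\<^bsub>R\<^esub>" 1, rotated 2]) auto
  qed
  then obtain i0 where i0: "i0 \<in> {1..n}" "f i0 \<noteq> \<zero>\<^bsub>R\<^esub>" by blast
  \<comment> \<open>For n = 1 the term \<open>d (n - 1)\<close> would be the value at index 0, about
    which nothing is known.\<close>
  have "n \<noteq> 1"
  proof
    assume n: "n = 1"
    have 1: "1 \<in> {1..n}" by (simp add: n)
    have "f ` {1..n} \<subseteq> PIdl\<^bsub>R\<^esub> (f 1)" using cgenideal_self[OF fc[OF 1]] by (simp add: n)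
    then show False by (rule not_principal[OF assms(6)[OF 1] assms(8)[OF 1]])
  qed
  then have n: "2 \<le> n" using i0(1) by simp
  \<comment> \<open>Of two distinct indices at most one is \<open>n\<close>, so their degrees are
    bounded by \<open>d (n - 1)\<close> and \<open>d n\<close> in one order or the other. This is
    the origin of the degree bound.\<close>
  have dm: "d i0 + d i \<le> m" if i: "i \<in> {1..n}" "i \<noteq> i0" for i
  proof (cases "i = n")
    case True
    then have "d i0 \<le> d (n - 1)" using i i0(1) by (intro assms(9)) auto
    then show ?thesis using m True by simp
  next
    case False
    then have "d i \<le> d (n - 1)" "d i0 \<le> d n" using i i0(1) by (auto intro!: assms(9))
    then show ?thesis using m by simp
  qed
  have am: "d i0 \<le> m" using assms(9)[of i0 n] i0(1) m by simp
  have "\<exists>w. (\<forall>\<mu>. w \<mu> \<in> carrier R) \<and> w {#} \<noteq> \<zero>\<^bsub>R\<^esub> \<and>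
    (\<forall>\<mu>. (\<Oplus>\<^bsub>R\<^esub>i\<in>{1..n}. f i \<otimes>\<^bsub>R\<^esub> w (add_mset i \<mu>)) = z \<otimes>\<^bsub>R\<^esub> w \<mu>)"
    by (rule exists_recurrence_graded[where f = f and d = d, OF finite_atLeastAtMost i0 assms(6) assms(8)[OF i0(1)] primary dim chain z am dm])
  then obtain w where w: "\<And>\<mu>. w \<mu> \<in> carrier R" "w {#} \<noteq> \<zero>\<^bsub>R\<^esub>"
      "\<And>\<mu>. (\<Oplus>\<^bsub>R\<^esub>i\<in>{1..n}. f i \<otimes>\<^bsub>R\<^esub> w (add_mset i \<mu>)) = z \<otimes>\<^bsub>R\<^esub> w \<mu>" by blast
  show "z \<in> solid_closure R (Idl\<^bsub>R\<^esub> (f ` {1..n}))"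
    by (rule solid_closure_memI[OF finite_atLeastAtMost fc grade_carrier[OF z] primary w])
qed

end
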